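(* (Attractive boundary) Let $\phi_b>0$, $\alpha\in[0,1)$, and, for some $r>2$, $f_b\in L^1(\mathbb{R}^3_+)\cap L^r(0,\sqrt{2\phi_b};L^1(\mathbb{R}^2))$, $f_\infty\in L^1(\mathbb{R}^3)$, with $f_b,f_\infty\ge0$. Let $V^+$ and $B^+$ be defined as in the context. Suppose that $\int_{\mathbb{R}^3}f_\infty(\xi)\,d\xi=1$, that $$f_\infty(\xi)=f_b\bigl(\sqrt{\xi_1^2+2\phi_b},\xi'\bigr)+\alpha f_\infty(-\xi_1,\xi'),\quad \xi\in\mathbb{R}^3_+,$$ and that $V^+\in C^2([0,\phi_b])$. Let (VP) be the boundary value problem of the context. (i) Assume that $\frac{d^2V^+}{d\phi^2}(0)>0$. Then the set $B^+$ is not empty. Furthermore, if and only if $\phi_b<\sup B^+$ holds, the problem (VP) has a unique solution $(f,\phi)$. There also hold that $$\begin{aligned}f(x,\xi)=\ &f_\infty\bigl(-\sqrt{\xi_1^2-2\phi(x)},\xi'\bigr)\chi(\xi_1^2-2\phi(x))\chi(-\xi_1)\\&+\frac1{1-\alpha}f_b\bigl(\sqrt{\xi_1^2-2\phi(x)+2\phi_b},\xi'\bigr)\chi(-\xi_1^2+2\phi(x))\\&+f_\infty\bigl(\sqrt{\xi_1^2-2\phi(x)},\xi'\bigr)\chi(\xi_1^2-2\phi(x))\chi(\xi_1),\end{aligned}\qquad(\ast)$$ $$|\partial_x^l\phi(x)|\le Ce^{-cx},\quad l=0,1,2,$$ where $c$ and $C$ are positive constants independent of $x$. (ii) Assume that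 $\frac{d^2V^+}{d\phi^2}(0)=0$ and $B^+\ne\emptyset$. If and only if $\phi_b<\sup B^+$ holds, the problem (VP) has a unique solution $(f,\phi)$. Furthermore, $(\ast)$ holds. (iii) Assume that $\frac{d^2V^+}{d\phi^2}(0)=0$ and $B^+=\emptyset$. Then the problem (VP) admits no solution. (iv) Assume that $\frac{d^2V^+}{d\phi^2}(0)<0$. Then the problem (VP) admits no solution.
   Context: Notation: $\mathbb{R}_+=\{x>0\}$, $\overline{\mathbb{R}_+}=[0,\infty)$; $\xi=(\xi_1,\xi_2,\xi_3)=(\xi_1,\xi')\in\mathbb{R}^3$; $\mathbb{R}^3_+=\{\xi\in\mathbb{R}^3:\xi_1>0\}$. $\chi(s)$ is the one-dimensional indicator function of $\{s>0\}$; an expression multiplied by a vanishing $\chi$-factor is $0$. Equalities between $L^1$ functions are understood almost everywhere in $\xi$. For $-\infty\le a<b\le\infty$, $L^r(a,b;L^1(\mathbb{R}^2))$ is the set of $f\in L^1((a,b)\times\mathbb{R}^2)$ with $\|f\|_{L^r(a,b;L^1(\mathbb{R}^2))}:=\{\int_a^b(\int_{\mathbb{R}^2}|f(\xi_1,\xi')|\,d\xi')^r\,d\xi_1\}^{1/r}<\infty$. Derivatives at endpoints are one-sided. The function $n_e\in C^2(\mathbb{R})$ is given with $n_e(0)=1$, $n_e'(0)=-1$. The problem (VP), with data $\alpha\in[0,1]$, $\phi_b\in\mathbb{R}$ and nonnegative functions $f_b$ on $\mathbb{R}^3_+$ and $f_\infty$ on $\mathbb{R}^3$, is to find $f=f(x,\xi)$,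 $\phi=\phi(x)$ with $$\xi_1\partial_xf+\partial_x\phi\,\partial_{\xi_1}f=0,\qquad \partial_{xx}\phi=\int_{\mathbb{R}^3}f\,d\xi-n_e(\phi),\qquad x>0,\ \xi\in\mathbb{R}^3,$$ $$f(0,\xi)=f_b(\xi)+\alpha f(0,-\xi_1,\xi')\ (\xi_1>0),\quad \phi(0)=\phi_b,\quad \lim_{x\to\infty}f(x,\xi)=f_\infty(\xi),\quad \lim_{x\to\infty}\phi(x)=0.$$ $(f,\phi)$ is called a solution of (VP) if: (1) $f\in L^1_{loc}(\overline{\mathbb{R}_+}\times\mathbb{R}^3)\cap C(\overline{\mathbb{R}_+};L^1(\mathbb{R}^3))$ and $\phi\in C^1(\overline{\mathbb{R}_+})\cap C^2(\mathbb{R}_+)$; (2) $f\ge0$, and either $\partial_x\phi(x)>0$ for all $x\in\overline{\mathbb{R}_+}$ or $\partial_x\phi(x)<0$ for all $x\in\overline{\mathbb{R}_+}$; (3) $(f,\xi_1\partial_x\psi+\partial_x\phi\,\partial_{\xi_1}\psi)_{L^2(\mathbb{R}_+\times\mathbb{R}^3)}+(f_b,\xi_1\psi(0,\cdot))_{L^2(\mathbb{R}^3_+)}=0$ for all $\psi\in\mathcal{X}$, where $\mathcal{X}=\{\psi\in C_0^1(\overline{\mathbb{R}_+}\times\mathbb{R}^3): \alpha\psi(0,\xi_1,\xi')=\psi(0,-\xi_1,\xi')\text{ for }(\xi_1,\xi')\in\mathbb{R}^3_+\}$ ($C^1$ functions with compact support in $\overline{\mathbb{R}_+}\times\mathbb{R}^3$),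 and $\lim_{x\to\infty}\|f(x,\cdot)-f_\infty\|_{L^1(\mathbb{R}^3)}=0$; (4) $\phi$ solves $\partial_{xx}\phi=\int_{\mathbb{R}^3}f\,d\xi-n_e(\phi)$ for $x>0$ with $\phi(0)=\phi_b$ and $\lim_{x\to\infty}\phi(x)=0$ in the classical sense. For $\phi\ge0$, $$\rho_i^+(\phi):=\int_{\mathbb{R}^3}f_\infty(\xi)\frac{|\xi_1|}{\sqrt{\xi_1^2+2\phi}}\,d\xi+\frac{2}{1-\alpha}\int_{\sqrt{2(\phi_b-\phi)\chi(\phi_b-\phi)}}^{\sqrt{2\phi_b}}\int_{\mathbb{R}^2}f_b(\xi)\frac{\xi_1}{\sqrt{\xi_1^2+2(\phi-\phi_b)}}\,d\xi'\,d\xi_1,$$ $$V^+(\phi):=\int_0^\phi\bigl(\rho_i^+(\varphi)-n_e(\varphi)\bigr)\,d\varphi,\qquad B^+:=\{\varphi>0:\ V^+(\phi)>0\ \text{for all }\phi\in(0,\varphi]\}$$ ($\sup B^+=+\infty$ is allowed; $B^+$ may depend on $\phi_b$). *)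

theory Defs
  imports "HOL-Analysis.Analysis"
begin

section \<open>One-sided derivatives and classes \<open>C\<^sup>k\<close>\<close>

text \<open>On a nondegenerate interval \<open>S\<close> the derivative within \<open>S\<close> is the ordinary one at interior
  points and the one-sided one at endpoints belonging to \<open>S\<close>.\<close>

definition deriv_within :: "real set \<Rightarrow> (real \<Rightarrow> real) \<Rightarrow> real \<Rightarrow> real" where
  "deriv_within S g x = vector_derivative g (at x within S)"

primrec Ck_on :: "nat \<Rightarrow> real set \<Rightarrow> (real \<Rightarrow> real) \<Rightarrow> bool" where
  "Ck_on 0 S g \<longleftrightarrow> continuous_on S g"
| "Ck_on (Suc k) S g \<longleftrightarrow> g differentiable_on S \<and> Ck_on k S (deriv_within S g)"

section \<open>Function spaces\<close>

text \<open>A velocity is \<open>\<xi> = (\<xi>\<^sub>1, \<xi>')\<close>.  Elements of \<open>L\<^sup>1\<close> are represented by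
  (Borel) functions integrable with respect to \<open>lborel\<close>, and their equality is equality almost
  everywhere.  A function on the half space is a total function of which only the values
  on \<open>half_space\<close> are ever relevant.\<close>

type_synonym velocity = "real \<times> (real ^ 2)"

definition half_space :: "velocity set" where
  "half_space = {\<xi>. fst \<xi> > 0}"

definition chi :: "real \<Rightarrow> real" where
  "chi = indicator {0<..}"

text \<open>Membership in \<open>L\<^sup>r(a,b;L\<^sup>1(\<real>\<^sup>2))\<close>.  By Fubini, the first conjunct makes the inner
  integral below a genuine finite integral for almost every \<open>s\<close>, and a measurable function of \<open>s\<close>;
  the second one then says that the integral of its \<open>r\<close>-th power is finite.\<close>

definition in_Lr_L1 :: "real \<Rightarrow> ereal \<Rightarrow> ereal \<Rightarrow> (velocity \<Rightarrow> real) \<Rightarrow> bool" where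
  "in_Lr_L1 r a b g \<longleftrightarrow>
     set_integrable lborel (einterval a b \<times> UNIV) g \<and>
     set_integrable lborel (einterval a b) (\<lambda>s. (LINT \<eta>|lborel. \<bar>g (s, \<eta>)\<bar>) powr r)"

definition L1_loc :: "(real \<Rightarrow> velocity \<Rightarrow> real) \<Rightarrow> bool" where
  "L1_loc f \<longleftrightarrow>
     (\<forall>K. compact K \<and> K \<subseteq> {0..} \<times> UNIV \<longrightarrow> set_integrable lborel K (\<lambda>(x, \<xi>). f x \<xi>))"

definition continuous_into_L1 :: "(real \<Rightarrow> velocity \<Rightarrow> real) \<Rightarrow> bool" where
  "continuous_into_L1 f \<longleftrightarrow>
     (\<forall>x\<ge>0. integrable lborel (f x)) \<and>
     (\<forall>x\<ge>0. ((\<lambda>y. LINT \<xi>|lborel. \<bar>f y \<xi> - f x \<xi>\<bar>) \<longlongrightarrow> 0) (at x within {0..}))"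

text \<open>\<open>C\<^sup>1\<close> functions on the closed set \<open>{0..} \<times> UNIV\<close> (up to the boundary) with compact support
  in it, subject to the reflection condition at \<open>x = 0\<close>.\<close>

definition test_functions :: "real \<Rightarrow> (real \<times> velocity \<Rightarrow> real) set" where
  "test_functions \<alpha> = {\<psi>.
     (\<exists>D :: real \<times> velocity \<Rightarrow> (real \<times> velocity) \<Rightarrow>\<^sub>L real.
        (\<forall>z \<in> {0..} \<times> UNIV. (\<psi> has_derivative blinfun_apply (D z)) (at z within {0..} \<times> UNIV)) \<and>
        continuous_on ({0..} \<times> UNIV) D) \<and>
     compact (closure {z \<in> {0..} \<times> UNIV. \<psi> z \<noteq> 0}) \<and>
     (\<forall>s \<eta>. s > 0 \<longrightarrow> \<alpha> * \<psi> (0, (s, \<eta>)) = \<psi> (0, (- s, \<eta>)))}"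

section \<open>The boundary value problem\<close>

definition VP_weak ::
  "real \<Rightarrow> (velocity \<Rightarrow> real) \<Rightarrow> (real \<Rightarrow> velocity \<Rightarrow> real) \<Rightarrow> (real \<Rightarrow> real) \<Rightarrow> bool" where
  "VP_weak \<alpha> f_b f \<phi> \<longleftrightarrow>
     (\<forall>\<psi> \<in> test_functions \<alpha>.
        (LINT (x, s, \<eta>):({0<..} \<times> UNIV)|lborel.
           f x (s, \<eta>) * (s * deriv (\<lambda>x'. \<psi> (x', (s, \<eta>))) x
              + deriv_within {0..} \<phi> x * deriv (\<lambda>s'. \<psi> (x, (s', \<eta>))) s))
        + (LINT \<xi>:half_space|lborel. f_b \<xi> * (fst \<xi> * \<psi> (0, \<xi>))) = 0)"

definition VP_solution ::
  "(real \<Rightarrow> real) \<Rightarrow> real \<Rightarrow> real \<Rightarrow> (velocity \<Rightarrow> real) \<Rightarrow> (velocity \<Rightarrow> real)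
     \<Rightarrow> (real \<Rightarrow> velocity \<Rightarrow> real) \<Rightarrow> (real \<Rightarrow> real) \<Rightarrow> bool" where
  "VP_solution n_e \<alpha> \<phi>\<^sub>b f_b f_inf f \<phi> \<longleftrightarrow>
     (L1_loc f \<and> continuous_into_L1 f \<and> Ck_on 1 {0..} \<phi> \<and> Ck_on 2 {0<..} \<phi>) \<and>
     ((\<forall>x\<ge>0. AE \<xi> in lborel. f x \<xi> \<ge> 0) \<and>
      ((\<forall>x\<ge>0. deriv_within {0..} \<phi> x > 0) \<or> (\<forall>x\<ge>0. deriv_within {0..} \<phi> x < 0))) \<and>
     (VP_weak \<alpha> f_b f \<phi> \<and>
      ((\<lambda>x. LINT \<xi>|lborel. \<bar>f x \<xi> - f_inf \<xi>\<bar>) \<longlongrightarrow> 0) at_top) \<and>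
     ((\<forall>x>0. (deriv_within {0..} ^^ 2) \<phi> x = (LINT \<xi>|lborel. f x \<xi>) - n_e (\<phi> x)) \<and>
      \<phi> 0 = \<phi>\<^sub>b \<and> (\<phi> \<longlongrightarrow> 0) at_top)"

text \<open>Only the values for \<open>x \<ge> 0\<close> belong to a solution, and \<open>f x\<close> is an element of \<open>L\<^sup>1\<close>.\<close>

definition VP_has_unique_solution ::
  "(real \<Rightarrow> real) \<Rightarrow> real \<Rightarrow> real \<Rightarrow> (velocity \<Rightarrow> real) \<Rightarrow> (velocity \<Rightarrow> real) \<Rightarrow> bool" where
  "VP_has_unique_solution n_e \<alpha> \<phi>\<^sub>b f_b f_inf \<longleftrightarrow>
     (\<exists>f \<phi>. VP_solution n_e \<alpha> \<phi>\<^sub>b f_b f_inf f \<phi>) \<and>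
     (\<forall>f \<phi> g \<theta>. VP_solution n_e \<alpha> \<phi>\<^sub>b f_b f_inf f \<phi> \<and> VP_solution n_e \<alpha> \<phi>\<^sub>b f_b f_inf g \<theta> \<longrightarrow>
        (\<forall>x\<ge>0. \<phi> x = \<theta> x \<and> (AE \<xi> in lborel. f x \<xi> = g x \<xi>)))"

section \<open>The Sagdeev potential for the attractive boundary\<close>

definition rho_plus ::
  "real \<Rightarrow> real \<Rightarrow> (velocity \<Rightarrow> real) \<Rightarrow> (velocity \<Rightarrow> real) \<Rightarrow> real \<Rightarrow> real" where
  "rho_plus \<alpha> \<phi>\<^sub>b f_b f_inf p =
     (LINT \<xi>|lborel. f_inf \<xi> * (\<bar>fst \<xi>\<bar> / sqrt ((fst \<xi>)\<^sup>2 + 2 * p)))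
     + 2 / (1 - \<alpha>) *
       (LBINT s = sqrt (2 * (\<phi>\<^sub>b - p) * chi (\<phi>\<^sub>b - p))..sqrt (2 * \<phi>\<^sub>b).
          (LINT \<eta>|lborel. f_b (s, \<eta>) * (s / sqrt (s\<^sup>2 + 2 * (p - \<phi>\<^sub>b)))))"

definition V_plus ::
  "(real \<Rightarrow> real) \<Rightarrow> real \<Rightarrow> real \<Rightarrow> (velocity \<Rightarrow> real) \<Rightarrow> (velocity \<Rightarrow> real) \<Rightarrow> real \<Rightarrow> real" where
  "V_plus n_e \<alpha> \<phi>\<^sub>b f_b f_inf p = (LBINT q=0..p. (rho_plus \<alpha> \<phi>\<^sub>b f_b f_inf q - n_e q))"

definition B_plus ::
  "(real \<Rightarrow> real) \<Rightarrow> real \<Rightarrow> real \<Rightarrow> (velocity \<Rightarrow> real) \<Rightarrow> (velocity \<Rightarrow> real) \<Rightarrow> real set" where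
  "B_plus n_e \<alpha> \<phi>\<^sub>b f_b f_inf =
     {q. q > 0 \<and> (\<forall>p \<in> {0<..q}. V_plus n_e \<alpha> \<phi>\<^sub>b f_b f_inf p > 0)}"

text \<open>The explicit density in terms of the potential.\<close>

definition density_plus ::
  "real \<Rightarrow> real \<Rightarrow> (velocity \<Rightarrow> real) \<Rightarrow> (velocity \<Rightarrow> real) \<Rightarrow> (real \<Rightarrow> real)
     \<Rightarrow> real \<Rightarrow> velocity \<Rightarrow> real" where
  "density_plus \<alpha> \<phi>\<^sub>b f_b f_inf \<phi> x = (\<lambda>(s, \<eta>).
     f_inf (- sqrt (s\<^sup>2 - 2 * \<phi> x), \<eta>) * chi (s\<^sup>2 - 2 * \<phi> x) * chi (- s)
     + 1 / (1 - \<alpha>) * f_b (sqrt (s\<^sup>2 - 2 * \<phi> x + 2 * \<phi>\<^sub>b), \<eta>) * chi (- (s\<^sup>2) + 2 * \<phi> x)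
     + f_inf (sqrt (s\<^sup>2 - 2 * \<phi> x), \<eta>) * chi (s\<^sup>2 - 2 * \<phi> x) * chi s)"

end

theory Submission
  imports Defs
begin

text \<open>
  Along a characteristic of \<open>\<xi>\<^sub>1 \<partial>\<^sub>x f + \<phi>' \<partial>\<^sub>\<xi>\<^sub>1 f = 0\<close> the energy
  \<open>E = \<xi>\<^sub>1\<^sup>2 / 2 - \<phi>\<close> is constant.  A solution of the problem has \<open>\<phi>' < 0\<close> everywhere, because
  \<open>\<phi>\<close> has to descend from the wall value \<open>\<phi>\<^sub>b > 0\<close> to \<open>0\<close>.  Hence \<open>\<phi>\<close> is invertible and
  \<open>(x, \<xi>) \<mapsto> (E, \<xi>)\<close> is a change of variables with Jacobian \<open>\<bar>\<phi>'\<bar>\<close>, on whose range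
  \<open>0 < \<xi>\<^sub>1\<^sup>2 / 2 - E < \<phi>\<^sub>b\<close> the transport operator becomes \<open>- \<bar>\<phi>'\<bar> \<partial>\<^sub>v\<close>, with \<open>v = \<xi>\<^sub>1\<close> the
  parameter along a characteristic.  For \<open>-\<phi>\<^sub>b < E < 0\<close> a
  characteristic leaves the wall with velocity \<open>v\<^sub>E = sqrt (2 (E + \<phi>\<^sub>b))\<close>, turns round and comes back
  with velocity \<open>- v\<^sub>E\<close> (trapped particles); for \<open>E > 0\<close> one branch comes from infinity to the wall
  and another one goes from the wall to infinity (free particles).

  A density that is constant along characteristics is thus determined by the data: free particles
  carry the value of \<open>f\<^sub>\<infinity>\<close> at infinity, trapped ones carry \<open>f\<^sub>b + \<alpha> f\<^sub>b + \<alpha>\<^sup>2 f\<^sub>b + \<dots>\<close>,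
  the sum over all reflections.
  This density depends on \<open>x\<close> only through \<open>p = \<phi> x\<close> and is called \<open>dens p\<close>.

  Three facts make this rigorous.  (a) \<open>dens p\<close> depends continuously on \<open>p\<close> in \<open>L\<^sup>1\<close>
  (\<open>dens_L1_convergence\<close>).  The free part is harmless, but substituting the wall velocity in the
  trapped part produces the kernel \<open>s / sqrt (s\<^sup>2 - 2 (\<phi>\<^sub>b - p))\<close>, which is bounded in \<open>L\<^sup>q\<close> uniformly
  in \<open>p\<close> only for \<open>q < 2\<close>; this is where \<open>r > 2\<close> enters (\<open>trap_bound\<close>).  In particular \<open>\<rho>\<^sub>i\<^sup>+\<close> is continuous on
  \<open>[0, \<phi>\<^sub>b]\<close>.  (b) \<open>dens (\<phi> x)\<close> satisfies the weak Vlasov equation (\<open>dens_weak\<close>): in energy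
  coordinates the integral over each characteristic is an exact derivative, and the boundary terms
  match the inflow term because of the reflection condition on the test functions and of the
  compatibility condition between \<open>f\<^sub>b\<close> and \<open>f\<^sub>\<infinity>\<close>.  (c) Nothing else does (\<open>solution_eq_dens\<close>): if
  \<open>g\<close> is the difference of two weak solutions, the test function
  \<open>\<theta>(E) (K(v) + (\<alpha> K(v\<^sub>E) - K(- v\<^sub>E)) / (1 - \<alpha>))\<close>, with a cutoff in \<open>x\<close> and a factor in \<open>\<xi>'\<close>,
  obeys the reflection condition, and transport turns it into \<open>\<phi>' \<theta>(E) K'(v)\<close>; hence
  \<open>\<phi>' g\<close> integrates to zero against
  arbitrary products \<open>\<theta>(E) K'(v)\<close>.  The cutoff is harmless because \<open>g\<close> tends to \<open>0\<close> in
  \<open>L\<^sup>1\<close> as \<open>x \<rightarrow> \<infinity>\<close>.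

  The problem is now equivalent to \<open>\<phi>'' = (V\<^sup>+)'(\<phi>)\<close> with \<open>\<phi>(0) = \<phi>\<^sub>b\<close>, \<open>\<phi>(\<infinity>) = 0\<close> and
  \<open>\<phi>' < 0\<close>.  The energy identity \<open>\<phi>'\<^sup>2 = 2 V\<^sup>+(\<phi>)\<close> (\<open>solution_energy\<close>) shows that \<open>V\<^sup>+ > 0\<close> on
  \<open>(0, \<phi>\<^sub>b]\<close> is necessary.  It is also sufficient, since then the separated equation
  \<open>\<phi>' = - sqrt (2 V\<^sup>+(\<phi>))\<close> has exactly one solution, and \<open>V\<^sup>+(p) = O(p\<^sup>2)\<close> keeps it from reaching
  \<open>0\<close> at a finite point.  Finally \<open>V\<^sup>+ > 0\<close> on \<open>(0, \<phi>\<^sub>b]\<close> is the same as \<open>\<phi>\<^sub>b < sup B\<^sup>+\<close>, as \<open>V\<^sup>+\<close> is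
  continuous beyond \<open>\<phi>\<^sub>b\<close> (\<open>barrier_iff\<close>).  A nonzero second derivative at \<open>0\<close> decides the sign
  of \<open>V\<^sup>+\<close> near \<open>0\<close>, and a positive one gives \<open>V\<^sup>+(p) \<ge> c p\<^sup>2\<close> and so exponential decay.
\<close>

section \<open>Substitution in Lebesgue integrals\<close>

lemma nn_integral_lborel_pair:
  fixes g :: "'a::euclidean_space \<times> 'b::euclidean_space \<Rightarrow> ennreal"
  assumes g: "g \<in> borel_measurable borel"
  shows "(\<integral>\<^sup>+z. g z \<partial>lborel) = (\<integral>\<^sup>+y. \<integral>\<^sup>+x. g (x, y) \<partial>lborel \<partial>lborel)"
    "(\<integral>\<^sup>+z. g z \<partial>lborel) = (\<integral>\<^sup>+x. \<integral>\<^sup>+y. g (x, y) \<partial>lborel \<partial>lborel)"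
proof -
  have [measurable]: "g \<in> borel_measurable (lborel \<Otimes>\<^sub>M lborel)" using g by (simp add: lborel_prod)
  show "(\<integral>\<^sup>+z. g z \<partial>lborel) = (\<integral>\<^sup>+y. \<integral>\<^sup>+x. g (x, y) \<partial>lborel \<partial>lborel)"
    by (subst lborel_pair.nn_integral_snd) (use g in \<open>auto simp: lborel_prod\<close>)
  show "(\<integral>\<^sup>+z. g z \<partial>lborel) = (\<integral>\<^sup>+x. \<integral>\<^sup>+y. g (x, y) \<partial>lborel \<partial>lborel)"
    by (subst lborel.nn_integral_fst) (use g in \<open>auto simp: lborel_prod\<close>)
qed

text \<open>The change of variables theorem for absolutely integrable functions, read off on indicator
  functions, is an equality of measures.  In this form it also transfers infinite integrals.\<close>

lemma distr_density_substitution: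
  fixes g g' :: "real \<Rightarrow> real"
  assumes S [measurable]: "S \<in> sets borel" and gS [measurable]: "g ` S \<in> sets borel"
    and g [measurable]: "g \<in> borel_measurable borel" and g' [measurable]: "g' \<in> borel_measurable borel"
    and der: "\<And>x. x \<in> S \<Longrightarrow> (g has_real_derivative g' x) (at x within S)"
    and inj: "inj_on g S"
  shows "distr (density lborel (\<lambda>x. ennreal \<bar>g' x\<bar> * indicator S x)) borel g
       = density lborel (indicator (g ` S))" (is "?M = ?N")
proof (rule measure_eqI)
  show "sets ?M = sets ?N" by simp
next
  fix A assume "A \<in> sets ?M"
  then have A [measurable]: "A \<in> sets borel" by simp
  let ?h = "\<lambda>x. \<bar>g' x\<bar> * indicator A (g x) :: real"
  have cv: "(?h absolutely_integrable_on S \<and> integral S ?h = c) \<longleftrightarrow>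
     ((indicator A :: real \<Rightarrow> real) absolutely_integrable_on (g ` S) \<and> integral (g ` S) (indicator A) = c)" for c
    by (rule has_absolute_integral_change_of_variables_1'[OF _ der inj]) auto
  have eq: "(\<integral>\<^sup>+x. ennreal (f x) * indicator U x \<partial>lborel) = ennreal (integral U f)"
      "f absolutely_integrable_on U"
    if f [measurable]: "f \<in> borel_measurable borel" and U [measurable]: "U \<in> sets borel" and pos: "\<And>x. f x \<ge> 0"
      and fin: "f absolutely_integrable_on U \<or> (\<integral>\<^sup>+x. ennreal (f x) * indicator U x \<partial>lborel) < \<infinity>"
    for f :: "real \<Rightarrow> real" and U
  proof -
    have "integrable lborel (\<lambda>x. indicator U x * f x) \<longleftrightarrow> f absolutely_integrable_on U"
      by (simp add: set_integrable_def integrable_completion)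
    moreover have "integrable lborel (\<lambda>x. indicator U x * f x)"
      if "(\<integral>\<^sup>+x. ennreal (f x) * indicator U x \<partial>lborel) < \<infinity>"
      using that by (intro integrableI_nonneg) 
        (auto simp: pos mult.commute ennreal_mult' ennreal_indicator intro!: AE_I2)
    ultimately have i: "integrable lborel (\<lambda>x. indicator U x * f x)" and a: "f absolutely_integrable_on U"
      using fin by blast+
    show "f absolutely_integrable_on U" by fact
    have "integral U f = (LINT x:U|lebesgue. f x)"
      using a by (simp add: set_lebesgue_integral_eq_integral)
    also have "\<dots> = (LINT x|lborel. indicator U x * f x)"
      by (simp add: set_lebesgue_integral_def integral_completion)
    finally have 1: "integral U f = (LINT x|lborel. indicator U x * f x)" .
    have "(\<integral>\<^sup>+x. ennreal (f x) * indicator U x \<partial>lborel) = (\<integral>\<^sup>+x. ennreal (indicator U x * f x) \<partial>lborel)"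
      by (auto intro!: nn_integral_cong split: split_indicator)
    also have "\<dots> = ennreal (integral U f)"
      unfolding 1 by (intro nn_integral_eq_integral i) (auto simp: pos)
    finally show "(\<integral>\<^sup>+x. ennreal (f x) * indicator U x \<partial>lborel) = ennreal (integral U f)" .
  qed
  have "(\<integral>\<^sup>+x. ennreal (?h x) * indicator S x \<partial>lborel) = (\<integral>\<^sup>+x. ennreal (indicator A x) * indicator (g ` S) x \<partial>lborel)"
  proof (cases "?h absolutely_integrable_on S")
    case True
    then have "(indicator A :: real \<Rightarrow> real) absolutely_integrable_on (g ` S)"
      "integral (g ` S) (indicator A) = integral S ?h" using cv[of "integral S ?h"] by auto
    with True show ?thesis by (subst (1 2) eq) auto
  next
    case False
    then have F2: "\<not> (indicator A :: real \<Rightarrow> real) absolutely_integrable_on (g ` S)"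
      using cv[of "integral (g ` S) (indicator A)"] by auto
    have "(\<integral>\<^sup>+x. ennreal (?h x) * indicator S x \<partial>lborel) = \<infinity>"
      using eq(2)[of ?h S] False by (auto simp: less_top[symmetric])
    moreover have "(\<integral>\<^sup>+x. ennreal (indicator A x) * indicator (g ` S) x \<partial>lborel) = \<infinity>"
      using eq(2)[of "indicator A" "g ` S"] F2 by (auto simp: less_top[symmetric])
    ultimately show ?thesis by simp
  qed
  moreover have "emeasure ?M A = (\<integral>\<^sup>+x. ennreal (?h x) * indicator S x \<partial>lborel)"
    by (subst emeasure_distr, simp, simp, subst emeasure_density)
       (auto intro!: nn_integral_cong simp: measurable_sets_borel[OF g A] split: split_indicator)
  moreover have "emeasure ?N A = (\<integral>\<^sup>+x. ennreal (indicator A x) * indicator (g ` S) x \<partial>lborel)"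
    by (subst emeasure_density) (auto intro!: nn_integral_cong split: split_indicator)
  ultimately show "emeasure ?M A = emeasure ?N A" by simp
qed

lemma nn_integral_real_substitution:
  fixes g g' :: "real \<Rightarrow> real" and f :: "real \<Rightarrow> ennreal"
  assumes S [measurable]: "S \<in> sets borel" and gS [measurable]: "g ` S \<in> sets borel"
    and g [measurable]: "g \<in> borel_measurable borel" and g' [measurable]: "g' \<in> borel_measurable borel"
    and der: "\<And>x. x \<in> S \<Longrightarrow> (g has_real_derivative g' x) (at x within S)"
    and inj: "inj_on g S" and f [measurable]: "f \<in> borel_measurable borel"
  shows "(\<integral>\<^sup>+y. f y * indicator (g ` S) y \<partial>lborel) = (\<integral>\<^sup>+x. f (g x) * ennreal \<bar>g' x\<bar> * indicator S x \<partial>lborel)"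
proof -
  have "(\<integral>\<^sup>+y. f y * indicator (g ` S) y \<partial>lborel) = (\<integral>\<^sup>+y. f y \<partial>density lborel (indicator (g ` S)))"
    by (simp add: nn_integral_density mult.commute)
  also have "\<dots> = (\<integral>\<^sup>+y. f y \<partial>distr (density lborel (\<lambda>x. ennreal \<bar>g' x\<bar> * indicator S x)) borel g)"
    using distr_density_substitution[OF S gS g g' der inj] by simp
  also have "\<dots> = (\<integral>\<^sup>+x. f (g x) * ennreal \<bar>g' x\<bar> * indicator S x \<partial>lborel)"
    by (subst nn_integral_distr, simp, simp, subst nn_integral_density)
       (auto intro!: nn_integral_cong simp: mult_ac)
  finally show ?thesis .
qed

section \<open>Continuity in \<open>L\<^sup>1\<close> of composition with a moving map\<close>

text \<open>Approximability by continuous functions is proved for indicators (inner and outer regularity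
  with a Urysohn function in between) and is stable under sums and dominated limits; the induction
  principle for integrable functions then gives it for all of \<open>L\<^sup>1\<close>.\<close>

definition L1_approximable :: "('a::euclidean_space \<Rightarrow> real) \<Rightarrow> bool" where
  "L1_approximable f \<longleftrightarrow> (\<forall>e>0. \<exists>h. continuous_on UNIV h \<and> integrable lborel h \<and> (LINT x|lborel. \<bar>f x - h x\<bar>) < e)"

lemma L1_approximable_indicator:
  fixes A :: "'a::euclidean_space set"
  assumes [measurable]: "A \<in> sets borel" and fin: "emeasure lborel A < \<infinity>"
  shows "L1_approximable (\<lambda>x. indicator A x * c)"
  unfolding L1_approximable_def
proof (intro allI impI)
  fix e :: real assume "e > 0"
  define d where "d = e / (4 * (\<bar>c\<bar> + 1))"
  have d: "d > 0" using \<open>e > 0\<close> by (auto simp: d_def)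
  obtain C where C: "closed C" "C \<subseteq> A" "A - C \<in> lmeasurable" "emeasure lebesgue (A - C) < ennreal d"
    using sets_lebesgue_inner_closed[OF _ d, of A] by auto
  obtain U where U: "open U" "A \<subseteq> U" "U - A \<in> lmeasurable" "emeasure lebesgue (U - A) < ennreal d"
    using sets_lebesgue_outer_open[OF _ d, of A] by auto
  obtain h :: "'a \<Rightarrow> real" where h: "continuous_on UNIV h" "\<And>x. h x \<in> closed_segment 1 0"
     "\<And>x. x \<in> C \<Longrightarrow> h x = 1" "\<And>x. x \<in> - U \<Longrightarrow> h x = 0"
    using Urysohn[of C "- U" 1 0] C U by (auto simp: closed_Compl)
  have h01: "0 \<le> h x" "h x \<le> 1" for x using h(2)[of x] by (auto simp: closed_segment_eq_real_ivl)
  have [measurable]: "h \<in> borel_measurable borel" using h(1) by (rule borel_measurable_continuous_onI)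
  have [measurable]: "C \<in> sets borel" "U \<in> sets borel" using C U by auto
  have mC: "emeasure lborel (A - C) < ennreal d" and mU: "emeasure lborel (U - A) < ennreal d"
    using C(4) U(4) by (simp_all add: emeasure_completion)
  have mUC: "emeasure lborel (U - C) < ennreal (2 * d)"
  proof -
    have "emeasure lborel (U - C) \<le> emeasure lborel ((A - C) \<union> (U - A))"
      by (intro emeasure_mono) auto
    also have "\<dots> \<le> emeasure lborel (A - C) + emeasure lborel (U - A)"
      by (intro emeasure_subadditive) auto
    also have "\<dots> < ennreal d + ennreal d" using mC mU by (intro add_strict_mono)
    also have "\<dots> = ennreal (2 * d)" using d by (simp flip: ennreal_plus)
    finally show ?thesis .
  qed
  have ptw: "\<bar>indicator A x - h x\<bar> \<le> indicator (U - C) x" for x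
    using h01[of x] h(3)[of x] h(4)[of x] C(2) U(2) by (auto split: split_indicator)
  have iUC: "integrable lborel (indicator (U - C) :: 'a \<Rightarrow> real)"
    using mUC by (intro integrable_real_indicator) (auto intro: less_trans)
  have iA: "integrable lborel (indicator A :: 'a \<Rightarrow> real)"
    using fin by (intro integrable_real_indicator) auto
  have idiff: "integrable lborel (\<lambda>x. indicator A x - h x)"
    by (rule Bochner_Integration.integrable_bound[OF iUC]) (use ptw in auto)
  have ih: "integrable lborel h"
    using Bochner_Integration.integrable_diff[OF iA idiff] by simp
  have m: "measure lborel (U - C) < 2 * d"
    using mUC d by (metis emeasure_eq_ennreal_measure ennreal_less_iff measure_nonneg top.not_eq_extremum infinity_ennreal_def order.strict_trans ennreal_less_top)
  have "(LINT x|lborel. \<bar>indicator A x * c - c * h x\<bar>) = \<bar>c\<bar> * (LINT x|lborel. \<bar>indicator A x - h x\<bar>)"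
    by (subst Bochner_Integration.integral_mult_right_zero[symmetric])
       (auto simp: abs_mult[symmetric] algebra_simps intro!: Bochner_Integration.integral_cong)
  also have "\<dots> \<le> \<bar>c\<bar> * (LINT x|lborel. indicator (U - C) x)"
    using ptw iUC idiff by (intro mult_left_mono integral_mono) auto
  also have "\<dots> = \<bar>c\<bar> * measure lborel (U - C)" by simp
  also have "\<dots> \<le> \<bar>c\<bar> * (2 * d)" using m by (intro mult_left_mono) auto
  also have "\<dots> < e" using \<open>e > 0\<close> by (simp add: d_def field_simps) (smt (verit) mult_nonneg_nonneg)
  finally have "(LINT x|lborel. \<bar>indicator A x * c - c * h x\<bar>) < e" .
  then show "\<exists>h. continuous_on UNIV h \<and> integrable lborel h \<and> (LINT x|lborel. \<bar>indicator A x * c - h x\<bar>) < e"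
    using h(1) ih by (intro exI[of _ "\<lambda>x. c * h x"]) (auto intro!: continuous_intros)
qed

lemma L1_approximable_integrable:
  fixes f :: "'a::euclidean_space \<Rightarrow> real"
  assumes "integrable lborel f"
  shows "L1_approximable f"
  using assms
proof (induction rule: integrable_induct)
  case (base A c)
  then show ?case using L1_approximable_indicator[of A c] by (simp add: mult.commute)
next
  case (add f g)
  show ?case unfolding L1_approximable_def
  proof (intro allI impI)
    fix e :: real assume "e > 0"
    then obtain h k where h: "continuous_on UNIV h" "integrable lborel h" "(LINT x|lborel. \<bar>f x - h x\<bar>) < e/2"
      and k: "continuous_on UNIV k" "integrable lborel k" "(LINT x|lborel. \<bar>g x - k x\<bar>) < e/2"
      using add(3,4) half_gt_zero[OF \<open>e > 0\<close>] unfolding L1_approximable_def by meson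
    have "(LINT x|lborel. \<bar>(f x + g x) - (h x + k x)\<bar>) \<le> (LINT x|lborel. \<bar>f x - h x\<bar> + \<bar>g x - k x\<bar>)"
      using add h k by (intro integral_mono) auto
    also have "\<dots> = (LINT x|lborel. \<bar>f x - h x\<bar>) + (LINT x|lborel. \<bar>g x - k x\<bar>)"
      using add h k by (intro Bochner_Integration.integral_add) auto
    finally show "\<exists>h. continuous_on UNIV h \<and> integrable lborel h \<and> (LINT x|lborel. \<bar>f x + g x - h x\<bar>) < e"
      using h k by (intro exI[of _ "\<lambda>x. h x + k x"]) (auto intro!: continuous_intros)
  qed
next
  case (lim f s)
  have app: "L1_approximable (s i)" for i using lim by auto
  have conv: "(\<lambda>i. s i x) \<longlonglongrightarrow> f x" for x using lim by auto
  have bnd: "\<bar>s i x\<bar> \<le> 2 * \<bar>f x\<bar>" for i x using lim by auto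
  show ?case unfolding L1_approximable_def
  proof (intro allI impI)
    fix e :: real assume e: "e > 0"
    have "(\<lambda>i. LINT x|lborel. \<bar>f x - s i x\<bar>) \<longlonglongrightarrow> (LINT x|(lborel :: 'a measure). (0::real))"
    proof (rule integral_dominated_convergence[where w = "\<lambda>x. 3 * \<bar>f x\<bar>"])
      show "AE x in lborel. (\<lambda>i. \<bar>f x - s i x\<bar>) \<longlonglongrightarrow> 0"
      proof (intro AE_I2)
        fix x
        have "(\<lambda>i. f x - s i x) \<longlonglongrightarrow> f x - f x" using conv[of x] by (intro tendsto_diff tendsto_const) auto
        then show "(\<lambda>i. \<bar>f x - s i x\<bar>) \<longlonglongrightarrow> 0" by (intro tendsto_rabs_zero) simp
      qed
      show "AE x in lborel. norm \<bar>f x - s i x\<bar> \<le> 3 * \<bar>f x\<bar>" for i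
      proof (intro AE_I2)
        fix x show "norm \<bar>f x - s i x\<bar> \<le> 3 * \<bar>f x\<bar>" using bnd[of i x] by (auto simp: abs_if split: if_splits)
      qed
    qed (use lim in auto)
    then have "\<forall>\<^sub>F i in sequentially. (LINT x|lborel. \<bar>f x - s i x\<bar>) < e/2"
      using e by (intro order_tendstoD(2)[of _ 0]) auto
    then obtain i where i: "(LINT x|lborel. \<bar>f x - s i x\<bar>) < e/2"
      by (meson eventually_happens trivial_limit_sequentially)
    obtain h where h: "continuous_on UNIV h" "integrable lborel h" "(LINT x|lborel. \<bar>s i x - h x\<bar>) < e/2"
      using app[of i] half_gt_zero[OF e] unfolding L1_approximable_def by meson
    have "(LINT x|lborel. \<bar>f x - h x\<bar>) \<le> (LINT x|lborel. \<bar>f x - s i x\<bar> + \<bar>s i x - h x\<bar>)"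
      using lim h by (intro integral_mono) auto
    also have "\<dots> = (LINT x|lborel. \<bar>f x - s i x\<bar>) + (LINT x|lborel. \<bar>s i x - h x\<bar>)"
      using lim h by (intro Bochner_Integration.integral_add) auto
    finally show "\<exists>h. continuous_on UNIV h \<and> integrable lborel h \<and> (LINT x|lborel. \<bar>f x - h x\<bar>) < e"
      using h i by (intro exI[of _ h]) auto
  qed
qed

text \<open>Clipping an approximation to the range of \<open>f\<close> and cutting it off outside the support of \<open>f\<close>
  only brings it closer to \<open>f\<close>.\<close>

lemma L1_approx_bounded:
  fixes f :: "'a::euclidean_space \<Rightarrow> real"
  assumes f: "integrable lborel f" and bnd: "\<And>x. \<bar>f x\<bar> \<le> M" and supp: "\<And>x. norm x > M \<Longrightarrow> f x = 0"
    and M: "M \<ge> 0" and e: "e > 0"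
  obtains h where "continuous_on UNIV h" "\<And>x. \<bar>h x\<bar> \<le> M" "\<And>x. norm x > M + 1 \<Longrightarrow> h x = 0"
    "integrable lborel h" "(LINT x|lborel. \<bar>f x - h x\<bar>) < e"
proof -
  obtain g where g: "continuous_on UNIV g" "integrable lborel g" "(LINT x|lborel. \<bar>f x - g x\<bar>) < e"
    using L1_approximable_integrable[OF f] e unfolding L1_approximable_def by meson
  define cut where "cut x = max 0 (min 1 (M + 1 - norm x))" for x :: 'a
  have cut: "0 \<le> cut x" "cut x \<le> 1" for x by (auto simp: cut_def)
  define h where "h x = max (-M) (min M (g x)) * cut x" for x
  have c: "continuous_on UNIV h"
    unfolding h_def cut_def by (intro continuous_intros g)
  have hb: "\<bar>h x\<bar> \<le> M" for x
    using mult_mono[of "\<bar>max (-M) (min M (g x))\<bar>" M "\<bar>cut x\<bar>" 1] cut[of x] M by (auto simp: h_def abs_mult)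
  have hg: "\<bar>h x\<bar> \<le> \<bar>g x\<bar>" for x
    using mult_mono[of "\<bar>max (-M) (min M (g x))\<bar>" "\<bar>g x\<bar>" "\<bar>cut x\<bar>" 1] cut[of x] M by (auto simp: h_def abs_mult)
  have d: "\<bar>f x - h x\<bar> \<le> \<bar>f x - g x\<bar>" for x
  proof (cases "norm x > M")
    case True then show ?thesis using supp[of x] hg[of x] by simp
  next
    case False
    then have "h x = max (-M) (min M (g x))" by (simp add: h_def cut_def)
    then show ?thesis using bnd[of x] by auto
  qed
  have ih: "integrable lborel h"
    by (rule Bochner_Integration.integrable_bound[OF g(2)]) 
       (use hg c in \<open>auto intro: borel_measurable_continuous_onI\<close>)
  have "(LINT x|lborel. \<bar>f x - h x\<bar>) \<le> (LINT x|lborel. \<bar>f x - g x\<bar>)"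
    using d f g ih by (intro integral_mono) auto
  then show thesis using g by (intro that[of h] c hb ih) (auto simp: h_def cut_def)
qed

text \<open>The value at \<open>z\<close> is the one carried from \<open>S z\<close> along the trajectory through \<open>z\<close>, if this
  trajectory is of the kind singled out by \<open>P\<close>.  Both parts of the stationary density have this form.\<close>

definition pull :: "('a \<Rightarrow> bool) \<Rightarrow> ('a \<Rightarrow> 'a) \<Rightarrow> ('a \<Rightarrow> real) \<Rightarrow> 'a \<Rightarrow> real" where
  "pull P S f z = (if P z then f (S z) else 0)"

lemma pull_measurable [measurable]:
  assumes [measurable]: "Measurable.pred borel P" "S \<in> borel_measurable borel" "f \<in> borel_measurable borel"
  shows "pull P S f \<in> borel_measurable borel"
  unfolding pull_def by measurable

text \<open>The composition is continuous in the map for continuous \<open>f\<close> with compact support, by dominated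
  convergence; \<open>far\<close> keeps the supports of the compositions in one ball.  Any other \<open>f\<close> is
  approximated, provided that the composition operators control the error uniformly, which is
  what \<open>appr\<close> asks for.\<close>

lemma pull_L1_convergence:
  fixes f :: "'a::euclidean_space \<Rightarrow> real" and Sn :: "nat \<Rightarrow> 'a \<Rightarrow> 'a"
  assumes meas: "\<And>n. Measurable.pred borel (Pn n)" "Measurable.pred borel P"
      "\<And>n. Sn n \<in> borel_measurable borel" "S \<in> borel_measurable borel"
    and int: "\<And>n. integrable lborel (pull (Pn n) (Sn n) f)" "integrable lborel (pull P S f)"
    and conv: "AE z in lborel. (\<forall>\<^sub>F n in sequentially. Pn n z = P z) \<and> (P z \<longrightarrow> (\<lambda>n. Sn n z) \<longlonglongrightarrow> S z)"
    and far: "\<And>n z. Pn n z \<Longrightarrow> norm z \<le> norm (Sn n z) + c" "\<And>z. P z \<Longrightarrow> norm z \<le> norm (S z) + c"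
    and appr: "\<And>e. e > 0 \<Longrightarrow> \<exists>h M. continuous_on UNIV h \<and> (\<forall>x. \<bar>h x\<bar> \<le> M) \<and> (\<forall>x. norm x > M \<longrightarrow> h x = 0) \<and>
       (\<forall>n. (\<integral>\<^sup>+z. ennreal \<bar>pull (Pn n) (Sn n) (\<lambda>x. f x - h x) z\<bar> \<partial>lborel) \<le> ennreal e) \<and>
       (\<integral>\<^sup>+z. ennreal \<bar>pull P S (\<lambda>x. f x - h x) z\<bar> \<partial>lborel) \<le> ennreal e"
  shows "(\<lambda>n. LINT z|lborel. \<bar>pull (Pn n) (Sn n) f z - pull P S f z\<bar>) \<longlonglongrightarrow> 0"
proof (rule LIMSEQ_I)
  fix e :: real assume e: "e > 0"
  note [measurable] = meas
  obtain h M where h: "continuous_on UNIV h" "\<And>x. \<bar>h x\<bar> \<le> M" "\<And>x. norm x > M \<Longrightarrow> h x = 0"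
    and a: "\<And>n. (\<integral>\<^sup>+z. ennreal \<bar>pull (Pn n) (Sn n) (\<lambda>x. f x - h x) z\<bar> \<partial>lborel) \<le> ennreal (e/4)"
      "(\<integral>\<^sup>+z. ennreal \<bar>pull P S (\<lambda>x. f x - h x) z\<bar> \<partial>lborel) \<le> ennreal (e/4)"
    using appr[of "e/4"] e by auto
  have [measurable]: "h \<in> borel_measurable borel" using h(1) by (rule borel_measurable_continuous_onI)
  let ?Tn = "\<lambda>n. pull (Pn n) (Sn n)" and ?T = "pull P S"
  have M0: "M \<ge> 0" using h(2)[of 0] by linarith
  define w :: "'a \<Rightarrow> real" where "w z = M * indicator (cball 0 (M + c)) z" for z
  have iw: "integrable lborel w" unfolding w_def
    by (intro integrable_mult_right integrable_real_indicator) (auto simp: emeasure_bounded_finite[OF bounded_cball, simplified])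
  have bn: "\<bar>?Tn n h z\<bar> \<le> w z" for n z
  proof (cases "Pn n z \<and> norm (Sn n z) \<le> M")
    case True then show ?thesis using far(1)[of n z] h(2)[of "Sn n z"] by (auto simp: pull_def w_def)
  next
    case False then show ?thesis using h(3)[of "Sn n z"] M0 by (auto simp: pull_def w_def)
  qed
  have b: "\<bar>?T h z\<bar> \<le> w z" for z
  proof (cases "P z \<and> norm (S z) \<le> M")
    case True then show ?thesis using far(2)[of z] h(2)[of "S z"] by (auto simp: pull_def w_def)
  next
    case False then show ?thesis using h(3)[of "S z"] M0 by (auto simp: pull_def w_def)
  qed
  have in1: "integrable lborel (?Tn n h)" for n
    by (rule Bochner_Integration.integrable_bound[OF iw]) (use bn order_trans[OF bn abs_ge_self] in auto)
  have in2: "integrable lborel (?T h)"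
    by (rule Bochner_Integration.integrable_bound[OF iw]) (use order_trans[OF b abs_ge_self] in auto)
  have "(\<lambda>n. LINT z|lborel. \<bar>?Tn n h z - ?T h z\<bar>) \<longlonglongrightarrow> (LINT z|(lborel :: 'a measure). (0::real))"
  proof (rule integral_dominated_convergence[where w = "\<lambda>z. 2 * w z"])
    show "AE z in lborel. (\<lambda>n. \<bar>?Tn n h z - ?T h z\<bar>) \<longlonglongrightarrow> 0"
      using conv
    proof eventually_elim
      case (elim z)
      have "(\<lambda>n. ?Tn n h z) \<longlonglongrightarrow> ?T h z"
      proof (cases "P z")
        case True
        then have "(\<lambda>n. h (Sn n z)) \<longlonglongrightarrow> h (S z)"
          using h(1) elim by (intro isCont_tendsto_compose[of _ h]) (auto simp: continuous_on_eq_continuous_at)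
        moreover have "\<forall>\<^sub>F n in sequentially. h (Sn n z) = ?Tn n h z"
          using elim True by (auto simp: pull_def elim: eventually_mono)
        ultimately show ?thesis using True
          by (simp add: pull_def Lim_transform_eventually)
      next
        case False
        then have "\<forall>\<^sub>F n in sequentially. 0 = ?Tn n h z"
          using elim by (auto simp: pull_def elim: eventually_mono)
        then have "(\<lambda>n. ?Tn n h z) \<longlonglongrightarrow> 0" by (intro tendsto_eventually) (auto elim: eventually_mono)
        then show ?thesis using False by (simp add: pull_def)
      qed
      from tendsto_diff[OF this tendsto_const[of "?T h z"]]
      show ?case by (intro tendsto_rabs_zero) simp
    qed
    show "AE z in lborel. norm \<bar>?Tn n h z - ?T h z\<bar> \<le> 2 * w z" for n
    proof (intro AE_I2)
      fix z show "norm \<bar>?Tn n h z - ?T h z\<bar> \<le> 2 * w z"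
        using bn[of n z] b[of z] unfolding real_norm_def by linarith
    qed
  qed (use iw in1 in2 in simp_all)
  then have "\<forall>\<^sub>F n in sequentially. (LINT z|lborel. \<bar>?Tn n h z - ?T h z\<bar>) < e / 4"
    using e by (intro order_tendstoD(2)[of _ 0]) auto
  then obtain N where N: "\<And>n. n \<ge> N \<Longrightarrow> (LINT z|lborel. \<bar>?Tn n h z - ?T h z\<bar>) < e / 4"
    by (auto simp: eventually_sequentially)
  have dn: "?Tn n (\<lambda>x. f x - h x) = (\<lambda>z. ?Tn n f z - ?Tn n h z)" for n by (auto simp: pull_def)
  have dd: "?T (\<lambda>x. f x - h x) = (\<lambda>z. ?T f z - ?T h z)" by (auto simp: pull_def)
  have a1: "(LINT z|lborel. \<bar>?Tn n f z - ?Tn n h z\<bar>) \<le> e/4" for n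
  proof -
    have "ennreal (LINT z|lborel. \<bar>?Tn n f z - ?Tn n h z\<bar>) \<le> ennreal (e/4)"
      using a(1)[of n] int in1 unfolding dn by (subst nn_integral_eq_integral[symmetric]) auto
    then show ?thesis using e by simp
  qed
  have a2: "(LINT z|lborel. \<bar>?T f z - ?T h z\<bar>) \<le> e/4"
  proof -
    have "ennreal (LINT z|lborel. \<bar>?T f z - ?T h z\<bar>) \<le> ennreal (e/4)"
      using a(2) int in2 unfolding dd by (subst nn_integral_eq_integral[symmetric]) auto
    then show ?thesis using e by simp
  qed
  have "norm ((LINT z|lborel. \<bar>?Tn n f z - ?T f z\<bar>) - 0) < e" if "n \<ge> N" for n
  proof -
    have "(LINT z|lborel. \<bar>?Tn n f z - ?T f z\<bar>) \<le>
        (LINT z|lborel. \<bar>?Tn n f z - ?Tn n h z\<bar> + \<bar>?Tn n h z - ?T h z\<bar> + \<bar>?T f z - ?T h z\<bar>)"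
      using int in1 in2 by (intro integral_mono) auto
    also have "\<dots> = (LINT z|lborel. \<bar>?Tn n f z - ?Tn n h z\<bar>) + (LINT z|lborel. \<bar>?Tn n h z - ?T h z\<bar>)
         + (LINT z|lborel. \<bar>?T f z - ?T h z\<bar>)"
      using int in1 in2 by (simp add: Bochner_Integration.integral_add)
    also have "\<dots> < e" using a1[of n] N[OF that] a2 e by linarith
    finally show ?thesis by simp
  qed
  then show "\<exists>N. \<forall>n\<ge>N. norm ((LINT z|lborel. \<bar>?Tn n f z - ?T f z\<bar>) - 0) < e" by blast
qed

section \<open>Free and trapped velocities\<close>

text \<open>At a point where the potential is \<open>p\<close>, a particle with \<open>\<xi>\<^sub>1\<^sup>2 > 2 p\<close> has positive energy and
  reaches infinity, where its velocity is \<open>free_map p\<close>.  One with \<open>\<xi>\<^sub>1\<^sup>2 < 2 p\<close> has come from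
  the wall, where the potential is \<open>b\<close>, with velocity \<open>trap_map b p\<close>.\<close>

definition free_dom :: "real \<Rightarrow> velocity \<Rightarrow> bool" where "free_dom p z \<longleftrightarrow> 2 * p < (fst z)\<^sup>2"
definition free_map :: "real \<Rightarrow> velocity \<Rightarrow> velocity" where
  "free_map p z = (sgn (fst z) * sqrt ((fst z)\<^sup>2 - 2 * p), snd z)"
definition trap_dom :: "real \<Rightarrow> velocity \<Rightarrow> bool" where "trap_dom p z \<longleftrightarrow> (fst z)\<^sup>2 < 2 * p"
definition trap_map :: "real \<Rightarrow> real \<Rightarrow> velocity \<Rightarrow> velocity" where
  "trap_map b p z = (sqrt ((fst z)\<^sup>2 + 2 * (b - p)), snd z)"

lemma borel_measurable_sgn_real [measurable]: "(sgn :: real \<Rightarrow> real) \<in> borel_measurable borel"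
  unfolding sgn_if[abs_def] by measurable

lemma free_trap_measurable [measurable]:
  "Measurable.pred borel (free_dom p)" "Measurable.pred borel (trap_dom p)"
  "free_map p \<in> borel_measurable borel" "trap_map b p \<in> borel_measurable borel"
proof -
  show "Measurable.pred borel (free_dom p)" "Measurable.pred borel (trap_dom p)"
    unfolding free_dom_def trap_dom_def borel_prod[symmetric] by measurable
  have "free_map p \<in> borel \<Otimes>\<^sub>M borel \<rightarrow>\<^sub>M borel \<Otimes>\<^sub>M borel" "trap_map b p \<in> borel \<Otimes>\<^sub>M borel \<rightarrow>\<^sub>M borel \<Otimes>\<^sub>M borel"
    unfolding free_map_def trap_map_def by measurable
  then show "free_map p \<in> borel_measurable borel" "trap_map b p \<in> borel_measurable borel"
    by (simp_all add: borel_prod)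
qed

text \<open>Substitute \<open>v = sgn s * sqrt (s\<^sup>2 + 2 * p)\<close>; the kernel is the derivative of this map.\<close>

lemma nn_integral_free_real:
  fixes g :: "real \<Rightarrow> ennreal"
  assumes [measurable]: "g \<in> borel_measurable borel" and p: "p \<ge> 0"
  shows "(\<integral>\<^sup>+v. g (sgn v * sqrt (v\<^sup>2 - 2 * p)) * indicator {v. 2 * p < v\<^sup>2} v \<partial>lborel)
       = (\<integral>\<^sup>+s. g s * ennreal (\<bar>s\<bar> / sqrt (s\<^sup>2 + 2 * p)) \<partial>lborel)"
proof -
  define k where "k s = sgn s * sqrt (s\<^sup>2 + 2 * p)" for s :: real
  have inv: "sgn (k s) * sqrt ((k s)\<^sup>2 - 2 * p) = s" if "s \<noteq> 0" for s
  proof -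
    have "s\<^sup>2 + 2 * p > 0" using that p by (intro add_pos_nonneg) auto
    then show ?thesis using that by (auto simp: k_def sgn_mult power_mult_distrib sgn_if)
  qed
  have im: "k ` (- {0}) = {v. 2 * p < v\<^sup>2}"
  proof (intro equalityI subsetI)
    fix v assume "v \<in> k ` (- {0})"
    then obtain s where s: "s \<noteq> 0" "v = k s" by auto
    have "v\<^sup>2 = s\<^sup>2 + 2 * p" using s p by (simp add: k_def power_mult_distrib sgn_if)
    then show "v \<in> {v. 2 * p < v\<^sup>2}" using s by simp
  next
    fix v assume v: "v \<in> {v. 2 * p < v\<^sup>2}"
    then have "v \<noteq> 0" using p by auto
    then have "v = k (sgn v * sqrt (v\<^sup>2 - 2 * p))" using v by (auto simp: k_def sgn_mult power_mult_distrib sgn_if)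
    moreover have "sgn v * sqrt (v\<^sup>2 - 2 * p) \<noteq> 0" using v \<open>v \<noteq> 0\<close> by (auto simp: sgn_if)
    ultimately show "v \<in> k ` (- {0})" by blast
  qed
  have der: "(k has_real_derivative \<bar>s\<bar> / sqrt (s\<^sup>2 + 2 * p)) (at s within - {0})" if "s \<in> - {0}" for s
  proof -
    have P: "s\<^sup>2 + 2 * p > 0" using that p by (intro add_pos_nonneg) auto
    show ?thesis
  proof (cases "s > 0")
    case True
    have "((\<lambda>s. sqrt (s\<^sup>2 + 2 * p)) has_real_derivative \<bar>s\<bar> / sqrt (s\<^sup>2 + 2 * p)) (at s)"
      using True P by (auto intro!: derivative_eq_intros simp: divide_simps)
    then have "(k has_real_derivative \<bar>s\<bar> / sqrt (s\<^sup>2 + 2 * p)) (at s)"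
      by (rule has_field_derivative_transform_within_open[of _ _ _ "{0<..}"]) (use True in \<open>auto simp: k_def\<close>)
    then show ?thesis by (rule has_field_derivative_at_within)
  next
    case False
    have "((\<lambda>s. - sqrt (s\<^sup>2 + 2 * p)) has_real_derivative \<bar>s\<bar> / sqrt (s\<^sup>2 + 2 * p)) (at s)"
      using False that P by (auto intro!: derivative_eq_intros simp: divide_simps)
    then have "(k has_real_derivative \<bar>s\<bar> / sqrt (s\<^sup>2 + 2 * p)) (at s)"
      by (rule has_field_derivative_transform_within_open[of _ _ _ "{..<0}"]) (use False that in \<open>auto simp: k_def\<close>)
    then show ?thesis by (rule has_field_derivative_at_within)
  qed
  qed
  have inj: "inj_on k (- {0})"
    by (rule inj_on_inverseI[where g = "\<lambda>v. sgn v * sqrt (v\<^sup>2 - 2 * p)"]) (use inv in auto)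
  have [measurable]: "k \<in> borel_measurable borel" unfolding k_def by measurable
  have "(\<integral>\<^sup>+v. g (sgn v * sqrt (v\<^sup>2 - 2 * p)) * indicator (k ` (- {0})) v \<partial>lborel)
     = (\<integral>\<^sup>+s. g (sgn (k s) * sqrt ((k s)\<^sup>2 - 2 * p)) * ennreal \<bar>\<bar>s\<bar> / sqrt (s\<^sup>2 + 2 * p)\<bar> * indicator (- {0}) s \<partial>lborel)"
    by (rule nn_integral_real_substitution[OF _ _ _ _ der inj]) (auto simp: im)
  also have "\<dots> = (\<integral>\<^sup>+s. g s * ennreal (\<bar>s\<bar> / sqrt (s\<^sup>2 + 2 * p)) \<partial>lborel)"
    using inv p by (intro nn_integral_cong) (auto split: split_indicator)
  finally show ?thesis by (simp add: im)
qed

text \<open>Substitute \<open>v = \<plusminus> sqrt (s\<^sup>2 - 2 * (b - p))\<close>; the two signs account for the factor \<open>2\<close>, since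
  a trapped particle passes every point twice.\<close>

lemma nn_integral_trap_real:
  fixes g :: "real \<Rightarrow> ennreal"
  assumes [measurable]: "g \<in> borel_measurable borel" and p: "0 \<le> p" "p \<le> b"
  shows "(\<integral>\<^sup>+v. g (sqrt (v\<^sup>2 + 2 * (b - p))) * indicator {v. v\<^sup>2 < 2 * p} v \<partial>lborel)
       = 2 * (\<integral>\<^sup>+s. g s * ennreal (s / sqrt (s\<^sup>2 - 2 * (b - p))) * indicator {sqrt (2 * (b - p))<..<sqrt (2 * b)} s \<partial>lborel)"
proof -
  define c where "c = sqrt (2 * (b - p))"
  have c: "c \<ge> 0" "c\<^sup>2 = 2 * (b - p)" using p by (auto simp: c_def)
  define k where "k s = sqrt (s\<^sup>2 - c\<^sup>2)" for s :: real
  let ?S = "{c<..<sqrt (2 * b)}"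
  have pos: "s\<^sup>2 - c\<^sup>2 > 0" if "s \<in> ?S" for s using that c(1) by (auto simp: power_strict_mono)
  have im: "k ` ?S = {0<..<sqrt (2 * p)}"
  proof (intro equalityI subsetI)
    fix v assume "v \<in> k ` ?S"
    then obtain s where s: "s \<in> ?S" "v = k s" by auto
    have "s < sqrt (2 * b)" "s \<ge> 0" using s c(1) by auto
    then have "s\<^sup>2 < (sqrt (2 * b))\<^sup>2" by (intro power_strict_mono) auto
    then have "s\<^sup>2 < 2 * b" using p by simp
    then show "v \<in> {0<..<sqrt (2 * p)}" using s pos[OF s(1)] c(2) by (auto simp: k_def)
  next
    fix v assume v: "v \<in> {0<..<sqrt (2 * p)}"
    then have "v\<^sup>2 < (sqrt (2 * p))\<^sup>2" by (intro power_strict_mono) auto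
    then have v2: "v\<^sup>2 < 2 * p" using p by simp
    have "sqrt (v\<^sup>2 + c\<^sup>2) > sqrt (c\<^sup>2)" using v by (intro real_sqrt_less_mono) auto
    then have "sqrt (v\<^sup>2 + c\<^sup>2) > c" using c(1) by simp
    moreover have "sqrt (v\<^sup>2 + c\<^sup>2) < sqrt (2 * b)" using v2 c(2) by (intro real_sqrt_less_mono) auto
    ultimately have "sqrt (v\<^sup>2 + c\<^sup>2) \<in> ?S" by simp
    moreover have "k (sqrt (v\<^sup>2 + c\<^sup>2)) = v" using v by (auto simp: k_def)
    ultimately show "v \<in> k ` ?S" by (metis image_eqI)
  qed
  have der: "(k has_real_derivative s / sqrt (s\<^sup>2 - c\<^sup>2)) (at s within ?S)" if "s \<in> ?S" for s
    unfolding k_def using pos[OF that] by (auto intro!: derivative_eq_intros simp: field_simps)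
  have inv: "sqrt ((k s)\<^sup>2 + c\<^sup>2) = s" if "s \<in> ?S" for s
    using pos[OF that] that c(1) by (auto simp: k_def)
  have inj: "inj_on k ?S" by (rule inj_on_inverseI[where g = "\<lambda>v. sqrt (v\<^sup>2 + c\<^sup>2)"]) (use inv in auto)
  have [measurable]: "k \<in> borel_measurable borel" unfolding k_def by measurable
  let ?G = "\<lambda>v. g (sqrt (v\<^sup>2 + c\<^sup>2))"
  have half: "(\<integral>\<^sup>+v. ?G v * indicator {0<..<sqrt (2 * p)} v \<partial>lborel) =
      (\<integral>\<^sup>+s. g s * ennreal (s / sqrt (s\<^sup>2 - c\<^sup>2)) * indicator ?S s \<partial>lborel)"
  proof -
    have "(\<integral>\<^sup>+v. ?G v * indicator (k ` ?S) v \<partial>lborel) =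
        (\<integral>\<^sup>+s. ?G (k s) * ennreal \<bar>s / sqrt (s\<^sup>2 - c\<^sup>2)\<bar> * indicator ?S s \<partial>lborel)"
      by (rule nn_integral_real_substitution[OF _ _ _ _ der inj]) (auto simp: im)
    also have "\<dots> = (\<integral>\<^sup>+s. g s * ennreal (s / sqrt (s\<^sup>2 - c\<^sup>2)) * indicator ?S s \<partial>lborel)"
      using inv c(1) pos by (intro nn_integral_cong) (auto split: split_indicator)
    finally show ?thesis by (simp add: im)
  qed
  have mirror: "(\<integral>\<^sup>+v. ?G v * indicator {-sqrt (2 * p)<..<0} v \<partial>lborel) = (\<integral>\<^sup>+v. ?G v * indicator {0<..<sqrt (2 * p)} v \<partial>lborel)"
    by (subst nn_integral_real_affine[where c = "-1" and t = 0])
       (auto intro!: nn_integral_cong split: split_indicator)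
  have set: "v\<^sup>2 < 2 * p \<longleftrightarrow> \<bar>v\<bar> < sqrt (2 * p)" for v
    using p by (metis real_sqrt_abs real_sqrt_less_iff)
  have "AE v in lborel. v \<noteq> (0::real)" by (rule AE_lborel_singleton)
  then have "(\<integral>\<^sup>+v. ?G v * indicator {v. v\<^sup>2 < 2 * p} v \<partial>lborel) =
     (\<integral>\<^sup>+v. ?G v * indicator {-sqrt (2 * p)<..<0} v + ?G v * indicator {0<..<sqrt (2 * p)} v \<partial>lborel)"
  proof (intro nn_integral_cong_AE, eventually_elim)
    case (elim v)
    have "indicator {v. v\<^sup>2 < 2 * p} v = (indicator {-sqrt (2 * p)<..<0} v + indicator {0<..<sqrt (2 * p)} v :: ennreal)"
      using elim by (auto simp: set split: split_indicator)
    then show ?case by (simp add: distrib_left)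
  qed
  also have "\<dots> = 2 * (\<integral>\<^sup>+s. g s * ennreal (s / sqrt (s\<^sup>2 - c\<^sup>2)) * indicator ?S s \<partial>lborel)"
    by (subst nn_integral_add, simp, simp) (simp only: mirror half mult_2[where 'a=ennreal])
  finally show ?thesis unfolding c(2) c_def[symmetric] .
qed

lemma nn_integral_free:
  fixes g :: "velocity \<Rightarrow> ennreal"
  assumes [measurable]: "g \<in> borel_measurable borel" and p: "p \<ge> 0"
  shows "(\<integral>\<^sup>+z. (if free_dom p z then g (free_map p z) else 0) \<partial>lborel)
       = (\<integral>\<^sup>+z. g z * ennreal (\<bar>fst z\<bar> / sqrt ((fst z)\<^sup>2 + 2 * p)) \<partial>lborel)"
proof -
  have [measurable]: "g \<in> borel_measurable (borel \<Otimes>\<^sub>M borel)" by (simp add: borel_prod)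
  have "(\<integral>\<^sup>+z. (if free_dom p z then g (free_map p z) else 0) \<partial>lborel)
      = (\<integral>\<^sup>+\<eta>. \<integral>\<^sup>+v. g (sgn v * sqrt (v\<^sup>2 - 2 * p), \<eta>) * indicator {v. 2 * p < v\<^sup>2} v \<partial>lborel \<partial>lborel)"
    by (subst nn_integral_lborel_pair(1), measurable)
       (auto intro!: nn_integral_cong simp: free_dom_def free_map_def split: split_indicator)
  also have "\<dots> = (\<integral>\<^sup>+\<eta>. \<integral>\<^sup>+s. g (s, \<eta>) * ennreal (\<bar>s\<bar> / sqrt (s\<^sup>2 + 2 * p)) \<partial>lborel \<partial>lborel)"
    by (intro nn_integral_cong nn_integral_free_real p) measurable
  also have "\<dots> = (\<integral>\<^sup>+z. g z * ennreal (\<bar>fst z\<bar> / sqrt ((fst z)\<^sup>2 + 2 * p)) \<partial>lborel)"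
    by (subst nn_integral_lborel_pair(1)) (auto simp flip: borel_prod)
  finally show ?thesis .
qed

lemma nn_integral_trap:
  fixes g :: "velocity \<Rightarrow> ennreal"
  assumes [measurable]: "g \<in> borel_measurable borel" and p: "0 \<le> p" "p \<le> b"
  shows "(\<integral>\<^sup>+z. (if trap_dom p z then g (trap_map b p z) else 0) \<partial>lborel)
       = 2 * (\<integral>\<^sup>+s. (\<integral>\<^sup>+\<eta>. g (s, \<eta>) \<partial>lborel) * ennreal (s / sqrt (s\<^sup>2 - 2 * (b - p)))
            * indicator {sqrt (2 * (b - p))<..<sqrt (2 * b)} s \<partial>lborel)"
proof -
  have [measurable]: "g \<in> borel_measurable (borel \<Otimes>\<^sub>M borel)" by (simp add: borel_prod)
  let ?k = "\<lambda>s. ennreal (s / sqrt (s\<^sup>2 - 2 * (b - p))) * indicator {sqrt (2 * (b - p))<..<sqrt (2 * b)} s"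
  have "(\<integral>\<^sup>+z. (if trap_dom p z then g (trap_map b p z) else 0) \<partial>lborel)
      = (\<integral>\<^sup>+\<eta>. \<integral>\<^sup>+v. g (sqrt (v\<^sup>2 + 2 * (b - p)), \<eta>) * indicator {v. v\<^sup>2 < 2 * p} v \<partial>lborel \<partial>lborel)"
    by (subst nn_integral_lborel_pair(1), measurable)
       (auto intro!: nn_integral_cong simp: trap_dom_def trap_map_def split: split_indicator)
  also have "\<dots> = (\<integral>\<^sup>+\<eta>. 2 * (\<integral>\<^sup>+s. g (s, \<eta>) * ?k s \<partial>lborel) \<partial>lborel)"
    using p by (intro nn_integral_cong) (subst nn_integral_trap_real, auto simp: mult.assoc)
  also have "\<dots> = 2 * (\<integral>\<^sup>+\<eta>. \<integral>\<^sup>+s. g (s, \<eta>) * ?k s \<partial>lborel \<partial>lborel)"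
    by (rule nn_integral_cmult) measurable
  also have "(\<integral>\<^sup>+\<eta>. \<integral>\<^sup>+s. g (s, \<eta>) * ?k s \<partial>lborel \<partial>lborel) = (\<integral>\<^sup>+s. \<integral>\<^sup>+\<eta>. g (s, \<eta>) * ?k s \<partial>lborel \<partial>lborel)"
    by (rule lborel_pair.Fubini'[symmetric]) measurable
  also have "\<dots> = (\<integral>\<^sup>+s. (\<integral>\<^sup>+\<eta>. g (s, \<eta>) \<partial>lborel) * ?k s \<partial>lborel)"
    by (intro nn_integral_cong nn_integral_multc) measurable
  finally show ?thesis by (simp add: mult.assoc)
qed

definition marg :: "(velocity \<Rightarrow> real) \<Rightarrow> real \<Rightarrow> real" where
  "marg g s = (LINT \<eta>|lborel. \<bar>g (s, \<eta>)\<bar>)"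

lemma marg_nonneg [simp]: "marg g s \<ge> 0"
  by (auto simp: marg_def)

lemma marg_measurable [measurable]: 
  assumes [measurable]: "g \<in> borel_measurable borel" shows "marg g \<in> borel_measurable borel"
proof -
  have [measurable]: "g \<in> borel_measurable (borel \<Otimes>\<^sub>M borel)" by (simp add: borel_prod)
  have "(\<lambda>s. LINT \<eta>|lborel. \<bar>g (s, \<eta>)\<bar>) \<in> borel_measurable borel"
    by (rule lborel.borel_measurable_lebesgue_integral) measurable
  then show ?thesis by (simp add: marg_def[abs_def])
qed

lemma AE_integrable_section:
  fixes g :: "velocity \<Rightarrow> real"
  assumes g: "integrable lborel g"
  shows "AE s in lborel. integrable lborel (\<lambda>\<eta>. g (s, \<eta>))"
  using lborel_pair.AE_integrable_fst'[of g] g by (simp add: lborel_prod)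

lemma nn_integral_marg:
  assumes g: "integrable lborel g"
  shows "AE s in lborel. (\<integral>\<^sup>+\<eta>. ennreal \<bar>g (s, \<eta>)\<bar> \<partial>lborel) = ennreal (marg g s)"
  using AE_integrable_section[OF g]
  by eventually_elim (simp add: marg_def nn_integral_eq_integral)

lemma marg_triangle:
  assumes g: "integrable lborel g" and h: "integrable lborel h"
  shows "AE s in lborel. marg (\<lambda>z. g z + h z) s \<le> marg g s + marg h s"
  using AE_integrable_section[OF g] AE_integrable_section[OF h]
proof eventually_elim
  case (elim s)
  have "marg (\<lambda>z. g z + h z) s \<le> (LINT \<eta>|lborel. \<bar>g (s, \<eta>)\<bar> + \<bar>h (s, \<eta>)\<bar>)"
    unfolding marg_def using elim by (intro integral_mono) auto
  also have "\<dots> = marg g s + marg h s"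
    unfolding marg_def using elim by (intro Bochner_Integration.integral_add) auto
  finally show ?case .
qed

lemma nn_integral_marg_total:
  assumes g: "integrable lborel g"
  shows "(\<integral>\<^sup>+s. ennreal (marg g s) \<partial>lborel) = ennreal (LINT z|lborel. \<bar>g z\<bar>)"
proof -
  have [measurable]: "g \<in> borel_measurable borel" using g by auto
  have "(\<integral>\<^sup>+s. ennreal (marg g s) \<partial>lborel) = (\<integral>\<^sup>+s. \<integral>\<^sup>+\<eta>. ennreal \<bar>g (s, \<eta>)\<bar> \<partial>lborel \<partial>lborel)"
    by (intro nn_integral_cong_AE) (use nn_integral_marg[OF g] in \<open>auto elim: eventually_mono\<close>)
  also have "\<dots> = (\<integral>\<^sup>+z. ennreal \<bar>g z\<bar> \<partial>lborel)"
    by (subst nn_integral_lborel_pair(2)) auto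
  also have "\<dots> = ennreal (LINT z|lborel. \<bar>g z\<bar>)" using g by (intro nn_integral_eq_integral) auto
  finally show ?thesis .
qed

lemma nn_integral_powr_singularity:
  assumes \<gamma>: "0 < \<gamma>" and cS: "c < S"
  shows "(\<integral>\<^sup>+s. ennreal ((s - c) powr (\<gamma> - 1)) * indicator {c<..<S} s \<partial>lborel) = ennreal ((S - c) powr \<gamma> / \<gamma>)"
proof -
  define k where "k s = (s - c) powr \<gamma>" for s
  have im: "k ` {c<..<S} = {0<..<(S - c) powr \<gamma>}"
  proof (intro equalityI subsetI)
    fix y assume "y \<in> k ` {c<..<S}" then show "y \<in> {0<..<(S - c) powr \<gamma>}"
      using \<gamma> by (auto simp: k_def intro!: powr_less_mono2)
  next
    fix y assume y: "y \<in> {0<..<(S - c) powr \<gamma>}"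
    then have "y powr (1/\<gamma>) < ((S - c) powr \<gamma>) powr (1/\<gamma>)" using \<gamma> by (intro powr_less_mono2) auto
    then have "c + y powr (1/\<gamma>) \<in> {c<..<S}" using y \<gamma> cS by (auto simp: powr_powr)
    moreover have "k (c + y powr (1/\<gamma>)) = y" using y \<gamma> by (simp add: k_def powr_powr)
    ultimately show "y \<in> k ` {c<..<S}" by (metis image_eqI)
  qed
  have der: "(k has_real_derivative \<gamma> * (s - c) powr (\<gamma> - 1)) (at s within {c<..<S})" if "s \<in> {c<..<S}" for s
    unfolding k_def using that by (auto intro!: derivative_eq_intros simp: )
  have inj: "inj_on k {c<..<S}"
    by (rule inj_on_inverseI[where g = "\<lambda>y. c + y powr (1/\<gamma>)"]) (use \<gamma> in \<open>auto simp: k_def powr_powr\<close>)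
  have [measurable]: "k \<in> borel_measurable borel" unfolding k_def by measurable
  have "(\<integral>\<^sup>+y. 1 * indicator (k ` {c<..<S}) y \<partial>lborel) = 
     (\<integral>\<^sup>+s. 1 * ennreal \<bar>\<gamma> * (s - c) powr (\<gamma> - 1)\<bar> * indicator {c<..<S} s \<partial>lborel)"
    by (rule nn_integral_real_substitution[OF _ _ _ _ der inj]) (auto simp: im)
  also have "\<dots> = (\<integral>\<^sup>+s. ennreal \<gamma> * (ennreal ((s - c) powr (\<gamma> - 1)) * indicator {c<..<S} s) \<partial>lborel)"
    using \<gamma> by (intro nn_integral_cong) (auto simp: abs_mult ennreal_mult' split: split_indicator)
  also have "\<dots> = ennreal \<gamma> * (\<integral>\<^sup>+s. ennreal ((s - c) powr (\<gamma> - 1)) * indicator {c<..<S} s \<partial>lborel)"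
    by (rule nn_integral_cmult) measurable
  finally have e: "ennreal \<gamma> * (\<integral>\<^sup>+s. ennreal ((s - c) powr (\<gamma> - 1)) * indicator {c<..<S} s \<partial>lborel) = ennreal ((S - c) powr \<gamma>)"
    by (simp add: im)
  let ?I = "(\<integral>\<^sup>+s. ennreal ((s - c) powr (\<gamma> - 1)) * indicator {c<..<S} s \<partial>lborel)"
  have "?I = ennreal (1/\<gamma>) * (ennreal \<gamma> * ?I)"
    using \<gamma> by (simp add: mult.assoc[symmetric] ennreal_mult'[symmetric] divide_simps)
  also have "\<dots> = ennreal ((S - c) powr \<gamma> / \<gamma>)"
    unfolding e using \<gamma> by (simp add: ennreal_mult'[symmetric])
  finally show ?thesis .
qed

text \<open>Bounding the kernel by \<open>sqrt (S / (s - c))\<close>, with \<open>c\<close> and \<open>S\<close> the ends of the interval, leaves a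
  power singularity of order \<open>q / 2 < 1\<close>.  The bound is uniform in \<open>p\<close>.\<close>

lemma trap_kernel_bound:
  assumes b: "b > 0" and p: "0 \<le> p" "p \<le> b" and q: "0 < q" "q < 2"
  shows "(\<integral>\<^sup>+s. ennreal ((s / sqrt (s\<^sup>2 - 2 * (b - p))) powr q) * indicator {sqrt (2 * (b - p))<..<sqrt (2 * b)} s \<partial>lborel)
     \<le> ennreal (sqrt (2 * b) / (1 - q / 2))"
proof (cases "p = 0")
  case True then show ?thesis by simp
next
  case False
  define c where "c = sqrt (2 * (b - p))" define S where "S = sqrt (2 * b)"
  have c: "c \<ge> 0" "c\<^sup>2 = 2 * (b - p)" using p by (auto simp: c_def)
  have cS: "c < S" using p False by (auto simp: c_def S_def)
  define \<gamma> where "\<gamma> = 1 - q / 2"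
  have \<gamma>: "0 < \<gamma>" using q by (simp add: \<gamma>_def)
  have le: "(s / sqrt (s\<^sup>2 - c\<^sup>2)) powr q \<le> S powr (q/2) * (s - c) powr (\<gamma> - 1)" if s: "s \<in> {c<..<S}" for s
  proof -
    have "s > 0" using s c by auto
    have "c\<^sup>2 \<le> s\<^sup>2" using s c(1) by (intro power_mono) auto
    then have nn: "0 \<le> s / sqrt (s\<^sup>2 - c\<^sup>2)" using \<open>s > 0\<close> by simp
    have "s / sqrt (s\<^sup>2 - c\<^sup>2) = sqrt (s\<^sup>2 / (s\<^sup>2 - c\<^sup>2))" using \<open>s > 0\<close> by (simp add: real_sqrt_divide)
    also have "s\<^sup>2 / (s\<^sup>2 - c\<^sup>2) \<le> S / (s - c)"
    proof -
      have "s\<^sup>2 - c\<^sup>2 = (s - c) * (s + c)" by (simp add: power2_eq_square algebra_simps)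
      then have "s\<^sup>2 / (s\<^sup>2 - c\<^sup>2) = s / (s - c) * (s / (s + c))" by (simp add: power2_eq_square)
      also have "\<dots> \<le> S / (s - c) * 1" using s \<open>s > 0\<close> c by (intro mult_mono) (auto simp: divide_simps)
      finally show ?thesis by simp
    qed
    then have "sqrt (s\<^sup>2 / (s\<^sup>2 - c\<^sup>2)) \<le> sqrt (S / (s - c))" by simp
    finally have "(s / sqrt (s\<^sup>2 - c\<^sup>2)) powr q \<le> sqrt (S / (s - c)) powr q"
      using q nn by (intro powr_mono2) auto
    also have "\<dots> = (S / (s - c)) powr (q/2)"
      using s \<open>s > 0\<close> by (subst powr_half_sqrt[symmetric]) (auto simp: powr_powr)
    also have "\<dots> = S powr (q/2) * (s - c) powr (\<gamma> - 1)"
      using s \<open>s > 0\<close> by (simp add: powr_divide \<gamma>_def powr_minus_divide)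
    finally show ?thesis .
  qed
  have "(\<integral>\<^sup>+s. ennreal ((s / sqrt (s\<^sup>2 - c\<^sup>2)) powr q) * indicator {c<..<S} s \<partial>lborel)
     \<le> (\<integral>\<^sup>+s. ennreal (S powr (q/2)) * (ennreal ((s - c) powr (\<gamma> - 1)) * indicator {c<..<S} s) \<partial>lborel)"
    using le by (intro nn_integral_mono) (auto simp: ennreal_mult'[symmetric] ennreal_leI split: split_indicator)
  also have "\<dots> = ennreal (S powr (q/2)) * ennreal ((S - c) powr \<gamma> / \<gamma>)"
    by (subst nn_integral_cmult) (auto simp: nn_integral_powr_singularity[OF \<gamma> cS])
  also have "\<dots> \<le> ennreal (S powr (q/2)) * ennreal (S powr \<gamma> / \<gamma>)"
    using c cS \<gamma> by (intro mult_left_mono ennreal_leI divide_right_mono powr_mono2) auto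
  also have "\<dots> = ennreal (S / \<gamma>)"
    using cS c \<gamma> by (simp add: ennreal_mult'[symmetric] powr_add[symmetric] \<gamma>_def)
  finally show ?thesis unfolding c(2) unfolding \<gamma>_def S_def c_def .
qed

text \<open>Young's inequality with weight \<open>d\<close> for the product of \<open>marg g\<close> and the kernel.  The conjugate
  exponent of \<open>r > 2\<close> is less than \<open>2\<close>, so the kernel part is finite, and a small \<open>d\<close>
  makes it small uniformly in \<open>p\<close>.\<close>

lemma trap_bound:
  assumes b: "b > 0" and p: "0 \<le> p" "p \<le> b" and r: "r > 2" and d: "d > 0" and e: "e \<ge> 0"
    and g: "integrable lborel g"
    and gr: "(\<integral>\<^sup>+s. ennreal (marg g s powr r) * indicator {0<..<sqrt (2 * b)} s \<partial>lborel) \<le> ennreal e"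
  shows "(\<integral>\<^sup>+z. ennreal \<bar>pull (trap_dom p) (trap_map b p) g z\<bar> \<partial>lborel)
     \<le> ennreal (2 * ((1/d) powr r * e + d powr (r/(r-1)) * (sqrt (2 * b) / (1 - r/(r-1) / 2))))"
proof -
  have [measurable]: "g \<in> borel_measurable borel" using g by auto
  define q where "q = r / (r - 1)"
  have q: "0 < q" "q < 2" "q > 1" "1/r + 1/q = 1" using r by (auto simp: q_def field_simps)
  let ?I = "{sqrt (2 * (b - p))<..<sqrt (2 * b)}"
  let ?k = "\<lambda>s. s / sqrt (s\<^sup>2 - 2 * (b - p))"
  have mg: "marg g \<in> borel_measurable lborel" using marg_measurable[of g] by simp
  have m1: "(\<lambda>s. ennreal (marg g s powr r) * indicator {0<..<sqrt (2 * b)} s) \<in> borel_measurable lborel"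
    by (intro borel_measurable_times_ennreal measurable_compose[OF _ measurable_ennreal] borel_measurable_indicator powr_real_measurable mg borel_measurable_const) auto
  have m2: "(\<lambda>s. ennreal (?k s powr q) * indicator ?I s) \<in> borel_measurable lborel"
    by (intro borel_measurable_times_ennreal measurable_compose[OF _ measurable_ennreal] borel_measurable_indicator powr_real_measurable) auto
  have young: "marg g s * ?k s \<le> (1/d) powr r * marg g s powr r + d powr q * ?k s powr q" if "s \<in> ?I" for s
  proof -
    have s0: "s > 0" 
    proof -
      have "0 \<le> sqrt (2 * (b - p))" using p by simp
      also have "\<dots> < s" using that by simp
      finally show ?thesis .
    qed
    have "sqrt (2 * (b - p)) < s" using that by auto
    then have "2 * (b - p) < s\<^sup>2" using p s0 by (metis real_sqrt_less_iff real_sqrt_abs abs_of_pos)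
    then have k0: "?k s \<ge> 0" using s0 by simp
    have "(marg g s * (1/d)) * (d * ?k s) \<le> (marg g s * (1/d)) powr r / r + (d * ?k s) powr q / q"
      using q r d mult_nonneg_nonneg[OF less_imp_le[OF d] k0] by (intro Youngs_inequality) auto
    also have "\<dots> \<le> (marg g s * (1/d)) powr r / 1 + (d * ?k s) powr q / 1"
      using q r by (intro add_mono divide_left_mono) auto
    finally show ?thesis using d k0 by (simp add: powr_mult powr_divide mult.commute)
  qed
  let ?J = "\<integral>\<^sup>+s. (\<integral>\<^sup>+\<eta>. ennreal \<bar>g (s, \<eta>)\<bar> \<partial>lborel) * ennreal (?k s) * indicator ?I s \<partial>lborel"
  let ?C = "sqrt (2 * b) / (1 - q / 2)"
  have "(\<integral>\<^sup>+z. ennreal \<bar>pull (trap_dom p) (trap_map b p) g z\<bar> \<partial>lborel)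
     = (\<integral>\<^sup>+z. (if trap_dom p z then ennreal \<bar>g (trap_map b p z)\<bar> else 0) \<partial>lborel)"
    by (intro nn_integral_cong) (auto simp: pull_def)
  also have "\<dots> = 2 * ?J"
    by (rule nn_integral_trap[OF _ p]) measurable
  finally have J: "(\<integral>\<^sup>+z. ennreal \<bar>pull (trap_dom p) (trap_map b p) g z\<bar> \<partial>lborel) = 2 * ?J" .
  have "?J
     \<le> (\<integral>\<^sup>+s. ennreal ((1/d) powr r) * (ennreal (marg g s powr r) * indicator {0<..<sqrt (2 * b)} s)
          + ennreal (d powr q) * (ennreal (?k s powr q) * indicator ?I s) \<partial>lborel)"
  proof (intro nn_integral_mono_AE, use nn_integral_marg[OF g] in eventually_elim)
    case (elim s)
    have "0 \<le> sqrt (2 * (b - p))" using p by simp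
    then have sI: "s \<in> {0<..<sqrt (2 * b)}" if "s \<in> ?I" using that by (metis (no_types) greaterThanLessThan_iff le_less_trans)
    show ?case
    proof (cases "s \<in> ?I")
      case True
      then have "s \<in> {0<..<sqrt (2 * b)}" by (rule sI)
      have "ennreal (marg g s) * ennreal (?k s) = ennreal (marg g s * ?k s)"
        by (rule ennreal_mult'[symmetric]) simp
      also have "\<dots> \<le> ennreal ((1/d) powr r * marg g s powr r + d powr q * ?k s powr q)"
        by (intro ennreal_leI young True)
      also have "\<dots> = ennreal ((1/d) powr r) * ennreal (marg g s powr r) + ennreal (d powr q) * ennreal (?k s powr q)"
        by (simp add: ennreal_mult')
      finally show ?thesis using True \<open>s \<in> {0<..<sqrt (2 * b)}\<close> unfolding elim by (simp only: indicator_simps mult_1_right)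
    next
      case False
      have "indicator ?I s = (0 :: ennreal)" using False by (rule indicator_simps(2))
      then show ?thesis by (simp only: mult_zero_right zero_le)
    qed
  qed
  also have "\<dots> = ennreal ((1/d) powr r) * (\<integral>\<^sup>+s. ennreal (marg g s powr r) * indicator {0<..<sqrt (2 * b)} s \<partial>lborel)
      + ennreal (d powr q) * (\<integral>\<^sup>+s. ennreal (?k s powr q) * indicator ?I s \<partial>lborel)"
    by (simp only: nn_integral_add nn_integral_cmult m1 m2 borel_measurable_times_ennreal borel_measurable_const)
  also have "\<dots> \<le> ennreal ((1/d) powr r) * ennreal e + ennreal (d powr q) * ennreal (sqrt (2 * b) / (1 - q / 2))"
    using gr by (intro add_mono mult_left_mono trap_kernel_bound[OF b p q(1,2)]) auto
  also have "\<dots> = ennreal ((1/d) powr r * e + d powr q * ?C)"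
  proof -
    have "?C \<ge> 0" using q b by simp
    then have 1: "0 \<le> d powr q * ?C" and 2: "0 \<le> (1/d) powr r * e" using e by (intro mult_nonneg_nonneg; simp)+
    show ?thesis unfolding ennreal_plus[OF 2 1] by (simp only: ennreal_mult'[OF powr_ge_zero])
  qed
  finally have "2 * ?J \<le> 2 * ennreal ((1/d) powr r * e + d powr q * ?C)" by (rule mult_left_mono) simp
  also have "\<dots> = ennreal (2 * ((1/d) powr r * e + d powr q * ?C))"
    using q b e by (intro numeral_mult_ennreal add_nonneg_nonneg mult_nonneg_nonneg divide_nonneg_nonneg) auto
  finally show ?thesis unfolding J q_def .
qed

section \<open>Approximation in \<open>L\<^sup>r(0,S;L\<^sup>1)\<close>\<close>

lemma marg_le_of_bounded_support:
  assumes g: "g \<in> borel_measurable borel" and bnd: "\<And>z. \<bar>g z\<bar> \<le> K" and supp: "\<And>z. norm z > R \<Longrightarrow> g z = 0"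
    and K: "K \<ge> 0"
  shows "marg g s \<le> K * measure lborel (cball (0 :: real^2) R)"
proof -
  have [measurable]: "g \<in> borel_measurable (borel \<Otimes>\<^sub>M borel)" using g by (simp add: borel_prod)
  have i: "integrable lborel (\<lambda>\<eta>. K * indicator (cball (0 :: real^2) R) \<eta>)"
    by (intro integrable_mult_right integrable_real_indicator) (auto simp: emeasure_bounded_finite[OF bounded_cball, simplified])
  have le: "\<bar>g (s, \<eta>)\<bar> \<le> K * indicator (cball (0 :: real^2) R) \<eta>" for \<eta>
  proof (cases "norm \<eta> \<le> R")
    case True then show ?thesis using bnd by simp
  next
    case False
    have "norm \<eta> \<le> norm (s, \<eta>)" using norm_snd_le[of "\<eta>" s] by simp
    then show ?thesis using supp[of "(s, \<eta>)"] K False by simp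
  qed
  have j: "integrable lborel (\<lambda>\<eta>. g (s, \<eta>))"
    by (rule Bochner_Integration.integrable_bound[OF i]) (use le in \<open>auto intro: order_trans[OF le abs_ge_self]\<close>)
  have "marg g s \<le> (LINT \<eta>|lborel. K * indicator (cball (0 :: real^2) R) \<eta>)"
    unfolding marg_def using le i j by (intro integral_mono) auto
  then show ?thesis by simp
qed

lemma powr_add_le:
  fixes a b r :: real assumes "a \<ge> 0" "b \<ge> 0" "r > 0"
  shows "(a + b) powr r \<le> 2 powr r * (a powr r + b powr r)"
proof -
  have "(a + b) powr r \<le> (2 * max a b) powr r" using assms by (intro powr_mono2) auto
  also have "\<dots> = 2 powr r * max a b powr r" using assms by (simp add: powr_mult)
  also have "\<dots> \<le> 2 powr r * (a powr r + b powr r)" by (intro mult_left_mono) (auto simp: max_def)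
  finally show ?thesis .
qed

text \<open>Truncations of \<open>f\<close> converge in the mixed norm by dominated convergence.  A truncation and its
  continuous approximation have bounded marginals, and for these the \<open>L\<^sup>r\<close> norm is controlled by the
  \<open>L\<^sup>1\<close> norm, where approximation is known.\<close>

lemma Lr_L1_approx:
  fixes f :: "velocity \<Rightarrow> real"
  assumes f: "integrable lborel f" and r: "r > 2"
    and fr: "integrable lborel (\<lambda>s. indicator {0<..<S} s * marg f s powr r)" and e: "e > 0"
  obtains h M where "continuous_on UNIV h" "\<And>x. \<bar>h x\<bar> \<le> M" "\<And>x. norm x > M \<Longrightarrow> h x = 0" "integrable lborel h"
    "(\<integral>\<^sup>+s. ennreal (marg (\<lambda>z. f z - h z) s powr r) * indicator {0<..<S} s \<partial>lborel) \<le> ennreal e"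
proof -
  have [measurable]: "f \<in> borel_measurable borel" using f by auto
  then have [measurable]: "f \<in> borel_measurable (borel \<Otimes>\<^sub>M borel)" by (simp add: borel_prod)
  define tr where "tr n z = (if \<bar>f z\<bar> \<le> real n \<and> norm z \<le> real n then f z else 0)" for n z
  have trm [measurable]: "tr n \<in> borel_measurable borel" for n unfolding tr_def by measurable
  have trle: "\<bar>tr n z\<bar> \<le> \<bar>f z\<bar>" "\<bar>f z - tr n z\<bar> \<le> \<bar>f z\<bar>" for n z by (auto simp: tr_def)
  have tri: "integrable lborel (tr n)" for n
    by (rule Bochner_Integration.integrable_bound[OF f]) (auto simp: trle)
  have trc: "(\<lambda>n. tr n z) \<longlonglongrightarrow> f z" for z
  proof (rule tendsto_eventually)
    obtain N :: nat where "max \<bar>f z\<bar> (norm z) \<le> real N" using real_arch_simple by blast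
    then show "\<forall>\<^sub>F n in sequentially. tr n z = f z"
      by (intro eventually_sequentiallyI[of N]) (auto simp: tr_def)
  qed
  let ?d = "\<lambda>n z. f z - tr n z"
  have "(\<lambda>n. LINT s|lborel. indicator {0<..<S} s * marg (?d n) s powr r) \<longlonglongrightarrow> (LINT s|(lborel :: real measure). (0::real))"
  proof (rule integral_dominated_convergence[where w = "\<lambda>s. indicator {0<..<S} s * marg f s powr r"])
    show "AE s in lborel. (\<lambda>n. indicator {0<..<S} s * marg (?d n) s powr r) \<longlonglongrightarrow> 0"
      using AE_integrable_section[OF f]
    proof eventually_elim
      case (elim s)
      have "(\<lambda>n. marg (?d n) s) \<longlonglongrightarrow> (LINT \<eta>|(lborel :: (real^2) measure). (0::real))" unfolding marg_def
      proof (rule integral_dominated_convergence[where w = "\<lambda>\<eta>. \<bar>f (s, \<eta>)\<bar>"])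
        show "AE \<eta> in lborel. (\<lambda>n. \<bar>f (s, \<eta>) - tr n (s, \<eta>)\<bar>) \<longlonglongrightarrow> 0"
        proof (intro AE_I2 tendsto_rabs_zero)
          fix \<eta>
          have "(\<lambda>n. f (s, \<eta>) - tr n (s, \<eta>)) \<longlonglongrightarrow> f (s, \<eta>) - f (s, \<eta>)" by (intro tendsto_diff tendsto_const trc)
          then show "(\<lambda>n. f (s, \<eta>) - tr n (s, \<eta>)) \<longlonglongrightarrow> 0" by simp
        qed
        have [measurable]: "tr n \<in> borel_measurable (borel \<Otimes>\<^sub>M borel)" for n using trm by (simp add: borel_prod)
        show "(\<lambda>\<eta>. \<bar>f (s, \<eta>) - tr n (s, \<eta>)\<bar>) \<in> borel_measurable lborel" for n by measurable
      qed (use elim trle in auto)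
      then have "(\<lambda>n. marg (?d n) s powr r) \<longlonglongrightarrow> 0 powr r"
        using r by (intro tendsto_powr') auto
      from tendsto_mult_left[OF this, of "indicator {0<..<S} s"] show ?case by simp
    qed
    show "AE s in lborel. norm (indicator {0<..<S} s * marg (?d n) s powr r) \<le> indicator {0<..<S} s * marg f s powr r" for n
      using AE_integrable_section[OF f]
    proof eventually_elim
      case (elim s)
      have [measurable]: "tr n \<in> borel_measurable (borel \<Otimes>\<^sub>M borel)" for n using trm by (simp add: borel_prod)
      have "integrable lborel (\<lambda>\<eta>. f (s, \<eta>) - tr n (s, \<eta>))"
        by (rule Bochner_Integration.integrable_bound[OF elim]) (auto simp: trle)
      then have "marg (?d n) s \<le> marg f s"
        unfolding marg_def using elim trle by (intro integral_mono) auto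
      then show ?case using r by (auto intro!: mult_left_mono powr_mono2)
    qed
  qed (use fr in auto)
  moreover define e1 where "e1 = e / (2 powr r * 2)"
  have e1: "e1 > 0" using e by (simp add: e1_def)
  ultimately have "\<forall>\<^sub>F n in sequentially. (LINT s|lborel. indicator {0<..<S} s * marg (?d n) s powr r) < e1"
    by (intro order_tendstoD(2)[of _ 0]) auto
  then obtain n where n: "(LINT s|lborel. indicator {0<..<S} s * marg (?d n) s powr r) < e1"
    by (meson eventually_happens trivial_limit_sequentially)
  have di: "integrable lborel (?d n)" using f tri by auto
  have n': "(\<integral>\<^sup>+s. ennreal (marg (?d n) s powr r) * indicator {0<..<S} s \<partial>lborel) \<le> ennreal e1"
  proof -
    have "integrable lborel (\<lambda>s. indicator {0<..<S} s * marg (?d n) s powr r)"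
    proof (rule Bochner_Integration.integrable_bound[OF fr])
      show "AE s in lborel. norm (indicator {0<..<S} s * marg (?d n) s powr r) \<le> norm (indicator {0<..<S} s * marg f s powr r)"
        using AE_integrable_section[OF f] AE_integrable_section[OF di]
      proof eventually_elim
        case (elim s)
        have "marg (?d n) s \<le> marg f s"
          unfolding marg_def using elim trle by (intro integral_mono) auto
        then show ?case using r by (auto intro!: mult_left_mono powr_mono2)
      qed
    qed measurable
    then have "(\<integral>\<^sup>+s. ennreal (indicator {0<..<S} s * marg (?d n) s powr r) \<partial>lborel) \<le> ennreal e1"
      using n e1 by (subst nn_integral_eq_integral) (auto intro!: ennreal_leI)
    also have "(\<integral>\<^sup>+s. ennreal (indicator {0<..<S} s * marg (?d n) s powr r) \<partial>lborel) 
      = (\<integral>\<^sup>+s. ennreal (marg (?d n) s powr r) * indicator {0<..<S} s \<partial>lborel)"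
      by (intro nn_integral_cong) (auto split: split_indicator)
    finally show ?thesis .
  qed
  define K where "K = real n"
  \<comment> \<open>a bound on the marginals of a function with values in \<open>[-2K, 2K]\<close> and support in a ball of radius \<open>K + 1\<close>; adding \<open>1\<close> makes it positive\<close>
  define L where "L = (K + K) * measure lborel (cball (0 :: real^2) (K + 1)) + 1"
  have L: "L > 0" by (auto simp: L_def K_def intro!: add_nonneg_pos)
  \<comment> \<open>so that \<open>marg powr r \<le> L powr (r - 1) * marg\<close> integrates to at most \<open>e1\<close>\<close>
  define e2 where "e2 = e1 / L powr (r - 1)"
  have e2: "e2 > 0" using e1 L by (simp add: e2_def)
  obtain h where h: "continuous_on UNIV h" "\<And>x. \<bar>h x\<bar> \<le> K" "\<And>x. norm x > K + 1 \<Longrightarrow> h x = 0"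
    "integrable lborel h" "(LINT x|lborel. \<bar>tr n x - h x\<bar>) < e2"
    by (rule L1_approx_bounded[OF tri[of n] _ _ _ e2, of K]) (auto simp: tr_def K_def)
  have hm [measurable]: "h \<in> borel_measurable borel" using h(1) by (rule borel_measurable_continuous_onI)
  let ?c = "\<lambda>z. tr n z - h z"
  have ci: "integrable lborel ?c" using tri h by auto
  have cL: "marg ?c s \<le> L" for s
  proof -
    have "marg ?c s \<le> (K + K) * measure lborel (cball (0 :: real^2) (K + 1))"
    proof (rule marg_le_of_bounded_support)
      show "\<bar>?c z\<bar> \<le> K + K" for z using h(2)[of z] by (auto simp: tr_def K_def)
    qed (use h(3) in \<open>auto simp: tr_def K_def\<close>)
    then show ?thesis by (simp add: L_def)
  qed
  have cr: "marg ?c s powr r \<le> L powr (r - 1) * marg ?c s" for s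
  proof (cases "marg ?c s = 0")
    case False
    then have "marg ?c s powr r = marg ?c s powr (r - 1) * marg ?c s powr 1"
      by (subst powr_add[symmetric]) simp
    also have "\<dots> \<le> L powr (r - 1) * marg ?c s powr 1" using cL r by (intro mult_right_mono powr_mono2) auto
    finally show ?thesis using False by simp
  qed simp
  have "(\<integral>\<^sup>+s. ennreal (marg ?c s powr r) * indicator {0<..<S} s \<partial>lborel) \<le> (\<integral>\<^sup>+s. ennreal (L powr (r - 1)) * ennreal (marg ?c s) \<partial>lborel)"
    using cr by (intro nn_integral_mono) (auto simp: ennreal_mult'[symmetric] ennreal_leI split: split_indicator)
  also have "\<dots> = ennreal (L powr (r - 1)) * ennreal (LINT z|lborel. \<bar>?c z\<bar>)"
    by (subst nn_integral_cmult) (auto simp: nn_integral_marg_total[OF ci])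
  also have "\<dots> \<le> ennreal (L powr (r - 1)) * ennreal e2"
    using h(5) by (intro mult_left_mono ennreal_leI) auto
  also have "\<dots> = ennreal e1" using L by (simp add: ennreal_mult'[symmetric] e2_def)
  finally have c': "(\<integral>\<^sup>+s. ennreal (marg ?c s powr r) * indicator {0<..<S} s \<partial>lborel) \<le> ennreal e1" .
  have "(\<integral>\<^sup>+s. ennreal (marg (\<lambda>z. f z - h z) s powr r) * indicator {0<..<S} s \<partial>lborel)
     \<le> (\<integral>\<^sup>+s. ennreal (2 powr r) * (ennreal (marg (?d n) s powr r) * indicator {0<..<S} s + ennreal (marg ?c s powr r) * indicator {0<..<S} s) \<partial>lborel)"
  proof (intro nn_integral_mono_AE, use marg_triangle[OF di ci] in eventually_elim)
    case (elim s)
    have "marg (\<lambda>z. f z - h z) s powr r \<le> (marg (?d n) s + marg ?c s) powr r"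
      using elim r by (intro powr_mono2) auto
    also have "\<dots> \<le> 2 powr r * (marg (?d n) s powr r + marg ?c s powr r)" using r by (intro powr_add_le) auto
    finally show ?case
      by (auto split: split_indicator simp: ennreal_mult'[symmetric] ennreal_plus[symmetric] simp del: ennreal_plus intro!: ennreal_leI)
  qed
  also have "\<dots> = ennreal (2 powr r) * ((\<integral>\<^sup>+s. ennreal (marg (?d n) s powr r) * indicator {0<..<S} s \<partial>lborel) 
     + (\<integral>\<^sup>+s. ennreal (marg ?c s powr r) * indicator {0<..<S} s \<partial>lborel))"
    by (subst nn_integral_cmult) (auto simp: nn_integral_add)
  also have "\<dots> \<le> ennreal (2 powr r) * (ennreal e1 + ennreal e1)"
    by (intro mult_left_mono add_mono n' c') auto
  also have "\<dots> = ennreal e" using e1 by (simp add: e1_def ennreal_mult'[symmetric] flip: ennreal_plus)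
  finally show thesis using h by (intro that[of h "K + 1"]) (auto simp: K_def intro!: order_trans[OF h(2)])
qed

section \<open>The two parts of the density under a change of the potential\<close>

lemma AE_fst_neq: "AE z in lborel. fst (z :: velocity) \<noteq> a"
proof (rule AE_I[of _ _ "{a} \<times> UNIV"])
  show "emeasure lborel ({a} \<times> (UNIV :: (real^2) set)) = 0"
    unfolding lborel_prod[symmetric] by (subst lborel.emeasure_pair_measure_Times) auto
qed (auto simp: mem_Times_iff simp flip: lborel_prod)

lemma AE_fst_square_neq: "AE z in lborel. (fst (z :: velocity))\<^sup>2 \<noteq> a"
  using AE_fst_neq[of "sqrt a"] AE_fst_neq[of "- sqrt a"]
  by eventually_elim (metis abs_if minus_minus real_sqrt_abs)

lemma velocity_dist: "norm (v, \<eta>) \<le> norm (s, \<eta>) + \<bar>v - s\<bar>" for v s :: real and \<eta> :: "real^2"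
proof -
  have "norm (v, \<eta>) \<le> norm (s, \<eta>) + norm ((v, \<eta>) - (s, \<eta>))" by (rule norm_triangle_sub)
  also have "(v, \<eta>) - (s, \<eta>) = (v - s, 0)" by simp
  finally show ?thesis by simp
qed

lemma free_integrable:
  assumes f: "integrable lborel f" and p: "p \<ge> 0"
  shows "integrable lborel (pull (free_dom p) (free_map p) f)"
    "(\<integral>\<^sup>+z. ennreal \<bar>pull (free_dom p) (free_map p) f z\<bar> \<partial>lborel) \<le> ennreal (LINT z|lborel. \<bar>f z\<bar>)"
    "(\<And>z. f z \<ge> 0) \<Longrightarrow> (LINT z|lborel. pull (free_dom p) (free_map p) f z) = 
        (LINT z|lborel. f z * (\<bar>fst z\<bar> / sqrt ((fst z)\<^sup>2 + 2 * p)))"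
proof -
  have [measurable]: "f \<in> borel_measurable borel" using f by auto
  have k: "\<bar>s\<bar> / sqrt (s\<^sup>2 + 2 * p) \<le> 1" for s :: real
  proof (cases "s = 0")
    case False
    have "sqrt (s\<^sup>2) \<le> sqrt (s\<^sup>2 + 2 * p)" using p by (intro real_sqrt_le_mono) auto
    moreover have "s\<^sup>2 + 2 * p > 0" using p False by (intro add_pos_nonneg) auto
    ultimately show ?thesis by (auto simp: divide_simps)
  qed simp
  have [measurable]: "(\<lambda>z :: velocity. \<bar>fst z\<bar> / sqrt ((fst z)\<^sup>2 + 2 * p)) \<in> borel_measurable borel"
    unfolding borel_prod[symmetric] by measurable
  have e: "(\<integral>\<^sup>+z. ennreal \<bar>pull (free_dom p) (free_map p) f z\<bar> \<partial>lborel) = 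
     (\<integral>\<^sup>+z. ennreal \<bar>f z\<bar> * ennreal (\<bar>fst z\<bar> / sqrt ((fst z)\<^sup>2 + 2 * p)) \<partial>lborel)"
    by (subst nn_integral_free[OF _ p, symmetric]) (auto intro!: nn_integral_cong simp: pull_def)
  also have "\<dots> \<le> (\<integral>\<^sup>+z. ennreal \<bar>f z\<bar> * ennreal 1 \<partial>lborel)"
    using k by (intro nn_integral_mono mult_left_mono ennreal_leI) auto
  also have "\<dots> = ennreal (LINT z|lborel. \<bar>f z\<bar>)"
    using f by (simp add: nn_integral_eq_integral)
  finally show le: "(\<integral>\<^sup>+z. ennreal \<bar>pull (free_dom p) (free_map p) f z\<bar> \<partial>lborel) \<le> ennreal (LINT z|lborel. \<bar>f z\<bar>)" .
  show i: "integrable lborel (pull (free_dom p) (free_map p) f)"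
    by (rule integrableI_bounded) (use le in \<open>auto intro: le_less_trans\<close>)
  assume pos: "\<And>z. f z \<ge> 0"
  have pp: "pull (free_dom p) (free_map p) f z \<ge> 0" for z by (auto simp: pull_def pos)
  have ik: "integrable lborel (\<lambda>z. f z * (\<bar>fst z\<bar> / sqrt ((fst z)\<^sup>2 + 2 * p)))"
  proof (rule Bochner_Integration.integrable_bound[OF f])
    show "AE z in lborel. norm (f z * (\<bar>fst z\<bar> / sqrt ((fst z)\<^sup>2 + 2 * p))) \<le> norm (f z)"
    proof (intro AE_I2)
      fix z :: velocity
      have "\<bar>f z\<bar> * \<bar>\<bar>fst z\<bar> / sqrt ((fst z)\<^sup>2 + 2 * p)\<bar> \<le> \<bar>f z\<bar> * 1"
        using k[of "fst z"] p by (intro mult_left_mono) auto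
      then show "norm (f z * (\<bar>fst z\<bar> / sqrt ((fst z)\<^sup>2 + 2 * p))) \<le> norm (f z)"
        unfolding real_norm_def abs_mult by (simp only: mult_1_right)
    qed
  qed measurable
  have "ennreal (LINT z|lborel. pull (free_dom p) (free_map p) f z) = (\<integral>\<^sup>+z. ennreal \<bar>pull (free_dom p) (free_map p) f z\<bar> \<partial>lborel)"
    using i pp by (subst nn_integral_eq_integral[symmetric]) auto
  also have "\<dots> = ennreal (LINT z|lborel. f z * (\<bar>fst z\<bar> / sqrt ((fst z)\<^sup>2 + 2 * p)))"
    unfolding e using ik pos p 
    by (subst nn_integral_eq_integral[symmetric]) (auto simp: ennreal_mult' simp del: times_divide_eq_right intro!: nn_integral_cong)
  finally show "(LINT z|lborel. pull (free_dom p) (free_map p) f z) = 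
        (LINT z|lborel. f z * (\<bar>fst z\<bar> / sqrt ((fst z)\<^sup>2 + 2 * p)))"
    using pos pp p by (subst (asm) ennreal_inj) (auto intro!: integral_nonneg_AE AE_I2 mult_nonneg_nonneg divide_nonneg_nonneg)
qed

lemma trap_Lr_finite:
  assumes f: "integrable lborel f" and fr: "integrable lborel (\<lambda>s. indicator {0<..<S} s * marg f s powr r)"
  obtains e where "e \<ge> 0" "(\<integral>\<^sup>+s. ennreal (marg f s powr r) * indicator {0<..<S} s \<partial>lborel) \<le> ennreal e"
proof -
  have "(\<integral>\<^sup>+s. ennreal (marg f s powr r) * indicator {0<..<S} s \<partial>lborel) = (\<integral>\<^sup>+s. ennreal (indicator {0<..<S} s * marg f s powr r) \<partial>lborel)"
    by (intro nn_integral_cong) (auto split: split_indicator)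
  also have "\<dots> = ennreal (LINT s|lborel. indicator {0<..<S} s * marg f s powr r)"
    by (intro nn_integral_eq_integral fr) auto
  finally show thesis by (intro that[of "LINT s|lborel. indicator {0<..<S} s * marg f s powr r"]) auto
qed

lemma trap_integrable:
  assumes f: "integrable lborel f" and b: "b > 0" and p: "0 \<le> p" "p \<le> b" and r: "r > 2"
    and fr: "integrable lborel (\<lambda>s. indicator {0<..<sqrt (2 * b)} s * marg f s powr r)"
  shows "integrable lborel (pull (trap_dom p) (trap_map b p) f)"
    "(\<And>z. f z \<ge> 0) \<Longrightarrow> (LINT z|lborel. pull (trap_dom p) (trap_map b p) f z) = 
        2 * (LBINT s=sqrt (2 * (b - p))..sqrt (2 * b). (LINT \<eta>|lborel. f (s, \<eta>) * (s / sqrt (s\<^sup>2 + 2 * (p - b)))))"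
proof -
  have fm [measurable]: "f \<in> borel_measurable borel" using f by auto
  then have [measurable]: "f \<in> borel_measurable (borel \<Otimes>\<^sub>M borel)" by (simp add: borel_prod)
  obtain e where e: "e \<ge> 0" "(\<integral>\<^sup>+s. ennreal (marg f s powr r) * indicator {0<..<sqrt (2 * b)} s \<partial>lborel) \<le> ennreal e"
    by (rule trap_Lr_finite[OF f fr])
  have fin: "(\<integral>\<^sup>+z. ennreal \<bar>pull (trap_dom p) (trap_map b p) f z\<bar> \<partial>lborel) < \<infinity>"
    by (rule le_less_trans[OF trap_bound[OF b p r zero_less_one e(1) f e(2)]]) simp
  show i: "integrable lborel (pull (trap_dom p) (trap_map b p) f)"
    by (rule integrableI_bounded) (use fin in auto)
  assume pos: "\<And>z. f z \<ge> 0"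
  let ?I = "{sqrt (2 * (b - p))<..<sqrt (2 * b)}"
  let ?k = "\<lambda>s. s / sqrt (s\<^sup>2 - 2 * (b - p))"
  have ppos: "pull (trap_dom p) (trap_map b p) f z \<ge> 0" for z by (auto simp: pull_def pos)
  have k0: "?k s \<ge> 0" if "s \<in> ?I" for s
  proof -
    have c: "sqrt (2 * (b - p)) < s" "0 \<le> sqrt (2 * (b - p))" using that p by auto
    then have "(sqrt (2 * (b - p)))\<^sup>2 \<le> s\<^sup>2" by (intro power_mono) auto
    moreover have "s \<ge> 0" using c by linarith
    ultimately show ?thesis using p by simp
  qed
  have n0: "0 \<le> indicator ?I s * (marg f s * ?k s)" for s
  proof (cases "s \<in> ?I")
    case True
    then show ?thesis using k0[OF True] by (intro mult_nonneg_nonneg) auto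
  next
    case False
    then have "indicator ?I s = (0 :: real)" by (rule indicator_simps(2))
    then show ?thesis by (simp only: mult_zero_left)
  qed
  have [measurable]: "(\<lambda>s. marg f s * ?k s) \<in> borel_measurable borel" by measurable
  have e1: "(\<integral>\<^sup>+z. ennreal \<bar>pull (trap_dom p) (trap_map b p) f z\<bar> \<partial>lborel)
     = 2 * (\<integral>\<^sup>+s. ennreal (indicator ?I s * (marg f s * ?k s)) \<partial>lborel)"
  proof -
    have "(\<integral>\<^sup>+z. ennreal \<bar>pull (trap_dom p) (trap_map b p) f z\<bar> \<partial>lborel) 
       = (\<integral>\<^sup>+z. (if trap_dom p z then ennreal \<bar>f (trap_map b p z)\<bar> else 0) \<partial>lborel)"
      by (intro nn_integral_cong) (auto simp: pull_def)
    also have "\<dots> = 2 * (\<integral>\<^sup>+s. (\<integral>\<^sup>+\<eta>. ennreal \<bar>f (s, \<eta>)\<bar> \<partial>lborel) * ennreal (?k s) * indicator ?I s \<partial>lborel)"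
      by (rule nn_integral_trap[OF _ p]) measurable
    also have "(\<integral>\<^sup>+s. (\<integral>\<^sup>+\<eta>. ennreal \<bar>f (s, \<eta>)\<bar> \<partial>lborel) * ennreal (?k s) * indicator ?I s \<partial>lborel)
       = (\<integral>\<^sup>+s. ennreal (indicator ?I s * (marg f s * ?k s)) \<partial>lborel)"
    proof (intro nn_integral_cong_AE, use nn_integral_marg[OF f] in eventually_elim)
      case (elim s)
      show ?case unfolding elim using k0[of s] by (auto simp: ennreal_mult' simp del: times_divide_eq_right split: split_indicator)
    qed
    finally show ?thesis .
  qed
  have im: "integrable lborel (\<lambda>s. indicator ?I s * (marg f s * ?k s))"
  proof (rule integrableI_nonneg)
    show "(\<integral>\<^sup>+s. ennreal (indicator ?I s * (marg f s * ?k s)) \<partial>lborel) < \<infinity>"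
    proof -
      have *: "X < \<infinity>" if "2 * X < \<infinity>" for X :: ennreal
        using that by (cases X) (auto simp: ennreal_mult_top)
      show ?thesis using fin unfolding e1 by (rule *)
    qed
    show "AE s in lborel. 0 \<le> indicator ?I s * (marg f s * ?k s)"
      by (intro AE_I2 n0)
  qed measurable
  have le: "sqrt (2 * (b - p)) \<le> sqrt (2 * b)" using p by simp
  have e2: "(LBINT s=sqrt (2 * (b - p))..sqrt (2 * b). (LINT \<eta>|lborel. f (s, \<eta>) * (s / sqrt (s\<^sup>2 + 2 * (p - b)))))
     = (LINT s|lborel. indicator ?I s * (marg f s * ?k s))"
  proof -
    have *: "s\<^sup>2 + 2 * (p - b) = s\<^sup>2 - 2 * (b - p)" for s by simp
    have "(LINT \<eta>|lborel. f (s, \<eta>) * (s / sqrt (s\<^sup>2 + 2 * (p - b)))) = marg f s * ?k s" for s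
      unfolding marg_def * using pos by simp
    then show ?thesis using le by (simp add: interval_lebesgue_integral_def set_lebesgue_integral_def einterval_eq)
  qed
  have "ennreal (LINT z|lborel. pull (trap_dom p) (trap_map b p) f z) = (\<integral>\<^sup>+z. ennreal \<bar>pull (trap_dom p) (trap_map b p) f z\<bar> \<partial>lborel)"
    using i ppos by (subst nn_integral_eq_integral[symmetric]) auto
  also have "\<dots> = ennreal (2 * (LINT s|lborel. indicator ?I s * (marg f s * ?k s)))"
    unfolding e1 using im n0 by (subst nn_integral_eq_integral) (auto simp: ennreal_mult')
  finally show "(LINT z|lborel. pull (trap_dom p) (trap_map b p) f z) = 
        2 * (LBINT s=sqrt (2 * (b - p))..sqrt (2 * b). (LINT \<eta>|lborel. f (s, \<eta>) * (s / sqrt (s\<^sup>2 + 2 * (p - b)))))"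
    unfolding e2 using n0 ppos by (subst (asm) ennreal_inj) (auto intro!: integral_nonneg_AE AE_I2)
qed

lemma L1_approx_compact_support:
  fixes f :: "'a::euclidean_space \<Rightarrow> real"
  assumes f: "integrable lborel f" and e: "e > 0"
  obtains h M where "continuous_on UNIV h" "\<And>x. \<bar>h x\<bar> \<le> M" "\<And>x. norm x > M \<Longrightarrow> h x = 0" "integrable lborel h"
    "(LINT x|lborel. \<bar>f x - h x\<bar>) < e"
proof -
  have [measurable]: "f \<in> borel_measurable borel" using f by auto
  define tr where "tr n z = (if \<bar>f z\<bar> \<le> real n \<and> norm z \<le> real n then f z else 0)" for n z
  have [measurable]: "tr n \<in> borel_measurable borel" for n unfolding tr_def by measurable
  have trle: "\<bar>tr n z\<bar> \<le> \<bar>f z\<bar>" "\<bar>f z - tr n z\<bar> \<le> \<bar>f z\<bar>" for n z by (auto simp: tr_def)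
  have tri: "integrable lborel (tr n)" for n
    by (rule Bochner_Integration.integrable_bound[OF f]) (auto simp: trle)
  have trc: "(\<lambda>n. \<bar>f z - tr n z\<bar>) \<longlonglongrightarrow> 0" for z
  proof (rule tendsto_eventually)
    obtain N :: nat where "max \<bar>f z\<bar> (norm z) \<le> real N" using real_arch_simple by blast
    then show "\<forall>\<^sub>F n in sequentially. \<bar>f z - tr n z\<bar> = 0"
      by (intro eventually_sequentiallyI[of N]) (auto simp: tr_def)
  qed
  have "(\<lambda>n. LINT z|lborel. \<bar>f z - tr n z\<bar>) \<longlonglongrightarrow> (LINT z|(lborel :: 'a measure). (0::real))"
    by (rule integral_dominated_convergence[where w = "\<lambda>z. \<bar>f z\<bar>"]) (use f trle trc in auto)
  then have "\<forall>\<^sub>F n in sequentially. (LINT z|lborel. \<bar>f z - tr n z\<bar>) < e/2"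
    using e by (intro order_tendstoD(2)[of _ 0]) auto
  then obtain n where n: "(LINT z|lborel. \<bar>f z - tr n z\<bar>) < e/2"
    by (meson eventually_happens trivial_limit_sequentially)
  have e2: "e / 2 > 0" using e by simp
  obtain h where h: "continuous_on UNIV h" "\<And>x. \<bar>h x\<bar> \<le> real n" "\<And>x. norm x > real n + 1 \<Longrightarrow> h x = 0"
    "integrable lborel h" "(LINT x|lborel. \<bar>tr n x - h x\<bar>) < e/2"
    by (rule L1_approx_bounded[OF tri[of n] _ _ _ e2, of "real n"]) (auto simp: tr_def)
  have "(LINT x|lborel. \<bar>f x - h x\<bar>) \<le> (LINT x|lborel. \<bar>f x - tr n x\<bar> + \<bar>tr n x - h x\<bar>)"
    using f tri h by (intro integral_mono) auto
  also have "\<dots> = (LINT x|lborel. \<bar>f x - tr n x\<bar>) + (LINT x|lborel. \<bar>tr n x - h x\<bar>)"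
    using f tri h by (intro Bochner_Integration.integral_add) auto
  finally show thesis using n h by (intro that[of h "real n + 1"]) (auto intro!: order_trans[OF h(2)])
qed

text \<open>Only the velocities with \<open>\<xi>\<^sub>1\<^sup>2 = 2 * p\<close>, a null set, lie on the border between free and trapped.\<close>

lemma AE_trap_free_convergence:
  assumes X: "X \<longlonglongrightarrow> p"
  shows "AE z in lborel. (\<forall>\<^sub>F n in sequentially. free_dom (X n) z = free_dom p z) \<and> (\<lambda>n. free_map (X n) z) \<longlonglongrightarrow> free_map p z"
    "AE z in lborel. (\<forall>\<^sub>F n in sequentially. trap_dom (X n) z = trap_dom p z) \<and> (\<lambda>n. trap_map b (X n) z) \<longlonglongrightarrow> trap_map b p z"
proof -
  have X2: "(\<lambda>n. 2 * X n) \<longlonglongrightarrow> 2 * p" by (intro tendsto_intros X)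
  have ev: "\<forall>\<^sub>F n in sequentially. (2 * X n < y) = (2 * p < y) \<and> (y < 2 * X n) = (y < 2 * p)" if "y \<noteq> 2 * p" for y
  proof (cases "2 * p < y")
    case True
    show ?thesis using order_tendstoD(2)[OF X2 True] by eventually_elim (use True in auto)
  next
    case False
    then have F: "y < 2 * p" using that by simp
    show ?thesis using order_tendstoD(1)[OF X2 F] by eventually_elim (use F in auto)
  qed
  have m: "(\<lambda>n. free_map (X n) z) \<longlonglongrightarrow> free_map p z" "(\<lambda>n. trap_map b (X n) z) \<longlonglongrightarrow> trap_map b p z" for z
    unfolding free_map_def trap_map_def by (intro tendsto_intros X)+
  show "AE z in lborel. (\<forall>\<^sub>F n in sequentially. free_dom (X n) z = free_dom p z) \<and> (\<lambda>n. free_map (X n) z) \<longlonglongrightarrow> free_map p z"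
    "AE z in lborel. (\<forall>\<^sub>F n in sequentially. trap_dom (X n) z = trap_dom p z) \<and> (\<lambda>n. trap_map b (X n) z) \<longlonglongrightarrow> trap_map b p z"
    using AE_fst_square_neq[of "2 * p"]
    by (eventually_elim, use m ev in \<open>fastforce simp: free_dom_def trap_dom_def elim: eventually_mono\<close>)+
qed

lemma norm_le_free_map:
  assumes "free_dom p z" "0 \<le> p" "p \<le> b"
  shows "norm z \<le> norm (free_map p z) + 2 * sqrt (2 * b)"
proof -
  obtain v \<eta> where z: "z = (v, \<eta>)" by (cases z)
  define s where "s = sqrt (v\<^sup>2 - 2 * p)"
  have s: "s\<^sup>2 = v\<^sup>2 - 2 * p" "s \<ge> 0" using assms by (auto simp: s_def free_dom_def z)
  have "\<bar>v\<bar> = sqrt (s\<^sup>2 + 2 * p)" using s by simp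
  also have "\<dots> \<le> sqrt (s\<^sup>2) + sqrt (2 * p)" using assms by (intro sqrt_add_le_add_sqrt) auto
  also have "\<dots> \<le> s + sqrt (2 * b)"
    using s(2) assms(3) by (intro add_mono real_sqrt_le_mono) simp_all
  finally have v: "\<bar>v\<bar> \<le> s + sqrt (2 * b)" .
  have b0: "sqrt (2 * b) \<ge> 0" using assms by simp
  have "s \<le> sqrt (v\<^sup>2)" unfolding s_def using assms by (intro real_sqrt_le_mono) simp
  then have "s \<le> \<bar>v\<bar>" by simp
  then have "\<bar>v - sgn v * s\<bar> \<le> sqrt (2 * b)" using v s(2) b0 by (auto simp: sgn_if abs_if split: if_splits)
  with b0  show ?thesis using velocity_dist[of v \<eta> "sgn v * s"] unfolding z free_map_def s_def[symmetric] by (simp add: s_def[symmetric])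
qed

lemma norm_le_trap_map:
  assumes "trap_dom p z" "0 \<le> p" "p \<le> b"
  shows "norm z \<le> norm (trap_map b p z) + 2 * sqrt (2 * b)"
proof -
  obtain v \<eta> where z: "z = (v, \<eta>)" by (cases z)
  have v: "v\<^sup>2 < 2 * p" using assms by (simp add: trap_dom_def z)
  have 1: "\<bar>v\<bar> \<le> sqrt (2 * b)" 
  proof -
    have "sqrt (v\<^sup>2) \<le> sqrt (2 * b)" using v assms(3) by (intro real_sqrt_le_mono) linarith
    then show ?thesis by simp
  qed
  have 2: "sqrt (v\<^sup>2 + 2 * (b - p)) \<le> sqrt (2 * b)" using v by simp
  have "0 \<le> sqrt (v\<^sup>2 + 2 * (b - p))" using assms by simp
  with 1 2 have "\<bar>v - sqrt (v\<^sup>2 + 2 * (b - p))\<bar> \<le> 2 * sqrt (2 * b)" by linarith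
  then show ?thesis using velocity_dist[of v \<eta> "sqrt (v\<^sup>2 + 2 * (b - p))"] by (simp add: z trap_map_def)
qed

lemma free_L1_convergence:
  assumes f: "integrable lborel f" and X: "X \<longlonglongrightarrow> p" "\<And>n. 0 \<le> X n" "\<And>n. X n \<le> b" and p: "0 \<le> p" "p \<le> b"
  shows "(\<lambda>n. LINT z|lborel. \<bar>pull (free_dom (X n)) (free_map (X n)) f z - pull (free_dom p) (free_map p) f z\<bar>) \<longlonglongrightarrow> 0"
proof (rule pull_L1_convergence[where c = "2 * sqrt (2 * b)"])
  fix e :: real assume e: "e > 0"
  obtain h M where h: "continuous_on UNIV h" "\<And>x. \<bar>h x\<bar> \<le> M" "\<And>x. norm x > M \<Longrightarrow> h x = 0" "integrable lborel h"
    "(LINT x|lborel. \<bar>f x - h x\<bar>) < e" by (rule L1_approx_compact_support[OF f e]) blast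
  have i: "integrable lborel (\<lambda>z. f z - h z)" using f h by auto
  have "(\<integral>\<^sup>+z. ennreal \<bar>pull (free_dom q) (free_map q) (\<lambda>x. f x - h x) z\<bar> \<partial>lborel) \<le> ennreal e" if "q \<ge> 0" for q
    by (rule order_trans[OF free_integrable(2)[OF i that]]) (use h(5) in \<open>auto intro!: ennreal_leI\<close>)
  then show "\<exists>h M. continuous_on UNIV h \<and> (\<forall>x. \<bar>h x\<bar> \<le> M) \<and> (\<forall>x. norm x > M \<longrightarrow> h x = 0) \<and>
       (\<forall>n. (\<integral>\<^sup>+z. ennreal \<bar>pull (free_dom (X n)) (free_map (X n)) (\<lambda>x. f x - h x) z\<bar> \<partial>lborel) \<le> ennreal e) \<and>
       (\<integral>\<^sup>+z. ennreal \<bar>pull (free_dom p) (free_map p) (\<lambda>x. f x - h x) z\<bar> \<partial>lborel) \<le> ennreal e"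
    using h X p by blast
next
  show "AE z in lborel. (\<forall>\<^sub>F n in sequentially. free_dom (X n) z = free_dom p z) \<and> (free_dom p z \<longrightarrow> (\<lambda>n. free_map (X n) z) \<longlonglongrightarrow> free_map p z)"
    using AE_trap_free_convergence(1)[OF X(1)] by eventually_elim auto
qed (use X p free_integrable(1)[OF f] norm_le_free_map in auto)

lemma trap_L1_convergence:
  assumes f: "integrable lborel f" and X: "X \<longlonglongrightarrow> p" "\<And>n. 0 \<le> X n" "\<And>n. X n \<le> b" and p: "0 \<le> p" "p \<le> b"
    and b: "b > 0" and r: "r > 2" and fr: "integrable lborel (\<lambda>s. indicator {0<..<sqrt (2 * b)} s * marg f s powr r)"
  shows "(\<lambda>n. LINT z|lborel. \<bar>pull (trap_dom (X n)) (trap_map b (X n)) f z - pull (trap_dom p) (trap_map b p) f z\<bar>) \<longlonglongrightarrow> 0"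
proof (rule pull_L1_convergence[where c = "2 * sqrt (2 * b)"])
  fix e :: real assume e: "e > 0"
  define q where "q = r / (r - 1)"
  have q: "0 < q" "q < 2" using r by (auto simp: q_def field_simps)
  define C where "C = sqrt (2 * b) / (1 - q / 2)"
  have C: "C \<ge> 0" using q b by (simp add: C_def)
  \<comment> \<open>\<open>d\<close> makes the kernel term in the bound of \<open>trap_bound\<close> at most \<open>e / 4\<close>, and \<open>e'\<close> below does so with the other term\<close>
  define d where "d = (e / (4 * C + 4)) powr (1 / q)"
  have d0: "e / (4 * C + 4) > 0" using e C by simp
  have d: "d > 0" using d0 unfolding d_def by (subst powr_gt_zero) linarith
  have dq: "d powr q = e / (4 * C + 4)" using q d0 C e unfolding d_def powr_powr by simp
  define e' where "e' = e / (4 * (1/d) powr r)"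
  have e': "e' > 0" using e d by (simp add: e'_def)
  obtain h M where h: "continuous_on UNIV h" "\<And>x. \<bar>h x\<bar> \<le> M" "\<And>x. norm x > M \<Longrightarrow> h x = 0" "integrable lborel h"
    "(\<integral>\<^sup>+s. ennreal (marg (\<lambda>z. f z - h z) s powr r) * indicator {0<..<sqrt (2 * b)} s \<partial>lborel) \<le> ennreal e'"
    by (rule Lr_L1_approx[OF f r fr e']) blast
  have i: "integrable lborel (\<lambda>z. f z - h z)" using f h by auto
  have t: "2 * ((1/d) powr r * e' + d powr q * C) \<le> e"
  proof -
    have "(1/d) powr r * e' = e / 4" using d by (simp add: e'_def)
    moreover have "d powr q * C \<le> e / 4" unfolding dq using C e by (simp add: field_simps)
    ultimately show ?thesis using e by (simp only: distrib_left)
  qed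
  have "(\<integral>\<^sup>+z. ennreal \<bar>pull (trap_dom y) (trap_map b y) (\<lambda>x. f x - h x) z\<bar> \<partial>lborel) \<le> ennreal e" if "y \<ge> 0" "y \<le> b" for y
    by (rule order_trans[OF trap_bound[OF b that r d less_imp_le[OF e'] i h(5)]]) (use t in \<open>simp add: q_def[symmetric] C_def ennreal_leI\<close>)
  then show "\<exists>h M. continuous_on UNIV h \<and> (\<forall>x. \<bar>h x\<bar> \<le> M) \<and> (\<forall>x. norm x > M \<longrightarrow> h x = 0) \<and>
       (\<forall>n. (\<integral>\<^sup>+z. ennreal \<bar>pull (trap_dom (X n)) (trap_map b (X n)) (\<lambda>x. f x - h x) z\<bar> \<partial>lborel) \<le> ennreal e) \<and>
       (\<integral>\<^sup>+z. ennreal \<bar>pull (trap_dom p) (trap_map b p) (\<lambda>x. f x - h x) z\<bar> \<partial>lborel) \<le> ennreal e"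
    using h X p by blast
next
  show "AE z in lborel. (\<forall>\<^sub>F n in sequentially. trap_dom (X n) z = trap_dom p z) \<and> (trap_dom p z \<longrightarrow> (\<lambda>n. trap_map b (X n) z) \<longlonglongrightarrow> trap_map b p z)"
    using AE_trap_free_convergence(2)[OF X(1)] by eventually_elim auto
qed (use X p trap_integrable(1)[OF f b _ _ r fr] norm_le_trap_map in auto)

section \<open>The stationary density as a function of the potential\<close>

text \<open>The data of the problem with \<open>b\<close> for \<open>\<phi>\<^sub>b\<close>, in the normal form of Borel functions that are
  nonnegative everywhere and of an inflow \<open>fb\<close> that is defined, and integrable, on the whole space.\<close>

locale attractive_data =
  fixes \<alpha> b r :: real and fb fi :: "velocity \<Rightarrow> real"
  assumes b: "b > 0" and \<alpha>: "0 \<le> \<alpha>" "\<alpha> < 1" and r: "r > 2"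
    and fb: "integrable lborel fb" "\<And>z. fb z \<ge> 0"
    and fb_Lr: "integrable lborel (\<lambda>s. indicator {0<..<sqrt (2 * b)} s * marg fb s powr r)"
    and fi: "integrable lborel fi" "\<And>z. fi z \<ge> 0" "(LINT z|lborel. fi z) = 1"
    and compat: "AE z in lborel. z \<in> half_space \<longrightarrow>
      fi z = fb (sqrt ((fst z)\<^sup>2 + 2 * b), snd z) + \<alpha> * fi (- fst z, snd z)"
begin

text \<open>The factor \<open>1 / (1 - \<alpha>)\<close> sums the geometric series of reflections of a trapped particle.\<close>

definition dens :: "real \<Rightarrow> velocity \<Rightarrow> real" where
  "dens p z = pull (free_dom p) (free_map p) fi z + 1 / (1 - \<alpha>) * pull (trap_dom p) (trap_map b p) fb z"

lemma fb_measurable [measurable]: "fb \<in> borel_measurable borel" and fi_measurable [measurable]: "fi \<in> borel_measurable borel"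
  using fb fi by auto

lemma dens_measurable [measurable]: "dens p \<in> borel_measurable borel"
  unfolding dens_def by measurable

text \<open>Joint measurability in the potential and the velocity, needed for Fubini's theorem in phase space.\<close>

lemma dens_measurable_pair [measurable]: "(\<lambda>w. dens (fst w) (snd w)) \<in> borel_measurable borel"
proof -
  have *: "fb \<in> borel_measurable (borel \<Otimes>\<^sub>M borel)" "fi \<in> borel_measurable (borel \<Otimes>\<^sub>M borel)"
    by (simp_all add: borel_prod)
  note [measurable] = *
  have "(\<lambda>w. dens (fst w) (snd w)) \<in> borel_measurable (borel \<Otimes>\<^sub>M (borel \<Otimes>\<^sub>M borel))"
    unfolding dens_def pull_def free_dom_def trap_dom_def free_map_def trap_map_def by measurable
  then show ?thesis by (simp add: borel_prod)
qed

lemma dens_nonneg: "dens p z \<ge> 0"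
  using \<alpha> by (auto simp: dens_def pull_def fb fi)

lemma dens_integrable: 
  assumes "0 \<le> p" "p \<le> b" shows "integrable lborel (dens p)"
  unfolding dens_def
  by (intro Bochner_Integration.integrable_add integrable_mult_right free_integrable(1) 
      trap_integrable(1)[OF fb(1) b _ _ r fb_Lr] fi assms)

lemma dens_L1_convergence:
  assumes X: "X \<longlonglongrightarrow> p" "\<And>n. 0 \<le> X n" "\<And>n. X n \<le> b" and p: "0 \<le> p" "p \<le> b"
  shows "(\<lambda>n. LINT z|lborel. \<bar>dens (X n) z - dens p z\<bar>) \<longlonglongrightarrow> 0"
proof -
  let ?F = "\<lambda>p. pull (free_dom p) (free_map p) fi" and ?T = "\<lambda>p. pull (trap_dom p) (trap_map b p) fb"
  have i: "integrable lborel (?F q)" "integrable lborel (?T q)" if "0 \<le> q" "q \<le> b" for q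
    by (intro free_integrable(1) trap_integrable(1)[OF fb(1) b _ _ r fb_Lr] fi that)+
  have lim: "(\<lambda>n. (LINT z|lborel. \<bar>?F (X n) z - ?F p z\<bar>) + 1 / (1 - \<alpha>) * (LINT z|lborel. \<bar>?T (X n) z - ?T p z\<bar>)) \<longlonglongrightarrow> 0 + 1 / (1 - \<alpha>) * 0"
    by (intro tendsto_intros free_L1_convergence[OF fi(1) X p] trap_L1_convergence[OF fb(1) X p b r fb_Lr])
  show ?thesis
  proof (rule tendsto_sandwich[OF _ _ tendsto_const])
    show "\<forall>\<^sub>F n in sequentially. 0 \<le> (LINT z|lborel. \<bar>dens (X n) z - dens p z\<bar>)" by (intro always_eventually) auto
    show "\<forall>\<^sub>F n in sequentially. (LINT z|lborel. \<bar>dens (X n) z - dens p z\<bar>) \<le>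
       (LINT z|lborel. \<bar>?F (X n) z - ?F p z\<bar>) + 1 / (1 - \<alpha>) * (LINT z|lborel. \<bar>?T (X n) z - ?T p z\<bar>)"
    proof (intro always_eventually allI)
      fix n
      have ia: "integrable lborel (\<lambda>z. \<bar>?F (X n) z - ?F p z\<bar>)"
        by (intro integrable_abs Bochner_Integration.integrable_diff i X p)
      have ib: "integrable lborel (\<lambda>z. \<bar>?T (X n) z - ?T p z\<bar>)"
        by (intro integrable_abs Bochner_Integration.integrable_diff i X p)
      have id: "integrable lborel (\<lambda>z. \<bar>dens (X n) z - dens p z\<bar>)"
        by (intro integrable_abs Bochner_Integration.integrable_diff dens_integrable X p)
      have "(LINT z|lborel. \<bar>dens (X n) z - dens p z\<bar>) \<le> (LINT z|lborel. \<bar>?F (X n) z - ?F p z\<bar> + 1 / (1 - \<alpha>) * \<bar>?T (X n) z - ?T p z\<bar>)"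
      proof (rule integral_mono)
        fix z
        have d: "dens (X n) z - dens p z = (?F (X n) z - ?F p z) + 1 / (1 - \<alpha>) * (?T (X n) z - ?T p z)"
          unfolding dens_def by (simp add: right_diff_distrib[symmetric] diff_divide_distrib)
        have "\<bar>1 / (1 - \<alpha>) * (?T (X n) z - ?T p z)\<bar> = 1 / (1 - \<alpha>) * \<bar>?T (X n) z - ?T p z\<bar>"
          using \<alpha> by (simp add: abs_mult)
        then show "\<bar>dens (X n) z - dens p z\<bar> \<le> \<bar>?F (X n) z - ?F p z\<bar> + 1 / (1 - \<alpha>) * \<bar>?T (X n) z - ?T p z\<bar>"
          unfolding d by (metis abs_triangle_ineq)
      qed (use ia ib id in auto)
      also have "\<dots> = (LINT z|lborel. \<bar>?F (X n) z - ?F p z\<bar>) + (LINT z|lborel. 1 / (1 - \<alpha>) * \<bar>?T (X n) z - ?T p z\<bar>)"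
        using ia ib by (intro Bochner_Integration.integral_add) auto
      finally show "(LINT z|lborel. \<bar>dens (X n) z - dens p z\<bar>) \<le>
       (LINT z|lborel. \<bar>?F (X n) z - ?F p z\<bar>) + 1 / (1 - \<alpha>) * (LINT z|lborel. \<bar>?T (X n) z - ?T p z\<bar>)"
        by (simp only: integral_mult_right_zero)
    qed
  qed (use lim in simp)
qed

definition rho :: "real \<Rightarrow> real" where "rho p = (LINT z|lborel. dens p z)"

text \<open>The two terms of \<open>rho_plus\<close> are the integrals of the free and of the trapped part of \<open>dens\<close> after
  substituting the velocity at infinity and at the wall.\<close>

lemma rho_plus_eq:
  assumes p: "0 \<le> p" "p \<le> b" shows "rho_plus \<alpha> b fb fi p = rho p"
proof -
  have c: "2 * (b - p) * chi (b - p) = 2 * (b - p)" using p by (auto simp: chi_def indicator_def)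
  have "rho p = (LINT z|lborel. pull (free_dom p) (free_map p) fi z) + 1 / (1 - \<alpha>) * (LINT z|lborel. pull (trap_dom p) (trap_map b p) fb z)"
    unfolding rho_def dens_def
    by (subst Bochner_Integration.integral_add)
       (auto intro!: free_integrable(1) integrable_divide trap_integrable(1)[OF fb(1) b _ _ r fb_Lr] fi p)
  also have "\<dots> = rho_plus \<alpha> b fb fi p"
    unfolding rho_plus_def c free_integrable(3)[OF fi(1) p(1) fi(2)] trap_integrable(2)[OF fb(1) b p r fb_Lr fb(2)]
    by simp
  finally show ?thesis by simp
qed

lemma rho_continuous: "continuous_on {0..b} rho"
proof (rule continuous_on_sequentiallyI)
  fix X p assume X: "\<forall>n. X n \<in> {0..b}" and p: "p \<in> {0..b}" and lim: "X \<longlonglongrightarrow> p"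
  have i: "integrable lborel (dens q)" if "q \<in> {0..b}" for q using that by (intro dens_integrable) auto
  have c: "(\<lambda>n. LINT z|lborel. \<bar>dens (X n) z - dens p z\<bar>) \<longlonglongrightarrow> 0"
    using X p by (intro dens_L1_convergence lim) auto
  have "(\<lambda>n. rho (X n) - rho p) \<longlonglongrightarrow> 0"
  proof (rule Lim_null_comparison[OF always_eventually c], intro allI)
    fix n
    have "rho (X n) - rho p = (LINT z|lborel. dens (X n) z - dens p z)"
      unfolding rho_def using X p i by (simp add: Bochner_Integration.integral_diff)
    then show "norm (rho (X n) - rho p) \<le> (LINT z|lborel. \<bar>dens (X n) z - dens p z\<bar>)"
      using integral_norm_bound[of lborel "\<lambda>z. dens (X n) z - dens p z"] by simp
  qed
  then show "(\<lambda>n. rho (X n)) \<longlonglongrightarrow> rho p" by (simp add: LIM_zero_iff)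
qed

lemma dens_0: "AE z in lborel. dens 0 z = fi z"
  using AE_fst_neq[of 0]
proof eventually_elim
  case (elim z)
  have "sgn v * \<bar>v\<bar> = v" for v :: real by (simp add: sgn_if)
  then show ?case using elim by (auto simp: dens_def pull_def free_dom_def trap_dom_def free_map_def)
qed

lemma rho_0: "rho 0 = 1"
proof -
  have "rho 0 = (LINT z|lborel. fi z)" unfolding rho_def
    using dens_0 by (intro integral_cong_AE) auto
  then show ?thesis by (simp add: fi)
qed

lemma density_plus_eq:
  assumes "\<phi> x \<ge> 0" shows "density_plus \<alpha> b fb fi \<phi> x z = dens (\<phi> x) z"
proof -
  obtain s \<eta> where z: "z = (s, \<eta>)" by (cases z)
  have e: "s\<^sup>2 - 2 * \<phi> x + 2 * b = s\<^sup>2 + (2 * b - 2 * \<phi> x)" by simp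
  have "s \<noteq> 0" if "s\<^sup>2 > 2 * \<phi> x" using that assms by auto
  then show ?thesis
    unfolding z density_plus_def dens_def pull_def free_dom_def trap_dom_def free_map_def trap_map_def
    unfolding fst_conv snd_conv by (auto simp: e chi_def indicator_def sgn_if)
qed

end

section \<open>Energy coordinates for a decreasing potential\<close>

text \<open>The one-dimensional substitution applied in the first variable for every fixed value of the second.\<close>

lemma distr_density_fibre:
  fixes g g' :: "real \<Rightarrow> 'b::euclidean_space \<Rightarrow> real" and W :: "'b \<Rightarrow> real set"
  assumes S [measurable]: "S \<in> sets borel"
    and g [measurable]: "(\<lambda>w. g (fst w) (snd w)) \<in> borel_measurable borel"
    and g' [measurable]: "(\<lambda>w. g' (fst w) (snd w)) \<in> borel_measurable borel"
    and W: "{w. fst w \<in> W (snd w)} \<in> sets borel" and im: "\<And>z. (\<lambda>x. g x z) ` S = W z"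
    and der: "\<And>x z. x \<in> S \<Longrightarrow> ((\<lambda>x. g x z) has_real_derivative g' x z) (at x within S)"
    and inj: "\<And>z. inj_on (\<lambda>x. g x z) S"
  shows "distr (density lborel (\<lambda>w. ennreal (\<bar>g' (fst w) (snd w)\<bar> * indicator S (fst w)))) borel (\<lambda>w. (g (fst w) (snd w), snd w))
       = density lborel (indicator {w. fst w \<in> W (snd w)})" (is "?M = ?N")
proof (rule measure_eqI)
  show "sets ?M = sets ?N" by simp
next
  fix A assume "A \<in> sets ?M"
  then have A [measurable]: "A \<in> sets borel" by simp
  have gp [measurable]: "(\<lambda>w. g (fst w) (snd w)) \<in> borel_measurable (borel \<Otimes>\<^sub>M borel)"
    "(\<lambda>w. g' (fst w) (snd w)) \<in> borel_measurable (borel \<Otimes>\<^sub>M borel)"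
    using g g' by (simp_all add: borel_prod)
  have gz [measurable]: "(\<lambda>x. g x z) \<in> borel_measurable borel" "(\<lambda>x. g' x z) \<in> borel_measurable borel" for z
    using measurable_Pair2'[of z borel borel] measurable_compose[OF _ gp(1), of "\<lambda>x. (x, z)" borel]
      measurable_compose[OF _ gp(2), of "\<lambda>x. (x, z)" borel] by auto
  have Ap [measurable]: "A \<in> sets (borel \<Otimes>\<^sub>M borel)" and Wp [measurable]: "{w. fst w \<in> W (snd w)} \<in> sets (borel \<Otimes>\<^sub>M borel)"
    unfolding borel_prod by (fact A W)+
  have T [measurable]: "(\<lambda>w. (g (fst w) (snd w), snd w)) \<in> borel \<Otimes>\<^sub>M borel \<rightarrow>\<^sub>M borel \<Otimes>\<^sub>M borel" by measurable
  then have T' [measurable]: "(\<lambda>w. (g (fst w) (snd w), snd w)) \<in> borel_measurable borel" by (simp add: borel_prod)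
  have Wz [measurable]: "W z \<in> sets borel" for z
  proof -
    have "W z = (\<lambda>x. (x, z)) -` {w. fst w \<in> W (snd w)}" by auto
    then show ?thesis using sets_Pair2[OF Wp] by simp
  qed
  have m1: "(\<lambda>w. ennreal (\<bar>g' (fst w) (snd w)\<bar> * indicator S (fst w)) * indicator A (g (fst w) (snd w), snd w)) \<in> borel_measurable (borel \<Otimes>\<^sub>M borel)"
    by measurable
  have "emeasure ?M A = (\<integral>\<^sup>+w. ennreal (\<bar>g' (fst w) (snd w)\<bar> * indicator S (fst w)) * indicator A (g (fst w) (snd w), snd w) \<partial>lborel)"
  proof -
    have "(\<lambda>w. \<bar>g' (fst w) (snd w)\<bar> * indicator S (fst w)) \<in> borel_measurable (borel \<Otimes>\<^sub>M borel)" by measurable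
    then have [measurable]: "(\<lambda>w. \<bar>g' (fst w) (snd w)\<bar> * indicator S (fst w)) \<in> borel_measurable borel" by (simp add: borel_prod)
    show ?thesis
      by (subst emeasure_distr, simp, simp, subst emeasure_density)
         (auto intro!: nn_integral_cong simp: measurable_sets_borel[OF T' A] split: split_indicator)
  qed
  also have "\<dots> = (\<integral>\<^sup>+z. \<integral>\<^sup>+x. ennreal (\<bar>g' x z\<bar> * indicator S x) * indicator A (g x z, z) \<partial>lborel \<partial>lborel)"
    using m1 unfolding lborel_prod[symmetric] by (subst lborel_pair.nn_integral_snd[symmetric]) auto
  also have "\<dots> = (\<integral>\<^sup>+z. \<integral>\<^sup>+x. indicator A (g x z, z) * ennreal \<bar>g' x z\<bar> * indicator S x \<partial>lborel \<partial>lborel)"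
    by (intro nn_integral_cong) (auto split: split_indicator)
  also have "\<dots> = (\<integral>\<^sup>+z. \<integral>\<^sup>+E. indicator A (E, z) * indicator (W z) E \<partial>lborel \<partial>lborel)"
  proof (rule nn_integral_cong)
    fix z :: 'b
    have [measurable]: "(\<lambda>E. indicator A (E, z) :: ennreal) \<in> borel_measurable borel" by measurable
    show "(\<integral>\<^sup>+x. indicator A (g x z, z) * ennreal \<bar>g' x z\<bar> * indicator S x \<partial>lborel) = (\<integral>\<^sup>+E. indicator A (E, z) * indicator (W z) E \<partial>lborel)"
      using nn_integral_real_substitution[where g = "\<lambda>x. g x z" and g' = "\<lambda>x. g' x z" and S = S and f = "\<lambda>E. indicator A (E, z)"]
      unfolding im using der inj by auto
  qed
  also have "\<dots> = (\<integral>\<^sup>+z. \<integral>\<^sup>+E. indicator {w. fst w \<in> W (snd w)} (E, z) * indicator A (E, z) \<partial>lborel \<partial>lborel)"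
    by (intro nn_integral_cong) (auto split: split_indicator)
  also have "\<dots> = (\<integral>\<^sup>+w. indicator {w. fst w \<in> W (snd w)} w * indicator A w \<partial>lborel)"
    unfolding lborel_prod[symmetric] by (subst lborel_pair.nn_integral_snd) auto
  also have "\<dots> = emeasure ?N A" using W by (subst emeasure_density) auto
  finally show "emeasure ?M A = emeasure ?N A" .
qed

text \<open>What the phase space geometry uses of a potential; \<open>\<phi>'\<close> is one-sided at \<open>0\<close>.\<close>

locale monotone_profile =
  fixes b :: real and \<phi> \<phi>' :: "real \<Rightarrow> real"
  assumes b_pos: "b > 0" and \<phi>0: "\<phi> 0 = b"
    and \<phi>_der: "\<And>x. x \<ge> 0 \<Longrightarrow> (\<phi> has_real_derivative \<phi>' x) (at x within {0..})"
    and \<phi>'_cont: "continuous_on {0..} \<phi>'" and \<phi>'_neg: "\<And>x. x \<ge> 0 \<Longrightarrow> \<phi>' x < 0"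
    and \<phi>_lim: "(\<phi> \<longlongrightarrow> 0) at_top"
begin

lemma \<phi>_cont: "continuous_on {0..} \<phi>"
  using \<phi>_der by (intro DERIV_continuous_on) auto

lemma \<phi>_der_at: "x > 0 \<Longrightarrow> (\<phi> has_real_derivative \<phi>' x) (at x)"
  using \<phi>_der[of x] at_within_interior[of x "{0..}"] by (simp add: interior_real_atLeast)

lemma \<phi>_strict_decreasing:
  assumes "0 \<le> x" "x < y" shows "\<phi> y < \<phi> x"
proof (rule DERIV_neg_imp_decreasing_open[OF assms(2)])
  fix t assume "x < t" "t < y"
  then show "\<exists>l. (\<phi> has_real_derivative l) (at t) \<and> l < 0"
    using \<phi>_der_at[of t] \<phi>'_neg[of t] assms by (intro exI[of _ "\<phi>' t"]) auto
qed (use assms in \<open>auto intro: continuous_on_subset[OF \<phi>_cont]\<close>)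

lemma \<phi>_decreasing: "0 \<le> x \<Longrightarrow> x \<le> y \<Longrightarrow> \<phi> y \<le> \<phi> x"
  using \<phi>_strict_decreasing[of x y] by (cases "x = y") auto

lemma \<phi>_pos: assumes "x \<ge> 0" shows "\<phi> x > 0"
proof -
  have "\<phi> (x + 1) \<ge> 0"
    by (rule tendsto_upperbound[OF \<phi>_lim]) 
       (use assms in \<open>auto intro!: eventually_at_top_linorderI[of "x + 1"] \<phi>_decreasing\<close>)
  then show ?thesis using \<phi>_strict_decreasing[of x "x + 1"] assms by simp
qed

lemma \<phi>_le: "x \<ge> 0 \<Longrightarrow> \<phi> x \<le> b" using \<phi>_decreasing[of 0 x] \<phi>0 by simp
lemma \<phi>_less: "x > 0 \<Longrightarrow> \<phi> x < b" using \<phi>_strict_decreasing[of 0 x] \<phi>0 by simp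

lemma \<phi>_inj: "inj_on \<phi> {0..}"
  by (rule inj_onI) (metis \<phi>_strict_decreasing atLeast_iff less_irrefl linorder_neqE_linordered_idom)

lemma \<phi>_surj: assumes "0 < p" "p \<le> b" obtains x where "x \<ge> 0" "\<phi> x = p"
proof -
  have "\<forall>\<^sub>F x in at_top. \<phi> x < p" using order_tendstoD(2)[OF \<phi>_lim] assms by auto
  then have "\<forall>\<^sub>F x in at_top. \<phi> x < p \<and> x \<ge> 0" using eventually_ge_at_top[of 0] by eventually_elim auto
  from eventually_happens[OF this] obtain y where y: "\<phi> y < p" "y \<ge> 0" by auto
  have "\<exists>x\<ge>0. x \<le> y \<and> \<phi> x = p"
    using y assms \<phi>0 by (intro IVT2') (auto intro: continuous_on_subset[OF \<phi>_cont])
  then show thesis using that by auto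
qed

definition pos :: "real \<Rightarrow> real" where "pos p = (THE x. x \<ge> 0 \<and> \<phi> x = p)"

lemma pos_\<phi> [simp]: assumes "x \<ge> 0" shows "pos (\<phi> x) = x"
  unfolding pos_def by (rule the_equality) (use assms \<phi>_inj in \<open>auto dest: inj_onD\<close>)

lemma pos: assumes "0 < p" "p \<le> b" shows "pos p \<ge> 0" "\<phi> (pos p) = p"
proof -
  obtain x where "x \<ge> 0" "\<phi> x = p" by (rule \<phi>_surj[OF assms])
  then show "pos p \<ge> 0" "\<phi> (pos p) = p" by auto
qed

lemma pos_gt0: assumes "0 < p" "p < b" shows "pos p > 0"
  using pos[of p] assms \<phi>0 by (cases "pos p = 0") auto

lemma pos_b [simp]: "pos b = 0" using pos_\<phi>[of 0] \<phi>0 by simp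

lemma pos_large: assumes "R \<ge> 0" "0 < p" "p < \<phi> R" shows "pos p > R"
proof (rule ccontr)
  assume "\<not> pos p > R"
  moreover have "p \<le> b" using assms \<phi>_le[of R] by simp
  ultimately have "\<phi> R \<le> p" using \<phi>_decreasing[of "pos p" R] pos[of p] assms by simp
  then show False using assms by simp
qed

lemma \<phi>_image: "\<phi> ` {0<..} = {0<..<b}"
proof (intro equalityI subsetI)
  fix p assume "p \<in> {0<..<b}"
  then show "p \<in> \<phi> ` {0<..}" using pos[of p] pos_gt0[of p] by (intro image_eqI[of _ _ "pos p"]) auto
qed (auto simp: \<phi>_pos \<phi>_less)

lemma pos_cont: "continuous_on {0<..b} pos"
proof (rule continuous_on_eq_continuous_within[THEN iffD2], intro ballI)
  fix p assume p: "p \<in> {0<..b}"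
  define n where "n = pos p + 1"
  have n: "n \<ge> 0" "\<phi> n < p" using pos[of p] p \<phi>_strict_decreasing[of "pos p" n] by (auto simp: n_def)
  have im: "{\<phi> n..b} \<subseteq> \<phi> ` {0..n}"
  proof
    fix q assume q: "q \<in> {\<phi> n..b}"
    then have q': "0 < q" "q \<le> b" using \<phi>_pos[OF n(1)] by auto
    have "pos q \<le> n"
    proof (rule ccontr)
      assume "\<not> pos q \<le> n"
      then have "\<phi> (pos q) < \<phi> n" using n by (intro \<phi>_strict_decreasing) auto
      then show False using pos(2)[OF q'] q by simp
    qed
    then show "q \<in> \<phi> ` {0..n}" using pos[OF q'] by (intro image_eqI[of _ _ "pos q"]) auto
  qed
  have "continuous_on (\<phi> ` {0..n}) pos"
    by (rule continuous_on_inv) (auto intro: continuous_on_subset[OF \<phi>_cont])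
  then have "continuous_on {\<phi> n..b} pos" using im by (rule continuous_on_subset)
  then have "continuous (at p within {\<phi> n..b}) pos" using n p by (auto simp: continuous_on_eq_continuous_within)
  moreover have "at p within {0<..b} = at p within {\<phi> n..b}"
    by (rule at_within_nhd[of _ "{\<phi> n<..}"]) (use n p \<phi>_pos[OF n(1)] in auto)
  ultimately show "continuous (at p within {0<..b}) pos" by (simp add: continuous_within)
qed

lemma pos_isCont: assumes "0 < p" "p < b" shows "isCont pos p"
proof -
  have "continuous_on {0<..<b} pos" by (rule continuous_on_subset[OF pos_cont]) auto
  then show ?thesis using assms by (auto simp: continuous_on_eq_continuous_at)
qed

lemma pos_der: assumes "0 < p" "p < b" shows "(pos has_real_derivative inverse (\<phi>' (pos p))) (at p)"
  by (rule DERIV_inverse_function[where f = \<phi> and a = 0 and b = b])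
     (use assms pos pos_gt0 \<phi>_der_at \<phi>'_neg[of "pos p"] pos_isCont in auto)

text \<open>Extensions to negative positions by the value at the wall, which are Borel functions on the line.\<close>

definition \<phi>x :: "real \<Rightarrow> real" where "\<phi>x x = \<phi> (max 0 x)"
definition \<phi>x' :: "real \<Rightarrow> real" where "\<phi>x' x = \<phi>' (max 0 x)"

lemma \<phi>x_measurable [measurable]: "\<phi>x \<in> borel_measurable borel" "\<phi>x' \<in> borel_measurable borel"
proof -
  have "continuous_on UNIV \<phi>x" unfolding \<phi>x_def
    by (rule continuous_on_compose2[OF \<phi>_cont]) (auto intro!: continuous_intros)
  then show "\<phi>x \<in> borel_measurable borel" by (rule borel_measurable_continuous_onI)
  have "continuous_on UNIV \<phi>x'" unfolding \<phi>x'_def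
    by (rule continuous_on_compose2[OF \<phi>'_cont]) (auto intro!: continuous_intros)
  then show "\<phi>x' \<in> borel_measurable borel" by (rule borel_measurable_continuous_onI)
qed

lemma \<phi>x_eq [simp]: "x \<ge> 0 \<Longrightarrow> \<phi>x x = \<phi> x" "x \<ge> 0 \<Longrightarrow> \<phi>x' x = \<phi>' x"
  by (auto simp: \<phi>x_def \<phi>x'_def)

text \<open>The position is replaced by the energy and the velocity is kept.  The Jacobian is \<open>\<bar>\<phi>'\<bar>\<close>, which
  together with the restriction to positive positions is the function \<open>flux\<close>; the image
  is \<open>energy_range\<close>.\<close>

definition energy_map :: "real \<times> velocity \<Rightarrow> real \<times> velocity" where
  "energy_map w = ((fst (snd w))\<^sup>2 / 2 - \<phi>x (fst w), snd w)"

definition energy_range :: "(real \<times> velocity) set" where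
  "energy_range = {w. 0 < (fst (snd w))\<^sup>2 / 2 - fst w \<and> (fst (snd w))\<^sup>2 / 2 - fst w < b}"

definition flux :: "real \<times> velocity \<Rightarrow> real" where "flux w = \<bar>\<phi>x' (fst w)\<bar> * indicator {0<..} (fst w)"

lemma energy_measurable [measurable]:
  "energy_map \<in> borel_measurable borel" "energy_range \<in> sets borel" "flux \<in> borel_measurable borel"
proof -
  have "energy_map \<in> borel \<Otimes>\<^sub>M (borel \<Otimes>\<^sub>M borel) \<rightarrow>\<^sub>M borel \<Otimes>\<^sub>M (borel \<Otimes>\<^sub>M borel)"
    unfolding energy_map_def by measurable
  then show "energy_map \<in> borel_measurable borel" by (simp add: borel_prod)
  have "flux \<in> borel_measurable (borel \<Otimes>\<^sub>M (borel \<Otimes>\<^sub>M borel))" unfolding flux_def by measurable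
  then show "flux \<in> borel_measurable borel" by (simp add: borel_prod)
  have "open energy_range" unfolding energy_range_def by (intro open_Collect_conj open_Collect_less continuous_intros) auto
  then show "energy_range \<in> sets borel" by (rule borel_open)
qed

lemma energy_distr: "distr (density lborel (\<lambda>w. ennreal (flux w))) borel energy_map = density lborel (indicator energy_range)"
proof -
  let ?g = "\<lambda>x (z::velocity). (fst z)\<^sup>2 / 2 - \<phi>x x" and ?g' = "\<lambda>x (z::velocity). - \<phi>x' x"
  let ?W = "\<lambda>z :: velocity. {(fst z)\<^sup>2 / 2 - b<..<(fst z)\<^sup>2 / 2}"
  have m: "(\<lambda>w. ?g (fst w) (snd w)) \<in> borel_measurable (borel \<Otimes>\<^sub>M (borel \<Otimes>\<^sub>M borel))" "(\<lambda>w. ?g' (fst w) (snd w)) \<in> borel_measurable (borel \<Otimes>\<^sub>M (borel \<Otimes>\<^sub>M borel))"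
    by measurable
  have W: "{w. fst w \<in> ?W (snd w)} = energy_range" by (auto simp: energy_range_def)
  have "distr (density lborel (\<lambda>w. ennreal (\<bar>?g' (fst w) (snd w)\<bar> * indicator {0<..} (fst w)))) borel (\<lambda>w. (?g (fst w) (snd w), snd w))
       = density lborel (indicator {w. fst w \<in> ?W (snd w)})"
  proof (rule distr_density_fibre)
    show "(\<lambda>x. ?g x z) ` {0<..} = ?W z" for z
    proof -
      have "(\<lambda>x. ?g x z) ` {0<..} = (\<lambda>p. (fst z)\<^sup>2 / 2 - p) ` (\<phi> ` {0<..})" by (auto simp: image_image)
      also have "\<dots> = ?W z" unfolding \<phi>_image
      proof (intro equalityI subsetI)
        fix y assume "y \<in> ?W z"
        then show "y \<in> (\<lambda>p. (fst z)\<^sup>2 / 2 - p) ` {0<..<b}"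
          by (intro image_eqI[of _ _ "(fst z)\<^sup>2 / 2 - y"]) auto
      qed auto
      finally show ?thesis .
    qed
    show "((\<lambda>x. ?g x z) has_real_derivative ?g' x z) (at x within {0<..})" if "x \<in> {0<..}" for x z
    proof -
      have "(\<phi>x has_real_derivative \<phi>' x) (at x)"
        by (rule has_field_derivative_transform_within_open[OF \<phi>_der_at, of _ "{0<..}"]) (use that in auto)
      then have "((\<lambda>x. ?g x z) has_real_derivative ?g' x z) (at x)"
        using that by (auto intro!: derivative_eq_intros)
      then show ?thesis by (rule has_field_derivative_at_within)
    qed
    show "inj_on (\<lambda>x. ?g x z) {0<..}" for z
      using \<phi>_inj by (auto simp: inj_on_def)
    show "{w. fst w \<in> ?W (snd w)} \<in> sets borel" unfolding W by measurable
    show "(\<lambda>w. ?g (fst w) (snd w)) \<in> borel_measurable borel" "(\<lambda>w. ?g' (fst w) (snd w)) \<in> borel_measurable borel"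
      by (rule m[unfolded borel_prod])+
  qed simp
  then show ?thesis unfolding W energy_map_def[abs_def] flux_def[abs_def] by simp
qed

end

section \<open>The stationary density solves the weak Vlasov equation\<close>

text \<open>Compact support bounds a test function and its derivative.  At interior points the derivative
  relative to the closed half space is the ordinary one, and outside the support it vanishes.\<close>

lemma test_function_props:
  assumes "\<psi> \<in> test_functions \<alpha>"
  obtains D R C where "R \<ge> 0" "C \<ge> 0"
    "\<And>w. fst w > 0 \<Longrightarrow> (\<psi> has_derivative blinfun_apply (D w)) (at w)"
    "continuous_on ({0..} \<times> UNIV) D" "continuous_on ({0..} \<times> UNIV) \<psi>"
    "\<And>w. fst w \<ge> 0 \<Longrightarrow> norm w > R \<Longrightarrow> \<psi> w = 0" "\<And>w. fst w > 0 \<Longrightarrow> norm w > R \<Longrightarrow> D w = 0"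
    "\<And>w. fst w \<ge> 0 \<Longrightarrow> \<bar>\<psi> w\<bar> \<le> C" "\<And>w. fst w > 0 \<Longrightarrow> norm (D w) \<le> C"
    "\<And>s \<eta>. s > 0 \<Longrightarrow> \<alpha> * \<psi> (0, (s, \<eta>)) = \<psi> (0, (- s, \<eta>))"
proof -
  let ?H = "{0..} \<times> UNIV :: (real \<times> velocity) set"
  obtain D where D: "\<And>z. z \<in> ?H \<Longrightarrow> (\<psi> has_derivative blinfun_apply (D z)) (at z within ?H)"
    and Dc: "continuous_on ?H D" and K: "compact (closure {z \<in> ?H. \<psi> z \<noteq> 0})"
    and refl: "\<And>s \<eta>. s > 0 \<Longrightarrow> \<alpha> * \<psi> (0, (s, \<eta>)) = \<psi> (0, (- s, \<eta>))"
    using assms unfolding test_functions_def by blast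
  have \<psi>c: "continuous_on ?H \<psi>"
    using D by (rule has_derivative_continuous_on)
  have "bounded {z \<in> ?H. \<psi> z \<noteq> 0}" using K by (rule bounded_subset[OF compact_imp_bounded closure_subset])
  then obtain R where R: "R > 0" "\<And>z. z \<in> ?H \<Longrightarrow> \<psi> z \<noteq> 0 \<Longrightarrow> norm z \<le> R" unfolding bounded_pos by auto
  have z: "\<psi> w = 0" if "fst w \<ge> 0" "norm w > R" for w
  proof (rule ccontr)
    assume "\<psi> w \<noteq> 0"
    then have "norm w \<le> R" using that by (intro R(2)) (auto simp: mem_Times_iff)
    then show False using that by simp
  qed
  have op: "open {w :: real \<times> velocity. fst w > 0}" by (intro open_Collect_less continuous_intros)
  have Dat: "(\<psi> has_derivative blinfun_apply (D w)) (at w)" if "fst w > 0" for w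
  proof -
    have "at w within ?H = at w within UNIV"
      by (rule at_within_nhd[of _ "{w. fst w > 0}"]) (use that op in \<open>auto simp: mem_Times_iff\<close>)
    then show ?thesis using D[of w] that by (auto simp: mem_Times_iff)
  qed
  have Dz: "D w = 0" if "fst w > 0" "norm w > R" for w
  proof -
    have "((\<lambda>w. 0) has_derivative (\<lambda>h. 0 :: real)) (at w)" by simp
    then have "(\<psi> has_derivative (\<lambda>h. 0)) (at w)"
    proof (rule has_derivative_transform_within_open)
      show "open ({w. fst w > 0} \<inter> {w :: real \<times> velocity. R < norm w})"
        by (intro open_Int op open_Collect_less continuous_intros)
    qed (use that z in auto)
    then have "blinfun_apply (D w) = (\<lambda>h. 0)" using Dat[OF that(1)] by (rule has_derivative_unique[rotated])
    then show ?thesis by (intro blinfun_eqI) simp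
  qed
  let ?K = "?H \<inter> cball 0 R"
  have cK: "compact ?K" by (rule closed_Int_compact) (auto intro: closed_Times)
  have "bounded (D ` ?K)" "bounded (\<psi> ` ?K)"
    by (intro compact_imp_bounded compact_continuous_image cK continuous_on_subset[OF Dc] continuous_on_subset[OF \<psi>c]; auto)+
  then obtain C1 C2 where C: "C1 > 0" "\<And>w. w \<in> ?K \<Longrightarrow> norm (D w) \<le> C1" "C2 > 0" "\<And>w. w \<in> ?K \<Longrightarrow> \<bar>\<psi> w\<bar> \<le> C2"
    unfolding bounded_pos by (auto simp: mem_Times_iff)
  show thesis
  proof (rule that[of R "max C1 C2" D])
    show "\<bar>\<psi> w\<bar> \<le> max C1 C2" if "fst w \<ge> 0" for w
      using C(4)[of w] z[of w] that C(1,3) by (cases "norm w \<le> R") (auto simp: mem_Times_iff)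
    show "norm (D w) \<le> max C1 C2" if "fst w > 0" for w
      using C(2)[of w] Dz[of w] that C(1,3) by (cases "norm w \<le> R") (auto simp: mem_Times_iff)
  qed (use R C z Dz Dat Dc \<psi>c refl in auto)
qed

lemma transport_deriv:
  fixes \<psi> :: "real \<times> velocity \<Rightarrow> real"
  assumes "(\<psi> has_derivative blinfun_apply D) (at (x, (s, \<eta>)))"
  shows "s * deriv (\<lambda>x'. \<psi> (x', (s, \<eta>))) x + c * deriv (\<lambda>s'. \<psi> (x, (s', \<eta>))) s = blinfun_apply D (s, (c, 0))"
proof -
  have 1: "((\<lambda>x'. (x', (s, \<eta>))) has_derivative (\<lambda>h. (h, 0))) (at x)"
    by (auto intro!: derivative_eq_intros simp: zero_prod_def)
  have 2: "((\<lambda>s'. (x, (s', \<eta>))) has_derivative (\<lambda>h. (0, (h, 0)))) (at s)"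
    by (auto intro!: derivative_eq_intros)
  have "((\<lambda>x'. \<psi> (x', (s, \<eta>))) has_derivative (\<lambda>h. blinfun_apply D (h, 0))) (at x)"
    using has_derivative_compose[OF 1, of \<psi> "blinfun_apply D"] assms by simp
  then have "((\<lambda>x'. \<psi> (x', (s, \<eta>))) has_real_derivative blinfun_apply D (1, 0)) (at x)"
  proof (rule has_derivative_imp_has_field_derivative)
    fix h
    have "h *\<^sub>R blinfun_apply D (1, 0) = blinfun_apply D (h *\<^sub>R (1, 0))" by (rule blinfun.scaleR_right[symmetric])
    also have "h *\<^sub>R (1, 0) = ((h, 0) :: real \<times> velocity)" by (simp add: zero_prod_def)
    finally show "h * blinfun_apply D (1, 0) = blinfun_apply D (h, 0)" by simp
  qed
  then have d1: "deriv (\<lambda>x'. \<psi> (x', (s, \<eta>))) x = blinfun_apply D (1, 0)" by (rule DERIV_imp_deriv)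
  have "((\<lambda>s'. \<psi> (x, (s', \<eta>))) has_derivative (\<lambda>h. blinfun_apply D (0, (h, 0)))) (at s)"
    using has_derivative_compose[OF 2, of \<psi> "blinfun_apply D"] assms by simp
  then have "((\<lambda>s'. \<psi> (x, (s', \<eta>))) has_real_derivative blinfun_apply D (0, (1, 0))) (at s)"
  proof (rule has_derivative_imp_has_field_derivative)
    fix h
    have "h *\<^sub>R blinfun_apply D (0, (1, 0)) = blinfun_apply D (h *\<^sub>R (0, (1, 0)))" by (rule blinfun.scaleR_right[symmetric])
    also have "h *\<^sub>R (0, (1, 0)) = ((0, (h, 0)) :: real \<times> velocity)" by (simp add: zero_prod_def)
    finally show "h * blinfun_apply D (0, (1, 0)) = blinfun_apply D (0, (h, 0))" by simp
  qed
  then have d2: "deriv (\<lambda>s'. \<psi> (x, (s', \<eta>))) s = blinfun_apply D (0, (1, 0))" by (rule DERIV_imp_deriv)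
  have "(s, (c, 0)) = s *\<^sub>R (1, 0) + c *\<^sub>R (0, (1, 0 :: real^2))" by (simp add: zero_prod_def)
  then show ?thesis unfolding d1 d2 by (simp only: blinfun.add_right blinfun.scaleR_right real_scaleR_def)
qed

text \<open>The map \<open>E \<mapsto> sqrt (2 * E)\<close> pulls null sets back to null sets, because its inverse
  \<open>s \<mapsto> s\<^sup>2 / 2\<close> is differentiable.\<close>

lemma AE_sqrt_double:
  assumes "AE s in lborel. Q (s::real)"
  shows "AE E in lborel. E > 0 \<longrightarrow> Q (sqrt (2 * E))"
proof -
  obtain N where N0: "{s \<in> space lborel. \<not> Q s} \<subseteq> N" "emeasure lborel N = 0" "N \<in> sets lborel"
    by (rule AE_E[OF assms])
  then have N: "{s. \<not> Q s} \<subseteq> N" "N \<in> sets borel" "emeasure lborel N = 0" by simp_all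
  note [measurable] = N(2)
  have im: "(\<lambda>s :: real. s\<^sup>2 / 2) ` {0<..} = {0<..}"
  proof (intro equalityI subsetI)
    fix E :: real assume "E \<in> {0<..}"
    then show "E \<in> (\<lambda>s. s\<^sup>2 / 2) ` {0<..}" by (intro image_eqI[of _ _ "sqrt (2 * E)"]) auto
  qed auto
  have "(\<integral>\<^sup>+E. indicator N (sqrt (2 * E)) * indicator ((\<lambda>s :: real. s\<^sup>2 / 2) ` {0<..}) E \<partial>lborel)
    = (\<integral>\<^sup>+s. indicator N (sqrt (2 * (s\<^sup>2 / 2))) * ennreal \<bar>s\<bar> * indicator {0<..} s \<partial>lborel)"
    by (rule nn_integral_real_substitution)
       (auto simp: im inj_on_def intro!: derivative_eq_intros)
  also have "\<dots> = (\<integral>\<^sup>+(s::real). 0 \<partial>lborel)"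
  proof (rule nn_integral_cong_AE)
    have "AE s in lborel. s \<notin> N" using N by (intro AE_not_in) (auto simp: null_sets_def)
    then show "AE s in lborel. indicator N (sqrt (2 * (s\<^sup>2 / 2))) * ennreal \<bar>s\<bar> * indicator {0<..} s = 0"
      by eventually_elim (auto split: split_indicator)
  qed
  finally have "(\<integral>\<^sup>+E. indicator N (sqrt (2 * E)) * indicator {0<..} E \<partial>lborel) = 0" by (simp add: im)
  then have "AE E in lborel. indicator N (sqrt (2 * E)) * indicator {0<..} E = (0 :: ennreal)"
    by (subst (asm) nn_integral_0_iff_AE) auto
  then show ?thesis
    by eventually_elim (use N(1) in \<open>auto split: split_indicator_asm\<close>)
qed

context monotone_profile
begin

lemma nn_integral_flux: "(\<integral>\<^sup>+x. ennreal (\<bar>\<phi>x' x\<bar> * indicator {0<..} x) \<partial>lborel) = ennreal b"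
proof -
  have im: "\<phi>x ` {0<..} = {0<..<b}" unfolding \<phi>_image[symmetric] by (intro image_cong) auto
  have "(\<integral>\<^sup>+y. 1 * indicator (\<phi>x ` {0<..}) y \<partial>lborel) = (\<integral>\<^sup>+x. 1 * ennreal \<bar>\<phi>x' x\<bar> * indicator {0<..} x \<partial>lborel)"
  proof (rule nn_integral_real_substitution)
    fix x :: real assume x: "x \<in> {0<..}"
    have "(\<phi>x has_real_derivative \<phi>' x) (at x)"
      by (rule has_field_derivative_transform_within_open[OF \<phi>_der_at, of _ "{0<..}"]) (use x in auto)
    then show "(\<phi>x has_real_derivative \<phi>x' x) (at x within {0<..})"
      using x by (auto intro: has_field_derivative_at_within)
  qed (use \<phi>_inj in \<open>auto simp: im \<phi>_image inj_on_def\<close>)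
  also have "\<dots> = (\<integral>\<^sup>+x. ennreal (\<bar>\<phi>x' x\<bar> * indicator {0<..} x) \<partial>lborel)"
    by (intro nn_integral_cong) (auto split: split_indicator)
  finally show ?thesis using b_pos by (simp add: im \<phi>_image)
qed

text \<open>The weight \<open>\<bar>\<phi>'\<bar>\<close> has total mass \<open>b\<close>, the descent of \<open>\<phi>\<close>.  So a uniform bound on the integrals
  over velocities suffices although positions range over a half line.\<close>

lemma flux_integrable:
  fixes f :: "real \<times> velocity \<Rightarrow> real"
  assumes f [measurable]: "f \<in> borel_measurable borel" and C: "\<And>x. x > 0 \<Longrightarrow> (\<integral>\<^sup>+z. ennreal \<bar>f (x, z)\<bar> \<partial>lborel) \<le> ennreal C"
  shows "integrable lborel (\<lambda>w. flux w * f w)"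
proof (rule integrableI_bounded)
  have [measurable]: "f \<in> borel_measurable (borel \<Otimes>\<^sub>M borel)" "flux \<in> borel_measurable (borel \<Otimes>\<^sub>M borel)"
    unfolding borel_prod by (fact f energy_measurable)+
  have "(\<integral>\<^sup>+w. ennreal (norm (flux w * f w)) \<partial>lborel) = (\<integral>\<^sup>+x. \<integral>\<^sup>+z. ennreal (norm (flux (x, z) * f (x, z))) \<partial>lborel \<partial>lborel)"
    by (rule nn_integral_lborel_pair(2)) measurable
  also have "\<dots> \<le> (\<integral>\<^sup>+x. ennreal (\<bar>\<phi>x' x\<bar> * indicator {0<..} x) * ennreal C \<partial>lborel)"
  proof (intro nn_integral_mono)
    fix x :: real
    have "(\<integral>\<^sup>+z. ennreal (norm (flux (x, z) * f (x, z))) \<partial>lborel) = (\<integral>\<^sup>+z. ennreal (\<bar>\<phi>x' x\<bar> * indicator {0<..} x) * ennreal \<bar>f (x, z)\<bar> \<partial>lborel)"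
      by (intro nn_integral_cong) (auto simp: flux_def abs_mult ennreal_mult')
    also have "\<dots> = ennreal (\<bar>\<phi>x' x\<bar> * indicator {0<..} x) * (\<integral>\<^sup>+z. ennreal \<bar>f (x, z)\<bar> \<partial>lborel)"
      by (rule nn_integral_cmult) measurable
    also have "\<dots> \<le> ennreal (\<bar>\<phi>x' x\<bar> * indicator {0<..} x) * ennreal C"
      by (cases "x > 0") (auto intro!: mult_left_mono C)
    finally show "(\<integral>\<^sup>+z. ennreal (norm (flux (x, z) * f (x, z))) \<partial>lborel) \<le> ennreal (\<bar>\<phi>x' x\<bar> * indicator {0<..} x) * ennreal C" .
  qed
  also have "\<dots> = ennreal b * ennreal C"
    by (subst nn_integral_multc) (auto simp: nn_integral_flux)
  also have "\<dots> < \<infinity>" by (simp add: ennreal_mult_less_top)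
  finally show "(\<integral>\<^sup>+w. ennreal (norm (flux w * f w)) \<partial>lborel) < \<infinity>" .
qed measurable

lemma energy_integral:
  fixes H :: "real \<times> velocity \<Rightarrow> real"
  assumes [measurable]: "H \<in> borel_measurable borel"
  shows "(LINT w|lborel. flux w * H (energy_map w)) = (LINT e|lborel. indicator energy_range e * H e)"
    "integrable lborel (\<lambda>w. flux w * H (energy_map w)) = integrable lborel (\<lambda>e. indicator energy_range e * H e)"
proof -
  have d: "density lborel (indicator energy_range) = density lborel (\<lambda>e. ennreal (indicator energy_range e))"
    by (simp add: ennreal_indicator[abs_def])
  have f: "flux w \<ge> 0" for w by (auto simp: flux_def)
  have "(LINT w|lborel. flux w * H (energy_map w)) = (LINT w|density lborel (\<lambda>w. ennreal (flux w)). H (energy_map w))"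
    by (subst integral_density) (auto simp: f)
  also have "\<dots> = (LINT e|distr (density lborel (\<lambda>w. ennreal (flux w))) borel energy_map. H e)"
    by (subst integral_distr) auto
  also have "\<dots> = (LINT e|lborel. indicator energy_range e * H e)"
    unfolding energy_distr d by (subst integral_density) auto
  finally show "(LINT w|lborel. flux w * H (energy_map w)) = (LINT e|lborel. indicator energy_range e * H e)" .
  have "integrable lborel (\<lambda>w. flux w * H (energy_map w)) = integrable (density lborel (\<lambda>w. ennreal (flux w))) (\<lambda>w. H (energy_map w))"
    by (subst integrable_density) (auto simp: f)
  also have "\<dots> = integrable (distr (density lborel (\<lambda>w. ennreal (flux w))) borel energy_map) H"
    by (subst integrable_distr_eq) auto
  also have "\<dots> = integrable lborel (\<lambda>e. indicator energy_range e * H e)"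
    unfolding energy_distr d by (subst integrable_density) auto
  finally show "integrable lborel (\<lambda>w. flux w * H (energy_map w)) = integrable lborel (\<lambda>e. indicator energy_range e * H e)" .
qed

end

locale attractive_profile = attractive_data \<alpha> b r fb fi + monotone_profile b \<phi> \<phi>'
  for \<alpha> b r :: real and fb fi :: "velocity \<Rightarrow> real" and \<phi> \<phi>' :: "real \<Rightarrow> real"
begin

lemma rho_bounded: obtains C where "\<And>p. p \<in> {0..b} \<Longrightarrow> rho p \<le> C"
proof -
  have "bounded (rho ` {0..b})"
    by (intro compact_imp_bounded compact_continuous_image rho_continuous) auto
  then obtain C where "\<And>y. y \<in> rho ` {0..b} \<Longrightarrow> norm y \<le> C" unfolding bounded_iff by auto
  then show thesis by (intro that[of C]) (metis abs_le_D1 imageI real_norm_def)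
qed

lemma dens_\<phi>_measurable [measurable]: "(\<lambda>w. dens (\<phi>x (fst w)) (snd w)) \<in> borel_measurable borel"
proof -
  have [measurable]: "(\<lambda>w. dens (fst w) (snd w)) \<in> borel_measurable (borel \<Otimes>\<^sub>M borel)"
    unfolding borel_prod by (rule dens_measurable_pair)
  have "(\<lambda>w. (\<lambda>w. dens (fst w) (snd w)) (\<phi>x (fst w), snd w)) \<in> borel_measurable (borel \<Otimes>\<^sub>M borel)"
    by measurable
  then show ?thesis by (simp add: borel_prod)
qed

lemma nn_integral_dens: "p \<in> {0..b} \<Longrightarrow> (\<integral>\<^sup>+z. ennreal \<bar>dens p z\<bar> \<partial>lborel) = ennreal (rho p)"
  unfolding rho_def using dens_integrable[of p] by (subst nn_integral_eq_integral) (auto simp: dens_nonneg)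

lemma flux_dens_integrable: "integrable lborel (\<lambda>w. flux w * dens (\<phi>x (fst w)) (snd w))"
proof -
  obtain C where C: "\<And>p. p \<in> {0..b} \<Longrightarrow> rho p \<le> C" using rho_bounded by blast
  show ?thesis
    by (rule flux_integrable[where C = C])
       (use C \<phi>_pos \<phi>_le in \<open>auto simp: nn_integral_dens less_imp_le intro!: ennreal_leI\<close>)
qed

lemma snd_energy_map [simp]: "snd (energy_map w) = snd w" by (simp add: energy_map_def)

text \<open>The density in energy coordinates: the potential at the point with energy \<open>E\<close> and velocity \<open>v\<close>
  is \<open>v\<^sup>2 / 2 - E\<close>, and the value depends on \<open>v\<close> only through the branch of the characteristic.\<close>

definition dens_energy :: "real \<times> velocity \<Rightarrow> real" where
  "dens_energy e = dens ((fst (snd e))\<^sup>2 / 2 - fst e) (snd e)"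

lemma dens_energy_measurable [measurable]: "dens_energy \<in> borel_measurable borel"
proof -
  have [measurable]: "(\<lambda>w. dens (fst w) (snd w)) \<in> borel_measurable (borel \<Otimes>\<^sub>M (borel \<Otimes>\<^sub>M borel))"
    unfolding borel_prod by (rule dens_measurable_pair)
  have "(\<lambda>w. (\<lambda>w. dens (fst w) (snd w)) ((fst (snd w))\<^sup>2 / 2 - fst w, snd w)) \<in> borel_measurable (borel \<Otimes>\<^sub>M (borel \<Otimes>\<^sub>M borel))"
    by measurable
  then show ?thesis by (simp add: borel_prod dens_energy_def[abs_def])
qed

lemma dens_energy_map: "x \<ge> 0 \<Longrightarrow> dens_energy (energy_map (x, z)) = dens (\<phi> x) z"
  by (simp add: dens_energy_def energy_map_def)

lemma dens_energy_integrable: "integrable lborel (\<lambda>e. indicator energy_range e * dens_energy e)"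
proof -
  have "integrable lborel (\<lambda>w. flux w * dens_energy (energy_map w))"
  proof -
    have "(\<lambda>w. flux w * dens_energy (energy_map w)) = (\<lambda>w. flux w * dens (\<phi>x (fst w)) (snd w))"
      by (auto simp: flux_def fun_eq_iff dens_energy_map split: split_indicator)
    then show ?thesis using flux_dens_integrable by simp
  qed
  then show ?thesis by (subst (asm) energy_integral(2)) auto
qed

text \<open>The speed with which particles of energy \<open>E\<close> hit or leave the wall, where the potential is \<open>b\<close>.\<close>

definition wall_speed :: "real \<Rightarrow> real" where "wall_speed E = sqrt (2 * (E + b))"

text \<open>For fixed \<open>E\<close> this is the characteristic of energy \<open>E\<close>, parametrised by the velocity.\<close>

definition path :: "real \<Rightarrow> velocity \<Rightarrow> real \<times> velocity" where
  "path E z = (pos ((fst z)\<^sup>2 / 2 - E), z)"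

end

text \<open>A test function with a chosen derivative and the bounds of \<open>test_function_props\<close>.\<close>

locale weak_test = attractive_profile +
  fixes \<psi> :: "real \<times> velocity \<Rightarrow> real" and D :: "real \<times> velocity \<Rightarrow> (real \<times> velocity) \<Rightarrow>\<^sub>L real" and R C :: real
  assumes R: "R \<ge> 0" and C: "C \<ge> 0"
    and D_der: "\<And>w. fst w > 0 \<Longrightarrow> (\<psi> has_derivative blinfun_apply (D w)) (at w)"
    and D_cont: "continuous_on ({0..} \<times> UNIV) D" and \<psi>_cont: "continuous_on ({0..} \<times> UNIV) \<psi>"
    and \<psi>_zero: "\<And>w. fst w \<ge> 0 \<Longrightarrow> norm w > R \<Longrightarrow> \<psi> w = 0" and D_zero: "\<And>w. fst w > 0 \<Longrightarrow> norm w > R \<Longrightarrow> D w = 0"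
    and \<psi>_bound: "\<And>w. fst w \<ge> 0 \<Longrightarrow> \<bar>\<psi> w\<bar> \<le> C" and D_bound: "\<And>w. fst w > 0 \<Longrightarrow> norm (D w) \<le> C"
    and reflect: "\<And>s \<eta>. s > 0 \<Longrightarrow> \<alpha> * \<psi> (0, (s, \<eta>)) = \<psi> (0, (- s, \<eta>))"
begin

text \<open>The transport operator applied to \<open>\<psi>\<close>, as a function of energy and velocity, divided by the Jacobian
  of the energy coordinates.\<close>

definition rate :: "real \<times> velocity \<Rightarrow> real" where
  "rate e = (let w = path (fst e) (snd e) in blinfun_apply (D w) (fst (snd e), (\<phi>' (fst w), 0)) / \<bar>\<phi>' (fst w)\<bar>)"

lemma energy_range_pot: 
  assumes "(E, z) \<in> energy_range" shows "0 < (fst z)\<^sup>2 / 2 - E" "(fst z)\<^sup>2 / 2 - E < b"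
  using assms by (auto simp: energy_range_def)

lemma rate_continuous: "continuous_on energy_range rate"
proof -
  have p: "continuous_on energy_range (\<lambda>e. pos ((fst (snd e))\<^sup>2 / 2 - fst e))"
    by (rule continuous_on_compose2[OF pos_cont]) (auto intro!: continuous_intros simp: energy_range_def)
  have pp: "pos ((fst (snd e))\<^sup>2 / 2 - fst e) \<ge> 0" if "e \<in> energy_range" for e
    using that by (intro pos(1)) (auto simp: energy_range_def)
  have w: "continuous_on energy_range (\<lambda>e. path (fst e) (snd e))"
    unfolding path_def by (intro continuous_intros p)
  have Dw: "continuous_on energy_range (\<lambda>e. D (path (fst e) (snd e)))"
    by (rule continuous_on_compose2[OF D_cont w]) (use pp in \<open>auto simp: path_def\<close>)
  have ph: "continuous_on energy_range (\<lambda>e. \<phi>' (pos ((fst (snd e))\<^sup>2 / 2 - fst e)))"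
    by (rule continuous_on_compose2[OF \<phi>'_cont p]) (use pp in auto)
  show ?thesis
    unfolding rate_def Let_def
    by (intro continuous_intros blinfun.continuous_on Dw) (use ph pp \<phi>'_neg in \<open>force simp: path_def\<close>)+
qed

lemma rate_bounded: obtains B where "B \<ge> 0" "\<And>e. e \<in> energy_range \<Longrightarrow> \<bar>rate e\<bar> \<le> B"
proof -
  have "continuous_on {0..R} (\<lambda>x. - \<phi>' x)"
    by (intro continuous_intros continuous_on_subset[OF \<phi>'_cont]) auto
  then obtain x0 where x0: "x0 \<in> {0..R}" "\<And>x. x \<in> {0..R} \<Longrightarrow> - \<phi>' x0 \<le> - \<phi>' x"
    using continuous_attains_inf[of "{0..R}" "\<lambda>x. - \<phi>' x"] R by auto
  define c where "c = - \<phi>' x0"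
  have c: "c > 0" using \<phi>'_neg[of x0] x0 by (simp add: c_def)
  show thesis
  proof (rule that[of "C * (R / c + 1)"])
    show "0 \<le> C * (R / c + 1)" using C R c by simp
    fix e assume e: "e \<in> energy_range"
    obtain E v \<eta> where ee: "e = (E, (v, \<eta>))" by (cases e) auto
    define x where "x = pos (v\<^sup>2 / 2 - E)"
    have x: "x > 0" unfolding x_def using energy_range_pot[of E "(v, \<eta>)"] e ee by (intro pos_gt0) auto
    have m: "rate e = blinfun_apply (D (x, (v, \<eta>))) (v, (\<phi>' x, 0)) / \<bar>\<phi>' x\<bar>"
      by (simp add: rate_def ee path_def x_def)
    show "\<bar>rate e\<bar> \<le> C * (R / c + 1)"
    proof (cases "norm (x, (v, \<eta>)) > R")
      case True
      then show ?thesis using D_zero[of "(x, (v, \<eta>))"] x m C R c by simp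
    next
      case False
      have "\<bar>x\<bar> \<le> norm (x, (v, \<eta>))" "norm (v, \<eta>) \<le> norm (x, (v, \<eta>))" "\<bar>v\<bar> \<le> norm (v, \<eta>)"
        using norm_fst_le[of x "(v, \<eta>)"] norm_snd_le[of "(v, \<eta>)" x] norm_fst_le[of v \<eta>] by auto
      then have xv: "x \<le> R" "\<bar>v\<bar> \<le> R" using False by auto
      have ph: "c \<le> \<bar>\<phi>' x\<bar>" using x0(2)[of x] xv x \<phi>'_neg[of x] by (simp add: c_def)
      have "\<bar>blinfun_apply (D (x, (v, \<eta>))) (v, (\<phi>' x, 0))\<bar> \<le> norm (D (x, (v, \<eta>))) * norm (v, (\<phi>' x, 0 :: real^2))"
        using norm_blinfun[of "D (x, (v, \<eta>))"] by simp
      also have "\<dots> \<le> C * (\<bar>v\<bar> + \<bar>\<phi>' x\<bar>)"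
        using D_bound[of "(x, (v, \<eta>))"] x C norm_Pair_le[of v "(\<phi>' x, 0 :: real^2)"] norm_Pair_le[of "\<phi>' x" "0 :: real^2"]
        by (intro mult_mono) auto
      finally have "\<bar>rate e\<bar> \<le> C * (\<bar>v\<bar> + \<bar>\<phi>' x\<bar>) / \<bar>\<phi>' x\<bar>"
        unfolding m abs_divide abs_abs by (intro divide_right_mono) auto
      also have "\<dots> = C * (\<bar>v\<bar> / \<bar>\<phi>' x\<bar> + 1)" using ph c by (simp add: field_simps)
      also have "\<dots> \<le> C * (R / c + 1)"
        using xv ph c C by (intro mult_left_mono add_right_mono frac_le) auto
      finally show ?thesis .
    qed
  qed
qed

lemma rate_measurable: "(\<lambda>e. indicator energy_range e * rate e) \<in> borel_measurable borel"
  using borel_measurable_continuous_on_indicator[OF _ rate_continuous] by simp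

lemma dens_rate_integrable: "integrable lborel (\<lambda>e. indicator energy_range e * (dens_energy e * rate e))"
proof -
  obtain B where B: "B \<ge> 0" "\<And>e. e \<in> energy_range \<Longrightarrow> \<bar>rate e\<bar> \<le> B" using rate_bounded by blast
  have "integrable lborel (\<lambda>e. B * (indicator energy_range e * dens_energy e))"
    by (intro integrable_mult_right dens_energy_integrable)
  then show ?thesis
  proof (rule Bochner_Integration.integrable_bound)
    have "(\<lambda>e. indicator energy_range e * (dens_energy e * rate e)) = (\<lambda>e. dens_energy e * (indicator energy_range e * rate e))"
      by auto
    then show "(\<lambda>e. indicator energy_range e * (dens_energy e * rate e)) \<in> borel_measurable lborel"
      using borel_measurable_times[OF dens_energy_measurable rate_measurable] by simp
    show "AE e in lborel. norm (indicator energy_range e * (dens_energy e * rate e)) \<le> norm (B * (indicator energy_range e * dens_energy e))"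
      using B by (intro AE_I2) (auto simp: abs_mult mult.commute intro!: mult_right_mono split: split_indicator)
  qed
qed

lemma transport_integral:
  "(LINT w:({0<..} \<times> UNIV)|lborel. dens (\<phi> (fst w)) (snd w) * blinfun_apply (D w) (fst (snd w), (\<phi>' (fst w), 0)))
     = (LINT e|lborel. indicator energy_range e * (dens_energy e * rate e))"
proof -
  let ?H = "\<lambda>e. indicator energy_range e * (dens_energy e * rate e)"
  have [measurable]: "?H \<in> borel_measurable borel" using dens_rate_integrable by auto
  have "indicator ({0<..} \<times> UNIV) w * (dens (\<phi> (fst w)) (snd w) * blinfun_apply (D w) (fst (snd w), (\<phi>' (fst w), 0)))
      = flux w * ?H (energy_map w)" for w
  proof (cases "fst w > 0")
    case True
    obtain x v \<eta> where w: "w = (x, (v, \<eta>))" by (cases w) auto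
    have x: "x > 0" using True w by simp
    have "energy_map w \<in> energy_range" using x \<phi>_pos[of x] \<phi>_less[of x] by (auto simp: energy_map_def energy_range_def w)
    moreover have "path (fst (energy_map w)) (snd (energy_map w)) = w" using x by (simp add: path_def energy_map_def w)
    moreover have "\<phi>' x < 0" using \<phi>'_neg[of x] x by simp
    ultimately show ?thesis using x by (auto simp: flux_def rate_def Let_def dens_energy_map w)
  next
    case False then show ?thesis by (cases w) (auto simp: flux_def)
  qed
  then have "(LINT w:({0<..} \<times> UNIV)|lborel. dens (\<phi> (fst w)) (snd w) * blinfun_apply (D w) (fst (snd w), (\<phi>' (fst w), 0)))
     = (LINT w|lborel. flux w * ?H (energy_map w))"
    by (simp add: set_lebesgue_integral_def)
  also have "\<dots> = (LINT e|lborel. indicator energy_range e * ?H e)" by (rule energy_integral(1)) measurable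
  also have "\<dots> = (LINT e|lborel. ?H e)" by (intro Bochner_Integration.integral_cong) (auto split: split_indicator)
  finally show ?thesis .
qed

definition \<psi>_path :: "real \<Rightarrow> real^2 \<Rightarrow> real \<Rightarrow> real" where "\<psi>_path E \<eta> v = \<psi> (path E (v, \<eta>))"

text \<open>On the characteristic of energy \<open>E\<close> the position satisfies \<open>\<phi> x = v\<^sup>2 / 2 - E\<close>, hence
  \<open>dx/dv = v / \<phi>' x\<close>, and the chain rule produces the transport operator divided by \<open>\<phi>' x < 0\<close>.\<close>

lemma \<psi>_path_der:
  assumes "0 < v\<^sup>2 / 2 - E" "v\<^sup>2 / 2 - E < b"
  shows "(\<psi>_path E \<eta> has_real_derivative - rate (E, (v, \<eta>))) (at v)"
proof -
  let ?p = "v\<^sup>2 / 2 - E" let ?x = "pos ?p"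
  have x: "?x > 0" using assms by (rule pos_gt0)
  have neg: "\<phi>' ?x < 0" using \<phi>'_neg x by simp
  have d1: "((\<lambda>v. pos (v\<^sup>2 / 2 - E)) has_real_derivative inverse (\<phi>' ?x) * v) (at v)"
  proof (rule DERIV_chain2[where g = "\<lambda>v. v\<^sup>2 / 2 - E"])
    show "(pos has_real_derivative inverse (\<phi>' ?x)) (at ?p)" by (rule pos_der[OF assms])
  qed (auto intro!: derivative_eq_intros)
  have "((\<lambda>v. path E (v, \<eta>)) has_derivative (\<lambda>h. (inverse (\<phi>' ?x) * v * h, (h, 0)))) (at v)"
    unfolding path_def fst_conv
    by (intro has_derivative_Pair has_derivative_ident has_derivative_const d1[THEN has_field_derivative_imp_has_derivative])
  from has_derivative_compose[OF this D_der]
  have "(\<psi>_path E \<eta> has_derivative (\<lambda>h. blinfun_apply (D (path E (v, \<eta>))) (inverse (\<phi>' ?x) * v * h, (h, 0)))) (at v)"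
    using x by (simp add: \<psi>_path_def[abs_def] path_def)
  then show ?thesis
  proof (rule has_derivative_imp_has_field_derivative)
    fix h
    have "(inverse (\<phi>' ?x) * v * h, (h, 0 :: real^2)) = (h / \<phi>' ?x) *\<^sub>R (v, (\<phi>' ?x, 0))"
      using neg by (simp add: field_simps)
    then have "blinfun_apply (D (path E (v, \<eta>))) (inverse (\<phi>' ?x) * v * h, (h, 0)) 
       = (h / \<phi>' ?x) * blinfun_apply (D (path E (v, \<eta>))) (v, (\<phi>' ?x, 0))"
      by (simp only: blinfun.scaleR_right real_scaleR_def)
    then show "h * - rate (E, (v, \<eta>)) = blinfun_apply (D (path E (v, \<eta>))) (inverse (\<phi>' ?x) * v * h, (h, 0))"
      using neg by (simp add: rate_def Let_def path_def)
  qed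
qed

text \<open>Fundamental theorem of calculus on an open piece of a characteristic, with the values at the ends
  given as one-sided limits: \<open>\<phi>'\<close> may tend to \<open>0\<close> far out, so the path need not extend smoothly.\<close>

lemma rate_path_integral:
  assumes ac: "a < c" and T: "\<And>v. a < v \<Longrightarrow> v < c \<Longrightarrow> 0 < v\<^sup>2 / 2 - E \<and> v\<^sup>2 / 2 - E < b"
    and A: "(\<psi>_path E \<eta> \<longlongrightarrow> A) (at_right a)" and Bc: "(\<psi>_path E \<eta> \<longlongrightarrow> B) (at_left c)"
  shows "integrable lborel (\<lambda>v. indicator {a<..<c} v * rate (E, (v, \<eta>)))"
    "(LINT v|lborel. indicator {a<..<c} v * rate (E, (v, \<eta>))) = A - B"
proof -
  obtain K where K: "K \<ge> 0" "\<And>e. e \<in> energy_range \<Longrightarrow> \<bar>rate e\<bar> \<le> K" using rate_bounded by blast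
  have er: "(E, (v, \<eta>)) \<in> energy_range" if "v \<in> {a<..<c}" for v
    using T[of v] that by (auto simp: energy_range_def)
  have cont: "continuous_on {a<..<c} (\<lambda>v. rate (E, (v, \<eta>)))"
    by (rule continuous_on_compose2[OF rate_continuous]) (use er in \<open>auto intro!: continuous_intros\<close>)
  have m: "(\<lambda>v. indicator {a<..<c} v * rate (E, (v, \<eta>))) \<in> borel_measurable borel"
    using borel_measurable_continuous_on_indicator[OF _ cont] by simp
  show i: "integrable lborel (\<lambda>v. indicator {a<..<c} v * rate (E, (v, \<eta>)))"
  proof (rule Bochner_Integration.integrable_bound)
    show "integrable lborel (\<lambda>v. K * indicator {a<..<c} v)"
      using ac by (intro integrable_mult_right integrable_real_indicator) auto
    show "AE v in lborel. norm (indicator {a<..<c} v * rate (E, (v, \<eta>))) \<le> norm (K * indicator {a<..<c} v)"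
      using K er by (intro AE_I2) (auto split: split_indicator)
  qed (use m in simp)
  have "(LBINT v=a..c. - rate (E, (v, \<eta>))) = B - A"
  proof (rule interval_integral_FTC_integrable[where F = "\<psi>_path E \<eta>"])
    show "(\<psi>_path E \<eta> has_vector_derivative - rate (E, (v, \<eta>))) (at v)" if "ereal a < ereal v" "ereal v < ereal c" for v
      using \<psi>_path_der[of v E \<eta>] T[of v] that by (simp add: has_real_derivative_iff_has_vector_derivative)
    show "isCont (\<lambda>v. - rate (E, (v, \<eta>))) v" if "ereal a < ereal v" "ereal v < ereal c" for v
      using cont that by (intro isCont_minus) (simp add: continuous_on_eq_continuous_at)
    show "set_integrable lborel (einterval (ereal a) (ereal c)) (\<lambda>v. - rate (E, (v, \<eta>)))"
      using i by (simp add: set_integrable_def)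
  qed (use ac A Bc in \<open>auto simp: ereal_tendsto_simps1\<close>)
  then have "- (LINT v|lborel. indicator {a<..<c} v * rate (E, (v, \<eta>))) = B - A"
    using ac by (simp add: interval_lebesgue_integral_def set_lebesgue_integral_def)
  then show "(LINT v|lborel. indicator {a<..<c} v * rate (E, (v, \<eta>))) = A - B" by simp
qed

lemma \<psi>_path_wall:
  assumes v0: "v0\<^sup>2 / 2 - E = b" and S: "\<And>v. v \<in> S \<Longrightarrow> 0 < v\<^sup>2 / 2 - E \<and> v\<^sup>2 / 2 - E \<le> b"
  shows "(\<psi>_path E \<eta> \<longlongrightarrow> \<psi> (0, (v0, \<eta>))) (at v0 within S)"
proof -
  have "continuous_on (insert v0 S) (\<lambda>v. path E (v, \<eta>))"
    unfolding path_def fst_conv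
    by (intro continuous_intros continuous_on_compose2[OF pos_cont]) (use S v0 b in auto)
  then have "continuous_on (insert v0 S) (\<psi>_path E \<eta>)"
    unfolding \<psi>_path_def
    by (rule continuous_on_compose2[OF \<psi>_cont]) (use S v0 b pos(1) in \<open>auto simp: path_def\<close>)
  then have "(\<psi>_path E \<eta> \<longlongrightarrow> \<psi>_path E \<eta> v0) (at v0 within insert v0 S)"
    by (auto simp: continuous_on_def)
  then have "(\<psi>_path E \<eta> \<longlongrightarrow> \<psi>_path E \<eta> v0) (at v0 within S)" by (rule tendsto_within_subset) auto
  then show ?thesis by (simp add: \<psi>_path_def path_def v0)
qed

text \<open>Where the potential is below \<open>\<phi> R\<close> the position exceeds \<open>R\<close>, outside the support of \<open>\<psi>\<close>.\<close>

lemma \<psi>_path_far: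
  assumes "0 < v\<^sup>2 / 2 - E" "v\<^sup>2 / 2 - E < \<phi> R"
  shows "\<psi>_path E \<eta> v = 0"
proof -
  have "pos (v\<^sup>2 / 2 - E) > R" by (rule pos_large[OF R assms])
  moreover have "\<bar>pos (v\<^sup>2 / 2 - E)\<bar> \<le> norm (path E (v, \<eta>))"
    unfolding path_def using norm_fst_le[of "pos (v\<^sup>2 / 2 - E)" "(v, \<eta>)"] by simp
  ultimately show ?thesis unfolding \<psi>_path_def using R by (intro \<psi>_zero) (auto simp: path_def)
qed

end

lemma integral_lborel_pair:
  fixes f :: "'a::euclidean_space \<times> 'b::euclidean_space \<Rightarrow> real"
  assumes f: "integrable lborel f"
  shows "(LINT w|lborel. f w) = (LINT x|lborel. LINT y|lborel. f (x, y))"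
    "(LINT w|lborel. f w) = (LINT y|lborel. LINT x|lborel. f (x, y))"
    "AE x in lborel. integrable lborel (\<lambda>y. f (x, y))"
proof -
  have f': "integrable (lborel \<Otimes>\<^sub>M lborel) f" using f by (simp add: lborel_prod)
  show "(LINT w|lborel. f w) = (LINT x|lborel. LINT y|lborel. f (x, y))"
    using lborel_pair.integral_fst'[OF f'] by (simp add: lborel_prod)
  show "(LINT w|lborel. f w) = (LINT y|lborel. LINT x|lborel. f (x, y))"
    using lborel_pair.integral_snd[of "\<lambda>x y. f (x, y)"] f' by (simp add: lborel_prod)
  show "AE x in lborel. integrable lborel (\<lambda>y. f (x, y))"
    using lborel_pair.AE_integrable_fst'[OF f'] .
qed

lemma borel_measurable_section_integral:
  fixes f :: "'a::euclidean_space \<times> 'b::euclidean_space \<Rightarrow> real"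
  assumes f: "f \<in> borel_measurable borel"
  shows "(\<lambda>x. LINT y|lborel. f (x, y)) \<in> borel_measurable borel" "(\<lambda>y. LINT x|lborel. f (x, y)) \<in> borel_measurable borel"
    "(\<lambda>y. f (x, y)) \<in> borel_measurable borel" "(\<lambda>x. f (x, y)) \<in> borel_measurable borel"
proof -
  have [measurable]: "f \<in> borel_measurable (borel \<Otimes>\<^sub>M borel)" using f by (simp add: borel_prod)
  show "(\<lambda>x. LINT y|lborel. f (x, y)) \<in> borel_measurable borel" "(\<lambda>y. LINT x|lborel. f (x, y)) \<in> borel_measurable borel"
    by (rule lborel.borel_measurable_lebesgue_integral, measurable)+
  show "(\<lambda>y. f (x, y)) \<in> borel_measurable borel" "(\<lambda>x. f (x, y)) \<in> borel_measurable borel" by measurable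
qed

context weak_test
begin

abbreviation "fibre E \<eta> v \<equiv> indicator energy_range (E, (v, \<eta>)) * (dens_energy (E, (v, \<eta>)) * rate (E, (v, \<eta>)))"

lemma wall_speed_lt: "-b < E \<Longrightarrow> v\<^sup>2 / 2 - E < b \<longleftrightarrow> - wall_speed E < v \<and> v < wall_speed E"
proof -
  assume E: "-b < E"
  have "v\<^sup>2 / 2 - E < b \<longleftrightarrow> v\<^sup>2 < 2 * (E + b)" by auto
  also have "\<dots> \<longleftrightarrow> \<bar>v\<bar> < wall_speed E" unfolding wall_speed_def by (metis real_sqrt_abs real_sqrt_less_iff)
  also have "\<dots> \<longleftrightarrow> - wall_speed E < v \<and> v < wall_speed E" by auto
  finally show ?thesis .
qed

lemma wall_speed_pos: "-b < E \<Longrightarrow> wall_speed E > 0" by (simp add: wall_speed_def)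
lemma wall_speed_sq: "-b < E \<Longrightarrow> (wall_speed E)\<^sup>2 / 2 - E = b" by (simp add: wall_speed_def field_simps)

lemma wall_limits:
  assumes E: "-b < E" and a: "a < wall_speed E" and T: "\<And>v. a < v \<Longrightarrow> v < wall_speed E \<Longrightarrow> 0 < v\<^sup>2 / 2 - E"
  shows "(\<psi>_path E \<eta> \<longlongrightarrow> \<psi> (0, (wall_speed E, \<eta>))) (at_left (wall_speed E))"
    and "(\<psi>_path E \<eta> \<longlongrightarrow> \<psi> (0, (- wall_speed E, \<eta>))) (at_right (- wall_speed E))"
proof -
  have l: "v\<^sup>2 / 2 - E \<le> b" if "v \<in> {max a (-wall_speed E)<..<wall_speed E}" for v
    using wall_speed_lt[OF E, of v] that by auto
  have l': "v\<^sup>2 / 2 - E \<le> b" if "v \<in> {-wall_speed E<..<min (-a) (wall_speed E)}" for v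
    using wall_speed_lt[OF E, of v] that by auto
  have t: "0 < v\<^sup>2 / 2 - E" if "v \<in> {-wall_speed E<..<min (-a) (wall_speed E)}" for v
    using T[of "-v"] that by auto
  have 1: "(\<psi>_path E \<eta> \<longlongrightarrow> \<psi> (0, (wall_speed E, \<eta>))) (at (wall_speed E) within {max a (-wall_speed E)<..<wall_speed E})"
    using T l by (intro \<psi>_path_wall) (auto simp: wall_speed_sq E)
  have "max a (-wall_speed E) < wall_speed E" using a wall_speed_pos[OF E] by auto
  then show "(\<psi>_path E \<eta> \<longlongrightarrow> \<psi> (0, (wall_speed E, \<eta>))) (at_left (wall_speed E))"
  proof -
    assume "max a (-wall_speed E) < wall_speed E"
    then have "at (wall_speed E) within {max a (-wall_speed E)<..<wall_speed E} = at_left (wall_speed E)"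
      by (intro at_within_nhd[of _ "{max a (-wall_speed E)<..}"]) auto
    then show ?thesis using 1 by simp
  qed
  have 2: "(\<psi>_path E \<eta> \<longlongrightarrow> \<psi> (0, (- wall_speed E, \<eta>))) (at (- wall_speed E) within {-wall_speed E<..<min (-a) (wall_speed E)})"
    using t l' by (intro \<psi>_path_wall) (auto simp: wall_speed_sq E)
  have "-wall_speed E < min (-a) (wall_speed E)" using a wall_speed_pos[OF E] by auto
  then show "(\<psi>_path E \<eta> \<longlongrightarrow> \<psi> (0, (- wall_speed E, \<eta>))) (at_right (- wall_speed E))"
  proof -
    assume "-wall_speed E < min (-a) (wall_speed E)"
    then have "at (- wall_speed E) within {-wall_speed E<..<min (-a) (wall_speed E)} = at_right (- wall_speed E)"
      by (intro at_within_nhd[of _ "{..<min (-a) (wall_speed E)}"]) auto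
    then show ?thesis using 2 by simp
  qed
qed

text \<open>The characteristic runs from the wall to the wall and the density on it is the constant
  \<open>fb / (1 - \<alpha>)\<close>.  The reflection condition turns the difference of the two boundary values
  of \<open>\<psi>\<close> into \<open>(\<alpha> - 1) * \<psi>\<close>.\<close>

lemma fibre_trapped:
  assumes E: "-b < E" "E < 0"
  shows "(LINT v|lborel. fibre E \<eta> v) = - (fb (wall_speed E, \<eta>) * \<psi> (0, (wall_speed E, \<eta>)))"
proof -
  have T: "0 < v\<^sup>2 / 2 - E" for v using E zero_le_power2[of v] by linarith
  have v0: "- wall_speed E < wall_speed E" using wall_speed_pos[OF E(1)] by simp
  have f: "fibre E \<eta> v = (1 / (1 - \<alpha>) * fb (wall_speed E, \<eta>)) * (indicator {- wall_speed E<..<wall_speed E} v * rate (E, (v, \<eta>)))" for v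
  proof -
    have e: "(E, (v, \<eta>)) \<in> energy_range \<longleftrightarrow> v \<in> {- wall_speed E<..<wall_speed E}"
      using wall_speed_lt[OF E(1), of v] T[of v] by (auto simp: energy_range_def)
    have d: "dens_energy (E, (v, \<eta>)) = 1 / (1 - \<alpha>) * fb (wall_speed E, \<eta>)"
      using E by (simp add: dens_energy_def dens_def pull_def free_dom_def trap_dom_def trap_map_def wall_speed_def algebra_simps)
    show ?thesis unfolding d using e by (auto split: split_indicator)
  qed
  have "(LINT v|lborel. fibre E \<eta> v) = (1 / (1 - \<alpha>) * fb (wall_speed E, \<eta>)) * (LINT v|lborel. indicator {- wall_speed E<..<wall_speed E} v * rate (E, (v, \<eta>)))"
    unfolding f by (rule integral_mult_right_zero)
  also have "(LINT v|lborel. indicator {- wall_speed E<..<wall_speed E} v * rate (E, (v, \<eta>))) = \<psi> (0, (- wall_speed E, \<eta>)) - \<psi> (0, (wall_speed E, \<eta>))"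
    using wall_speed_lt[OF E(1)] T wall_limits[OF E(1) v0 T] by (intro rate_path_integral(2) v0) auto
  also have "\<dots> = (\<alpha> - 1) * \<psi> (0, (wall_speed E, \<eta>))" using reflect[OF wall_speed_pos[OF E(1)], of \<eta>] by (simp add: algebra_simps)
  also have "(1 / (1 - \<alpha>) * fb (wall_speed E, \<eta>)) * ((\<alpha> - 1) * \<psi> (0, (wall_speed E, \<eta>))) = - (fb (wall_speed E, \<eta>) * \<psi> (0, (wall_speed E, \<eta>)))"
    using \<alpha> by (simp add: field_simps)
  finally show ?thesis .
qed

text \<open>There are two branches, each with one end at the wall and the other at infinity, where \<open>\<psi>\<close> vanishes.
  The reflection condition puts both boundary terms at the outgoing velocity, and the
  compatibility condition combines the two values of \<open>fi\<close> into \<open>fb\<close>.\<close>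

lemma fibre_free:
  assumes E: "0 < E" and comp: "fi (sqrt (2 * E), \<eta>) = fb (wall_speed E, \<eta>) + \<alpha> * fi (- sqrt (2 * E), \<eta>)"
  shows "(LINT v|lborel. fibre E \<eta> v) = - (fb (wall_speed E, \<eta>) * \<psi> (0, (wall_speed E, \<eta>)))"
proof -
  define u where "u = sqrt (2 * E)"
  have Eb: "-b < E" using E b by simp
  have u: "u > 0" "u\<^sup>2 = 2 * E" using E by (auto simp: u_def)
  have uv: "u < wall_speed E" using b by (simp add: u_def wall_speed_def)
  have gt: "0 < v\<^sup>2 / 2 - E \<longleftrightarrow> v < - u \<or> u < v" for v
  proof -
    have "0 < v\<^sup>2 / 2 - E \<longleftrightarrow> u\<^sup>2 < v\<^sup>2" using u by auto
    also have "\<dots> \<longleftrightarrow> \<bar>u\<bar> < \<bar>v\<bar>" by (metis abs_le_square_iff linorder_not_less)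
    finally show ?thesis using u by auto
  qed
  let ?P = "\<lambda>v. indicator {u<..<wall_speed E} v * rate (E, (v, \<eta>))" and ?N = "\<lambda>v. indicator {- wall_speed E<..<-u} v * rate (E, (v, \<eta>))"
  have f: "fibre E \<eta> v = fi (u, \<eta>) * ?P v + fi (- u, \<eta>) * ?N v" for v
  proof -
    have e: "(E, (v, \<eta>)) \<in> energy_range \<longleftrightarrow> v \<in> {u<..<wall_speed E} \<or> v \<in> {- wall_speed E<..<-u}"
      unfolding energy_range_def mem_Collect_eq fst_conv snd_conv gt wall_speed_lt[OF Eb] using u uv by auto
    have d: "dens_energy (E, (v, \<eta>)) = fi (sgn v * u, \<eta>)"
      using E by (simp add: dens_energy_def dens_def pull_def free_dom_def trap_dom_def free_map_def u_def algebra_simps)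
    show ?thesis unfolding d using e u by (auto simp: sgn_if split: split_indicator)
  qed
  have \<phi>R: "\<phi> R > 0" using \<phi>_pos R by simp
  \<comment> \<open>for speeds between \<open>u\<close> and \<open>u1\<close> the position is beyond \<open>R\<close>, so that \<open>\<psi>\<close> vanishes near the far end of the branch\<close>
  define u1 where "u1 = sqrt (2 * E + 2 * \<phi> R)"
  have u1: "u < u1" "u1\<^sup>2 = 2 * E + 2 * \<phi> R" "u1 > 0" using \<phi>R E by (auto simp: u_def u1_def)
  have far: "\<psi>_path E \<eta> v = 0" if "u < \<bar>v\<bar>" "\<bar>v\<bar> < u1" for v
  proof (rule \<psi>_path_far)
    show "0 < v\<^sup>2 / 2 - E" using gt[of v] that by auto
    have "v\<^sup>2 < u1\<^sup>2" using that u1 by (metis abs_le_square_iff abs_of_pos linorder_not_less)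
    then show "v\<^sup>2 / 2 - E < \<phi> R" using u1 by simp
  qed
  have lim1: "(\<psi>_path E \<eta> \<longlongrightarrow> 0) (at_right u)"
  proof (rule tendsto_eventually)
    show "\<forall>\<^sub>F v in at_right u. \<psi>_path E \<eta> v = 0"
      using u u1 far by (auto simp: eventually_at_right_field intro!: exI[of _ u1])
  qed
  have lim2: "(\<psi>_path E \<eta> \<longlongrightarrow> 0) (at_left (- u))"
  proof (rule tendsto_eventually)
    show "\<forall>\<^sub>F v in at_left (- u). \<psi>_path E \<eta> v = 0"
      using u u1 far by (auto simp: eventually_at_left_field intro!: exI[of _ "- u1"])
  qed
  have T: "0 < v\<^sup>2 / 2 - E" if "u < v" "v < wall_speed E" for v using gt that by auto
  have T2: "0 < v\<^sup>2 / 2 - E \<and> v\<^sup>2 / 2 - E < b" if "u < v" "v < wall_speed E" for v using gt[of v] wall_speed_lt[OF Eb, of v] that u by auto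
  have T3: "0 < v\<^sup>2 / 2 - E \<and> v\<^sup>2 / 2 - E < b" if "- wall_speed E < v" "v < - u" for v using gt[of v] wall_speed_lt[OF Eb, of v] that u by auto
  have uv': "- wall_speed E < - u" using uv by simp
  note P = rate_path_integral[OF uv T2 lim1 wall_limits(1)[OF Eb uv T]]
  note N = rate_path_integral[OF uv' T3 wall_limits(2)[OF Eb uv T] lim2]
  have "(LINT v|lborel. fibre E \<eta> v) = fi (u, \<eta>) * (LINT v|lborel. ?P v) + fi (- u, \<eta>) * (LINT v|lborel. ?N v)"
    unfolding f by (subst Bochner_Integration.integral_add) (auto intro!: integrable_mult_right P(1) N(1))
  also have "\<dots> = fi (u, \<eta>) * (0 - \<psi> (0, (wall_speed E, \<eta>))) + fi (- u, \<eta>) * (\<psi> (0, (- wall_speed E, \<eta>)) - 0)"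
    by (simp only: P(2) N(2))
  also have "\<dots> = - (fb (wall_speed E, \<eta>) * \<psi> (0, (wall_speed E, \<eta>)))"
    using comp reflect[OF wall_speed_pos[OF Eb], of \<eta>] by (simp add: u_def algebra_simps)
  finally show ?thesis .
qed

lemma fibre_none:
  assumes E: "E \<le> - b" shows "(LINT v|lborel. fibre E \<eta> v) = 0"
proof -
  have "(E, (v, \<eta>)) \<notin> energy_range" for v
  proof -
    have "v\<^sup>2 / 2 \<ge> 0" by simp
    then show ?thesis unfolding energy_range_def mem_Collect_eq fst_conv snd_conv using E by linarith
  qed
  then show ?thesis by simp
qed

text \<open>The inflow term as a function of the energy, which replaces the normal velocity at the wall.\<close>

definition wall :: "real \<times> (real^2) \<Rightarrow> real" where
  "wall y = indicator {- b<..} (fst y) * (fb (wall_speed (fst y), snd y) * \<psi> (0, (wall_speed (fst y), snd y)))"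

lemma wall_integral:
  "integrable lborel wall" "(LINT z:half_space|lborel. fb z * (fst z * \<psi> (0, z))) = (LINT y|lborel. wall y)"
proof -
  let ?g = "\<lambda>s (\<eta>::real^2). s\<^sup>2 / 2 - b" and ?g' = "\<lambda>(s::real) (\<eta>::real^2). s"
  let ?d = "\<lambda>w. \<bar>?g' (fst w) (snd w)\<bar> * indicator {0<..} (fst w)" and ?T = "\<lambda>w. (?g (fst w) (snd w), snd w)"
  have "continuous_on UNIV (\<lambda>z :: velocity. \<psi> (0, z))"
    by (rule continuous_on_compose2[OF \<psi>_cont]) (auto intro!: continuous_intros)
  then have \<psi>m: "(\<lambda>z. \<psi> (0, z)) \<in> borel_measurable (borel \<Otimes>\<^sub>M borel)"
    unfolding borel_prod by (rule borel_measurable_continuous_onI)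
  have fbm: "fb \<in> borel_measurable (borel \<Otimes>\<^sub>M borel)" unfolding borel_prod by (rule fb_measurable)
  have vm: "(\<lambda>y. (wall_speed (fst y), snd y)) \<in> borel \<Otimes>\<^sub>M borel \<rightarrow>\<^sub>M borel \<Otimes>\<^sub>M borel"
    unfolding wall_speed_def by measurable
  have "wall \<in> borel_measurable (borel \<Otimes>\<^sub>M borel)"
    unfolding wall_def[abs_def]
    using measurable_compose[OF vm \<psi>m] measurable_compose[OF vm fbm] by measurable
  then have wm [measurable]: "wall \<in> borel_measurable borel" by (simp add: borel_prod)
  have Tm [measurable]: "?T \<in> borel_measurable borel"
  proof -
    have "?T \<in> borel \<Otimes>\<^sub>M borel \<rightarrow>\<^sub>M borel \<Otimes>\<^sub>M borel" by measurable
    then show ?thesis by (simp add: borel_prod)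
  qed
  have dm [measurable]: "?d \<in> borel_measurable borel"
    unfolding borel_prod[symmetric] by measurable
  have im: "(\<lambda>s. s\<^sup>2 / 2 - b) ` {0<..} = {- b<..}"
  proof (intro equalityI subsetI)
    fix E assume "E \<in> {- b<..}"
    then show "E \<in> (\<lambda>s. s\<^sup>2 / 2 - b) ` {0<..}"
      by (intro image_eqI[of _ _ "wall_speed E"]) (auto simp: wall_speed_def field_simps)
  qed auto
  have D: "distr (density lborel (\<lambda>w. ennreal (?d w))) borel ?T = density lborel (indicator {w. fst w \<in> {- b<..}})"
  proof (rule distr_density_fibre[where W = "\<lambda>_. {- b<..}"])
    show "{w :: real \<times> (real^2). fst w \<in> {- b<..}} \<in> sets borel"
      by (intro borel_open) (auto intro!: open_Collect_less continuous_intros)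
    show "(\<lambda>w :: real \<times> (real^2). (fst w)\<^sup>2 / 2 - b) \<in> borel_measurable borel" "(\<lambda>w :: real \<times> (real^2). fst w) \<in> borel_measurable borel"
      unfolding borel_prod[symmetric] by measurable
  qed (auto simp: im inj_on_def intro!: derivative_eq_intros)
  have wi: "indicator {w. fst w \<in> {- b<..}} w * wall w = wall w" for w by (auto simp: wall_def split: split_indicator)
  have ci: "{w :: real \<times> (real^2). fst w \<in> {- b<..}} \<in> sets borel"
    by (intro borel_open) (auto intro!: open_Collect_less continuous_intros)
  have d2: "density lborel (indicator {w :: real \<times> (real^2). fst w \<in> {- b<..}}) = density lborel (\<lambda>w. ennreal (indicator {w. fst w \<in> {- b<..}} w))"
    by (simp add: ennreal_indicator[abs_def])
  have pt: "?d z * wall (?T z) = indicator half_space z * (fb z * (fst z * \<psi> (0, z)))" for z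
  proof (cases "fst z > 0")
    case True
    have "wall_speed ((fst z)\<^sup>2 / 2 - b) = fst z" using True by (simp add: wall_speed_def)
    moreover have "- b < (fst z)\<^sup>2 / 2 - b" using True by simp
    ultimately show ?thesis using True by (simp add: wall_def half_space_def)
  next
    case False then show ?thesis by (simp add: half_space_def)
  qed
  have hm: "half_space \<in> sets borel"
    unfolding half_space_def by (intro borel_open) (auto intro!: open_Collect_less continuous_intros)
  have "integrable lborel (\<lambda>z. ?d z * wall (?T z))"
  proof (rule Bochner_Integration.integrable_bound)
    show "integrable lborel (\<lambda>z. (R * C) * fb z)" by (intro integrable_mult_right fb)
    show "AE z in lborel. norm (?d z * wall (?T z)) \<le> norm (R * C * fb z)"
    proof (intro AE_I2)
      fix z :: velocity
      have "\<bar>fst z * \<psi> (0, z)\<bar> \<le> R * C"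
      proof (cases "norm (0 :: real, z) > R")
        case True then show ?thesis using \<psi>_zero[of "(0, z)"] R C by simp
      next
        case False
        have "\<bar>fst z\<bar> \<le> norm z" using norm_fst_le[of "fst z" "snd z"] by simp
        then have "\<bar>fst z\<bar> \<le> R" using False by simp
        then show ?thesis unfolding abs_mult using \<psi>_bound[of "(0, z)"] R by (intro mult_mono) auto
      qed
      then have "\<bar>fb z\<bar> * \<bar>fst z * \<psi> (0, z)\<bar> \<le> \<bar>fb z\<bar> * (R * C)" by (intro mult_left_mono) auto
      then show "norm (?d z * wall (?T z)) \<le> norm (R * C * fb z)"
        unfolding pt using R C by (auto simp: abs_mult mult_ac split: split_indicator)
    qed
  qed measurable
  moreover have "integrable lborel (\<lambda>z. ?d z * wall (?T z)) = integrable (density lborel (\<lambda>w. ennreal (?d w))) (\<lambda>w. wall (?T w))"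
    by (subst integrable_density) (auto simp: )
  moreover have "\<dots> = integrable (distr (density lborel (\<lambda>w. ennreal (?d w))) borel ?T) wall"
    by (subst integrable_distr_eq) (use Tm in auto)
  moreover have "\<dots> = integrable lborel (\<lambda>w. indicator {w. fst w \<in> {- b<..}} w * wall w)"
    unfolding D d2 using ci by (subst integrable_density) auto
  ultimately show "integrable lborel wall" by (simp only: wi)
  have "(LINT z:half_space|lborel. fb z * (fst z * \<psi> (0, z))) = (LINT z|lborel. ?d z * wall (?T z))"
    unfolding pt by (simp add: set_lebesgue_integral_def)
  also have "\<dots> = (LINT w|density lborel (\<lambda>w. ennreal (?d w)). wall (?T w))"
    by (subst integral_density) auto
  also have "\<dots> = (LINT w|distr (density lborel (\<lambda>w. ennreal (?d w))) borel ?T. wall w)"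
    by (subst integral_distr) (use Tm in auto)
  also have "\<dots> = (LINT w|lborel. indicator {w. fst w \<in> {- b<..}} w * wall w)"
    unfolding D d2 using ci by (subst integral_density) auto
  also have "\<dots> = (LINT y|lborel. wall y)" by (simp only: wi)
  finally show "(LINT z:half_space|lborel. fb z * (fst z * \<psi> (0, z))) = (LINT y|lborel. wall y)" .
qed

lemma AE_fibre: "AE E in lborel. AE \<eta> in lborel. (LINT v|lborel. fibre E \<eta> v) = - wall (E, \<eta>)"
proof -
  have "AE s in lborel. s > 0 \<longrightarrow> (AE \<eta> in lborel. fi (s, \<eta>) = fb (sqrt (s\<^sup>2 + 2 * b), \<eta>) + \<alpha> * fi (- s, \<eta>))"
  proof -
    have "AE z in lborel \<Otimes>\<^sub>M lborel. z \<in> half_space \<longrightarrow> fi z = fb (sqrt ((fst z)\<^sup>2 + 2 * b), snd z) + \<alpha> * fi (- fst z, snd z)"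
      unfolding lborel_prod by (rule compat)
    from lborel_pair.AE_pair[OF this] show ?thesis by (simp add: half_space_def)
  qed
  from AE_sqrt_double[OF this]
  have "AE E in lborel. E > 0 \<longrightarrow> (AE \<eta> in lborel. fi (sqrt (2 * E), \<eta>) = fb (wall_speed E, \<eta>) + \<alpha> * fi (- sqrt (2 * E), \<eta>))"
    by eventually_elim (auto simp: wall_speed_def algebra_simps elim: eventually_mono)
  moreover have "AE E in lborel. E \<noteq> (0::real)" by (rule AE_lborel_singleton)
  ultimately show ?thesis
  proof eventually_elim
    case (elim E)
    consider "E \<le> - b" | "- b < E" "E < 0" | "E > 0" using elim(2) by linarith
    then show ?case
    proof cases
      case 1 then show ?thesis by (intro AE_I2) (simp add: fibre_none wall_def)
    next
      case 2 then show ?thesis by (intro AE_I2) (simp add: fibre_trapped wall_def)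
    next
      case 3
      then have "AE \<eta> in lborel. fi (sqrt (2 * E), \<eta>) = fb (wall_speed E, \<eta>) + \<alpha> * fi (- sqrt (2 * E), \<eta>)" using elim by simp
      then show ?thesis by eventually_elim (use 3 b in \<open>simp add: fibre_free wall_def\<close>)
    qed
  qed
qed

text \<open>Integrate along each characteristic first; almost all of them contribute minus the inflow term.\<close>

lemma dens_weak:
  "(LINT w:({0<..} \<times> UNIV)|lborel. dens (\<phi> (fst w)) (snd w) * blinfun_apply (D w) (fst (snd w), (\<phi>' (fst w), 0)))
   + (LINT z:half_space|lborel. fb z * (fst z * \<psi> (0, z))) = 0"
proof -
  let ?H = "\<lambda>e. indicator energy_range e * (dens_energy e * rate e)"
  note i = dens_rate_integrable
  have Hm: "?H \<in> borel_measurable borel" using i by auto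
  have wm: "wall \<in> borel_measurable borel" using wall_integral(1) by auto
  have "(LINT e|lborel. ?H e) = (LINT E|lborel. LINT z|lborel. ?H (E, z))" by (rule integral_lborel_pair(1)[OF i])
  also have "\<dots> = (LINT E|lborel. LINT \<eta>|lborel. - wall (E, \<eta>))"
  proof (rule integral_cong_AE)
    show "(\<lambda>E. LINT z|lborel. ?H (E, z)) \<in> borel_measurable lborel"
      using borel_measurable_section_integral(1)[OF Hm] by simp
    show "(\<lambda>E. LINT \<eta>|lborel. - wall (E, \<eta>)) \<in> borel_measurable lborel"
      using borel_measurable_section_integral(1)[OF wm] by simp
    show "AE E in lborel. (LINT z|lborel. ?H (E, z)) = (LINT \<eta>|lborel. - wall (E, \<eta>))"
      using AE_fibre integral_lborel_pair(3)[OF i]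
    proof eventually_elim
      case (elim E)
      have "(LINT z|lborel. ?H (E, z)) = (LINT \<eta>|lborel. LINT v|lborel. ?H (E, (v, \<eta>)))"
        by (rule integral_lborel_pair(2)[OF elim(2)])
      also have "\<dots> = (LINT \<eta>|lborel. - wall (E, \<eta>))"
      proof (rule integral_cong_AE)
        have "(\<lambda>z. ?H (E, z)) \<in> borel_measurable borel" using elim(2) by auto
        from borel_measurable_section_integral(2)[OF this]
        show "(\<lambda>\<eta>. LINT v|lborel. ?H (E, (v, \<eta>))) \<in> borel_measurable lborel" by simp
        show "(\<lambda>\<eta>. - wall (E, \<eta>)) \<in> borel_measurable lborel"
          using borel_measurable_section_integral(3)[OF wm] by simp
      qed (use elim(1) in simp)
      finally show ?case .
    qed
  qed
  also have "\<dots> = - (LINT E|lborel. LINT \<eta>|lborel. wall (E, \<eta>))" by simp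
  also have "\<dots> = - (LINT y|lborel. wall y)" by (simp only: integral_lborel_pair(1)[OF wall_integral(1)])
  finally show ?thesis unfolding transport_integral wall_integral(2) by simp
qed

end

section \<open>Smooth bumps and functions on the closed half space\<close>

text \<open>Squaring the positive part makes it continuously differentiable.\<close>

definition sqpos :: "real \<Rightarrow> real" where "sqpos u = (max 0 u)\<^sup>2"

lemma sqpos_nonneg [simp]: "sqpos u \<ge> 0" by (simp add: sqpos_def)
lemma sqpos_zero: "u \<le> 0 \<Longrightarrow> sqpos u = 0" by (simp add: sqpos_def)
lemma sqpos_pos: "u > 0 \<Longrightarrow> sqpos u > 0" by (simp add: sqpos_def)

lemma sqpos_deriv: "(sqpos has_real_derivative 2 * max 0 u) (at u)"
proof -
  consider "u > 0" | "u < 0" | "u = 0" by linarith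
  then show ?thesis
  proof cases
    case 1
    have "((\<lambda>u. u\<^sup>2) has_real_derivative 2 * max 0 u) (at u)"
      using 1 by (auto intro!: derivative_eq_intros)
    then show ?thesis
      by (rule has_field_derivative_transform_within_open[of _ _ _ "{0<..}"]) (use 1 in \<open>auto simp: sqpos_def\<close>)
  next
    case 2
    have "((\<lambda>u. 0) has_real_derivative 2 * max 0 u) (at u)" using 2 by simp
    then show ?thesis
      by (rule has_field_derivative_transform_within_open[of _ _ _ "{..<0}"]) (use 2 in \<open>auto simp: sqpos_def\<close>)
  next
    case 3
    have "((\<lambda>h. (sqpos h - sqpos 0) / (h - 0)) \<longlongrightarrow> 0) (at 0)"
    proof (rule Lim_null_comparison)
      show "\<forall>\<^sub>F h in at 0. norm ((sqpos h - sqpos 0) / (h - 0)) \<le> \<bar>h\<bar>"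
        by (intro always_eventually) (auto simp: sqpos_def power2_eq_square max_def)
      show "((\<lambda>h :: real. \<bar>h\<bar>) \<longlongrightarrow> 0) (at 0)" using tendsto_rabs_zero[OF tendsto_ident_at[of 0 UNIV]] by simp
    qed
    then show ?thesis using 3 by (simp add: has_field_derivative_iff)
  qed
qed

text \<open>A continuously differentiable function with values in \<open>[0, 1)\<close> that vanishes outside
  \<open>(l, u)\<close> and increases to \<open>1\<close> inside as \<open>n\<close> grows, since \<open>n * y / (1 + n * y)\<close> does so for \<open>y > 0\<close>.\<close>

definition bump :: "nat \<Rightarrow> real \<Rightarrow> real \<Rightarrow> real \<Rightarrow> real" where
  "bump n l u t = real n * sqpos ((t - l) * (u - t)) / (1 + real n * sqpos ((t - l) * (u - t)))"

definition bump' :: "nat \<Rightarrow> real \<Rightarrow> real \<Rightarrow> real \<Rightarrow> real" where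
  "bump' n l u t = real n / (1 + real n * sqpos ((t - l) * (u - t)))\<^sup>2 * (2 * max 0 ((t - l) * (u - t)) * ((u - t) - (t - l)))"

lemma bump_denom: "1 + real n * sqpos y > 0"
  by (rule add_pos_nonneg) auto

lemma bump_deriv: "(bump n l u has_real_derivative bump' n l u t) (at t)"
proof -
  have 1: "((\<lambda>t. sqpos ((t - l) * (u - t))) has_real_derivative (2 * max 0 ((t - l) * (u - t)) * ((u - t) - (t - l)))) (at t)"
    by (rule DERIV_chain2[OF sqpos_deriv]) (auto intro!: derivative_eq_intros)
  have 2: "((\<lambda>z. real n * z / (1 + real n * z)) has_real_derivative real n / (1 + real n * z)\<^sup>2) (at z)" if "1 + real n * z > 0" for z
    using that by (auto intro!: derivative_eq_intros simp: field_simps power2_eq_square)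
  show ?thesis
    unfolding bump_def[abs_def] bump'_def by (rule DERIV_chain2[OF 2 1]) (rule bump_denom)
qed

lemma sqpos_cont: "continuous_on UNIV sqpos"
  using sqpos_deriv DERIV_isCont by (auto simp: continuous_on_eq_continuous_at)

lemma bump_cont: "continuous_on S (bump n l u)"
  by (rule DERIV_continuous_on[OF has_field_derivative_at_within[OF bump_deriv]])

lemma bump'_cont: "continuous_on S (bump' n l u)"
proof -
  have "continuous_on UNIV (\<lambda>t. sqpos ((t - l) * (u - t)))"
    by (rule continuous_on_compose2[OF sqpos_cont]) (auto intro!: continuous_intros)
  then have "continuous_on UNIV (bump' n l u)"
    unfolding bump'_def[abs_def]
    by (intro continuous_intros) (use bump_denom in \<open>auto simp: less_imp_neq[symmetric] dest: less_imp_neq\<close>)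
  then show ?thesis by (rule continuous_on_subset) auto
qed

lemma bump_01: "0 \<le> bump n l u t" "bump n l u t \<le> 1"
  using bump_denom[of n "(t - l) * (u - t)"] by (auto simp: bump_def)

lemma bump_outside:
  assumes "l \<le> u" "t \<notin> {l<..<u}" shows "bump n l u t = 0" "bump' n l u t = 0"
proof -
  have "(t - l) * (u - t) \<le> 0" using assms by (auto simp: mult_le_0_iff)
  then show "bump n l u t = 0" "bump' n l u t = 0" by (auto simp: bump_def bump'_def sqpos_zero)
qed

lemma bump_limit:
  assumes "l \<le> u" shows "(\<lambda>n. bump n l u t) \<longlonglongrightarrow> indicator {l<..<u} t"
proof (cases "t \<in> {l<..<u}")
  case True
  define c where "c = sqpos ((t - l) * (u - t))"
  have c: "c > 0" unfolding c_def using True by (intro sqpos_pos mult_pos_pos) auto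
  have "(\<lambda>n. 1 - bump n l u t) \<longlonglongrightarrow> 0"
  proof (rule Lim_null_comparison)
    show "\<forall>\<^sub>F n in sequentially. norm (1 - bump n l u t) \<le> (1 / c) * (1 / real n)"
    proof (rule eventually_sequentiallyI[of 1])
      fix n :: nat assume n: "n \<ge> 1"
      have "1 - bump n l u t = 1 / (1 + real n * c)"
        using bump_denom[of n "(t - l) * (u - t)"] by (simp add: bump_def c_def field_simps)
      also have "\<dots> \<le> 1 / (real n * c)" using n c by (intro divide_left_mono mult_pos_pos add_pos_nonneg) auto
      finally have "1 - bump n l u t \<le> (1 / c) * (1 / real n)" by (simp add: mult.commute)
      then show "norm (1 - bump n l u t) \<le> (1 / c) * (1 / real n)" using bump_01(2)[of n l u t] by simp
    qed
    show "(\<lambda>n. (1 / c) * (1 / real n)) \<longlonglongrightarrow> 0"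
      using tendsto_mult_left[OF lim_1_over_n, of "1 / c"] by simp
  qed
  from tendsto_diff[OF tendsto_const[of 1] this] show ?thesis using True by simp
next
  case False
  then have "bump n l u t = 0" for n using bump_outside[OF assms] by auto
  then show ?thesis using False by simp
qed

definition bump_int :: "nat \<Rightarrow> real \<Rightarrow> real \<Rightarrow> real \<Rightarrow> real" where
  "bump_int n l u v = (if v \<ge> 0 then integral {0..v} (bump n l u) else - integral {v..0} (bump n l u))"

lemma bump_int_deriv: "(bump_int n l u has_real_derivative bump n l u v) (at v)"
proof -
  define A where "A = - \<bar>v\<bar> - 1" define B where "B = \<bar>v\<bar> + 1"
  have AB: "A < 0" "0 < B" "A < v" "v < B" by (auto simp: A_def B_def)
  have int: "bump n l u integrable_on {s..t}" for s t by (intro integrable_continuous_interval bump_cont)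
  have eq: "bump_int n l u w = integral {A..w} (bump n l u) - integral {A..0} (bump n l u)" if "w \<in> {A<..<B}" for w
  proof (cases "w \<ge> 0")
    case True
    have "integral {A..0} (bump n l u) + integral {0..w} (bump n l u) = integral {A..w} (bump n l u)"
      using True AB int by (intro Henstock_Kurzweil_Integration.integral_combine) auto
    then show ?thesis using True by (simp add: bump_int_def)
  next
    case False
    have "integral {A..w} (bump n l u) + integral {w..0} (bump n l u) = integral {A..0} (bump n l u)"
      using False that int by (intro Henstock_Kurzweil_Integration.integral_combine) auto
    then show ?thesis using False by (simp add: bump_int_def)
  qed
  have "((\<lambda>w. integral {A..w} (bump n l u)) has_real_derivative bump n l u v) (at v within {A..B})"
    using AB by (intro integral_has_real_derivative bump_cont) auto
  then have "((\<lambda>w. integral {A..w} (bump n l u)) has_real_derivative bump n l u v) (at v)"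
    using AB by (simp add: at_within_interior[of v "{A..B}"])
  then have "((\<lambda>w. integral {A..w} (bump n l u) - integral {A..0} (bump n l u)) has_real_derivative bump n l u v) (at v)"
    by (auto intro!: derivative_eq_intros)
  then show ?thesis
    by (rule has_field_derivative_transform_within_open[of _ _ _ "{A<..<B}"]) (use AB eq in auto)
qed

lemma bump_int_cont: "continuous_on S (bump_int n l u)"
  by (rule DERIV_continuous_on[OF has_field_derivative_at_within[OF bump_int_deriv]])

lemma bump_int_le: "\<bar>bump_int n l u v\<bar> \<le> \<bar>v\<bar>"
proof -
  have i: "0 \<le> integral {s..t} (bump n l u)" "integral {s..t} (bump n l u) \<le> t - s" if "s \<le> t" for s t
  proof -
    have int: "bump n l u integrable_on {s..t}" by (intro integrable_continuous_interval bump_cont)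
    show "0 \<le> integral {s..t} (bump n l u)" by (intro integral_nonneg int) (simp add: bump_01)
    have "integral {s..t} (bump n l u) \<le> integral {s..t} (\<lambda>_. 1)" by (intro integral_le int) (auto simp: bump_01)
    then show "integral {s..t} (bump n l u) \<le> t - s" using that by simp
  qed
  show ?thesis using i[of 0 v] i[of v 0] by (auto simp: bump_int_def)
qed

abbreviation "closed_half \<equiv> ({0..} \<times> UNIV :: (real \<times> velocity) set)"

text \<open>The differentiability requirement in the definition of test functions.\<close>

definition C1_half :: "(real \<times> velocity \<Rightarrow> real) \<Rightarrow> bool" where
  "C1_half \<psi> \<longleftrightarrow> (\<exists>D :: real \<times> velocity \<Rightarrow> (real \<times> velocity) \<Rightarrow>\<^sub>L real.
     (\<forall>z \<in> closed_half. (\<psi> has_derivative blinfun_apply (D z)) (at z within closed_half)) \<and> continuous_on closed_half D)"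

lemma C1_half_linear:
  assumes "bounded_linear L" shows "C1_half L"
  unfolding C1_half_def
  by (rule exI[of _ "\<lambda>_. Blinfun L"])
     (use assms in \<open>auto simp: bounded_linear_Blinfun_apply bounded_linear_imp_has_derivative\<close>)

lemma C1_half_continuous: assumes "C1_half f" shows "continuous_on closed_half f"
proof -
  obtain F where "\<And>z. z \<in> closed_half \<Longrightarrow> (f has_derivative blinfun_apply (F z)) (at z within closed_half)"
    using assms unfolding C1_half_def by blast
  then show ?thesis by (rule has_derivative_continuous_on)
qed

lemma C1_half_add: assumes "C1_half f" "C1_half g" shows "C1_half (\<lambda>z. f z + g z)"
proof -
  obtain F where F: "\<And>z. z \<in> closed_half \<Longrightarrow> (f has_derivative blinfun_apply (F z)) (at z within closed_half)" "continuous_on closed_half F"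
    using assms(1) unfolding C1_half_def by blast
  obtain G where G: "\<And>z. z \<in> closed_half \<Longrightarrow> (g has_derivative blinfun_apply (G z)) (at z within closed_half)" "continuous_on closed_half G"
    using assms(2) unfolding C1_half_def by blast
  show ?thesis unfolding C1_half_def
  proof (intro exI[of _ "\<lambda>z. F z + G z"] conjI ballI)
    fix z :: "real \<times> velocity" assume z: "z \<in> closed_half"
    show "((\<lambda>z. f z + g z) has_derivative blinfun_apply (F z + G z)) (at z within closed_half)"
      using has_derivative_add[OF F(1)[OF z] G(1)[OF z]] by (simp add: plus_blinfun.rep_eq)
  qed (intro continuous_intros F G)
qed

lemma C1_half_mult: assumes "C1_half f" "C1_half g" shows "C1_half (\<lambda>z. f z * g z)"
proof -
  obtain F where F: "\<And>z. z \<in> closed_half \<Longrightarrow> (f has_derivative blinfun_apply (F z)) (at z within closed_half)" "continuous_on closed_half F"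
    using assms(1) unfolding C1_half_def by blast
  obtain G where G: "\<And>z. z \<in> closed_half \<Longrightarrow> (g has_derivative blinfun_apply (G z)) (at z within closed_half)" "continuous_on closed_half G"
    using assms(2) unfolding C1_half_def by blast
  show ?thesis unfolding C1_half_def
  proof (intro exI[of _ "\<lambda>z. f z *\<^sub>R G z + g z *\<^sub>R F z"] conjI ballI)
    fix z :: "real \<times> velocity" assume z: "z \<in> closed_half"
    show "((\<lambda>z. f z * g z) has_derivative blinfun_apply (f z *\<^sub>R G z + g z *\<^sub>R F z)) (at z within closed_half)"
      using has_derivative_mult[OF F(1)[OF z] G(1)[OF z]]
      by (simp add: plus_blinfun.rep_eq scaleR_blinfun.rep_eq mult.commute)
  qed (intro continuous_intros F G C1_half_continuous assms)
qed

text \<open>The outer function is differentiated within \<open>S\<close> only, because the potential itself has merely a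
  one-sided derivative at the wall.\<close>

lemma C1_half_comp:
  assumes f: "C1_half f" and S: "\<And>z. z \<in> closed_half \<Longrightarrow> f z \<in> S"
    and h: "\<And>t. t \<in> S \<Longrightarrow> (h has_real_derivative h' t) (at t within S)" and h': "continuous_on S h'"
  shows "C1_half (\<lambda>z. h (f z))"
proof -
  obtain F where F: "\<And>z. z \<in> closed_half \<Longrightarrow> (f has_derivative blinfun_apply (F z)) (at z within closed_half)" "continuous_on closed_half F"
    using f unfolding C1_half_def by blast
  show ?thesis unfolding C1_half_def
  proof (intro exI[of _ "\<lambda>z. h' (f z) *\<^sub>R F z"] conjI ballI)
    fix z :: "real \<times> velocity" assume z: "z \<in> closed_half"
    have "(h has_derivative (*) (h' (f z))) (at (f z) within f ` closed_half)"
      using h[OF S[OF z]] unfolding has_field_derivative_def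
      by (rule has_derivative_subset) (use S in blast)
    from has_derivative_in_compose[OF F(1)[OF z] this]
    show "((\<lambda>z. h (f z)) has_derivative blinfun_apply (h' (f z) *\<^sub>R F z)) (at z within closed_half)"
      by (simp add: scaleR_blinfun.rep_eq)
  next
    show "continuous_on closed_half (\<lambda>z. h' (f z) *\<^sub>R F z)"
    proof (intro continuous_on_scaleR F(2))
      show "continuous_on closed_half (\<lambda>z. h' (f z))"
        by (rule continuous_on_compose2[OF h' C1_half_continuous[OF f]]) (use S in blast)
    qed
  qed
qed

lemma C1_half_comp_UNIV:
  assumes "C1_half f" "\<And>t. (h has_real_derivative h' t) (at t)" "continuous_on UNIV h'"
  shows "C1_half (\<lambda>z. h (f z))"
  by (rule C1_half_comp[OF assms(1) UNIV_I has_field_derivative_at_within[OF assms(2)] assms(3)])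

section \<open>Density and transport operator in phase space\<close>

lemma L1_loc_of_bounded_sections:
  assumes m: "(\<lambda>w. indicator closed_half w * f (fst w) (snd w)) \<in> borel_measurable borel"
    and C: "\<And>x. x \<ge> 0 \<Longrightarrow> (\<integral>\<^sup>+z. ennreal \<bar>f x z\<bar> \<partial>lborel) \<le> ennreal C"
  shows "L1_loc f"
  unfolding L1_loc_def
proof (intro allI impI, elim conjE)
  fix K :: "(real \<times> velocity) set" assume K: "compact K" "K \<subseteq> {0..} \<times> UNIV"
  have [measurable]: "K \<in> sets borel" using K by (simp add: borel_compact)
  obtain R where R: "\<And>w. w \<in> K \<Longrightarrow> norm w \<le> R" using compact_imp_bounded[OF K(1)] unfolding bounded_iff by auto
  let ?F = "\<lambda>w. indicator closed_half w * f (fst w) (snd w)"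
  have e: "indicator K w *\<^sub>R (case w of (x, \<xi>) \<Rightarrow> f x \<xi>) = indicator K w * ?F w" for w
    using K(2) by (cases w) (auto split: split_indicator)
  note [measurable] = m
  have Fp: "(\<lambda>w. ennreal \<bar>?F w\<bar> * indicator ({0..R} \<times> UNIV) w) \<in> borel_measurable borel"
    by (intro borel_measurable_times_ennreal borel_measurable_indicator) (auto intro!: borel_closed closed_Times)
  show "set_integrable lborel K (\<lambda>(x, \<xi>). f x \<xi>)"
    unfolding set_integrable_def e
  proof (rule integrableI_bounded)
    have "(\<integral>\<^sup>+w. ennreal (norm (indicator K w * ?F w)) \<partial>lborel) \<le> (\<integral>\<^sup>+w. ennreal \<bar>?F w\<bar> * indicator ({0..R} \<times> UNIV) w \<partial>lborel)"
    proof (intro nn_integral_mono)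
      fix w :: "real \<times> velocity"
      have "w \<in> {0..R} \<times> UNIV" if "w \<in> K"
        using R[OF that] K(2) that norm_fst_le[of "fst w" "snd w"] by (cases w) auto
      then show "ennreal (norm (indicator K w * ?F w)) \<le> ennreal \<bar>?F w\<bar> * indicator ({0..R} \<times> UNIV) w"
        by (auto split: split_indicator)
    qed
    also have "\<dots> = (\<integral>\<^sup>+x. \<integral>\<^sup>+z. ennreal \<bar>?F (x, z)\<bar> * indicator ({0..R} \<times> UNIV) (x, z) \<partial>lborel \<partial>lborel)"
      by (rule nn_integral_lborel_pair(2)[OF Fp])
    also have "\<dots> \<le> (\<integral>\<^sup>+x. ennreal C * indicator {0..R} x \<partial>lborel)"
    proof (intro nn_integral_mono)
      fix x :: real
      show "(\<integral>\<^sup>+z. ennreal \<bar>?F (x, z)\<bar> * indicator ({0..R} \<times> UNIV) (x, z) \<partial>lborel) \<le> ennreal C * indicator {0..R} x"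
      proof (cases "x \<in> {0..R}")
        case True then show ?thesis using C[of x] by simp
      next
        case False
        then have "(\<lambda>z. ennreal \<bar>?F (x, z)\<bar> * indicator ({0..R} \<times> UNIV) (x, z)) = (\<lambda>z. 0)" by (auto simp: fun_eq_iff)
        then show ?thesis by simp
      qed
    qed
    also have "\<dots> = ennreal C * emeasure lborel {0..R}" by (subst nn_integral_cmult_indicator) auto
    also have "\<dots> < \<infinity>" by (auto simp: ennreal_mult_less_top emeasure_lborel_Icc_eq)
    finally show "(\<integral>\<^sup>+w. ennreal (norm (indicator K w * ?F w)) \<partial>lborel) < \<infinity>" .
  qed measurable
qed

text \<open>On each compact cylinder the function is measurable, being integrable there, and the cylinders
  exhaust the closed half space.\<close>

lemma L1_loc_measurable:
  assumes "L1_loc f"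
  shows "(\<lambda>w. indicator closed_half w * f (fst w) (snd w)) \<in> borel_measurable borel"
proof -
  let ?K = "\<lambda>n. {0..real n} \<times> cball 0 (real n) :: (real \<times> velocity) set"
  have "set_integrable lborel (?K n) (\<lambda>(x, \<xi>). f x \<xi>)" for n
    using assms unfolding L1_loc_def by (elim allE[of _ "?K n"] impE) (auto intro!: compact_Times)
  then have m: "(\<lambda>w. indicator (?K n) w *\<^sub>R (case w of (x, \<xi>) \<Rightarrow> f x \<xi>)) \<in> borel_measurable borel" for n
    unfolding set_integrable_def by (auto dest: borel_measurable_integrable)
  show ?thesis
  proof (rule borel_measurable_LIMSEQ_real[OF _ m])
    fix w :: "real \<times> velocity"
    show "(\<lambda>n. indicator (?K n) w *\<^sub>R (case w of (x, \<xi>) \<Rightarrow> f x \<xi>)) \<longlonglongrightarrow> indicator closed_half w * f (fst w) (snd w)"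
    proof (rule tendsto_eventually)
      obtain N :: nat where N: "max \<bar>fst w\<bar> (norm (snd w)) \<le> real N" using real_arch_simple by blast
      show "\<forall>\<^sub>F n in sequentially. indicator (?K n) w *\<^sub>R (case w of (x, \<xi>) \<Rightarrow> f x \<xi>) = indicator closed_half w * f (fst w) (snd w)"
      proof (rule eventually_sequentiallyI[of N])
        fix n assume "N \<le> n"
        then have "real N \<le> real n" by simp
        then show "indicator (?K n) w *\<^sub>R (case w of (x, \<xi>) \<Rightarrow> f x \<xi>) = indicator closed_half w * f (fst w) (snd w)"
          using N by (cases w) (auto split: split_indicator)
      qed
    qed
  qed
qed

context attractive_profile
begin

lemma \<phi>x_range: "0 < \<phi>x x" "\<phi>x x \<le> b"
  by (auto simp: \<phi>x_def intro!: \<phi>_pos \<phi>_le)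

lemma dens_L1_continuous:
  assumes x: "x \<ge> 0" shows "((\<lambda>y. LINT z|lborel. \<bar>dens (\<phi> y) z - dens (\<phi> x) z\<bar>) \<longlongrightarrow> 0) (at x within {0..})"
  unfolding tendsto_at_iff_sequentially
proof (intro allI impI)
  fix X :: "nat \<Rightarrow> real" assume X: "\<forall>i. X i \<in> {0..} - {x}" "X \<longlonglongrightarrow> x"
  have "(\<lambda>n. \<phi> (X n)) \<longlonglongrightarrow> \<phi> x"
    using \<phi>_cont X x by (auto simp: continuous_on_sequentially comp_def)
  then show "((\<lambda>y. LINT z|lborel. \<bar>dens (\<phi> y) z - dens (\<phi> x) z\<bar>) \<circ> X) \<longlonglongrightarrow> 0"
    unfolding comp_def using X x \<phi>_pos \<phi>_le by (intro dens_L1_convergence) (auto intro: less_imp_le)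
qed

lemma dens_L1_limit: "((\<lambda>x. LINT z|lborel. \<bar>dens (\<phi> x) z - fi z\<bar>) \<longlongrightarrow> 0) at_top"
proof (rule tendsto_at_topI_sequentially)
  fix X :: "nat \<Rightarrow> real" assume X: "filterlim X at_top sequentially"
  have ev: "\<forall>\<^sub>F n in sequentially. X n \<ge> 0" using X by (auto simp: filterlim_at_top)
  have "(\<lambda>n. \<phi> (X n)) \<longlonglongrightarrow> 0" by (rule filterlim_compose[OF \<phi>_lim X])
  then have "(\<lambda>n. \<phi>x (X n)) \<longlonglongrightarrow> 0"
    by (rule Lim_transform_eventually) (use ev in \<open>auto elim: eventually_mono\<close>)
  then have "(\<lambda>n. LINT z|lborel. \<bar>dens (\<phi>x (X n)) z - dens 0 z\<bar>) \<longlonglongrightarrow> 0"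
    using \<phi>x_range b by (intro dens_L1_convergence) (auto intro: less_imp_le)
  moreover have "(LINT z|lborel. \<bar>dens p z - dens 0 z\<bar>) = (LINT z|lborel. \<bar>dens p z - fi z\<bar>)" for p
    using dens_0 by (intro integral_cong_AE) auto
  ultimately have "(\<lambda>n. LINT z|lborel. \<bar>dens (\<phi>x (X n)) z - fi z\<bar>) \<longlonglongrightarrow> 0" by simp
  then show "(\<lambda>n. LINT z|lborel. \<bar>dens (\<phi> (X n)) z - fi z\<bar>) \<longlonglongrightarrow> 0"
    by (rule Lim_transform_eventually) (use ev in \<open>auto elim: eventually_mono\<close>)
qed

lemma dens_L1_loc: "L1_loc (\<lambda>x. dens (\<phi> x))"
proof -
  obtain C where C: "\<And>p. p \<in> {0..b} \<Longrightarrow> rho p \<le> C" using rho_bounded by blast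
  show ?thesis
  proof (rule L1_loc_of_bounded_sections[where C = C])
    have "(\<lambda>w. indicator closed_half w * dens (\<phi> (fst w)) (snd w)) = (\<lambda>w. indicator closed_half w * dens (\<phi>x (fst w)) (snd w))"
      by (auto simp: fun_eq_iff split: split_indicator)
    moreover have "closed_half \<in> sets borel" by (intro borel_closed closed_Times) auto
    ultimately show "(\<lambda>w. indicator closed_half w * dens (\<phi> (fst w)) (snd w)) \<in> borel_measurable borel" by simp
    show "(\<integral>\<^sup>+z. ennreal \<bar>dens (\<phi> x) z\<bar> \<partial>lborel) \<le> ennreal C" if "x \<ge> 0" for x
      using that C[of "\<phi> x"] \<phi>_pos[of x] \<phi>_le[of x] by (simp add: nn_integral_dens ennreal_leI)
  qed
qed

definition transport :: "(real \<times> velocity \<Rightarrow> real) \<Rightarrow> real \<times> velocity \<Rightarrow> real" where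
  "transport \<psi> w = fst (snd w) * deriv (\<lambda>x'. \<psi> (x', snd w)) (fst w)
     + \<phi>' (fst w) * deriv (\<lambda>s'. \<psi> (fst w, (s', snd (snd w)))) (fst (snd w))"

lemma transport_blinfun:
  assumes "(\<psi> has_derivative blinfun_apply (D w)) (at w)"
  shows "transport \<psi> w = blinfun_apply (D w) (fst (snd w), (\<phi>' (fst w), 0))"
  using transport_deriv[of \<psi> "D w" "fst w" "fst (snd w)" "snd (snd w)" "\<phi>' (fst w)"] assms
  by (simp add: transport_def)

text \<open>The derivatives of \<open>\<psi>\<close> are bounded with compact support, and there \<open>f\<close> is integrable.\<close>

lemma transport_set_integrable:
  assumes \<psi>: "\<psi> \<in> test_functions \<alpha>" and f: "L1_loc f"
  shows "integrable lborel (\<lambda>w. indicator ({0<..} \<times> UNIV) w * (f (fst w) (snd w) * transport \<psi> w))"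
proof -
  obtain D R C where R: "R \<ge> 0" and C: "C \<ge> 0" and D: "\<And>w. fst w > 0 \<Longrightarrow> (\<psi> has_derivative blinfun_apply (D w)) (at w)"
    and Dc: "continuous_on closed_half D" and Dz: "\<And>w. fst w > 0 \<Longrightarrow> norm w > R \<Longrightarrow> D w = 0"
    and Db: "\<And>w. fst w > 0 \<Longrightarrow> norm (D w) \<le> C"
    by (rule test_function_props[OF \<psi>]) blast
  let ?O = "{0<..} \<times> UNIV :: (real \<times> velocity) set"
  let ?T = "\<lambda>w. blinfun_apply (D w) (fst (snd w), (\<phi>' (fst w), 0))"
  have T: "transport \<psi> w = ?T w" if "w \<in> ?O" for w using that D[of w] by (intro transport_blinfun) (auto simp: mem_Times_iff)
  have opn: "open ?O" by (intro open_Times) auto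
  have "continuous_on ?O ?T"
    by (intro blinfun.continuous_on continuous_intros continuous_on_subset[OF Dc] continuous_on_compose2[OF \<phi>'_cont]) auto
  then have mT: "(\<lambda>w. indicator ?O w * ?T w) \<in> borel_measurable borel"
    using borel_measurable_continuous_on_indicator[of ?O ?T] opn by simp
  have "bounded (\<phi>' ` {0..R})" 
    by (intro compact_imp_bounded compact_continuous_image continuous_on_subset[OF \<phi>'_cont]) auto
  then obtain M where "\<forall>y\<in>\<phi>' ` {0..R}. norm y \<le> M" unfolding bounded_iff by blast
  then have M: "\<bar>\<phi>' x\<bar> \<le> M" if "x \<in> {0..R}" for x using that by simp
  have M0: "M \<ge> 0" using M[of 0] R by auto
  let ?K = "{0..R} \<times> cball 0 R :: (real \<times> velocity) set"
  have Kc: "compact ?K" by (intro compact_Times) auto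
  have "set_integrable lborel ?K (\<lambda>(x, \<xi>). f x \<xi>)"
    using f Kc unfolding L1_loc_def by (elim allE[of _ ?K] impE) auto
  then have iK: "integrable lborel (\<lambda>w. indicator ?K w * f (fst w) (snd w))"
    by (simp add: set_integrable_def case_prod_beta')
  have Tz: "?T w = 0" if "w \<in> ?O" "w \<notin> ?K" for w
  proof -
    have "norm w > R"
      using that norm_fst_le[of "fst w" "snd w"] norm_snd_le[of "snd w" "fst w"] by (cases w) auto
    then show ?thesis using Dz[of w] that by (auto simp: mem_Times_iff)
  qed
  have Tb: "\<bar>?T w\<bar> \<le> C * (R + M)" if "w \<in> ?O" "w \<in> ?K" for w
  proof -
    have v: "\<bar>fst (snd w)\<bar> \<le> R" using that norm_fst_le[of "fst (snd w)" "snd (snd w)"] by (cases w) auto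
    have "\<bar>?T w\<bar> \<le> norm (D w) * norm (fst (snd w), (\<phi>' (fst w), 0 :: real^2))" using norm_blinfun[of "D w"] by simp
    also have "\<dots> \<le> C * (R + M)"
      using Db[of w] that v M[of "fst w"] C norm_Pair_le[of "fst (snd w)" "(\<phi>' (fst w), 0 :: real^2)"] norm_Pair_le[of "\<phi>' (fst w)" "0 :: real^2"]
      by (intro mult_mono) (auto simp: mem_Times_iff)
    finally show ?thesis .
  qed
  have e: "indicator ?O w * (f (fst w) (snd w) * transport \<psi> w) = (indicator ?K w * f (fst w) (snd w)) * (indicator ?O w * ?T w)" for w
    using T[of w] Tz[of w] by (auto split: split_indicator)
  show ?thesis unfolding e
  proof (rule Bochner_Integration.integrable_bound)
    show "integrable lborel (\<lambda>w. (C * (R + M)) * (indicator ?K w * f (fst w) (snd w)))" by (intro integrable_mult_right iK)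
    show "AE w in lborel. norm (indicator ?K w * f (fst w) (snd w) * (indicator ?O w * ?T w)) \<le> norm ((C * (R + M)) * (indicator ?K w * f (fst w) (snd w)))"
    proof (intro AE_I2)
      fix w :: "real \<times> velocity"
      show "norm (indicator ?K w * f (fst w) (snd w) * (indicator ?O w * ?T w)) \<le> norm ((C * (R + M)) * (indicator ?K w * f (fst w) (snd w)))"
      proof (cases "w \<in> ?O \<and> w \<in> ?K")
        case True
        have "\<bar>f (fst w) (snd w)\<bar> * \<bar>?T w\<bar> \<le> \<bar>f (fst w) (snd w)\<bar> * (C * (R + M))"
          using Tb[of w] True by (intro mult_left_mono) auto
        then show ?thesis using True C R M0 by (simp add: abs_mult mult.commute)
      next
        case False then show ?thesis by (auto split: split_indicator)
      qed
    qed
  qed (use mT iK in auto)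
qed

lemma dens_weak_transport:
  assumes \<psi>: "\<psi> \<in> test_functions \<alpha>"
  shows "(LINT w|lborel. indicator ({0<..} \<times> UNIV) w * (dens (\<phi> (fst w)) (snd w) * transport \<psi> w))
   + (LINT z:half_space|lborel. fb z * (fst z * \<psi> (0, z))) = 0"
proof -
  obtain D R C where P: "R \<ge> 0" "C \<ge> 0"
    "\<And>w. fst w > 0 \<Longrightarrow> (\<psi> has_derivative blinfun_apply (D w)) (at w)"
    "continuous_on closed_half D" "continuous_on closed_half \<psi>"
    "\<And>w. fst w \<ge> 0 \<Longrightarrow> norm w > R \<Longrightarrow> \<psi> w = 0" "\<And>w. fst w > 0 \<Longrightarrow> norm w > R \<Longrightarrow> D w = 0"
    "\<And>w. fst w \<ge> 0 \<Longrightarrow> \<bar>\<psi> w\<bar> \<le> C" "\<And>w. fst w > 0 \<Longrightarrow> norm (D w) \<le> C"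
    "\<And>s \<eta>. s > 0 \<Longrightarrow> \<alpha> * \<psi> (0, (s, \<eta>)) = \<psi> (0, (- s, \<eta>))"
    by (rule test_function_props[OF \<psi>]) blast
  interpret weak_test \<alpha> b r fb fi \<phi> \<phi>' \<psi> D R C
    by unfold_locales (fact P)+
  have e: "indicator ({0<..} \<times> UNIV) w * (dens (\<phi> (fst w)) (snd w) * transport \<psi> w)
     = indicator ({0<..} \<times> UNIV) w * (dens (\<phi> (fst w)) (snd w) * blinfun_apply (D w) (fst (snd w), (\<phi>' (fst w), 0)))" for w
    using transport_blinfun[of \<psi> D w] P(3)[of w] by (cases w) (auto split: split_indicator)
  show ?thesis unfolding e using dens_weak unfolding set_lebesgue_integral_def by simp
qed

end

section \<open>Uniqueness for the weak Vlasov equation\<close>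

text \<open>The positive and the negative part of \<open>h\<close> have image measures under \<open>T\<close> that agree on boxes,
  which generate the Borel sets.\<close>

lemma box_integrals_zero:
  fixes h :: "'a::euclidean_space \<Rightarrow> real" and T :: "'a \<Rightarrow> 'b::euclidean_space"
  assumes h: "integrable lborel h" and T [measurable]: "T \<in> borel_measurable borel"
    and z: "\<And>l u. (LINT w|lborel. h w * indicator (box l u) (T w)) = 0" and A [measurable]: "A \<in> sets borel"
  shows "(LINT w|lborel. h w * indicator A (T w)) = 0"
proof -
  have hm [measurable]: "h \<in> borel_measurable borel" using h by auto
  define M where "M s = distr (density lborel (\<lambda>w. ennreal (max 0 (s * h w)))) borel T" for s :: real
  have ih: "integrable lborel (\<lambda>w. max 0 (s * h w) * indicator B (T w))" if [measurable]: "B \<in> sets borel" for s :: real and B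
  proof (rule Bochner_Integration.integrable_bound)
    show "integrable lborel (\<lambda>w. s * h w)" using h by simp
    show "AE w in lborel. norm (max 0 (s * h w) * indicator B (T w)) \<le> norm (s * h w)"
      by (intro AE_I2) (auto split: split_indicator)
  qed measurable
  have em: "emeasure (M s) B = ennreal (LINT w|lborel. max 0 (s * h w) * indicator B (T w))" if B [measurable]: "B \<in> sets borel" for B s
  proof -
    have "emeasure (M s) B = (\<integral>\<^sup>+w. ennreal (max 0 (s * h w) * indicator B (T w)) \<partial>lborel)"
      unfolding M_def by (subst emeasure_distr, simp, simp, subst emeasure_density)
        (auto intro!: nn_integral_cong simp: measurable_sets_borel[OF T B] split: split_indicator)
    also have "\<dots> = ennreal (LINT w|lborel. max 0 (s * h w) * indicator B (T w))"
      by (intro nn_integral_eq_integral ih B) (auto split: split_indicator)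
    finally show ?thesis .
  qed
  have dif: "(LINT w|lborel. h w * indicator B (T w)) =
     (LINT w|lborel. max 0 (1 * h w) * indicator B (T w)) - (LINT w|lborel. max 0 (-1 * h w) * indicator B (T w))" 
    if B: "B \<in> sets borel" for B
  proof -
    have "h w * indicator B (T w) = max 0 (1 * h w) * indicator B (T w) - max 0 (-1 * h w) * indicator B (T w)" for w
      by (auto split: split_indicator)
    then show ?thesis using Bochner_Integration.integral_diff[OF ih[OF B, of 1] ih[OF B, of "-1"]] by simp
  qed
  have "M 1 = M (-1)"
  proof (rule measure_eqI_generator_eq)
    let ?E = "range (\<lambda>(a, b). box a b :: 'b set)"
    show "Int_stable ?E" by (auto simp: Int_stable_def box_Int_box)
    show "?E \<subseteq> Pow UNIV" "sets (M 1) = sigma_sets UNIV ?E" "sets (M (-1)) = sigma_sets UNIV ?E"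
      by (simp_all add: M_def borel_eq_box)
    let ?A = "\<lambda>n::nat. box (- (real n *\<^sub>R One)) (real n *\<^sub>R One) :: 'b set"
    show "range ?A \<subseteq> ?E" "(\<Union>i. ?A i) = UNIV" unfolding UN_box_eq_UNIV by auto
    show "emeasure (M 1) (?A i) \<noteq> \<infinity>" for i by (subst em) auto
    fix X assume "X \<in> ?E"
    then obtain l u where X: "X = box l u" by auto
    show "emeasure (M 1) X = emeasure (M (-1)) X"
      using z[of l u] dif[of X] by (subst (1 2) em) (auto simp: X)
  qed
  then have "ennreal (LINT w|lborel. max 0 (1 * h w) * indicator A (T w)) = ennreal (LINT w|lborel. max 0 (-1 * h w) * indicator A (T w))"
    using em[OF A, of 1] em[OF A, of "-1"] by simp
  then have "(LINT w|lborel. max 0 (1 * h w) * indicator A (T w)) = (LINT w|lborel. max 0 (-1 * h w) * indicator A (T w))"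
    by (subst (asm) ennreal_inj) (auto intro!: integral_nonneg_AE AE_I2)
  then show ?thesis using dif[OF A] by simp
qed

text \<open>Rescaling \<open>x = (n + 1) * y\<close> fixes the interval and leaves \<open>N ((n + 1) * y)\<close>, which tends to \<open>0\<close> for
  every \<open>y\<close>.  The weight \<open>2 / (n + 1)\<close> is the bound on the slope of the cutoff in
  the test functions below.\<close>

lemma average_vanishes:
  fixes N :: "real \<Rightarrow> real"
  assumes m [measurable]: "N \<in> borel_measurable borel" and b: "\<And>x. \<bar>N x\<bar> \<le> C" and lim: "(N \<longlongrightarrow> 0) at_top"
  shows "(\<lambda>n. LINT x|lborel. indicator {0<..<real (Suc n)} x * (2 / real (Suc n) * N x)) \<longlonglongrightarrow> 0"
proof -
  have e: "(LINT x|lborel. indicator {0<..<real (Suc n)} x * (2 / real (Suc n) * N x)) = (LINT y|lborel. indicator {0<..<1} y * (2 * N (real (Suc n) * y)))" for n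
  proof -
    have "(LINT x|lborel. indicator {0<..<real (Suc n)} x * (2 / real (Suc n) * N x))
       = \<bar>real (Suc n)\<bar> *\<^sub>R (LINT y|lborel. indicator {0<..<real (Suc n)} (0 + real (Suc n) * y) * (2 / real (Suc n) * N (0 + real (Suc n) * y)))"
      by (rule lborel_integral_real_affine) simp
    also have "\<dots> = (LINT y|lborel. real (Suc n) * (indicator {0<..<real (Suc n)} (real (Suc n) * y) * (2 / real (Suc n) * N (real (Suc n) * y))))"
      by simp
    also have "\<dots> = (LINT y|lborel. indicator {0<..<1} y * (2 * N (real (Suc n) * y)))"
    proof (rule Bochner_Integration.integral_cong[OF refl])
      fix y :: real
      have "real (Suc n) * y \<in> {0<..<real (Suc n)} \<longleftrightarrow> y \<in> {0<..<1}" by (auto simp: zero_less_mult_iff mult_less_cancel_left1 simp del: of_nat_Suc)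
      then show "real (Suc n) * (indicator {0<..<real (Suc n)} (real (Suc n) * y) * (2 / real (Suc n) * N (real (Suc n) * y))) = indicator {0<..<1} y * (2 * N (real (Suc n) * y))"
        by (cases "y \<in> {0<..<1}") (simp_all only: indicator_simps, simp_all)
    qed
    finally show ?thesis .
  qed
  have "(\<lambda>n. LINT y|lborel. indicator {0<..<1} y * (2 * N (real (Suc n) * y))) \<longlonglongrightarrow> (LINT y|(lborel :: real measure). (0 :: real))"
  proof (rule integral_dominated_convergence[where w = "\<lambda>y. 2 * C * indicator {0<..<1} y"])
    show "AE y in lborel. (\<lambda>n. indicator {0<..<1} y * (2 * N (real (Suc n) * y))) \<longlonglongrightarrow> 0"
    proof (intro AE_I2)
      fix y :: real
      show "(\<lambda>n. indicator {0<..<1} y * (2 * N (real (Suc n) * y))) \<longlonglongrightarrow> 0"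
      proof (cases "y \<in> {0<..<1}")
        case True
        have "filterlim (\<lambda>n. real (Suc n) * y) at_top sequentially"
        proof -
          have "filterlim (\<lambda>n. real (Suc n)) at_top sequentially"
            by (rule filterlim_compose[OF filterlim_real_sequentially filterlim_Suc])
          then have "filterlim (\<lambda>n. y * real (Suc n)) at_top sequentially"
            using True by (intro filterlim_tendsto_pos_mult_at_top[OF tendsto_const]) auto
          then show ?thesis by (simp only: mult.commute)
        qed
        then have "(\<lambda>n. N (real (Suc n) * y)) \<longlonglongrightarrow> 0" by (rule filterlim_compose[OF lim])
        from tendsto_mult_left[OF this, of 2] True show ?thesis by simp
      next
        case False
        then have "indicator {0<..<1} y = (0::real)" by (rule indicator_simps(2))
        then show ?thesis by simp
      qed
    qed
    show "AE y in lborel. norm (indicator {0<..<1} y * (2 * N (real (Suc n) * y))) \<le> 2 * C * indicator {0<..<1} y" for n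
      using b by (intro AE_I2) (auto simp: abs_mult split: split_indicator)
    show "integrable lborel (\<lambda>y. 2 * C * indicator {0<..<1} (y::real))"
      by (intro integrable_mult_right integrable_real_indicator) auto
  qed auto
  then show ?thesis unfolding e by simp
qed

text \<open>A given potential together with a density that satisfies everything but Poisson's equation.\<close>

locale attractive_solution = attractive_profile +
  fixes f :: "real \<Rightarrow> velocity \<Rightarrow> real"
  assumes f_loc: "L1_loc f" and f_cont: "continuous_into_L1 f"
    and f_lim: "((\<lambda>x. LINT \<xi>|lborel. \<bar>f x \<xi> - fi \<xi>\<bar>) \<longlongrightarrow> 0) at_top"
    and f_weak: "\<And>\<psi>. \<psi> \<in> test_functions \<alpha> \<Longrightarrow> (LINT w|lborel. indicator ({0<..} \<times> UNIV) w * (f (fst w) (snd w) * transport \<psi> w))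
   + (LINT z:half_space|lborel. fb z * (fst z * \<psi> (0, z))) = 0"
begin

text \<open>The deviation of the given density from the explicit one; it satisfies the homogeneous weak
  equation and vanishes at infinity in \<open>L\<^sup>1\<close>.\<close>

definition gap :: "real \<times> velocity \<Rightarrow> real" where
  "gap w = indicator closed_half w * (f (fst w) (snd w) - dens (\<phi>x (fst w)) (snd w))"

lemma closed_half_borel [measurable]: "closed_half \<in> sets borel"
  by (intro borel_closed closed_Times) auto

lemma gap_measurable [measurable]: "gap \<in> borel_measurable borel"
proof -
  have "(\<lambda>w. indicator closed_half w * f (fst w) (snd w) - indicator closed_half w * dens (\<phi>x (fst w)) (snd w)) \<in> borel_measurable borel"
    by (intro borel_measurable_diff borel_measurable_times L1_loc_measurable[OF f_loc]) auto
  then show ?thesis by (simp add: gap_def[abs_def] right_diff_distrib)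
qed

definition gap_norm :: "real \<Rightarrow> real" where "gap_norm x = (LINT z|lborel. \<bar>gap (x, z)\<bar>)"

lemma gap_norm_measurable [measurable]: "gap_norm \<in> borel_measurable borel"
  unfolding gap_norm_def[abs_def] using borel_measurable_section_integral(1)[of "\<lambda>w. \<bar>gap w\<bar>"] by simp

lemma gap_eq: "x \<ge> 0 \<Longrightarrow> gap (x, z) = f x z - dens (\<phi> x) z" by (simp add: gap_def)
lemma gap_neg: "x < 0 \<Longrightarrow> gap (x, z) = 0" by (simp add: gap_def)

lemma f_integrable: "x \<ge> 0 \<Longrightarrow> integrable lborel (f x)" using f_cont by (simp add: continuous_into_L1_def)
lemma dens_\<phi>_integrable: "x \<ge> 0 \<Longrightarrow> integrable lborel (dens (\<phi> x))"
  using \<phi>_pos[of x] \<phi>_le[of x] by (intro dens_integrable) auto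

lemma gap_integrable: "integrable lborel (\<lambda>z. gap (x, z))"
  by (cases "x \<ge> 0") (auto simp: gap_eq gap_neg f_integrable dens_\<phi>_integrable)

lemma gap_norm_nonneg: "gap_norm x \<ge> 0" by (simp add: gap_norm_def)

lemma gap_norm_continuous: "continuous_on {0..} gap_norm"
proof (rule continuous_on_eq_continuous_within[THEN iffD2], intro ballI)
  fix x :: real assume "x \<in> {0..}"
  then have x: "x \<ge> 0" by simp
  have F: "((\<lambda>y. LINT \<xi>|lborel. \<bar>f y \<xi> - f x \<xi>\<bar>) \<longlongrightarrow> 0) (at x within {0..})"
    using f_cont x by (simp add: continuous_into_L1_def)
  have "((\<lambda>y. gap_norm y - gap_norm x) \<longlongrightarrow> 0) (at x within {0..})"
  proof (rule Lim_null_comparison)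
    show "((\<lambda>y. (LINT \<xi>|lborel. \<bar>f y \<xi> - f x \<xi>\<bar>) + (LINT z|lborel. \<bar>dens (\<phi> y) z - dens (\<phi> x) z\<bar>)) \<longlongrightarrow> 0) (at x within {0..})"
      using tendsto_add[OF F dens_L1_continuous[OF x]] by simp
    show "\<forall>\<^sub>F y in at x within {0..}. norm (gap_norm y - gap_norm x) \<le> (LINT \<xi>|lborel. \<bar>f y \<xi> - f x \<xi>\<bar>) + (LINT z|lborel. \<bar>dens (\<phi> y) z - dens (\<phi> x) z\<bar>)"
      unfolding eventually_at_filter
    proof (intro always_eventually allI impI)
      fix y :: real assume "y \<in> {0..}"
      then have y: "y \<ge> 0" by simp
      note i = f_integrable[OF x] f_integrable[OF y] dens_\<phi>_integrable[OF x] dens_\<phi>_integrable[OF y]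
      have "gap_norm y - gap_norm x = (LINT z|lborel. \<bar>f y z - dens (\<phi> y) z\<bar> - \<bar>f x z - dens (\<phi> x) z\<bar>)"
        unfolding gap_norm_def gap_eq[OF x] gap_eq[OF y] using i by (subst Bochner_Integration.integral_diff) auto
      then have "norm (gap_norm y - gap_norm x) \<le> (LINT z|lborel. norm (\<bar>f y z - dens (\<phi> y) z\<bar> - \<bar>f x z - dens (\<phi> x) z\<bar>))"
        by (simp only: integral_norm_bound)
      also have "\<dots> \<le> (LINT z|lborel. \<bar>f y z - f x z\<bar> + \<bar>dens (\<phi> y) z - dens (\<phi> x) z\<bar>)"
        using i by (intro integral_mono) auto
      also have "\<dots> = (LINT \<xi>|lborel. \<bar>f y \<xi> - f x \<xi>\<bar>) + (LINT z|lborel. \<bar>dens (\<phi> y) z - dens (\<phi> x) z\<bar>)"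
        using i by (intro Bochner_Integration.integral_add) auto
      finally show "norm (gap_norm y - gap_norm x) \<le> (LINT \<xi>|lborel. \<bar>f y \<xi> - f x \<xi>\<bar>) + (LINT z|lborel. \<bar>dens (\<phi> y) z - dens (\<phi> x) z\<bar>)" .
    qed
  qed
  then show "continuous (at x within {0..}) gap_norm" by (simp add: continuous_within LIM_zero_iff)
qed

lemma gap_norm_limit: "(gap_norm \<longlongrightarrow> 0) at_top"
proof (rule Lim_null_comparison)
  show "((\<lambda>x. (LINT z|lborel. \<bar>f x z - fi z\<bar>) + (LINT z|lborel. \<bar>dens (\<phi> x) z - fi z\<bar>)) \<longlongrightarrow> 0) at_top"
    using tendsto_add[OF f_lim dens_L1_limit] by simp
  show "\<forall>\<^sub>F x in at_top. norm (gap_norm x) \<le> (LINT z|lborel. \<bar>f x z - fi z\<bar>) + (LINT z|lborel. \<bar>dens (\<phi> x) z - fi z\<bar>)"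
    using eventually_ge_at_top[of 0]
  proof eventually_elim
    case (elim x)
    note i = f_integrable[OF elim] dens_\<phi>_integrable[OF elim] fi(1)
    have "gap_norm x \<le> (LINT z|lborel. \<bar>f x z - fi z\<bar> + \<bar>dens (\<phi> x) z - fi z\<bar>)"
      unfolding gap_norm_def gap_eq[OF elim] using i by (intro integral_mono) auto
    also have "\<dots> = (LINT z|lborel. \<bar>f x z - fi z\<bar>) + (LINT z|lborel. \<bar>dens (\<phi> x) z - fi z\<bar>)"
      using i by (intro Bochner_Integration.integral_add) auto
    finally show ?case using gap_norm_nonneg by simp
  qed
qed

lemma gap_norm_bounded: obtains C where "C \<ge> 0" "\<And>x. gap_norm x \<le> C"
proof -
  have "\<forall>\<^sub>F x in at_top. gap_norm x < 1" using order_tendstoD(2)[OF gap_norm_limit] by simp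
  then obtain X where X: "\<And>x. x \<ge> X \<Longrightarrow> gap_norm x < 1" unfolding eventually_at_top_linorder by auto
  have "bounded (gap_norm ` {0..max 0 X})"
    by (intro compact_imp_bounded compact_continuous_image continuous_on_subset[OF gap_norm_continuous]) auto
  then obtain B where B0: "\<forall>y\<in>gap_norm ` {0..max 0 X}. norm y \<le> B" unfolding bounded_iff by blast
  have B: "gap_norm x \<le> B" if "x \<in> {0..max 0 X}" for x
  proof -
    have "norm (gap_norm x) \<le> B" using B0 that by blast
    then show ?thesis using gap_norm_nonneg[of x] by simp
  qed
  have n: "gap_norm x = 0" if "x < 0" for x using that by (simp add: gap_norm_def gap_neg)
  show thesis
  proof (rule that[of "max 1 B"])
    fix x
    consider "x < 0" | "x \<in> {0..max 0 X}" | "x \<ge> X" by fastforce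
    then show "gap_norm x \<le> max 1 B"
    proof cases
      case 1 then show ?thesis using n[of x] by simp
    next
      case 2 then show ?thesis using B[of x] by linarith
    next
      case 3 then show ?thesis using X[of x] by linarith
    qed
  qed auto
qed

lemma nn_integral_gap: "(\<integral>\<^sup>+z. ennreal \<bar>gap (x, z)\<bar> \<partial>lborel) = ennreal (gap_norm x)"
  unfolding gap_norm_def using gap_integrable[of x] by (subst nn_integral_eq_integral) auto

lemma flux_gap_integrable: "integrable lborel (\<lambda>w. flux w * gap w)"
proof -
  obtain C where "C \<ge> 0" "\<And>x. gap_norm x \<le> C" by (rule gap_norm_bounded) blast
  then show ?thesis by (intro flux_integrable[where C = C]) (auto simp: nn_integral_gap ennreal_leI)
qed

lemma gap_weak:
  assumes \<psi>: "\<psi> \<in> test_functions \<alpha>"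
  shows "integrable lborel (\<lambda>w. indicator ({0<..} \<times> UNIV) w * (gap w * transport \<psi> w))"
    "(LINT w|lborel. indicator ({0<..} \<times> UNIV) w * (gap w * transport \<psi> w)) = 0"
proof -
  let ?F = "\<lambda>w. indicator ({0<..} \<times> UNIV) w * (f (fst w) (snd w) * transport \<psi> w)"
  let ?G = "\<lambda>w. indicator ({0<..} \<times> UNIV) w * (dens (\<phi> (fst w)) (snd w) * transport \<psi> w)"
  have e: "(\<lambda>w. indicator ({0<..} \<times> UNIV) w * (gap w * transport \<psi> w)) = (\<lambda>w. ?F w - ?G w)"
  proof
    fix w :: "real \<times> velocity"
    show "indicator ({0<..} \<times> UNIV) w * (gap w * transport \<psi> w) = ?F w - ?G w"
      by (cases w) (auto simp: gap_eq left_diff_distrib split: split_indicator)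
  qed
  have i: "integrable lborel ?F" "integrable lborel ?G"
    using transport_set_integrable[OF \<psi> f_loc] transport_set_integrable[OF \<psi> dens_L1_loc] by simp_all
  show "integrable lborel (\<lambda>w. indicator ({0<..} \<times> UNIV) w * (gap w * transport \<psi> w))"
    unfolding e using i by simp
  show "(LINT w|lborel. indicator ({0<..} \<times> UNIV) w * (gap w * transport \<psi> w)) = 0"
    unfolding e using i f_weak[OF \<psi>] dens_weak_transport[OF \<psi>] by simp
qed

end

context attractive_profile
begin

text \<open>The constant (on a characteristic) that has to be added to \<open>K = bump_int n c d\<close> for the reflection condition
  at the wall: \<open>R\<close> solves \<open>\<alpha> * (K s + R) = K (- s) + R\<close> for \<open>s = wall_speed E\<close>.\<close>

definition reflected :: "nat \<Rightarrow> real \<Rightarrow> real \<Rightarrow> real \<Rightarrow> real" where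
  "reflected n c d E = (\<alpha> * bump_int n c d (wall_speed E) - bump_int n c d (- wall_speed E)) / (1 - \<alpha>)"

text \<open>The bump in the energy vanishes below \<open>a > - b\<close>, away from the energy \<open>- b\<close> at which the square root
  in \<open>wall_speed\<close> fails to be differentiable.\<close>

definition amp :: "nat \<Rightarrow> real \<Rightarrow> real \<Rightarrow> real \<Rightarrow> real \<Rightarrow> real \<Rightarrow> real" where
  "amp n a a' c d E = bump n a a' E * reflected n c d E"

definition amp' :: "nat \<Rightarrow> real \<Rightarrow> real \<Rightarrow> real \<Rightarrow> real \<Rightarrow> real \<Rightarrow> real" where
  "amp' n a a' c d E = bump' n a a' E * reflected n c d E
     + bump n a a' E * ((\<alpha> * bump n c d (wall_speed E) + bump n c d (- wall_speed E)) / wall_speed E / (1 - \<alpha>))"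

lemma wall_speed_deriv: "-b < E \<Longrightarrow> (wall_speed has_real_derivative 1 / wall_speed E) (at E)"
  unfolding wall_speed_def[abs_def] by (auto intro!: derivative_eq_intros simp: field_simps)

lemma wall_speed_cont: "continuous_on S wall_speed"
  unfolding wall_speed_def[abs_def] by (intro continuous_intros)

lemma reflected_cont: "continuous_on S (reflected n c d)"
  unfolding reflected_def[abs_def] using \<alpha>
  by (intro continuous_intros continuous_on_compose2[OF bump_int_cont[of UNIV]] wall_speed_cont) auto

lemma amp_deriv:
  assumes a: "-b < a" "a \<le> a'"
  shows "(amp n a a' c d has_real_derivative amp' n a a' c d E) (at E)"
proof (cases "-b < E")
  case True
  have ws: "wall_speed E \<noteq> 0" using True by (simp add: wall_speed_def)
  have 1: "((\<lambda>E. bump_int n c d (wall_speed E)) has_real_derivative bump n c d (wall_speed E) * (1 / wall_speed E)) (at E)"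
    by (rule DERIV_chain2[OF bump_int_deriv wall_speed_deriv[OF True]])
  have 2: "((\<lambda>E. bump_int n c d (- wall_speed E)) has_real_derivative bump n c d (- wall_speed E) * (- (1 / wall_speed E))) (at E)"
    by (rule DERIV_chain2[OF bump_int_deriv DERIV_minus[OF wall_speed_deriv[OF True]]])
  have "(reflected n c d has_real_derivative (\<alpha> * (bump n c d (wall_speed E) * (1 / wall_speed E)) - bump n c d (- wall_speed E) * (- (1 / wall_speed E))) / (1 - \<alpha>)) (at E)"
    unfolding reflected_def[abs_def] by (intro DERIV_cdivide DERIV_diff DERIV_cmult 1 2)
  also have "(\<alpha> * (bump n c d (wall_speed E) * (1 / wall_speed E)) - bump n c d (- wall_speed E) * (- (1 / wall_speed E))) / (1 - \<alpha>)
     = (\<alpha> * bump n c d (wall_speed E) + bump n c d (- wall_speed E)) / wall_speed E / (1 - \<alpha>)"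
    by (simp add: add_divide_distrib)
  finally have 3: "(reflected n c d has_real_derivative (\<alpha> * bump n c d (wall_speed E) + bump n c d (- wall_speed E)) / wall_speed E / (1 - \<alpha>)) (at E)" .
  show ?thesis
    using DERIV_mult[OF bump_deriv[of n a a' E] 3] unfolding amp_def[abs_def] amp'_def by (simp add: mult.commute add.commute)
next
  case False
  have z: "amp n a a' c d t = 0" if "t < a" for t using bump_outside(1)[OF a(2), of t n] that by (simp add: amp_def)
  have "((\<lambda>E. 0) has_real_derivative 0) (at E)" by simp
  then have "(amp n a a' c d has_real_derivative 0) (at E)"
    by (rule has_field_derivative_transform_within_open[of _ _ _ "{..<a}"]) (use False a z in auto)
  then show ?thesis using bump_outside[OF a(2), of E n] False a by (simp add: amp'_def)
qed

lemma amp'_cont: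
  assumes a: "-b < a" "a \<le> a'"
  shows "continuous_on UNIV (amp' n a a' c d)"
proof -
  have "continuous_on {-b<..} (amp' n a a' c d)"
    unfolding amp'_def[abs_def] using \<alpha>
    by (intro continuous_intros reflected_cont bump_cont bump'_cont continuous_on_compose2[OF bump_cont[of UNIV]] wall_speed_cont)
       (auto simp: wall_speed_def)
  moreover have "continuous_on {..<a} (amp' n a a' c d)"
  proof (rule continuous_on_eq[of _ "\<lambda>_. 0"])
    show "0 = amp' n a a' c d E" if "E \<in> {..<a}" for E
      using bump_outside[OF a(2), of E n] that by (simp add: amp'_def)
  qed simp
  ultimately have "continuous_on ({-b<..} \<union> {..<a}) (amp' n a a' c d)" by (intro continuous_on_open_Un) auto
  moreover have "{-b<..} \<union> {..<a} = UNIV" using a by auto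
  ultimately show ?thesis by simp
qed

definition energy :: "real \<times> velocity \<Rightarrow> real" where "energy w = (fst (snd w))\<^sup>2 / 2 - \<phi> (fst w)"

definition cutoff :: "nat \<Rightarrow> real \<Rightarrow> real" where "cutoff m x = sqpos (1 - x / real (Suc m))"

definition lateral :: "nat \<Rightarrow> real^2 \<Rightarrow> real^2 \<Rightarrow> real^2 \<Rightarrow> real" where
  "lateral n l u \<eta> = bump n (l$1) (u$1) (\<eta>$1) * bump n (l$2) (u$2) (\<eta>$2)"

text \<open>A primitive along characteristics of the product of a bump in the energy and one in the velocity,
  normalised by the reflection condition.\<close>

definition primitive :: "nat \<Rightarrow> real \<Rightarrow> real \<Rightarrow> real \<Rightarrow> real \<Rightarrow> real \<times> velocity \<Rightarrow> real" where
  "primitive n a a' c d w = bump n a a' (energy w) * bump_int n c d (fst (snd w)) + amp n a a' c d (energy w)"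

text \<open>The test function; \<open>m\<close> is the scale of the cutoff in the position and \<open>n\<close> the steepness of
  the bumps that approximate the indicator function of a box in energy, normal and lateral velocity.\<close>

definition probe :: "nat \<Rightarrow> nat \<Rightarrow> real \<Rightarrow> real \<Rightarrow> real \<Rightarrow> real \<Rightarrow> real^2 \<Rightarrow> real^2 \<Rightarrow> real \<times> velocity \<Rightarrow> real" where
  "probe m n a a' c d l u w = cutoff m (fst w) * lateral n l u (snd (snd w)) * primitive n a a' c d w"

lemma cutoff_deriv: "(cutoff m has_real_derivative 2 * max 0 (1 - x / real (Suc m)) * (- (1 / real (Suc m)))) (at x)"
  unfolding cutoff_def[abs_def]
  by (rule DERIV_chain2[OF sqpos_deriv]) (auto intro!: derivative_eq_intros simp del: of_nat_Suc)

lemma cutoff_01: "x \<ge> 0 \<Longrightarrow> 0 \<le> cutoff m x \<and> cutoff m x \<le> 1"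
proof -
  assume "x \<ge> 0"
  then have "max 0 (1 - x / real (Suc m)) \<le> 1" by simp
  then show ?thesis by (auto simp: cutoff_def sqpos_def power_le_one)
qed

lemma cutoff_zero: "x \<ge> real (Suc m) \<Longrightarrow> cutoff m x = 0"
  unfolding cutoff_def by (rule sqpos_zero) (simp add: divide_simps)

lemma cutoff_limit: "(\<lambda>m. cutoff m x) \<longlonglongrightarrow> 1"
proof -
  have "(\<lambda>m. (max 0 (1 - x * (1 / real (Suc m))))\<^sup>2) \<longlonglongrightarrow> (max 0 (1 - x * 0))\<^sup>2"
    using LIMSEQ_Suc[OF lim_1_over_n] by (intro tendsto_intros)
  then show ?thesis by (simp add: cutoff_def sqpos_def)
qed

lemma C1_energy: "C1_half energy"
proof -
  have v: "C1_half (\<lambda>w. fst (snd w))"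
    by (intro C1_half_linear bounded_linear_compose[OF bounded_linear_fst bounded_linear_snd])
  have 1: "C1_half (\<lambda>w. (fst (snd w))\<^sup>2 / 2)"
    by (rule C1_half_comp_UNIV[OF v, where h = "\<lambda>t. t\<^sup>2 / 2" and h' = "\<lambda>t. t"]) (auto intro!: derivative_eq_intros)
  have 2: "C1_half (\<lambda>w. - \<phi> (fst w))"
  proof (rule C1_half_comp[where S = "{0..}" and h = "\<lambda>t. - \<phi> t" and h' = "\<lambda>t. - \<phi>' t"])
    show "C1_half fst" by (intro C1_half_linear bounded_linear_fst)
  qed (auto intro!: DERIV_minus \<phi>_der continuous_intros \<phi>'_cont)
  show ?thesis using C1_half_add[OF 1 2] by (simp add: energy_def[abs_def])
qed

lemma C1_probe:
  assumes a: "-b < a" "a \<le> a'"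
  shows "C1_half (probe m n a a' c d l u)"
proof -
  have v: "C1_half (\<lambda>w. fst (snd w))"
    by (intro C1_half_linear bounded_linear_compose[OF bounded_linear_fst bounded_linear_snd])
  have \<eta>: "C1_half (\<lambda>w. snd (snd w) $ i)" for i
    by (intro C1_half_linear bounded_linear_compose[OF bounded_linear_vec_nth] bounded_linear_compose[OF bounded_linear_snd bounded_linear_snd])
  have x: "C1_half fst" by (intro C1_half_linear bounded_linear_fst)
  have "C1_half (\<lambda>w. cutoff m (fst w))"
    by (rule C1_half_comp_UNIV[OF x cutoff_deriv]) (intro continuous_intros, auto)
  moreover have "C1_half (\<lambda>w. bump n s t (snd (snd w) $ i))" for s t i
    by (rule C1_half_comp_UNIV[OF \<eta> bump_deriv bump'_cont])
  moreover have "C1_half (\<lambda>w. bump n a a' (energy w))"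
    by (rule C1_half_comp_UNIV[OF C1_energy bump_deriv bump'_cont])
  moreover have "C1_half (\<lambda>w. bump_int n c d (fst (snd w)))"
    by (rule C1_half_comp_UNIV[OF v bump_int_deriv bump_cont])
  moreover have "C1_half (\<lambda>w. amp n a a' c d (energy w))"
    by (rule C1_half_comp_UNIV[OF C1_energy amp_deriv[OF a] amp'_cont[OF a]])
  ultimately show ?thesis
    unfolding probe_def[abs_def] lateral_def primitive_def by (intro C1_half_mult C1_half_add)
qed

lemma primitive_support:
  assumes a: "-b < a" "a \<le> a'" and x: "fst w \<ge> 0" and nz: "primitive n a a' c d w \<noteq> 0"
  shows "energy w \<in> {a<..<a'}" "\<bar>fst (snd w)\<bar> \<le> wall_speed a'" "wall_speed (energy w) \<le> wall_speed a'"
proof -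
  show e: "energy w \<in> {a<..<a'}"
  proof (rule ccontr)
    assume "energy w \<notin> {a<..<a'}"
    then show False using nz bump_outside(1)[OF a(2)] by (simp add: primitive_def amp_def)
  qed
  have "\<phi> (fst w) \<le> b" using \<phi>_le x by simp
  then have "(fst (snd w))\<^sup>2 \<le> 2 * (a' + b)" using e by (simp add: energy_def)
  then have "sqrt ((fst (snd w))\<^sup>2) \<le> sqrt (2 * (a' + b))" by (rule real_sqrt_le_mono)
  then show "\<bar>fst (snd w)\<bar> \<le> wall_speed a'" by (simp add: wall_speed_def)
  show "wall_speed (energy w) \<le> wall_speed a'" using e by (simp add: wall_speed_def)
qed

text \<open>On the support the energy is less than \<open>a'\<close>, hence speeds are at most \<open>wall_speed a'\<close>, uniformly in the
  position.\<close>

lemma primitive_bound: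
  assumes a: "-b < a" "a \<le> a'" and x: "fst w \<ge> 0"
  shows "\<bar>fst (snd w) * primitive n a a' c d w\<bar> \<le> wall_speed a' * (wall_speed a' + 2 * wall_speed a' / (1 - \<alpha>))"
proof (cases "primitive n a a' c d w = 0")
  case True
  then show ?thesis using a \<alpha> by (auto simp: wall_speed_def intro!: mult_nonneg_nonneg add_nonneg_nonneg divide_nonneg_nonneg)
next
  case False
  note s = primitive_support[OF a x False]
  let ?M = "wall_speed a'" and ?s = "wall_speed (energy w)"
  have M: "?M \<ge> 0" using a by (simp add: wall_speed_def)
  have s0: "?s \<ge> 0" using s(1) a by (simp add: wall_speed_def)
  have K: "\<bar>bump_int n c d (fst (snd w))\<bar> \<le> ?M" "\<bar>bump_int n c d ?s\<bar> \<le> ?M" "\<bar>bump_int n c d (- ?s)\<bar> \<le> ?M"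
    using bump_int_le[of n c d "fst (snd w)"] bump_int_le[of n c d ?s] bump_int_le[of n c d "- ?s"] s s0 by auto
  have "\<bar>reflected n c d (energy w)\<bar> = \<bar>\<alpha> * bump_int n c d ?s - bump_int n c d (- ?s)\<bar> / (1 - \<alpha>)"
    using \<alpha> by (simp add: reflected_def)
  also have "\<dots> \<le> (2 * ?M) / (1 - \<alpha>)"
  proof (rule divide_right_mono)
    have "\<bar>\<alpha> * bump_int n c d ?s\<bar> \<le> 1 * ?M" unfolding abs_mult using \<alpha> K by (intro mult_mono) auto
    then show "\<bar>\<alpha> * bump_int n c d ?s - bump_int n c d (- ?s)\<bar> \<le> 2 * ?M" using K by linarith
  qed (use \<alpha> in simp)
  finally have r: "\<bar>reflected n c d (energy w)\<bar> \<le> (2 * ?M) / (1 - \<alpha>)" .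
  have "primitive n a a' c d w = bump n a a' (energy w) * (bump_int n c d (fst (snd w)) + reflected n c d (energy w))"
    by (simp add: primitive_def amp_def distrib_left)
  then have "\<bar>primitive n a a' c d w\<bar> = bump n a a' (energy w) * \<bar>bump_int n c d (fst (snd w)) + reflected n c d (energy w)\<bar>"
    using bump_01(1)[of n a a' "energy w"] by (simp add: abs_mult)
  also have "\<dots> \<le> 1 * (?M + 2 * ?M / (1 - \<alpha>))"
    using bump_01[of n a a' "energy w"] K(1) r by (intro mult_mono) auto
  finally show ?thesis unfolding abs_mult using s(2) M by (intro mult_mono) auto
qed

lemma probe_test_function:
  assumes a: "-b < a" "a \<le> a'" and lu: "\<And>i. l$i \<le> u$i"
  shows "probe m n a a' c d l u \<in> test_functions \<alpha>"
  unfolding test_functions_def mem_Collect_eq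
proof (intro conjI)
  show "\<exists>D :: real \<times> velocity \<Rightarrow> (real \<times> velocity) \<Rightarrow>\<^sub>L real.
        (\<forall>z \<in> {0..} \<times> UNIV. (probe m n a a' c d l u has_derivative blinfun_apply (D z)) (at z within {0..} \<times> UNIV)) \<and>
        continuous_on ({0..} \<times> UNIV) D"
    using C1_probe[OF a, of m n c d l u] unfolding C1_half_def .
  let ?M = "wall_speed a'"
  let ?K = "{0..real (Suc m)} \<times> ({- ?M..?M} \<times> cbox l u)"
  have "{z \<in> {0..} \<times> UNIV. probe m n a a' c d l u z \<noteq> 0} \<subseteq> ?K"
  proof
    fix z assume z: "z \<in> {z \<in> {0..} \<times> UNIV. probe m n a a' c d l u z \<noteq> 0}"
    then have x: "fst z \<ge> 0" and nz: "cutoff m (fst z) \<noteq> 0" "lateral n l u (snd (snd z)) \<noteq> 0" "primitive n a a' c d z \<noteq> 0"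
      by (auto simp: probe_def mem_Times_iff)
    have "fst z \<le> real (Suc m)" using cutoff_zero[of m "fst z"] nz(1) by linarith
    moreover have "\<bar>fst (snd z)\<bar> \<le> ?M" by (rule primitive_support(2)[OF a x nz(3)])
    moreover have "snd (snd z) $ i \<in> {l$i<..<u$i}" for i
    proof (rule ccontr)
      assume n: "snd (snd z) $ i \<notin> {l$i<..<u$i}"
      have "i = 1 \<or> i = 2" by (rule exhaust_2)
      then show False using bump_outside(1)[OF lu n, of n] nz(2) by (auto simp: lateral_def)
    qed
    then have "snd (snd z) \<in> cbox l u" by (auto simp: mem_box_cart less_imp_le)
    ultimately show "z \<in> ?K" using x by (cases z) auto
  qed
  moreover have "compact ?K" by (intro compact_Times) auto
  ultimately show "compact (closure {z \<in> {0..} \<times> UNIV. probe m n a a' c d l u z \<noteq> 0})"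
    using compact_closure bounded_subset compact_imp_bounded by blast
  show "\<forall>s \<eta>. s > 0 \<longrightarrow> \<alpha> * probe m n a a' c d l u (0, (s, \<eta>)) = probe m n a a' c d l u (0, (- s, \<eta>))"
  proof (intro allI impI)
    fix s :: real and \<eta> :: "real^2" assume s: "s > 0"
    define E where "E = s\<^sup>2 / 2 - b"
    have e: "energy (0, (s, \<eta>)) = E" "energy (0, (- s, \<eta>)) = E" by (auto simp: energy_def E_def \<phi>0)
    have w: "wall_speed E = s" using s by (simp add: wall_speed_def E_def)
    have "\<alpha> * (bump_int n c d s + reflected n c d E) = bump_int n c d (- s) + reflected n c d E"
      using \<alpha> unfolding reflected_def w by (simp add: field_simps)
    then have "\<alpha> * primitive n a a' c d (0, (s, \<eta>)) = primitive n a a' c d (0, (- s, \<eta>))"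
      unfolding primitive_def amp_def e snd_conv fst_conv by (metis (no_types, opaque_lifting) distrib_left mult.left_commute)
    then show "\<alpha> * probe m n a a' c d l u (0, (s, \<eta>)) = probe m n a a' c d l u (0, (- s, \<eta>))"
      unfolding probe_def snd_conv fst_conv by (metis mult.left_commute)
  qed
qed

text \<open>Transport annihilates functions of the energy.  What remains is the derivative of the cutoff and, from
  the primitive, the bump in the velocity.\<close>

lemma transport_probe:
  assumes a: "-b < a" "a \<le> a'" and x: "fst w > 0"
  shows "transport (probe m n a a' c d l u) w =
     2 * max 0 (1 - fst w / real (Suc m)) * (- (1 / real (Suc m))) * lateral n l u (snd (snd w)) * (fst (snd w) * primitive n a a' c d w)
     + \<phi>' (fst w) * (cutoff m (fst w) * lateral n l u (snd (snd w)) * (bump n a a' (energy w) * bump n c d (fst (snd w))))"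
proof -
  obtain y s \<eta> where w: "w = (y, (s, \<eta>))" by (cases w) auto
  have y: "y > 0" using x w by simp
  let ?W = "lateral n l u \<eta>" and ?E = "energy w" and ?z = "2 * max 0 (1 - y / real (Suc m)) * (- (1 / real (Suc m)))"
  have Ex: "((\<lambda>y. energy (y, (s, \<eta>))) has_real_derivative - \<phi>' y) (at y)"
    unfolding energy_def fst_conv snd_conv by (rule DERIV_cong[OF DERIV_diff[OF DERIV_const \<phi>_der_at[OF y]]]) simp
  have Es: "((\<lambda>s. energy (y, (s, \<eta>))) has_real_derivative s) (at s)"
    unfolding energy_def fst_conv snd_conv by (auto intro!: derivative_eq_intros)
  have E: "energy (y, (s, \<eta>)) = ?E" by (simp add: w)
  note chain = DERIV_chain2[OF _ Ex] DERIV_chain2[OF _ Es]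
  have tx: "((\<lambda>y. bump n a a' (energy (y, (s, \<eta>)))) has_real_derivative bump' n a a' ?E * (- \<phi>' y)) (at y)"
    by (rule DERIV_chain2[OF _ Ex]) (simp add: E bump_deriv)
  have ax: "((\<lambda>y. amp n a a' c d (energy (y, (s, \<eta>)))) has_real_derivative amp' n a a' c d ?E * (- \<phi>' y)) (at y)"
    by (rule DERIV_chain2[OF _ Ex]) (simp add: E amp_deriv[OF a])
  have ts: "((\<lambda>s. bump n a a' (energy (y, (s, \<eta>)))) has_real_derivative bump' n a a' ?E * s) (at s)"
    by (rule DERIV_chain2[OF _ Es]) (simp add: E bump_deriv)
  have as: "((\<lambda>s. amp n a a' c d (energy (y, (s, \<eta>)))) has_real_derivative amp' n a a' c d ?E * s) (at s)"
    by (rule DERIV_chain2[OF _ Es]) (simp add: E amp_deriv[OF a])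
  have Px: "((\<lambda>y. primitive n a a' c d (y, (s, \<eta>))) has_real_derivative
      - \<phi>' y * (bump' n a a' ?E * bump_int n c d s + amp' n a a' c d ?E)) (at y)"
    unfolding primitive_def snd_conv fst_conv
    by (rule DERIV_cong[OF DERIV_add[OF DERIV_cmult_right[OF tx] ax]]) (simp add: algebra_simps)
  have Ps: "((\<lambda>s. primitive n a a' c d (y, (s, \<eta>))) has_real_derivative
      s * (bump' n a a' ?E * bump_int n c d s + amp' n a a' c d ?E) + bump n a a' ?E * bump n c d s) (at s)"
    unfolding primitive_def snd_conv fst_conv
    by (rule DERIV_cong[OF DERIV_add[OF DERIV_mult[OF ts bump_int_deriv] as]]) (simp add: algebra_simps E)
  have dx: "deriv (\<lambda>y. probe m n a a' c d l u (y, (s, \<eta>))) y = 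
     ?z * ?W * primitive n a a' c d w + cutoff m y * ?W * (- \<phi>' y * (bump' n a a' ?E * bump_int n c d s + amp' n a a' c d ?E))"
    unfolding probe_def snd_conv fst_conv
    by (rule DERIV_imp_deriv, rule DERIV_cong[OF DERIV_mult[OF DERIV_cmult_right[OF cutoff_deriv] Px]]) (simp only: w mult.commute add.commute)
  have ds: "deriv (\<lambda>s. probe m n a a' c d l u (y, (s, \<eta>))) s = 
     cutoff m y * ?W * (s * (bump' n a a' ?E * bump_int n c d s + amp' n a a' c d ?E) + bump n a a' ?E * bump n c d s)"
    unfolding probe_def snd_conv fst_conv
    by (rule DERIV_imp_deriv, rule DERIV_cmult[OF Ps])
  have ident: "s * (z * W * P + C * W * (- f * Q)) + f * (C * W * (s * Q + t * k)) = z * W * (s * P) + f * (C * W * (t * k))"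
    for z W P C f Q t k :: real by (simp add: algebra_simps)
  show ?thesis
    unfolding transport_def unfolding w snd_conv fst_conv unfolding dx ds unfolding w[symmetric]
    by (rule ident)
qed

end

lemma box_Pair_eq: "box (a, b) (c, d) = box a c \<times> box b d"
  by (auto simp: box_def Basis_prod_def ball_Un inner_Pair)

context attractive_solution
begin

lemma gap_slab_integrable: "integrable lborel (\<lambda>w. indicator {0<..<X} (fst w) * gap w)"
proof (rule integrableI_bounded)
  obtain C where C: "C \<ge> 0" "\<And>x. gap_norm x \<le> C" by (rule gap_norm_bounded) blast
  have [measurable]: "gap \<in> borel_measurable (borel \<Otimes>\<^sub>M borel)" unfolding borel_prod by (rule gap_measurable)
  have "(\<lambda>w. indicator {0<..<X} (fst w) * gap w) \<in> borel_measurable (borel \<Otimes>\<^sub>M borel)" by measurable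
  then show m: "(\<lambda>w. indicator {0<..<X} (fst w) * gap w) \<in> borel_measurable lborel" by (simp add: borel_prod)
  have "(\<integral>\<^sup>+w. ennreal (norm (indicator {0<..<X} (fst w) * gap w)) \<partial>lborel)
     = (\<integral>\<^sup>+x. \<integral>\<^sup>+z. ennreal (norm (indicator {0<..<X} x * gap (x, z))) \<partial>lborel \<partial>lborel)"
    using m by (subst nn_integral_lborel_pair(2)) auto
  also have "\<dots> \<le> (\<integral>\<^sup>+x. ennreal C * indicator {0<..<X} x \<partial>lborel)"
  proof (intro nn_integral_mono)
    fix x :: real
    show "(\<integral>\<^sup>+z. ennreal (norm (indicator {0<..<X} x * gap (x, z))) \<partial>lborel) \<le> ennreal C * indicator {0<..<X} x"
      using C(2)[of x] by (cases "x \<in> {0<..<X}") (auto simp: nn_integral_gap ennreal_leI)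
  qed
  also have "\<dots> = ennreal C * emeasure lborel {0<..<X}" by (subst nn_integral_cmult_indicator) auto
  also have "\<dots> < \<infinity>" by (cases "0 \<le> X") (auto simp: ennreal_mult_less_top emeasure_lborel_Ioo)
  finally show "(\<integral>\<^sup>+w. ennreal (norm (indicator {0<..<X} (fst w) * gap w)) \<partial>lborel) < \<infinity>" .
qed

text \<open>A continuous approximation of the indicator function of a box in energy coordinates.\<close>

definition probe_density :: "nat \<Rightarrow> real \<Rightarrow> real \<Rightarrow> real \<Rightarrow> real \<Rightarrow> real^2 \<Rightarrow> real^2 \<Rightarrow> real \<times> velocity \<Rightarrow> real" where
  "probe_density n a a' c d l u e = lateral n l u (snd (snd e)) * (bump n a a' (fst e) * bump n c d (fst (snd e)))"

lemma lateral_01: "0 \<le> lateral n l u \<eta>" "lateral n l u \<eta> \<le> 1"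
  using bump_01[of n "l$1" "u$1" "\<eta>$1"] bump_01[of n "l$2" "u$2" "\<eta>$2"] by (auto simp: lateral_def mult_le_one)

lemma probe_density_01: "0 \<le> probe_density n a a' c d l u e" "probe_density n a a' c d l u e \<le> 1"
  using lateral_01[of n l u "snd (snd e)"] bump_01[of n a a' "fst e"] bump_01[of n c d "fst (snd e)"]
  by (auto simp: probe_density_def intro!: mult_nonneg_nonneg mult_le_one)

lemma bump_measurable [measurable]: "bump n l u \<in> borel_measurable borel"
  by (intro borel_measurable_continuous_onI bump_cont)

lemma lateral_measurable [measurable]: "lateral n l u \<in> borel_measurable borel"
proof -
  have "continuous_on UNIV (lateral n l u)"
    unfolding lateral_def[abs_def] by (intro continuous_intros continuous_on_compose2[OF bump_cont[of UNIV]]) auto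
  then show ?thesis by (rule borel_measurable_continuous_onI)
qed

lemma probe_density_measurable [measurable]: "probe_density n a a' c d l u \<in> borel_measurable borel"
proof -
  have "probe_density n a a' c d l u \<in> borel_measurable (borel \<Otimes>\<^sub>M (borel \<Otimes>\<^sub>M borel))"
    unfolding probe_density_def[abs_def] by measurable
  then show ?thesis by (simp add: borel_prod)
qed

lemma sqpos_measurable [measurable]: "sqpos \<in> borel_measurable borel"
  by (intro borel_measurable_continuous_onI sqpos_cont)

lemma cutoff_measurable [measurable]: "(\<lambda>w :: real \<times> velocity. cutoff m (fst w)) \<in> borel_measurable borel"
proof -
  have "(\<lambda>w :: real \<times> velocity. cutoff m (fst w)) \<in> borel_measurable (borel \<Otimes>\<^sub>M borel)"
    unfolding cutoff_def by measurable
  then show ?thesis by (simp add: borel_prod)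
qed

lemma energy_map_eq: "x \<ge> 0 \<Longrightarrow> energy_map (x, z) = (energy (x, z), z)"
  by (simp add: energy_map_def energy_def)

text \<open>Testing the homogeneous equation with \<open>probe\<close> leaves the integral of the gap against the bumps and an
  error from the cutoff, which is an average of \<open>gap_norm\<close> over \<open>(0, m + 1)\<close>.\<close>

lemma probe_identity:
  assumes a: "-b < a" "a \<le> a'" and lu: "\<And>i. l$i \<le> u$i"
  shows "\<bar>LINT w|lborel. flux w * gap w * (cutoff m (fst w) * probe_density n a a' c d l u (energy_map w))\<bar>
    \<le> wall_speed a' * (wall_speed a' + 2 * wall_speed a' / (1 - \<alpha>)) * (LINT x|lborel. indicator {0<..<real (Suc m)} x * (2 / real (Suc m) * gap_norm x))"
proof -
  let ?C = "wall_speed a' * (wall_speed a' + 2 * wall_speed a' / (1 - \<alpha>))"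
  let ?q = "\<lambda>w. flux w * gap w * (cutoff m (fst w) * probe_density n a a' c d l u (energy_map w))"
  let ?p = "\<lambda>w. indicator ({0<..} \<times> UNIV) w * (gap w * transport (probe m n a a' c d l u) w)"
  let ?s = "\<lambda>w. (2 / real (Suc m)) * ?C * \<bar>indicator {0<..<real (Suc m)} (fst w) * gap w\<bar>"
  have C0: "?C \<ge> 0" using a \<alpha> by (auto simp: wall_speed_def intro!: mult_nonneg_nonneg add_nonneg_nonneg divide_nonneg_nonneg)
  note tf = probe_test_function[OF a lu, where m = m and n = n and c = c and d = d]
  note p = gap_weak[OF tf]
  have iq: "integrable lborel ?q"
  proof (rule Bochner_Integration.integrable_bound[OF flux_gap_integrable])
    show "AE w in lborel. norm (?q w) \<le> norm (flux w * gap w)"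
    proof (intro AE_I2)
      fix w :: "real \<times> velocity"
      show "norm (?q w) \<le> norm (flux w * gap w)"
      proof (cases "fst w > 0")
        case True
        then have "\<bar>cutoff m (fst w) * probe_density n a a' c d l u (energy_map w)\<bar> \<le> 1"
          using cutoff_01[of "fst w" m] probe_density_01[of n a a' c d l u "energy_map w"] by (auto simp: abs_mult intro!: mult_le_one)
        then have "\<bar>flux w * gap w\<bar> * \<bar>cutoff m (fst w) * probe_density n a a' c d l u (energy_map w)\<bar> \<le> \<bar>flux w * gap w\<bar> * 1"
          by (intro mult_left_mono) auto
        then show ?thesis by (simp add: abs_mult)
      qed (simp add: flux_def)
    qed
  qed measurable
  have rem: "\<bar>?p w + ?q w\<bar> \<le> ?s w" for w
  proof (cases "fst w > 0")
    case True
    obtain x z where w: "w = (x, z)" by (cases w)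
    have x: "x > 0" using True w by simp
    have fl: "flux w = - \<phi>' x" using x \<phi>'_neg[of x] by (simp add: flux_def w)
    have em: "energy_map w = (energy w, snd w)" using x by (simp add: energy_map_eq w)
    let ?k = "2 * max 0 (1 - x / real (Suc m)) * (- (1 / real (Suc m)))" and ?L = "lateral n l u (snd z)"
    let ?P = "fst z * primitive n a a' c d w"
    have e1: "?p w + ?q w = gap w * (?k * ?L * ?P)"
      unfolding transport_probe[OF a True] fl em probe_density_def using x by (simp add: w algebra_simps)
    have e2: "\<bar>?k * ?L * ?P\<bar> \<le> (2 / real (Suc m) * indicator {0<..<real (Suc m)} x) * 1 * ?C"
      unfolding abs_mult[of _ ?P] abs_mult[of _ ?L]
    proof (intro mult_mono)
      show "\<bar>?k\<bar> \<le> 2 / real (Suc m) * indicator {0<..<real (Suc m)} x"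
      proof (cases "x < real (Suc m)")
        case True
        then have "0 \<le> 1 - x / real (Suc m)" "1 - x / real (Suc m) \<le> 1" using x by (auto simp: divide_simps)
        then have "max 0 (1 - x / real (Suc m)) \<le> 1" by simp
        then have "2 * max 0 (1 - x / real (Suc m)) * (1 / real (Suc m)) \<le> 2 * 1 * (1 / real (Suc m))" by (intro mult_right_mono mult_left_mono) auto
        moreover have "?k \<le> 0" by (intro mult_nonneg_nonpos) auto
        then have "\<bar>?k\<bar> = 2 * max 0 (1 - x / real (Suc m)) * (1 / real (Suc m))"
          by (simp only: abs_of_nonpos mult_minus_right minus_minus)
        moreover have "2 * 1 * (1 / real (Suc m)) = 2 / real (Suc m) * indicator {0<..<real (Suc m)} x" using True x by simp
        ultimately show ?thesis by (simp only:)
      next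
        case False
        then have "1 - x / real (Suc m) \<le> 0" by (simp add: divide_simps)
        then show ?thesis by (simp add: max_def)
      qed
      show "\<bar>?L\<bar> \<le> 1" using lateral_01[of n l u "snd z"] by simp
      show "\<bar>?P\<bar> \<le> ?C" using primitive_bound[OF a, of w n c d] x by (simp add: w)
    qed (use C0 in auto)
    have "\<bar>?p w + ?q w\<bar> = \<bar>gap w\<bar> * \<bar>?k * ?L * ?P\<bar>" unfolding e1 by (rule abs_mult)
    also have "\<dots> \<le> \<bar>gap w\<bar> * ((2 / real (Suc m) * indicator {0<..<real (Suc m)} x) * 1 * ?C)"
      by (rule mult_left_mono[OF e2]) simp
    finally have "\<bar>?p w + ?q w\<bar> \<le> \<bar>gap w\<bar> * ((2 / real (Suc m) * indicator {0<..<real (Suc m)} x) * 1 * ?C)" .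
    moreover have "\<bar>indicator {0<..<real (Suc m)} (fst w) * gap w\<bar> = indicator {0<..<real (Suc m)} x * \<bar>gap w\<bar>"
      by (simp add: abs_mult w)
    moreover have "g * ((t * i) * 1 * B) = t * B * (i * g)" for g t i B :: real by simp
    ultimately show ?thesis by (simp only:)
  next
    case False
    have "?s w \<ge> 0" by (rule mult_nonneg_nonneg[OF mult_nonneg_nonneg[OF _ C0]]) auto
    moreover have "?p w + ?q w = 0" using False by (cases w) (auto simp: flux_def)
    ultimately show ?thesis by (simp only: abs_zero)
  qed
  have slab: "integrable lborel (\<lambda>w. \<bar>indicator {0<..<real (Suc m)} (fst w) * gap w\<bar>)" by (intro integrable_abs gap_slab_integrable)
  have "(LINT w|lborel. ?q w) = (LINT w|lborel. ?p w + ?q w)"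
    using p iq by (subst Bochner_Integration.integral_add) auto
  then have "\<bar>LINT w|lborel. ?q w\<bar> \<le> (LINT w|lborel. \<bar>?p w + ?q w\<bar>)"
    using integral_norm_bound[of lborel "\<lambda>w. ?p w + ?q w"] by simp
  also have "\<dots> \<le> (LINT w|lborel. ?s w)"
    using p(1) iq by (intro integral_mono[OF _ _ rem] integrable_abs Bochner_Integration.integrable_add integrable_mult_right slab) auto
  also have "\<dots> = (2 / real (Suc m)) * ?C * (LINT x|lborel. LINT z|lborel. \<bar>indicator {0<..<real (Suc m)} (fst (x, z)) * gap (x, z)\<bar>)"
    by (simp only: integral_mult_right_zero integral_lborel_pair(1)[OF slab])
  also have "(LINT x|lborel. LINT z|lborel. \<bar>indicator {0<..<real (Suc m)} (fst (x, z)) * gap (x, z)\<bar>)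
     = (LINT x|lborel. indicator {0<..<real (Suc m)} x * gap_norm x)"
    by (simp add: abs_mult gap_norm_def)
  also have "(2 / real (Suc m)) * ?C * (LINT x|lborel. indicator {0<..<real (Suc m)} x * gap_norm x)
     = ?C * (LINT x|lborel. indicator {0<..<real (Suc m)} x * (2 / real (Suc m) * gap_norm x))"
  proof -
    have e: "indicator {0<..<real (Suc m)} x * (2 / real (Suc m) * gap_norm x) = (2 / real (Suc m)) * (indicator {0<..<real (Suc m)} x * gap_norm x)" for x
      by simp
    show ?thesis unfolding e integral_mult_right_zero by (simp only: mult.commute mult.left_commute)
  qed
  finally show ?thesis .
qed

lemma probe_density_integral:
  assumes a: "-b < a" "a \<le> a'" and lu: "\<And>i. l$i \<le> u$i"
  shows "(LINT w|lborel. flux w * gap w * probe_density n a a' c d l u (energy_map w)) = 0"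
proof -
  let ?C = "wall_speed a' * (wall_speed a' + 2 * wall_speed a' / (1 - \<alpha>))"
  let ?q = "\<lambda>m w. flux w * gap w * (cutoff m (fst w) * probe_density n a a' c d l u (energy_map w))"
  obtain K where K: "K \<ge> 0" "\<And>x. gap_norm x \<le> K" by (rule gap_norm_bounded) blast
  have av: "(\<lambda>m. LINT x|lborel. indicator {0<..<real (Suc m)} x * (2 / real (Suc m) * gap_norm x)) \<longlonglongrightarrow> 0"
    using K gap_norm_nonneg by (intro average_vanishes[where C = K] gap_norm_limit) auto
  have "(\<lambda>m. LINT w|lborel. ?q m w) \<longlonglongrightarrow> 0"
  proof (rule Lim_null_comparison)
    show "\<forall>\<^sub>F m in sequentially. norm (LINT w|lborel. ?q m w) \<le> ?C * (LINT x|lborel. indicator {0<..<real (Suc m)} x * (2 / real (Suc m) * gap_norm x))"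
      unfolding real_norm_def by (intro always_eventually allI probe_identity[OF a lu])
    show "(\<lambda>m. ?C * (LINT x|lborel. indicator {0<..<real (Suc m)} x * (2 / real (Suc m) * gap_norm x))) \<longlonglongrightarrow> 0"
      using tendsto_mult_left[OF av, of ?C] by simp
  qed
  moreover have "(\<lambda>m. LINT w|lborel. ?q m w) \<longlonglongrightarrow> (LINT w|lborel. flux w * gap w * probe_density n a a' c d l u (energy_map w))"
  proof (rule integral_dominated_convergence[where w = "\<lambda>w. \<bar>flux w * gap w\<bar>"])
    show "integrable lborel (\<lambda>w. \<bar>flux w * gap w\<bar>)" by (intro integrable_abs flux_gap_integrable)
    show "AE w in lborel. (\<lambda>m. ?q m w) \<longlonglongrightarrow> flux w * gap w * probe_density n a a' c d l u (energy_map w)"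
    proof (intro AE_I2)
      fix w :: "real \<times> velocity"
      have "(\<lambda>m. ?q m w) \<longlonglongrightarrow> flux w * gap w * (1 * probe_density n a a' c d l u (energy_map w))"
        by (intro tendsto_intros cutoff_limit)
      then show "(\<lambda>m. ?q m w) \<longlonglongrightarrow> flux w * gap w * probe_density n a a' c d l u (energy_map w)" by simp
    qed
    show "AE w in lborel. norm (?q m w) \<le> \<bar>flux w * gap w\<bar>" for m
    proof (intro AE_I2)
      fix w :: "real \<times> velocity"
      show "norm (?q m w) \<le> \<bar>flux w * gap w\<bar>"
      proof (cases "fst w > 0")
        case True
        then have "\<bar>cutoff m (fst w) * probe_density n a a' c d l u (energy_map w)\<bar> \<le> 1"
          using cutoff_01[of "fst w" m] probe_density_01[of n a a' c d l u "energy_map w"] by (auto simp: abs_mult intro!: mult_le_one)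
        then have "\<bar>flux w * gap w\<bar> * \<bar>cutoff m (fst w) * probe_density n a a' c d l u (energy_map w)\<bar> \<le> \<bar>flux w * gap w\<bar> * 1"
          by (intro mult_left_mono) auto
        then show ?thesis by (simp add: abs_mult)
      qed (simp add: flux_def)
    qed
  qed measurable
  ultimately show ?thesis by (rule LIMSEQ_unique[symmetric])
qed

lemma mem_box_triple: "fst e \<in> {a<..<a'} \<and> fst (snd e) \<in> {c<..<d} \<and> (\<forall>i. l$i < snd (snd e) $ i \<and> snd (snd e) $ i < u$i) \<longleftrightarrow> e \<in> box (a, (c, l)) (a', (d, u))"
  for e :: "real \<times> velocity"
  by (cases e) (auto simp: box_Pair_eq mem_box_cart)

lemma inner_box_integral:
  assumes a: "-b < a" "a \<le> a'" and cd: "c \<le> d" and lu: "\<And>i. l$i \<le> u$i"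
  shows "(LINT w|lborel. flux w * gap w * indicator (box (a, (c, l)) (a', (d, u))) (energy_map w)) = 0"
proof -
  let ?B = "box (a, (c, l)) (a', (d, u)) :: (real \<times> velocity) set"
  have lim: "(\<lambda>n. probe_density n a a' c d l u e) \<longlonglongrightarrow> indicator ?B e" for e
  proof -
    have "(\<lambda>n. probe_density n a a' c d l u e) \<longlonglongrightarrow>
       indicator {l$1<..<u$1} (snd (snd e) $ 1) * indicator {l$2<..<u$2} (snd (snd e) $ 2) * (indicator {a<..<a'} (fst e) * indicator {c<..<d} (fst (snd e)))"
      unfolding probe_density_def lateral_def by (intro tendsto_mult bump_limit a cd lu)
    also have "indicator {l$1<..<u$1} (snd (snd e) $ 1) * indicator {l$2<..<u$2} (snd (snd e) $ 2) * (indicator {a<..<a'} (fst e) * indicator {c<..<d} (fst (snd e)))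
       = (indicator ?B e :: real)"
      unfolding indicator_def of_bool_def mem_box_triple[symmetric] forall_2 by auto
    finally show ?thesis .
  qed
  have "(\<lambda>n. LINT w|lborel. flux w * gap w * probe_density n a a' c d l u (energy_map w)) \<longlonglongrightarrow> (LINT w|lborel. flux w * gap w * indicator ?B (energy_map w))"
  proof (rule integral_dominated_convergence[where w = "\<lambda>w. \<bar>flux w * gap w\<bar>"])
    show "integrable lborel (\<lambda>w. \<bar>flux w * gap w\<bar>)" by (intro integrable_abs flux_gap_integrable)
    show "AE w in lborel. (\<lambda>n. flux w * gap w * probe_density n a a' c d l u (energy_map w)) \<longlonglongrightarrow> flux w * gap w * indicator ?B (energy_map w)"
      by (intro AE_I2 tendsto_mult tendsto_const lim)
    show "AE w in lborel. norm (flux w * gap w * probe_density n a a' c d l u (energy_map w)) \<le> \<bar>flux w * gap w\<bar>" for n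
      unfolding real_norm_def abs_mult[of _ "probe_density _ _ _ _ _ _ _ _"]
      using probe_density_01 by (intro AE_I2 mult_left_le) auto
  qed measurable
  then show ?thesis unfolding probe_density_integral[OF a lu] by (simp add: LIMSEQ_const_iff)
qed

text \<open>Energies in phase space exceed \<open>- b\<close>, so boxes with a lower energy bound are
  exhausted by boxes whose energy bound is greater than \<open>- b\<close>.\<close>

lemma box_integral: "(LINT w|lborel. flux w * gap w * indicator (box L U) (energy_map w)) = 0"
proof -
  obtain a c l where L: "L = (a, (c, l))" by (cases L) auto
  obtain a' d u where U: "U = (a', (d, u))" by (cases U) auto
  show ?thesis
  proof (cases "box L U = {} \<or> a' \<le> - b")
    case True
    have eq0: "flux w * gap w * indicator (box L U) (energy_map w) = 0" for w
    proof (cases "fst w > 0")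
      case pos: True
      have "- b < energy w" using \<phi>_less[OF pos] zero_le_power2[of "fst (snd w)"] unfolding energy_def by linarith
      then have "energy_map w \<notin> box L U"
        using True pos energy_map_eq[of "fst w" "snd w"] by (auto simp: L U box_Pair_eq)
      then show ?thesis by simp
    qed (simp add: flux_def)
    show ?thesis unfolding eq0 by simp
  next
    case False
    then obtain e where "e \<in> box L U" by auto
    then have ne: "a < a'" "c < d" "\<And>i. l$i < u$i" unfolding L U mem_box_triple[symmetric] by (auto, (meson less_trans)+)
    \<comment> \<open>lower energy bounds in \<open>(- b, a']\<close> that tend to \<open>max a (- b)\<close>\<close>
    define an where "an n = max a (- b + (a' + b) / real (Suc (Suc n)))" for n
    have ab: "a' + b > 0" using False by simp
    have an: "- b < an n" "an n \<le> a'" for n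
    proof -
      have "(a' + b) / real (Suc (Suc n)) > 0" using ab by simp
      then show "- b < an n" by (simp add: an_def less_max_iff_disj)
      have "(a' + b) / real (Suc (Suc n)) \<le> (a' + b) / 1" using ab by (intro divide_left_mono) auto
      then show "an n \<le> a'" using ne by (simp add: an_def)
    qed
    have an_lim: "an \<longlonglongrightarrow> max a (- b)"
    proof -
      have "(\<lambda>n. max a (- b + (a' + b) * (1 / real (Suc (Suc n))))) \<longlonglongrightarrow> max a (- b + (a' + b) * 0)"
        using LIMSEQ_Suc[OF LIMSEQ_Suc[OF lim_1_over_n]] by (intro tendsto_intros)
      then show ?thesis by (simp add: an_def[abs_def])
    qed
    let ?B = "\<lambda>n. box (an n, (c, l)) (a', (d, u)) :: (real \<times> velocity) set"
    have "(\<lambda>n. LINT w|lborel. flux w * gap w * indicator (?B n) (energy_map w)) \<longlonglongrightarrow> (LINT w|lborel. flux w * gap w * indicator (box L U) (energy_map w))"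
    proof (rule integral_dominated_convergence[where w = "\<lambda>w. \<bar>flux w * gap w\<bar>"])
      show "integrable lborel (\<lambda>w. \<bar>flux w * gap w\<bar>)" by (intro integrable_abs flux_gap_integrable)
      show "AE w in lborel. (\<lambda>n. flux w * gap w * indicator (?B n) (energy_map w)) \<longlonglongrightarrow> flux w * gap w * indicator (box L U) (energy_map w)"
      proof (intro AE_I2)
        fix w :: "real \<times> velocity"
        show "(\<lambda>n. flux w * gap w * indicator (?B n) (energy_map w)) \<longlonglongrightarrow> flux w * gap w * indicator (box L U) (energy_map w)"
        proof (cases "fst w > 0")
          case pos: True
          have Eb: "- b < energy w" using \<phi>_less[OF pos] zero_le_power2[of "fst (snd w)"] unfolding energy_def by linarith
          have em: "energy_map w = (energy w, snd w)" using pos energy_map_eq[of "fst w" "snd w"] by simp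
          have "\<forall>\<^sub>F n in sequentially. indicator (?B n) (energy_map w) = (indicator (box L U) (energy_map w) :: real)"
          proof (cases "a < energy w")
            case True
            then have "max a (- b) < energy w" using Eb by simp
            then have "\<forall>\<^sub>F n in sequentially. an n < energy w" by (rule order_tendstoD(2)[OF an_lim])
            then show ?thesis
              by eventually_elim (use True in \<open>auto simp: em L U box_Pair_eq split: split_indicator\<close>)
          next
            case F: False
            have "energy_map w \<notin> ?B n" for n using F by (auto simp: em box_Pair_eq an_def)
            moreover have "energy_map w \<notin> box L U" using F by (auto simp: em L U box_Pair_eq)
            ultimately show ?thesis by simp
          qed
          then show ?thesis by (intro tendsto_mult tendsto_const tendsto_eventually)
        qed (simp add: flux_def)
      qed
      show "AE w in lborel. norm (flux w * gap w * indicator (?B n) (energy_map w)) \<le> \<bar>flux w * gap w\<bar>" for n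
        by (intro AE_I2) (auto split: split_indicator)
    qed measurable
    then show ?thesis
      using ne by (subst (asm) inner_box_integral[OF an]) (auto simp: LIMSEQ_const_iff less_imp_le)
  qed
qed

text \<open>The integrals over boxes vanish, hence those over all Borel sets in energy coordinates.  As
  \<open>energy_map\<close> is injective for positive positions, the sets where the gap is positive or
  negative are among them.\<close>

lemma gap_zero_AE: "AE w in lborel. fst w > 0 \<longrightarrow> gap w = 0"
proof -
  \<comment> \<open>a Borel left inverse of \<open>energy_map\<close>\<close>
  define P where "P e = indicator energy_range e *\<^sub>R path (fst e) (snd e)" for e
  have pc: "continuous_on energy_range (\<lambda>e. path (fst e) (snd e))"
    unfolding path_def by (intro continuous_intros continuous_on_compose2[OF pos_cont]) (auto simp: energy_range_def)
  have Pm [measurable]: "P \<in> borel_measurable borel"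
    unfolding P_def[abs_def] by (rule borel_measurable_continuous_on_indicator[OF energy_measurable(2) pc])
  have PT: "P (energy_map w) = w \<and> flux w > 0" if "fst w > 0" for w
  proof -
    obtain x v \<eta> where w: "w = (x, (v, \<eta>))" by (cases w) auto
    have x: "x > 0" using that w by simp
    have "energy_map w \<in> energy_range" using x \<phi>_pos[of x] \<phi>_less[of x] by (auto simp: energy_map_def energy_range_def w)
    then show ?thesis using x \<phi>'_neg[of x] by (simp add: P_def path_def energy_map_def w flux_def)
  qed
  have key: "AE w in lborel. \<not> (fst w > 0 \<and> s * gap w > 0)" for s :: real
  proof -
    define A where "A = {e. fst (P e) > 0 \<and> s * gap (P e) > 0}"
    have "open {w :: real \<times> velocity. fst w > 0}" by (intro open_Collect_less continuous_intros)
    then have [measurable]: "{w :: real \<times> velocity. fst w > 0} \<in> sets borel" by (rule borel_open)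
    have "{w :: real \<times> velocity. fst w > 0} \<inter> {w. s * gap w > 0} \<in> sets borel" by measurable
    then have "P -` ({w :: real \<times> velocity. fst w > 0} \<inter> {w. s * gap w > 0}) \<in> sets borel" by (rule measurable_sets_borel[OF Pm])
    also have "P -` ({w :: real \<times> velocity. fst w > 0} \<inter> {w. s * gap w > 0}) = A" by (auto simp: A_def)
    finally have Am [measurable]: "A \<in> sets borel" .
    let ?h = "\<lambda>w. s * (flux w * gap w * indicator A (energy_map w))"
    have z: "(LINT w|lborel. ?h w) = 0"
      using box_integrals_zero[OF flux_gap_integrable energy_measurable(1) box_integral Am] by simp
    have i: "integrable lborel ?h"
    proof (intro integrable_mult_right)
      show "integrable lborel (\<lambda>w. flux w * gap w * indicator A (energy_map w))"
        by (rule Bochner_Integration.integrable_bound[OF flux_gap_integrable]) (auto split: split_indicator)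
    qed
    have h: "?h w \<ge> 0 \<and> (fst w > 0 \<and> s * gap w > 0 \<longrightarrow> ?h w > 0)" for w
    proof (cases "fst w > 0")
      case True
      then have "energy_map w \<in> A \<longleftrightarrow> s * gap w > 0" using PT[OF True] by (auto simp: A_def)
      moreover have "flux w > 0" using PT[OF True] by simp
      moreover have "?h w = flux w * (s * gap w) * indicator A (energy_map w)" by simp
      ultimately show ?thesis by (cases "s * gap w > 0") (simp_all only: indicator_simps mult_1_right mult_zero_right mult_pos_pos less_imp_le, auto)
    qed (simp add: flux_def)
    have "AE w in lborel. ?h w = 0"
      using integral_nonneg_eq_0_iff_AE[OF i] h z by auto
    then show ?thesis by eventually_elim (use h in \<open>metis less_irrefl\<close>)
  qed
  from key[of 1] key[of "-1"] show ?thesis by eventually_elim auto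
qed

text \<open>The gap vanishes for almost every position, and its norm is continuous in the position.\<close>

lemma gap_norm_zero: assumes x: "x \<ge> 0" shows "gap_norm x = 0"
proof (rule ccontr)
  assume "gap_norm x \<noteq> 0"
  then have pos: "gap_norm x > 0" using gap_norm_nonneg[of x] by simp
  have "AE w in lborel \<Otimes>\<^sub>M lborel. fst w > 0 \<longrightarrow> gap w = 0" unfolding lborel_prod by (rule gap_zero_AE)
  from lborel_pair.AE_pair[OF this]
  have ae: "AE y in lborel. y > 0 \<longrightarrow> gap_norm y = 0"
  proof eventually_elim
    case (elim y)
    show ?case
    proof
      assume "y > 0"
      then have "AE z in lborel. \<bar>gap (y, z)\<bar> = 0" using elim by simp
      then show "gap_norm y = 0" unfolding gap_norm_def by (rule integral_eq_zero_AE)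
    qed
  qed
  have "(gap_norm \<longlongrightarrow> gap_norm x) (at x within {0..})" using gap_norm_continuous x by (simp add: continuous_on_def)
  then have "\<forall>\<^sub>F y in at x within {0..}. gap_norm y > 0" using pos by (rule order_tendstoD(1))
  then obtain d where d: "d > 0" "\<And>y. y \<in> {0..} \<Longrightarrow> y \<noteq> x \<Longrightarrow> dist y x < d \<Longrightarrow> gap_norm y > 0"
    unfolding eventually_at by auto
  have sub: "gap_norm y \<noteq> 0" if "y \<in> {x<..<x + d}" for y using d(2)[of y] that x by (auto simp: dist_real_def)
  have "AE y in lborel. y \<notin> {x<..<x + d}" using ae by eventually_elim (use sub x in auto)
  then have "emeasure lborel {y. y \<in> {x<..<x + d}} = 0" by (subst (asm) AE_iff_measurable[OF _ refl]) auto
  then have "emeasure lborel {x<..<x + d} = 0" unfolding Collect_mem_eq .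
  then show False using d by simp
qed

lemma solution_eq_dens: assumes x: "x \<ge> 0" shows "AE z in lborel. f x z = dens (\<phi> x) z"
proof -
  have "AE z in lborel. \<bar>gap (x, z)\<bar> = 0"
    using gap_norm_zero[OF x] unfolding gap_norm_def
    by (subst (asm) integral_nonneg_eq_0_iff_AE) (auto intro: gap_integrable)
  then show ?thesis by eventually_elim (simp add: gap_eq[OF x])
qed

end

section \<open>The Sagdeev potential\<close>

lemma deriv_within_eq:
  assumes "(g has_real_derivative D) (at x within S)" "at x within S \<noteq> bot"
  shows "deriv_within S g x = D"
  unfolding deriv_within_def using assms
  by (intro vector_derivative_within) (auto simp: has_real_derivative_iff_has_vector_derivative)

lemma deriv_within_works:
  assumes "g differentiable_on S" "x \<in> S"
  shows "(g has_real_derivative deriv_within S g x) (at x within S)"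
  unfolding deriv_within_def has_real_derivative_iff_has_vector_derivative
  using assms by (simp add: differentiable_on_def vector_derivative_works)

text \<open>Continuity of \<open>rho\<close> makes \<open>V\<close> an antiderivative of \<open>force\<close> on \<open>[0, b]\<close>.  Poisson's equation for
  the explicit density then reads \<open>\<phi>'' = force \<phi>\<close>, Newton's equation in the potential \<open>- V\<close>.\<close>

locale sheath = attractive_data +
  fixes n_e :: "real \<Rightarrow> real"
  assumes n_e_cont: "continuous_on UNIV n_e" and n_e_0: "n_e 0 = 1"
    and V_C2: "Ck_on 2 {0..b} (V_plus n_e \<alpha> b fb fi)"
begin

abbreviation V :: "real \<Rightarrow> real" where "V \<equiv> V_plus n_e \<alpha> b fb fi"

definition force :: "real \<Rightarrow> real" where "force p = rho p - n_e p"

lemma force_cont: "continuous_on {0..b} force"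
  unfolding force_def[abs_def] by (intro continuous_intros rho_continuous continuous_on_subset[OF n_e_cont]) auto

lemma V_integral: assumes p: "0 \<le> p" "p \<le> b" shows "V p = integral {0..p} force"
proof -
  have c: "continuous_on {0..p} force" by (rule continuous_on_subset[OF force_cont]) (use p in auto)
  have "V p = (LBINT q=ereal 0..ereal p. force q)"
    unfolding V_plus_def zero_ereal_def[symmetric]
  proof (rule interval_integral_cong)
    fix q assume "q \<in> einterval (min 0 (ereal p)) (max 0 (ereal p))"
    then have "0 \<le> q" "q \<le> p" using p by (auto simp: einterval_def min_def max_def zero_ereal_def split: if_splits)
    then show "rho_plus \<alpha> b fb fi q - n_e q = force q" using p by (simp add: force_def rho_plus_eq)
  qed
  also have "\<dots> = integral {0..p} force"
    by (rule interval_integral_eq_integral[OF p(1)]) (rule borel_integrable_atLeastAtMost', rule c)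
  finally show ?thesis .
qed

lemma V_deriv: assumes p: "p \<in> {0..b}" shows "(V has_real_derivative force p) (at p within {0..b})"
proof -
  have "((\<lambda>p. integral {0..p} force) has_real_derivative force p) (at p within {0..b})"
    by (rule integral_has_real_derivative[OF force_cont p])
  then show ?thesis
    by (rule has_field_derivative_transform_within[of _ _ _ _ 1]) (use p V_integral in auto)
qed

lemma V_0: "V 0 = 0" using V_integral[of 0] b by simp
lemma force_0: "force 0 = 0" by (simp add: force_def rho_0 n_e_0)
lemma V_cont: "continuous_on {0..b} V" by (rule DERIV_continuous_on[OF V_deriv])

lemma V_deriv_at: "0 < p \<Longrightarrow> p < b \<Longrightarrow> (V has_real_derivative force p) (at p)"
  using V_deriv[of p] by (simp add: at_within_interior[of p "{0..b}"])

definition curvature :: "real \<Rightarrow> real" where "curvature = (deriv_within {0..b} ^^ 2) V"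

lemma within_nontrivial: "p \<in> {0..b} \<Longrightarrow> at p within {0..b} \<noteq> bot"
  using b by (simp add: trivial_limit_within islimpt_Icc)

lemma force_deriv: assumes p: "p \<in> {0..b}" shows "(force has_real_derivative curvature p) (at p within {0..b})"
proof -
  have e: "deriv_within {0..b} V q = force q" if "q \<in> {0..b}" for q
    by (rule deriv_within_eq[OF V_deriv[OF that] within_nontrivial[OF that]])
  have "(deriv_within {0..b} V) differentiable_on {0..b}" using V_C2 by (simp add: numeral_2_eq_2)
  from deriv_within_works[OF this p]
  have "(deriv_within {0..b} V has_real_derivative curvature p) (at p within {0..b})"
    by (simp add: curvature_def numeral_2_eq_2)
  then show ?thesis
    by (rule has_field_derivative_transform_within[of _ _ _ _ 1]) (use p e in auto)
qed

lemma curvature_cont: "continuous_on {0..b} curvature"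
  using V_C2 by (simp add: curvature_def numeral_2_eq_2)

lemma force_deriv_at: "0 < p \<Longrightarrow> p < b \<Longrightarrow> (force has_real_derivative curvature p) (at p)"
  using force_deriv[of p] by (simp add: at_within_interior[of p "{0..b}"])

text \<open>\<open>V 0 = 0\<close> and \<open>force 0 = 0\<close>, the latter being neutrality at infinity, so the bounded second
  derivative controls both.\<close>

lemma quadratic_bounds:
  obtains C where "C > 0" "\<And>p. p \<in> {0..b} \<Longrightarrow> \<bar>force p\<bar> \<le> C * p" "\<And>p. p \<in> {0..b} \<Longrightarrow> V p \<le> C * p\<^sup>2"
proof -
  have "bounded (curvature ` {0..b})" by (intro compact_imp_bounded compact_continuous_image curvature_cont) auto
  then obtain C where C: "C > 0" "\<forall>y\<in>curvature ` {0..b}. norm y \<le> C" unfolding bounded_pos by blast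
  have f: "\<bar>force p\<bar> \<le> C * p" if p: "p \<in> {0..b}" for p
  proof -
    have "norm (force p - force 0) \<le> C * norm (p - 0)"
      by (rule field_differentiable_bound[of "{0..b}" force curvature]) (use p b C force_deriv in auto)
    then show ?thesis using p by (simp add: force_0)
  qed
  have "V p \<le> C * p\<^sup>2" if p: "p \<in> {0..b}" for p
  proof -
    have "norm (V p - V 0) \<le> (C * p) * norm (p - 0)"
    proof (rule field_differentiable_bound[of "{0..p}" V force])
      fix q assume q: "q \<in> {0..p}"
      show "(V has_real_derivative force q) (at q within {0..p})"
        using V_deriv[of q] q p by (intro has_field_derivative_subset[OF V_deriv]) auto
      have "\<bar>force q\<bar> \<le> C * q" using f[of q] q p by auto
      also have "\<dots> \<le> C * p" using C q by (intro mult_left_mono) auto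
      finally show "norm (force q) \<le> C * p" by simp
    qed (use p in auto)
    then show ?thesis using p by (simp add: V_0 power2_eq_square mult.assoc)
  qed
  with C f show thesis by (intro that[of C]) auto
qed

lemma V_lower_near_0:
  assumes "curvature 0 > 0"
  obtains c d where "c > 0" "0 < d" "d \<le> b" "\<And>p. p \<in> {0..d} \<Longrightarrow> c * p\<^sup>2 \<le> V p"
proof -
  define h where "h = curvature 0 / 2"
  have h: "h > 0" "h < curvature 0" using assms by (auto simp: h_def)
  have "(curvature \<longlongrightarrow> curvature 0) (at 0 within {0..b})" using curvature_cont b by (auto simp: continuous_on_def)
  from order_tendstoD(1)[OF this h(2)]
  obtain e where e: "e > 0" "\<And>p. p \<in> {0..b} \<Longrightarrow> p \<noteq> 0 \<Longrightarrow> dist p 0 < e \<Longrightarrow> h < curvature p"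
    unfolding eventually_at by auto
  define d where "d = min b (e / 2)"
  have d: "0 < d" "d \<le> b" "d < e" using e b by (auto simp: d_def)
  have f: "h * p \<le> force p" if p: "p \<in> {0..d}" for p
  proof -
    have "force 0 - h * 0 \<le> force p - h * p"
    proof (rule DERIV_nonneg_imp_increasing_open[where f = "\<lambda>p. force p - h * p"])
      fix q assume q: "0 < q" "q < p"
      have "((\<lambda>p. force p - h * p) has_real_derivative curvature q - h) (at q)"
        using force_deriv_at[of q] q p d by (auto intro!: derivative_eq_intros)
      then show "\<exists>y. ((\<lambda>p. force p - h * p) has_real_derivative y) (at q) \<and> 0 \<le> y"
        using e(2)[of q] q p d by (intro exI[of _ "curvature q - h"]) (auto simp: dist_real_def)
    qed (use p d in \<open>auto intro!: continuous_intros continuous_on_subset[OF force_cont]\<close>)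
    then show ?thesis by (simp add: force_0)
  qed
  have "(h / 2) * p\<^sup>2 \<le> V p" if p: "p \<in> {0..d}" for p
  proof -
    have "V 0 - (h / 2) * 0\<^sup>2 \<le> V p - (h / 2) * p\<^sup>2"
    proof (rule DERIV_nonneg_imp_increasing_open[where f = "\<lambda>p. V p - (h / 2) * p\<^sup>2"])
      fix q assume q: "0 < q" "q < p"
      have "((\<lambda>p. V p - (h / 2) * p\<^sup>2) has_real_derivative force q - h * q) (at q)"
        using V_deriv_at[of q] q p d by (auto intro!: derivative_eq_intros)
      then show "\<exists>y. ((\<lambda>p. V p - (h / 2) * p\<^sup>2) has_real_derivative y) (at q) \<and> 0 \<le> y"
        using f[of q] q p d by (intro exI[of _ "force q - h * q"]) auto
    qed (use p d in \<open>auto intro!: continuous_intros continuous_on_subset[OF V_cont]\<close>)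
    then show ?thesis by (simp add: V_0)
  qed
  then show thesis using h d by (intro that[of "h / 2" d]) auto
qed

lemma V_upper_near_0:
  assumes "curvature 0 < 0"
  obtains d where "0 < d" "d \<le> b" "\<And>p. p \<in> {0<..d} \<Longrightarrow> V p < 0"
proof -
  have "(curvature \<longlongrightarrow> curvature 0) (at 0 within {0..b})" using curvature_cont b by (auto simp: continuous_on_def)
  from order_tendstoD(2)[OF this assms]
  obtain e where e: "e > 0" "\<And>p. p \<in> {0..b} \<Longrightarrow> p \<noteq> 0 \<Longrightarrow> dist p 0 < e \<Longrightarrow> curvature p < 0"
    unfolding eventually_at by auto
  define d where "d = min b (e / 2)"
  have d: "0 < d" "d \<le> b" "d < e" using e b by (auto simp: d_def)
  have f: "force p < 0" if p: "p \<in> {0<..d}" for p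
  proof -
    have "force p < force 0"
    proof (rule DERIV_neg_imp_decreasing_open[where f = force])
      fix q assume q: "0 < q" "q < p"
      show "\<exists>y. (force has_real_derivative y) (at q) \<and> y < 0"
        using e(2)[of q] q p d force_deriv_at[of q] by (intro exI[of _ "curvature q"]) (auto simp: dist_real_def)
    qed (use p d in \<open>auto intro!: continuous_on_subset[OF force_cont]\<close>)
    then show ?thesis by (simp add: force_0)
  qed
  have "V p < 0" if p: "p \<in> {0<..d}" for p
  proof -
    have "V p < V 0"
    proof (rule DERIV_neg_imp_decreasing_open[where f = V])
      fix q assume q: "0 < q" "q < p"
      show "\<exists>y. (V has_real_derivative y) (at q) \<and> y < 0"
        using q p d V_deriv_at[of q] f[of q] by (intro exI[of _ "force q"]) auto
    qed (use p d in \<open>auto intro!: continuous_on_subset[OF V_cont]\<close>)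
    then show ?thesis by (simp add: V_0)
  qed
  then show thesis using d by (intro that[of d]) auto
qed

text \<open>Near \<open>0\<close> the convexity of \<open>V\<close> gives the bound, and away from \<open>0\<close> its positive minimum does.\<close>

lemma V_lower:
  assumes "curvature 0 > 0" and pos: "\<And>p. p \<in> {0<..b} \<Longrightarrow> V p > 0"
  obtains c where "c > 0" "\<And>p. p \<in> {0..b} \<Longrightarrow> c * p\<^sup>2 \<le> V p"
proof -
  obtain c d where c: "c > 0" "0 < d" "d \<le> b" "\<And>p. p \<in> {0..d} \<Longrightarrow> c * p\<^sup>2 \<le> V p"
    by (rule V_lower_near_0[OF assms(1)]) blast
  have "\<exists>x\<in>{d..b}. \<forall>y\<in>{d..b}. V x \<le> V y"
    by (rule continuous_attains_inf) (use c in \<open>auto intro: continuous_on_subset[OF V_cont]\<close>)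
  then obtain x where x: "x \<in> {d..b}" "\<And>y. y \<in> {d..b} \<Longrightarrow> V x \<le> V y" by auto
  have Vx: "V x > 0" using pos x c by auto
  define k where "k = min c (V x / b\<^sup>2)"
  have "k * p\<^sup>2 \<le> V p" if p: "p \<in> {0..b}" for p
  proof (cases "p \<le> d")
    case True
    have "k * p\<^sup>2 \<le> c * p\<^sup>2" by (intro mult_right_mono) (auto simp: k_def)
    then show ?thesis using c(4)[of p] p True by simp
  next
    case False
    have "k * p\<^sup>2 \<le> (V x / b\<^sup>2) * b\<^sup>2" using p Vx by (intro mult_mono power_mono) (auto simp: k_def)
    then show ?thesis using x(2)[of p] p False b by simp
  qed
  moreover have "k > 0" using c Vx b by (simp add: k_def)
  ultimately show thesis by (rule that[rotated])
qed

text \<open>The modulus of the slope of the potential, as a function of its value.  It is continued by a constant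
  beyond \<open>b\<close>, so that the potential constructed from it extends differentiably across the wall.\<close>

definition speed :: "real \<Rightarrow> real" where "speed p = sqrt (2 * V (min p b))"

text \<open>The position at which a potential with slope \<open>- speed\<close> and value \<open>b\<close> at the wall reaches the value \<open>p\<close>.\<close>

definition travel :: "real \<Rightarrow> real" where
  "travel p = (if p \<le> b then integral {p..b} (\<lambda>q. 1 / speed q) else - integral {b..p} (\<lambda>q. 1 / speed q))"

end

locale positive_sheath = sheath +
  assumes V_pos: "\<And>p. p \<in> {0<..b} \<Longrightarrow> V p > 0"
begin

lemma speed_pos: "p > 0 \<Longrightarrow> speed p > 0"
  using V_pos[of "min p b"] b by (simp add: speed_def)

lemma speed_cont: "continuous_on {0<..} speed"
  unfolding speed_def[abs_def]
  by (intro continuous_intros continuous_on_compose2[OF V_cont]) (use b in auto)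

lemma inv_speed_cont: "S \<subseteq> {0<..} \<Longrightarrow> continuous_on S (\<lambda>q. 1 / speed q)"
proof -
  assume S: "S \<subseteq> {0<..}"
  have "\<forall>q\<in>S. speed q \<noteq> 0"
  proof
    fix q assume "q \<in> S"
    then have "q > 0" using S by auto
    then show "speed q \<noteq> 0" using speed_pos[of q] by simp
  qed
  then show ?thesis using S by (intro continuous_intros continuous_on_subset[OF speed_cont])
qed

lemma travel_deriv: assumes p: "p > 0" shows "(travel has_real_derivative - (1 / speed p)) (at p)"
proof -
  define l where "l = min p b / 2" define u where "u = max p b + 1"
  have lu: "0 < l" "l < p" "l < b" "p < u" "b < u" using p b by (auto simp: l_def u_def)
  have c: "continuous_on {l..u} (\<lambda>q. 1 / speed q)" by (rule inv_speed_cont) (use lu in auto)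
  have int: "(\<lambda>q. 1 / speed q) integrable_on {s..t}" if "l \<le> s" "t \<le> u" for s t
    by (rule integrable_continuous_interval[OF continuous_on_subset[OF c]]) (use that in auto)
  have eq: "travel q = integral {l..b} (\<lambda>q. 1 / speed q) - integral {l..q} (\<lambda>q. 1 / speed q)" if q: "q \<in> {l<..<u}" for q
  proof (cases "q \<le> b")
    case True
    have "integral {l..q} (\<lambda>q. 1 / speed q) + integral {q..b} (\<lambda>q. 1 / speed q) = integral {l..b} (\<lambda>q. 1 / speed q)"
      using True q lu int by (intro Henstock_Kurzweil_Integration.integral_combine) auto
    then show ?thesis using True by (simp add: travel_def)
  next
    case False
    have "integral {l..b} (\<lambda>q. 1 / speed q) + integral {b..q} (\<lambda>q. 1 / speed q) = integral {l..q} (\<lambda>q. 1 / speed q)"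
      using False q lu int by (intro Henstock_Kurzweil_Integration.integral_combine) auto
    then show ?thesis using False by (simp add: travel_def)
  qed
  have "((\<lambda>q. integral {l..q} (\<lambda>q. 1 / speed q)) has_real_derivative 1 / speed p) (at p within {l..u})"
    by (rule integral_has_real_derivative[OF c]) (use lu in auto)
  then have "((\<lambda>q. integral {l..q} (\<lambda>q. 1 / speed q)) has_real_derivative 1 / speed p) (at p)"
    using lu by (simp add: at_within_interior[of p "{l..u}"])
  then have "((\<lambda>q. integral {l..b} (\<lambda>q. 1 / speed q) - integral {l..q} (\<lambda>q. 1 / speed q)) has_real_derivative - (1 / speed p)) (at p)"
    by (auto intro!: derivative_eq_intros)
  then show ?thesis
    by (rule has_field_derivative_transform_within_open[of _ _ _ "{l<..<u}"]) (use lu eq in auto)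
qed

lemma travel_b: "travel b = 0" by (simp add: travel_def)

lemma travel_decreasing: assumes "0 < p" "p < q" shows "travel q < travel p"
proof (rule DERIV_neg_imp_decreasing[OF assms(2)])
  fix x assume "p \<le> x" "x \<le> q"
  then have "x > 0" using assms by simp
  then show "\<exists>y. (travel has_real_derivative y) (at x) \<and> y < 0"
    using travel_deriv[of x] speed_pos[of x] by (intro exI[of _ "- (1 / speed x)"]) simp
qed

lemma travel_inj: "inj_on travel {0<..}"
  by (rule inj_onI) (metis travel_decreasing greaterThan_iff less_irrefl linorder_neqE_linordered_idom)

lemma travel_cont: "continuous_on {0<..} travel"
  by (rule DERIV_continuous_on[OF has_field_derivative_at_within[OF travel_deriv]]) auto

text \<open>By \<open>V p \<le> C * p\<^sup>2\<close> the speed is at most linear in \<open>p\<close>, so the travel time to \<open>0\<close> diverges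
  logarithmically.\<close>

lemma travel_unbounded: assumes "X \<ge> 0" obtains p where "0 < p" "p \<le> b" "travel p \<ge> X"
proof -
  obtain C where C: "C > 0" "\<And>p. p \<in> {0..b} \<Longrightarrow> V p \<le> C * p\<^sup>2" by (rule quadratic_bounds) blast
  define k where "k = sqrt (2 * C)"
  have k: "k > 0" using C by (simp add: k_def)
  have sp: "speed q \<le> k * q" if "0 < q" "q \<le> b" for q
  proof -
    have "speed q \<le> sqrt (2 * (C * q\<^sup>2))" unfolding speed_def using C(2)[of q] that by (intro real_sqrt_le_mono) auto
    also have "\<dots> = k * q" using that by (simp add: k_def real_sqrt_mult mult.assoc)
    finally show ?thesis .
  qed
  \<comment> \<open>the value at \<open>X\<close> of the potential that decays with the maximal slope \<open>k * p\<close>\<close>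
  define p where "p = b * exp (- k * X)"
  have p: "0 < p" "p \<le> b" using b k assms by (auto simp: p_def mult_le_cancel_left1)
  have "travel b + ln b / k \<le> travel p + ln p / k"
  proof (rule DERIV_nonpos_imp_decreasing_open[where f = "\<lambda>q. travel q + ln q / k", OF p(2)])
    fix q assume q: "p < q" "q < b"
    have "((\<lambda>q. travel q + ln q / k) has_real_derivative - (1 / speed q) + (1 / q) / k) (at q)"
      using travel_deriv[of q] q p k by (auto intro!: derivative_eq_intros simp: field_simps)
    moreover have "(1 / q) / k \<le> 1 / speed q"
      using sp[of q] speed_pos[of q] q p k by (simp add: divide_simps mult.commute)
    ultimately show "\<exists>y. ((\<lambda>q. travel q + ln q / k) has_real_derivative y) (at q) \<and> y \<le> 0" by fastforce
  qed (use p k in \<open>auto intro!: continuous_intros continuous_on_subset[OF travel_cont]\<close>)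
  moreover have "ln p = ln b - k * X" using b by (simp add: p_def ln_mult)
  ultimately have "travel p \<ge> X" using k by (simp add: travel_b field_simps)
  then show thesis using that p by blast
qed

end

section \<open>Solutions of the boundary value problem\<close>

lemma at_within_atLeast_nontrivial: "x \<ge> 0 \<Longrightarrow> at x within {0..} \<noteq> (bot :: real filter)"
proof -
  assume x: "x \<ge> 0"
  have "at_right x \<le> at x within {0..}" using x by (intro at_le) auto
  then show ?thesis using trivial_limit_at_right_real[of x] by (metis bot.extremum_uniqueI)
qed

context attractive_profile
begin

lemma deriv_within_\<phi>: "x \<ge> 0 \<Longrightarrow> deriv_within {0..} \<phi> x = \<phi>' x"
  by (rule deriv_within_eq[OF \<phi>_der at_within_atLeast_nontrivial])

lemma VP_weak_transport:
  "VP_weak \<alpha> fb f \<phi> \<longleftrightarrow> (\<forall>\<psi>\<in>test_functions \<alpha>.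
     (LINT w|lborel. indicator ({0<..} \<times> UNIV) w * (f (fst w) (snd w) * transport \<psi> w))
     + (LINT z:half_space|lborel. fb z * (fst z * \<psi> (0, z))) = 0)"
proof -
  have e: "indicator ({0<..} \<times> UNIV) w *\<^sub>R (case w of (x, s, \<eta>) \<Rightarrow> f x (s, \<eta>) * (s * deriv (\<lambda>x'. \<psi> (x', (s, \<eta>))) x
              + deriv_within {0..} \<phi> x * deriv (\<lambda>s'. \<psi> (x, (s', \<eta>))) s))
     = indicator ({0<..} \<times> UNIV) w * (f (fst w) (snd w) * transport \<psi> w)" for w \<psi>
    by (cases w) (auto simp: transport_def deriv_within_\<phi> split: split_indicator)
  show ?thesis unfolding VP_weak_def set_lebesgue_integral_def[of _ "{0<..} \<times> UNIV"] e ..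
qed

end

context sheath
begin

text \<open>A positive slope is excluded, since the potential has the value \<open>b > 0\<close> at the wall and the limit \<open>0\<close>.\<close>

lemma solution_profile:
  assumes sol: "VP_solution n_e \<alpha> b fb fi f \<phi>"
  shows "attractive_solution \<alpha> b r fb fi \<phi> (deriv_within {0..} \<phi>) f"
proof -
  let ?d = "deriv_within {0..} \<phi>"
  have C1: "\<phi> differentiable_on {0..}" "continuous_on {0..} ?d"
    and sgn: "(\<forall>x\<ge>0. ?d x > 0) \<or> (\<forall>x\<ge>0. ?d x < 0)" and \<phi>0: "\<phi> 0 = b" and lim: "(\<phi> \<longlongrightarrow> 0) at_top"
    using sol by (auto simp: VP_solution_def)
  have der: "(\<phi> has_real_derivative ?d x) (at x within {0..})" if "x \<ge> 0" for x
    using deriv_within_works[OF C1(1)] that by simp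
  have neg: "?d x < 0" if "x \<ge> 0" for x
  proof -
    have "\<not> (\<forall>x\<ge>0. ?d x > 0)"
    proof
      assume p: "\<forall>x\<ge>0. ?d x > 0"
      have c: "continuous_on {0..} \<phi>" using der by (intro DERIV_continuous_on) auto
      have inc: "\<phi> 0 \<le> \<phi> x" if "x \<ge> 0" for x
      proof (rule DERIV_nonneg_imp_increasing_open[where f = \<phi>, OF that])
        fix t assume t: "0 < t" "t < x"
        then have "(\<phi> has_real_derivative ?d t) (at t)"
          using der[of t] at_within_interior[of t "{0..}"] by (simp add: interior_real_atLeast)
        then show "\<exists>y. (\<phi> has_real_derivative y) (at t) \<and> 0 \<le> y" using p t by (intro exI[of _ "?d t"]) (auto intro: less_imp_le)
      qed (rule continuous_on_subset[OF c], auto)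
      have "b \<le> 0" using lim
        by (rule tendsto_lowerbound) (use inc \<phi>0 in \<open>auto intro!: eventually_at_top_linorderI[of 0]\<close>)
      then show False using b by simp
    qed
    then show ?thesis using sgn that by auto
  qed
  interpret P: attractive_profile \<alpha> b r fb fi \<phi> ?d
    by unfold_locales (use b \<phi>0 der C1 neg lim in auto)
  have weak: "VP_weak \<alpha> fb f \<phi>" using sol by (simp add: VP_solution_def)
  show ?thesis
    by unfold_locales (use sol weak in \<open>auto simp: VP_solution_def P.VP_weak_transport\<close>)
qed

lemma solution_dens:
  assumes sol: "VP_solution n_e \<alpha> b fb fi f \<phi>" and x: "x \<ge> 0"
  shows "AE z in lborel. f x z = dens (\<phi> x) z"
proof -
  interpret S: attractive_solution \<alpha> b r fb fi \<phi> "deriv_within {0..} \<phi>" f by (rule solution_profile[OF sol])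
  show ?thesis by (rule S.solution_eq_dens[OF x])
qed

lemma solution_ode:
  assumes sol: "VP_solution n_e \<alpha> b fb fi f \<phi>" and x: "x > 0"
  shows "(deriv_within {0..} \<phi> has_real_derivative force (\<phi> x)) (at x)"
    "(deriv_within {0..} ^^ 2) \<phi> x = force (\<phi> x)"
proof -
  interpret S: attractive_solution \<alpha> b r fb fi \<phi> "deriv_within {0..} \<phi>" f by (rule solution_profile[OF sol])
  let ?d = "deriv_within {0..} \<phi>"
  have ix: "integrable lborel (f x)" using x by (intro S.f_integrable) simp
  have "(LINT z|lborel. f x z) = rho (\<phi> x)"
    unfolding rho_def using ix by (intro integral_cong_AE solution_dens[OF sol]) (use x in auto)
  then show e: "(deriv_within {0..} ^^ 2) \<phi> x = force (\<phi> x)"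
    using sol x by (simp add: VP_solution_def force_def)
  have d: "deriv_within {0<..} \<phi> y = ?d y" if "y > 0" for y
    by (rule deriv_within_eq[OF has_field_derivative_at_within[OF S.\<phi>_der_at[OF that]]])
       (use that at_within_open[of y "{0<..}"] in auto)
  have "deriv_within {0<..} \<phi> differentiable_on {0<..}" using sol by (simp add: VP_solution_def numeral_2_eq_2)
  from deriv_within_works[OF this, of x] x
  have "(deriv_within {0<..} \<phi> has_real_derivative deriv_within {0<..} (deriv_within {0<..} \<phi>) x) (at x)"
    by (simp add: at_within_open[of x "{0<..}"])
  then have D: "(?d has_real_derivative deriv_within {0<..} (deriv_within {0<..} \<phi>) x) (at x)"
    by (rule has_field_derivative_transform_within_open[of _ _ _ "{0<..}"]) (use x d in auto)
  have "deriv_within {0..} ?d x = deriv_within {0<..} (deriv_within {0<..} \<phi>) x"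
    by (rule deriv_within_eq[OF has_field_derivative_at_within[OF D] at_within_atLeast_nontrivial]) (use x in simp)
  then show "(?d has_real_derivative force (\<phi> x)) (at x)" using D e by (simp add: numeral_2_eq_2)
qed

text \<open>The difference \<open>\<phi>'\<^sup>2 - 2 * V \<phi>\<close> is constant.  It is the limit of \<open>\<phi>'\<^sup>2\<close> at infinity, which cannot
  be positive: the slope would be bounded away from \<open>0\<close> and the potential would become negative.\<close>

lemma solution_energy:
  assumes sol: "VP_solution n_e \<alpha> b fb fi f \<phi>" and x: "x \<ge> 0"
  shows "(deriv_within {0..} \<phi> x)\<^sup>2 = 2 * V (\<phi> x)"
proof -
  interpret S: attractive_solution \<alpha> b r fb fi \<phi> "deriv_within {0..} \<phi>" f by (rule solution_profile[OF sol])
  let ?d = "deriv_within {0..} \<phi>"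
  define e where "e x = (?d x)\<^sup>2 - 2 * V (\<phi> x)" for x
  have Vc: "continuous_on {0..} (\<lambda>x. V (\<phi> x))"
    by (rule continuous_on_compose2[OF V_cont S.\<phi>_cont]) (auto simp: S.\<phi>_le S.\<phi>_pos less_imp_le)
  have ec: "continuous_on {0..} e" unfolding e_def by (intro continuous_intros S.\<phi>'_cont Vc)
  have ed: "(e has_real_derivative 0) (at t)" if t: "t > 0" for t
  proof -
    have 1: "((\<lambda>x. V (\<phi> x)) has_real_derivative force (\<phi> t) * ?d t) (at t)"
      by (rule DERIV_chain2[OF V_deriv_at S.\<phi>_der_at]) (use t S.\<phi>_pos[of t] S.\<phi>_less[of t] in auto)
    show ?thesis unfolding e_def[abs_def]
      by (rule DERIV_cong[OF DERIV_diff[OF DERIV_power[OF solution_ode(1)[OF sol t]] DERIV_cmult[OF 1]]]) simp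
  qed
  have const: "e y = e 0" if "y \<ge> 0" for y
  proof (cases "y = 0")
    case False
    then have "y > 0" using that by simp
    then show ?thesis
      by (intro DERIV_isconst_end) (use ed in \<open>auto intro: continuous_on_subset[OF ec]\<close>)
  qed simp
  have V0: "(V \<longlongrightarrow> 0) (at 0 within {0..b})" using V_cont[unfolded continuous_on_def, rule_format, of 0] b V_0 by simp
  have "filterlim \<phi> (at 0 within {0..b}) at_top"
    unfolding filterlim_at using S.\<phi>_lim S.\<phi>_pos S.\<phi>_le
    by (auto intro!: eventually_at_top_linorderI[of 0] simp: less_imp_le less_imp_neq[symmetric] dest: less_imp_neq)
  then have Vlim: "((\<lambda>x. V (\<phi> x)) \<longlongrightarrow> 0) at_top" by (rule filterlim_compose[OF V0])
  have dlim: "((\<lambda>x. (?d x)\<^sup>2) \<longlongrightarrow> e 0) at_top"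
  proof -
    have "((\<lambda>x. e 0 + 2 * V (\<phi> x)) \<longlongrightarrow> e 0 + 2 * 0) at_top" by (intro tendsto_intros Vlim)
    moreover have "\<forall>\<^sub>F x in at_top. e 0 + 2 * V (\<phi> x) = (?d x)\<^sup>2"
    proof (rule eventually_at_top_linorderI[of 0])
      fix x :: real assume "0 \<le> x"
      from const[OF this] show "e 0 + 2 * V (\<phi> x) = (?d x)\<^sup>2" unfolding e_def by linarith
    qed
    ultimately show ?thesis by (simp add: Lim_transform_eventually)
  qed
  have "e 0 \<ge> 0" by (rule tendsto_lowerbound[OF dlim]) auto
  moreover have "\<not> e 0 > 0"
  proof
    assume pos: "e 0 > 0"
    define k where "k = sqrt (e 0 / 2)"
    have k: "k > 0" using pos by (simp add: k_def)
    have "\<forall>\<^sub>F x in at_top. e 0 / 2 < (?d x)\<^sup>2" using order_tendstoD(1)[OF dlim, of "e 0 / 2"] pos by simp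
    then obtain X0 where X0: "\<And>x. x \<ge> X0 \<Longrightarrow> e 0 / 2 < (?d x)\<^sup>2" unfolding eventually_at_top_linorder by auto
    define X where "X = max 0 X0"
    have dk: "?d x \<le> - k" if "x \<ge> X" for x
    proof -
      have "k \<le> sqrt ((?d x)\<^sup>2)" unfolding k_def using X0[of x] that by (intro real_sqrt_le_mono) (auto simp: X_def)
      then show ?thesis using S.\<phi>'_neg[of x] that by (simp add: X_def)
    qed
    \<comment> \<open>descending from \<open>\<phi> X\<close> with slope at most \<open>- k\<close>, the potential is negative at \<open>Y\<close>\<close>
    define Y where "Y = X + \<phi> X / k + 1"
    have X0': "0 \<le> X" by (simp add: X_def)
    have "\<phi> X / k > 0" using S.\<phi>_pos[OF X0'] k by simp
    then have XY: "0 \<le> X" "X \<le> Y" using X0' by (simp_all add: Y_def)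
    have "\<phi> Y + k * Y \<le> \<phi> X + k * X"
    proof (rule DERIV_nonpos_imp_decreasing_open[where f = "\<lambda>x. \<phi> x + k * x", OF XY(2)])
      fix t assume t: "X < t" "t < Y"
      have "((\<lambda>x. \<phi> x + k * x) has_real_derivative ?d t + k) (at t)"
        using S.\<phi>_der_at[of t] t XY by (auto intro!: derivative_eq_intros)
      then show "\<exists>y. ((\<lambda>x. \<phi> x + k * x) has_real_derivative y) (at t) \<and> y \<le> 0"
        using dk[of t] t by (intro exI[of _ "?d t + k"]) auto
    qed (use XY in \<open>auto intro!: continuous_intros continuous_on_subset[OF S.\<phi>_cont]\<close>)
    moreover have "k * Y = k * X + \<phi> X + k" using k by (simp add: Y_def distrib_left)
    ultimately have "\<phi> Y \<le> - k" by simp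
    then show False using S.\<phi>_pos[of Y] XY k by simp
  qed
  ultimately have "e 0 = 0" by simp
  then have "e x = 0" using const[OF x] by (simp only:)
  then show ?thesis by (simp add: e_def)
qed

lemma solution_V_pos:
  assumes sol: "VP_solution n_e \<alpha> b fb fi f \<phi>" and p: "p \<in> {0<..b}"
  shows "V p > 0"
proof -
  interpret S: attractive_solution \<alpha> b r fb fi \<phi> "deriv_within {0..} \<phi>" f by (rule solution_profile[OF sol])
  obtain x where x: "x \<ge> 0" "\<phi> x = p" using S.\<phi>_surj[of p] p by auto
  have "0 < (deriv_within {0..} \<phi> x)\<^sup>2" using S.\<phi>'_neg[OF x(1)] by simp
  then show ?thesis using solution_energy[OF sol x(1)] x(2) by simp
qed

lemma solution_slope:
  assumes sol: "VP_solution n_e \<alpha> b fb fi f \<phi>" and x: "x \<ge> 0"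
  shows "deriv_within {0..} \<phi> x = - sqrt (2 * V (\<phi> x))"
proof -
  interpret S: attractive_solution \<alpha> b r fb fi \<phi> "deriv_within {0..} \<phi>" f by (rule solution_profile[OF sol])
  have "sqrt ((deriv_within {0..} \<phi> x)\<^sup>2) = sqrt (2 * V (\<phi> x))" using solution_energy[OF sol x] by simp
  then show ?thesis using S.\<phi>'_neg[OF x] by simp
qed

end

context positive_sheath
begin

text \<open>The inverse of \<open>travel\<close>.  As \<open>travel\<close> continues beyond \<open>b\<close> to negative values, the inverse is
  defined in a neighbourhood of the wall and is differentiable there in the ordinary sense.\<close>

definition potential :: "real \<Rightarrow> real" where "potential x = (THE p. p > 0 \<and> travel p = x)"

lemma potential_travel: assumes "p > 0" shows "potential (travel p) = p"
  unfolding potential_def by (rule the_equality) (use assms travel_inj in \<open>auto dest: inj_onD\<close>)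

lemma potential: assumes "x \<ge> travel (b + 1)" shows "potential x > 0" "travel (potential x) = x"
proof -
  obtain p0 where p0: "0 < p0" "p0 \<le> b" "travel p0 \<ge> max 0 x" by (rule travel_unbounded[of "max 0 x"]) auto
  have "\<exists>p\<ge>p0. p \<le> b + 1 \<and> travel p = x"
    by (rule IVT2') (use p0 assms in \<open>auto intro: continuous_on_subset[OF travel_cont]\<close>)
  then obtain p where p: "p \<ge> p0" "travel p = x" by auto
  have "potential x = p" using potential_travel[of p] p p0 by simp
  then show "potential x > 0" "travel (potential x) = x" using p p0 by auto
qed

lemma travel_b1: "travel (b + 1) < 0" using travel_decreasing[of b "b + 1"] b by (simp add: travel_b)

lemma potential_nonneg: assumes "x \<ge> 0" shows "potential x > 0" "travel (potential x) = x" "potential x \<le> b"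
proof -
  show 1: "potential x > 0" "travel (potential x) = x" using potential[of x] assms travel_b1 by auto
  show "potential x \<le> b"
  proof (rule ccontr)
    assume "\<not> potential x \<le> b"
    then have "travel (potential x) < travel b" using b by (intro travel_decreasing) auto
    then show False using 1 assms by (simp add: travel_b)
  qed
qed

lemma potential_0: "potential 0 = b" using potential_travel[of b] b by (simp add: travel_b)

lemma potential_isCont: assumes x: "x > travel (b + 1)" shows "isCont potential x"
proof -
  define p where "p = potential x"
  have p: "p > 0" "travel p = x" using potential[of x] x by (auto simp: p_def)
  have "isCont potential (travel p)"
  proof (rule isCont_inverse_function2[where f = travel and g = potential and x = p and a = "p / 2" and b = "p + 1"])
    fix z assume z: "p / 2 \<le> z" "z \<le> p + 1"
    then have "z > 0" using p by simp
    then show "potential (travel z) = z" "isCont travel z"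
      using potential_travel[of z] DERIV_isCont[OF travel_deriv[of z]] by auto
  qed (use p in auto)
  then show ?thesis by (simp add: p)
qed

lemma potential_deriv: assumes x: "x \<ge> 0" shows "(potential has_real_derivative - speed (potential x)) (at x)"
proof -
  have "(potential has_real_derivative inverse (- (1 / speed (potential x)))) (at x)"
  proof (rule DERIV_inverse_function[where f = travel and a = "travel (b + 1)" and b = "x + 1"])
    show "(travel has_real_derivative - (1 / speed (potential x))) (at (potential x))"
      by (rule travel_deriv[OF potential_nonneg(1)[OF x]])
    show "isCont potential x" by (rule potential_isCont) (use x travel_b1 in simp)
  qed (use x travel_b1 potential speed_pos[OF potential_nonneg(1)[OF x]] in auto)
  then show ?thesis by simp
qed

lemma potential_limit: "(potential \<longlongrightarrow> 0) at_top"
proof (rule order_tendstoI)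
  fix a :: real assume "a < 0"
  then show "\<forall>\<^sub>F x in at_top. a < potential x"
    using potential_nonneg(1) by (intro eventually_at_top_linorderI[of 0]) (auto intro: less_trans)
next
  fix a :: real assume a: "0 < a"
  show "\<forall>\<^sub>F x in at_top. potential x < a"
  proof (rule eventually_at_top_linorderI[of "max 0 (travel a + 1)"])
    fix x assume x: "max 0 (travel a + 1) \<le> x"
    show "potential x < a"
    proof (rule ccontr)
      assume n: "\<not> potential x < a"
      have "travel (potential x) \<le> travel a"
        using n a travel_decreasing[of a "potential x"] by (cases "potential x = a") auto
      then show False using potential_nonneg(2)[of x] x by simp
    qed
  qed
qed

lemma speed_potential_cont: "continuous_on {0..} (\<lambda>x. - speed (potential x))"
proof -
  have "continuous_on {0..} potential"
    by (rule DERIV_continuous_on[OF has_field_derivative_at_within[OF potential_deriv]]) auto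
  then show ?thesis
    by (intro continuous_on_minus continuous_on_compose2[OF speed_cont]) (auto simp: potential_nonneg(1))
qed

lemma potential_second_deriv:
  assumes x: "x > 0" shows "((\<lambda>x. - speed (potential x)) has_real_derivative force (potential x)) (at x)"
proof -
  let ?p = "potential x"
  have p: "0 < ?p" using potential_nonneg x by simp
  have pb: "?p < b" using potential_nonneg(2,3)[of x] x travel_b by (cases "?p = b") auto
  have Vp: "V ?p > 0" using V_pos[of ?p] p pb by simp
  have s: "speed ?p = sqrt (2 * V ?p)" using pb by (simp add: speed_def)
  have "((\<lambda>p. - sqrt (2 * V p)) has_real_derivative - (force ?p / sqrt (2 * V ?p))) (at ?p)"
    using V_deriv_at[OF p pb] Vp by (auto intro!: derivative_eq_intros simp: field_simps)
  then have "((\<lambda>p. - speed p) has_real_derivative - (force ?p / sqrt (2 * V ?p))) (at ?p)"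
    by (rule has_field_derivative_transform_within_open[of _ _ _ "{..<b}"]) (use pb in \<open>auto simp: speed_def\<close>)
  from DERIV_chain2[OF this potential_deriv] x
  have "((\<lambda>x. - speed (potential x)) has_real_derivative - (force ?p / sqrt (2 * V ?p)) * (- speed ?p)) (at x)" by simp
  also have "- (force ?p / sqrt (2 * V ?p)) * (- speed ?p) = force ?p" unfolding s using Vp by simp
  finally show ?thesis .
qed

lemma potential_solution: "VP_solution n_e \<alpha> b fb fi (\<lambda>x. dens (potential x)) potential"
proof -
  interpret P: attractive_profile \<alpha> b r fb fi potential "\<lambda>x. - speed (potential x)"
    by unfold_locales (use b potential_0 potential_limit speed_potential_cont potential_nonneg speed_pos
       in \<open>auto intro: has_field_derivative_at_within[OF potential_deriv]\<close>)
  have d: "deriv_within {0..} potential x = - speed (potential x)" if "x \<ge> 0" for x by (rule P.deriv_within_\<phi>[OF that])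
  have neg: "deriv_within {0..} potential x < 0" if "x \<ge> 0" for x using d[OF that] speed_pos[OF potential_nonneg(1)[OF that]] by simp
  have nt: "at x within {0<..} \<noteq> bot" if "x > 0" for x :: real using at_within_open[of x "{0<..}"] that by auto
  have d': "deriv_within {0<..} potential x = - speed (potential x)" if "x > 0" for x
    by (rule deriv_within_eq[OF has_field_derivative_at_within[OF potential_deriv] nt]) (use that in auto)
  have dd: "(deriv_within {0<..} potential has_real_derivative force (potential x)) (at x)" if "x > 0" for x
    by (rule has_field_derivative_transform_within_open[OF potential_second_deriv, of _ "{0<..}"]) (use that d' in auto)
  have dd2: "(deriv_within {0..} potential has_real_derivative force (potential x)) (at x)" if "x > 0" for x
    by (rule has_field_derivative_transform_within_open[OF potential_second_deriv, of _ "{0<..}"]) (use that d in auto)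
  have dde: "deriv_within {0<..} (deriv_within {0<..} potential) x = force (potential x)" if "x > 0" for x
    by (rule deriv_within_eq[OF has_field_derivative_at_within[OF dd] nt]) (use that in auto)
  have fc: "continuous_on {0<..} (\<lambda>x. force (potential x))"
    by (rule continuous_on_compose2[OF force_cont continuous_on_subset[OF P.\<phi>_cont]])
       (use potential_nonneg(1)[THEN less_imp_le] potential_nonneg(3) in auto)
  have D1: "potential differentiable_on {0..}"
    unfolding differentiable_on_def using P.\<phi>_der by (auto simp: real_differentiable_def)
  have D2: "potential differentiable_on {0<..}" by (rule differentiable_on_subset[OF D1]) auto
  have D3: "deriv_within {0<..} potential differentiable_on {0<..}"
    unfolding differentiable_on_def using has_field_derivative_at_within[OF dd] by (auto simp: real_differentiable_def)
  have c1: "Ck_on 1 {0..} potential"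
    using D1 speed_potential_cont d by (simp add: cong: continuous_on_cong_simp)
  have c2: "Ck_on 2 {0<..} potential"
    using D2 D3 fc dde by (simp add: numeral_2_eq_2 cong: continuous_on_cong_simp)
  have cont: "continuous_into_L1 (\<lambda>x. dens (potential x))"
    unfolding continuous_into_L1_def
    by (auto intro!: dens_integrable P.dens_L1_continuous potential_nonneg(3) less_imp_le[OF potential_nonneg(1)])
  have eq: "(deriv_within {0..} ^^ 2) potential x = (LINT z|lborel. dens (potential x) z) - n_e (potential x)" if "x > 0" for x
  proof -
    have "(deriv_within {0..} ^^ 2) potential x = force (potential x)"
      unfolding numeral_2_eq_2 funpow.simps comp_def id_def
      by (rule deriv_within_eq[OF has_field_derivative_at_within[OF dd2] at_within_atLeast_nontrivial]) (use that in auto)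
    then show ?thesis by (simp add: force_def rho_def)
  qed
  show ?thesis
    unfolding VP_solution_def
    using P.dens_L1_loc cont c1 c2 dens_nonneg neg P.dens_weak_transport P.dens_L1_limit eq potential_0 potential_limit
    by (auto simp: P.VP_weak_transport)
qed

text \<open>Along a solution \<open>travel (\<phi> x) - x\<close> has derivative \<open>0\<close>.\<close>

lemma solution_unique:
  assumes sol: "VP_solution n_e \<alpha> b fb fi f \<phi>" and x: "x \<ge> 0"
  shows "\<phi> x = potential x"
proof -
  interpret S: attractive_solution \<alpha> b r fb fi \<phi> "deriv_within {0..} \<phi>" f by (rule solution_profile[OF sol])
  have sl: "deriv_within {0..} \<phi> t = - speed (\<phi> t)" if "t \<ge> 0" for t
    using solution_slope[OF sol that] S.\<phi>_le[OF that] by (simp add: speed_def)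
  have tc: "continuous_on {0..} (\<lambda>x. travel (\<phi> x) - x)"
    by (intro continuous_intros continuous_on_compose2[OF travel_cont S.\<phi>_cont]) (auto simp: S.\<phi>_pos)
  have "travel (\<phi> x) - x = travel (\<phi> 0) - 0"
  proof (cases "x = 0")
    case False
    then have "0 < x" using x by simp
    then show ?thesis
    proof (rule DERIV_isconst_end)
      fix t assume t: "0 < t" "t < x"
      have "((\<lambda>x. travel (\<phi> x)) has_real_derivative - (1 / speed (\<phi> t)) * deriv_within {0..} \<phi> t) (at t)"
        by (rule DERIV_chain2[OF travel_deriv S.\<phi>_der_at]) (use t S.\<phi>_pos[of t] in auto)
      moreover have "- (1 / speed (\<phi> t)) * deriv_within {0..} \<phi> t = 1" using sl[of t] speed_pos[of "\<phi> t"] S.\<phi>_pos[of t] t by simp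
      ultimately have "((\<lambda>x. travel (\<phi> x)) has_real_derivative 1) (at t)" by simp
      from DERIV_diff[OF this DERIV_ident] show "((\<lambda>x. travel (\<phi> x) - x) has_real_derivative 0) (at t)" by simp
    qed (auto intro: continuous_on_subset[OF tc])
  qed simp
  then have "travel (\<phi> x) = x" by (simp add: S.\<phi>0 travel_b)
  then show ?thesis using potential_travel[OF S.\<phi>_pos[OF x]] by simp
qed

text \<open>From \<open>c * p\<^sup>2 \<le> V p \<le> C * p\<^sup>2\<close> the slope is comparable to the potential, and the lower bound gives
  exponential decay of the potential.  The slope and \<open>force\<close> inherit it.\<close>

lemma solution_decay:
  assumes sol: "VP_solution n_e \<alpha> b fb fi f \<phi>" and curv: "curvature 0 > 0"
  shows "\<exists>c>0. \<exists>C>0. \<forall>l\<in>{0, 1, 2}. \<forall>x\<ge>0. \<bar>(deriv_within {0..} ^^ l) \<phi> x\<bar> \<le> C * exp (- c * x)"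
proof -
  interpret S: attractive_solution \<alpha> b r fb fi \<phi> "deriv_within {0..} \<phi>" f by (rule solution_profile[OF sol])
  obtain c0 where c0: "c0 > 0" "\<And>p. p \<in> {0..b} \<Longrightarrow> c0 * p\<^sup>2 \<le> V p" by (rule V_lower[OF curv V_pos]) blast+
  obtain C0 where C0: "C0 > 0" "\<And>p. p \<in> {0..b} \<Longrightarrow> \<bar>force p\<bar> \<le> C0 * p" "\<And>p. p \<in> {0..b} \<Longrightarrow> V p \<le> C0 * p\<^sup>2"
    by (rule quadratic_bounds) blast
  define k where "k = sqrt (2 * c0)" define m where "m = sqrt (2 * C0)"
  have k: "k > 0" and m: "m > 0" using c0 C0 by (auto simp: k_def m_def)
  have pr: "\<phi> x \<in> {0..b}" "\<phi> x > 0" if "x \<ge> 0" for x using S.\<phi>_pos[OF that] S.\<phi>_le[OF that] by auto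
  have slope: "k * \<phi> x \<le> - deriv_within {0..} \<phi> x" "- deriv_within {0..} \<phi> x \<le> m * \<phi> x" if x: "x \<ge> 0" for x
  proof -
    have "k * \<phi> x = sqrt (2 * (c0 * (\<phi> x)\<^sup>2))" using pr(2)[OF x] by (simp add: k_def real_sqrt_mult)
    also have "\<dots> \<le> sqrt (2 * V (\<phi> x))" using c0(2)[OF pr(1)[OF x]] by (intro real_sqrt_le_mono) simp
    finally show "k * \<phi> x \<le> - deriv_within {0..} \<phi> x" by (simp add: solution_slope[OF sol x])
    have "sqrt (2 * V (\<phi> x)) \<le> sqrt (2 * (C0 * (\<phi> x)\<^sup>2))" using C0(3)[OF pr(1)[OF x]] by (intro real_sqrt_le_mono) simp
    also have "\<dots> = m * \<phi> x" using pr(2)[OF x] by (simp add: m_def real_sqrt_mult)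
    finally show "- deriv_within {0..} \<phi> x \<le> m * \<phi> x" by (simp add: solution_slope[OF sol x])
  qed
  have dec: "\<phi> x \<le> b * exp (- k * x)" if x: "x \<ge> 0" for x
  proof -
    have "\<phi> x * exp (k * x) \<le> \<phi> 0 * exp (k * 0)"
    proof (rule DERIV_nonpos_imp_decreasing_open[where f = "\<lambda>x. \<phi> x * exp (k * x)", OF x])
      fix t assume t: "0 < t" "t < x"
      have "((\<lambda>x. \<phi> x * exp (k * x)) has_real_derivative (deriv_within {0..} \<phi> t + k * \<phi> t) * exp (k * t)) (at t)"
        using S.\<phi>_der_at[of t] t by (auto intro!: derivative_eq_intros simp: algebra_simps)
      then show "\<exists>y. ((\<lambda>x. \<phi> x * exp (k * x)) has_real_derivative y) (at t) \<and> y \<le> 0"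
        using slope(1)[of t] t by (intro exI conjI) (auto intro!: mult_nonpos_nonneg)
    qed (auto intro!: continuous_intros continuous_on_subset[OF S.\<phi>_cont])
    then show ?thesis by (simp add: S.\<phi>0 exp_minus field_simps)
  qed
  \<comment> \<open>the last summand covers the second derivative at the wall, about which the equation says nothing\<close>
  define C where "C = b + m * b + C0 * b + \<bar>(deriv_within {0..} ^^ 2) \<phi> 0\<bar>"
  have Cpos: "C > 0" using b m C0 unfolding C_def by (intro add_pos_nonneg) auto
  have Cge: "b \<le> C" "m * b \<le> C" "C0 * b \<le> C" "\<bar>(deriv_within {0..} ^^ 2) \<phi> 0\<bar> \<le> C"
    using b m C0(1) mult_nonneg_nonneg[of m b] mult_nonneg_nonneg[of C0 b] by (auto simp: C_def)
  have up: "A * \<phi> x \<le> C * exp (- k * x)" if "x \<ge> 0" "A \<ge> 0" "A * b \<le> C" for A x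
  proof -
    have "A * \<phi> x \<le> A * (b * exp (- k * x))" using dec that by (intro mult_left_mono) auto
    also have "\<dots> \<le> C * exp (- k * x)" using that(3) by (simp add: mult.assoc[symmetric])
    finally show ?thesis .
  qed
  have "\<bar>(deriv_within {0..} ^^ l) \<phi> x\<bar> \<le> C * exp (- k * x)" if l: "l \<in> {0, 1, 2}" and x: "x \<ge> 0" for l :: nat and x
  proof -
    consider "l = 0" | "l = 1" | "l = 2" "x = 0" | "l = 2" "x > 0" using l x by fastforce
    then show ?thesis
    proof cases
      case 1 then show ?thesis using up[OF x, of 1] pr(2)[OF x] Cge by simp
    next
      case 2 then show ?thesis using up[OF x, of m] slope(2)[OF x] S.\<phi>'_neg[OF x] m Cge by simp
    next
      case 3 then show ?thesis using Cge by simp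
    next
      case 4
      have "\<bar>force (\<phi> x)\<bar> \<le> C0 * \<phi> x" by (rule C0(2)[OF pr(1)[OF x]])
      then show ?thesis using up[OF x, of C0] C0(1) Cge 4 solution_ode(2)[OF sol 4(2)] by simp
    qed
  qed
  then show ?thesis using k Cpos by blast
qed

end

section \<open>The barrier condition\<close>

context attractive_data
begin

text \<open>For \<open>q \<ge> b\<close> the integral over the inflow no longer has a singular kernel: it is that of free
  particles in the potential \<open>q - b\<close>.  So continuity in \<open>q\<close> follows from \<open>free_L1_convergence\<close>.\<close>

lemma rho_plus_beyond:
  assumes q: "q \<ge> b"
  shows "rho_plus \<alpha> b fb fi q = (LINT z|lborel. pull (free_dom q) (free_map q) fi z)
     + 2 / (1 - \<alpha>) * (LINT z|lborel. pull (free_dom (q - b)) (free_map (q - b)) (\<lambda>z. indicator {0<..<sqrt (2 * b)} (fst z) * fb z) z)"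
proof -
  define fc where "fc z = indicator {0<..<sqrt (2 * b)} (fst z) * fb z" for z
  have fbp: "fb \<in> borel_measurable (borel \<Otimes>\<^sub>M borel)" unfolding borel_prod by (rule fb_measurable)
  have "fc \<in> borel_measurable (borel \<Otimes>\<^sub>M borel)" unfolding fc_def[abs_def] using fbp by measurable
  then have fcm: "fc \<in> borel_measurable borel" by (simp add: borel_prod)
  have fci: "integrable lborel fc"
    by (rule Bochner_Integration.integrable_bound[OF fb(1)]) (use fcm in \<open>auto simp: fc_def split: split_indicator\<close>)
  have fc0: "fc z \<ge> 0" for z by (simp add: fc_def fb)
  have km: "(\<lambda>z :: velocity. \<bar>fst z\<bar> / sqrt ((fst z)\<^sup>2 + 2 * (q - b))) \<in> borel_measurable borel"
    unfolding borel_prod[symmetric] by measurable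
  have k1: "\<bar>\<bar>s\<bar> / sqrt (s\<^sup>2 + 2 * (q - b))\<bar> \<le> 1" for s :: real
  proof (cases "s = 0")
    case False
    have "sqrt (s\<^sup>2) \<le> sqrt (s\<^sup>2 + 2 * (q - b))" using q by (intro real_sqrt_le_mono) auto
    then have "\<bar>s\<bar> \<le> \<bar>sqrt (s\<^sup>2 + 2 * (q - b))\<bar>" by simp
    moreover have "0 < \<bar>sqrt (s\<^sup>2 + 2 * (q - b))\<bar>" using calculation False by linarith
    ultimately show ?thesis unfolding abs_divide abs_abs by (simp only: divide_le_eq_1_pos)
  qed simp
  have ki: "integrable lborel (\<lambda>z. fc z * (\<bar>fst z\<bar> / sqrt ((fst z)\<^sup>2 + 2 * (q - b))))"
  proof (rule Bochner_Integration.integrable_bound[OF fci])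
    show "(\<lambda>z. fc z * (\<bar>fst z\<bar> / sqrt ((fst z)\<^sup>2 + 2 * (q - b)))) \<in> borel_measurable lborel"
      using borel_measurable_times[OF fcm km] by simp
    show "AE z in lborel. norm (fc z * (\<bar>fst z\<bar> / sqrt ((fst z)\<^sup>2 + 2 * (q - b)))) \<le> norm (fc z)"
      unfolding real_norm_def abs_mult using k1 by (intro AE_I2 mult_left_le) auto
  qed
  have chi0: "sqrt (2 * (b - q) * chi (b - q)) = 0" using q by (simp add: chi_def)
  have "(LINT z|lborel. pull (free_dom (q - b)) (free_map (q - b)) fc z) = (LINT z|lborel. fc z * (\<bar>fst z\<bar> / sqrt ((fst z)\<^sup>2 + 2 * (q - b))))"
    by (rule free_integrable(3)[OF fci _ fc0]) (use q in simp)
  also have "\<dots> = (LINT s|lborel. LINT \<eta>|lborel. fc (s, \<eta>) * (\<bar>s\<bar> / sqrt (s\<^sup>2 + 2 * (q - b))))"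
    by (simp only: integral_lborel_pair(1)[OF ki] fst_conv)
  also have "\<dots> = (LINT s|lborel. indicator {0<..<sqrt (2 * b)} s * (LINT \<eta>|lborel. fb (s, \<eta>) * (s / sqrt (s\<^sup>2 + 2 * (q - b)))))"
  proof (rule Bochner_Integration.integral_cong[OF refl])
    fix s :: real
    show "(LINT \<eta>|lborel. fc (s, \<eta>) * (\<bar>s\<bar> / sqrt (s\<^sup>2 + 2 * (q - b)))) = indicator {0<..<sqrt (2 * b)} s * (LINT \<eta>|lborel. fb (s, \<eta>) * (s / sqrt (s\<^sup>2 + 2 * (q - b))))"
      by (cases "s \<in> {0<..<sqrt (2 * b)}") (auto simp: fc_def)
  qed
  also have "\<dots> = (LBINT s = sqrt (2 * (b - q) * chi (b - q))..sqrt (2 * b). (LINT \<eta>|lborel. fb (s, \<eta>) * (s / sqrt (s\<^sup>2 + 2 * (q - b)))))"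
    unfolding chi0 using b by (simp add: interval_lebesgue_integral_def set_lebesgue_integral_def)
  finally show ?thesis
    using q b unfolding rho_plus_def fc_def by (subst free_integrable(3)[OF fi(1) _ fi(2)]) auto
qed

lemma free_integral_continuous:
  assumes f: "integrable lborel f" and a: "a \<ge> 0"
  shows "continuous_on {a..} (\<lambda>q. LINT z|lborel. pull (free_dom (q - a)) (free_map (q - a)) f z)"
proof (rule continuous_on_sequentiallyI)
  fix X :: "nat \<Rightarrow> real" and p assume X: "\<forall>n. X n \<in> {a..}" and p: "p \<in> {a..}" and lim: "X \<longlonglongrightarrow> p"
  obtain K where K: "\<And>n. norm (X n) \<le> K" using convergent_imp_Bseq[OF convergentI[OF lim]] unfolding Bseq_def by auto
  let ?P = "\<lambda>q. pull (free_dom (q - a)) (free_map (q - a)) f"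
  have i: "integrable lborel (?P q)" if "q \<in> {a..}" for q using that by (intro free_integrable(1) f) simp
  have c: "(\<lambda>n. LINT z|lborel. \<bar>?P (X n) z - ?P p z\<bar>) \<longlonglongrightarrow> 0"
  proof (rule free_L1_convergence[OF f, where b = "max K p"])
    show "(\<lambda>n. X n - a) \<longlonglongrightarrow> p - a" by (intro tendsto_intros lim)
    show "X n - a \<le> max K p" for n using K[of n] a unfolding real_norm_def by linarith
  qed (use X p a in auto)
  have "(\<lambda>n. (LINT z|lborel. ?P (X n) z) - (LINT z|lborel. ?P p z)) \<longlonglongrightarrow> 0"
  proof (rule Lim_null_comparison[OF always_eventually c], intro allI)
    fix n
    have "(LINT z|lborel. ?P (X n) z) - (LINT z|lborel. ?P p z) = (LINT z|lborel. ?P (X n) z - ?P p z)"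
      using X p i by (simp add: Bochner_Integration.integral_diff)
    then show "norm ((LINT z|lborel. ?P (X n) z) - (LINT z|lborel. ?P p z)) \<le> (LINT z|lborel. \<bar>?P (X n) z - ?P p z\<bar>)"
      using integral_norm_bound[of lborel "\<lambda>z. ?P (X n) z - ?P p z"] by simp
  qed
  then show "(\<lambda>n. LINT z|lborel. ?P (X n) z) \<longlonglongrightarrow> (LINT z|lborel. ?P p z)" by (simp add: LIM_zero_iff)
qed

lemma rho_plus_beyond_cont: "continuous_on {b..} (rho_plus \<alpha> b fb fi)"
proof -
  define fc where "fc z = indicator {0<..<sqrt (2 * b)} (fst z) * fb z" for z
  have fbp: "fb \<in> borel_measurable (borel \<Otimes>\<^sub>M borel)" unfolding borel_prod by (rule fb_measurable)
  have "fc \<in> borel_measurable (borel \<Otimes>\<^sub>M borel)" unfolding fc_def[abs_def] using fbp by measurable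
  then have fcm: "fc \<in> borel_measurable borel" by (simp add: borel_prod)
  have fci: "integrable lborel fc"
    by (rule Bochner_Integration.integrable_bound[OF fb(1)]) (use fcm in \<open>auto simp: fc_def split: split_indicator\<close>)
  have 1: "continuous_on {b..} (\<lambda>q. LINT z|lborel. pull (free_dom q) (free_map q) fi z)"
    using continuous_on_subset[OF free_integral_continuous[OF fi(1), of 0], of "{b..}"] b by simp
  have 2: "continuous_on {b..} (\<lambda>q. LINT z|lborel. pull (free_dom (q - b)) (free_map (q - b)) fc z)"
    using free_integral_continuous[OF fci, of b] b by simp
  have "continuous_on {b..} (\<lambda>q. (LINT z|lborel. pull (free_dom q) (free_map q) fi z)
     + 2 / (1 - \<alpha>) * (LINT z|lborel. pull (free_dom (q - b)) (free_map (q - b)) fc z))"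
    by (intro continuous_intros 1 2)
  then show ?thesis
    by (rule continuous_on_eq) (simp add: rho_plus_beyond fc_def[abs_def])
qed

lemma rho_plus_beyond_nonneg: assumes "q \<ge> b" shows "rho_plus \<alpha> b fb fi q \<ge> 0"
  unfolding rho_plus_beyond[OF assms] using \<alpha>
  by (intro add_nonneg_nonneg mult_nonneg_nonneg integral_nonneg_AE AE_I2) (auto simp: pull_def fi fb)

end

context positive_sheath
begin

text \<open>Beyond \<open>b\<close> the derivative of \<open>V\<close> is at least \<open>- n_e\<close>, as \<open>rho_plus\<close> is nonnegative, so a positive
  value at \<open>b\<close> persists for a while.  This turns \<open>b \<in> B\<close> into \<open>b < sup B\<close>.\<close>

lemma V_pos_beyond: obtains q where "q > b" "\<And>p. p \<in> {0<..q} \<Longrightarrow> V p > 0"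
proof -
  let ?F = "\<lambda>q. rho_plus \<alpha> b fb fi q - n_e q"
  have c1: "continuous_on {0..b} ?F"
    by (rule continuous_on_eq[OF force_cont]) (simp add: force_def rho_plus_eq)
  have c2: "continuous_on {b..b + 1} ?F"
    by (intro continuous_intros continuous_on_subset[OF rho_plus_beyond_cont] continuous_on_subset[OF n_e_cont]) auto
  obtain M where M: "\<forall>y\<in>n_e ` {b..b + 1}. norm y \<le> M"
    using compact_imp_bounded[OF compact_continuous_image[OF continuous_on_subset[OF n_e_cont], of "{b..b + 1}"]]
    unfolding bounded_iff by auto
  have ne: "n_e q \<le> M" if "q \<in> {b..b + 1}" for q
  proof -
    have "norm (n_e q) \<le> M" using M that by blast
    then show ?thesis by simp
  qed
  have step: "V p \<ge> V b - M * (p - b)" if p: "p \<in> {b..b + 1}" for p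
  proof -
    have c3: "continuous_on {b..p} ?F" by (rule continuous_on_subset[OF c2]) (use p in auto)
    have s1: "set_integrable lborel {0..b} ?F" by (rule borel_integrable_atLeastAtMost'[OF c1])
    have s2: "set_integrable lborel {b..p} ?F" by (rule borel_integrable_atLeastAtMost'[OF c3])
    have un: "{0..b} \<union> {b..p} = {0..p}" using b p by auto
    have s3: "set_integrable lborel {0..p} ?F"
      using set_integrable_Un[OF s1 s2] un by simp
    have Vb: "V b = integral {0..b} ?F"
      unfolding V_plus_def zero_ereal_def using b by (intro interval_integral_eq_integral s1) auto
    have Vp: "V p = integral {0..p} ?F"
      unfolding V_plus_def zero_ereal_def using b p by (intro interval_integral_eq_integral s3) auto
    have i3: "?F integrable_on {0..p}" by (rule set_borel_integral_eq_integral(1)[OF s3])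
    have i2: "?F integrable_on {b..p}" by (rule set_borel_integral_eq_integral(1)[OF s2])
    have "V p = V b + integral {b..p} ?F"
      unfolding Vp Vb using b p i3 by (intro Henstock_Kurzweil_Integration.integral_combine[symmetric]) auto
    moreover have "integral {b..p} (\<lambda>_. - M) \<le> integral {b..p} ?F"
    proof (rule integral_le)
      fix q assume q: "q \<in> {b..p}"
      then show "- M \<le> ?F q" using rho_plus_beyond_nonneg[of q] ne[of q] p by auto
    qed (use i2 in auto)
    ultimately show ?thesis using p by (simp add: mult.commute)
  qed
  have Vb: "V b > 0" using V_pos[of b] b by simp
  \<comment> \<open>with slope at least \<open>- M\<close>, half of \<open>V b\<close> is left at \<open>b + d\<close>\<close>
  define d where "d = min 1 (V b / (2 * (\<bar>M\<bar> + 1)))"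
  have d: "d > 0" "d \<le> 1" using Vb by (auto simp: d_def)
  have Md: "M * d < V b"
  proof -
    have "M * d \<le> (\<bar>M\<bar> + 1) * (V b / (2 * (\<bar>M\<bar> + 1)))" using d by (intro mult_mono) (auto simp: d_def)
    also have "\<dots> = V b / 2" by (simp add: field_simps)
    finally show ?thesis using Vb by simp
  qed
  have "V p > 0" if p: "p \<in> {0<..b + d}" for p
  proof (cases "p \<le> b")
    case True then show ?thesis using V_pos p by simp
  next
    case False
    have "M * (p - b) < V b"
    proof (cases "M \<ge> 0")
      case True
      have "M * (p - b) \<le> M * d" using True p by (intro mult_left_mono) auto
      then show ?thesis using Md by simp
    next
      case M: False
      have "M * (p - b) \<le> 0" using M False by (intro mult_nonpos_nonneg) auto
      then show ?thesis using Vb by simp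
    qed
    then show ?thesis using step[of p] False p d by simp
  qed
  then show thesis using d by (intro that[of "b + d"]) auto
qed

end

context sheath
begin

abbreviation B :: "real set" where "B \<equiv> B_plus n_e \<alpha> b fb fi"

lemma positive_sheathI: "(\<And>p. p \<in> {0<..b} \<Longrightarrow> V p > 0) \<Longrightarrow> positive_sheath \<alpha> b r fb fi n_e"
  by unfold_locales

lemma barrier_iff: "ereal b < Sup (ereal ` B) \<longleftrightarrow> (\<forall>p\<in>{0<..b}. V p > 0)"
proof
  assume "ereal b < Sup (ereal ` B)"
  then obtain q where "q \<in> B" "b < q" unfolding less_Sup_iff by auto
  then show "\<forall>p\<in>{0<..b}. V p > 0" by (auto simp: B_plus_def)
next
  assume "\<forall>p\<in>{0<..b}. V p > 0"
  then interpret P: positive_sheath \<alpha> b r fb fi n_e by (intro positive_sheathI) auto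
  obtain q where "q > b" "\<And>p. p \<in> {0<..q} \<Longrightarrow> V p > 0" by (rule P.V_pos_beyond) blast
  then have "q \<in> B" "b < q" using b by (auto simp: B_plus_def)
  then show "ereal b < Sup (ereal ` B)" unfolding less_Sup_iff by (intro bexI[of _ "ereal q"]) auto
qed

text \<open>Necessity is the energy identity; sufficiency is the separated equation together with the
  uniqueness of the density for a given potential.\<close>

lemma unique_solution_iff: "VP_has_unique_solution n_e \<alpha> b fb fi \<longleftrightarrow> (\<forall>p\<in>{0<..b}. V p > 0)"
proof
  assume "VP_has_unique_solution n_e \<alpha> b fb fi"
  then obtain f \<phi> where "VP_solution n_e \<alpha> b fb fi f \<phi>" unfolding VP_has_unique_solution_def by blast
  then show "\<forall>p\<in>{0<..b}. V p > 0" using solution_V_pos by blast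
next
  assume "\<forall>p\<in>{0<..b}. V p > 0"
  then interpret P: positive_sheath \<alpha> b r fb fi n_e by (intro positive_sheathI) auto
  show "VP_has_unique_solution n_e \<alpha> b fb fi"
    unfolding VP_has_unique_solution_def
  proof (intro conjI allI impI, goal_cases)
    case 1
    show ?case using P.potential_solution by blast
  next
    case (2 f \<phi> g \<theta> x)
    then show ?case using P.solution_unique by metis
  next
    case (3 f \<phi> g \<theta> x)
    have "\<phi> x = \<theta> x" using 3 P.solution_unique by metis
    moreover have "AE z in lborel. f x z = dens (\<phi> x) z" "AE z in lborel. g x z = dens (\<theta> x) z"
      using 3 solution_dens by blast+
    ultimately show ?case by auto
  qed
qed

lemma B_nonempty: assumes "curvature 0 > 0" shows "B \<noteq> {}"
proof -
  obtain c d where c: "c > 0" "0 < d" "d \<le> b" "\<And>p. p \<in> {0..d} \<Longrightarrow> c * p\<^sup>2 \<le> V p"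
    by (rule V_lower_near_0[OF assms]) blast
  have "V p > 0" if "p \<in> {0<..d}" for p
    using c(4)[of p] that mult_pos_pos[OF c(1), of "p\<^sup>2"] by auto
  then have "d \<in> B" using c by (auto simp: B_plus_def)
  then show ?thesis by blast
qed

lemma no_solution_B_empty: assumes "B = {}" shows "\<not> VP_solution n_e \<alpha> b fb fi f \<phi>"
proof
  assume "VP_solution n_e \<alpha> b fb fi f \<phi>"
  then have "b \<in> B" using solution_V_pos b by (auto simp: B_plus_def)
  then show False using assms by blast
qed

lemma no_solution_concave: assumes "curvature 0 < 0" shows "\<not> VP_solution n_e \<alpha> b fb fi f \<phi>"
proof
  assume sol: "VP_solution n_e \<alpha> b fb fi f \<phi>"
  obtain d where d: "0 < d" "d \<le> b" "\<And>p. p \<in> {0<..d} \<Longrightarrow> V p < 0" by (rule V_upper_near_0[OF assms]) blast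
  then have "V d < 0" by simp
  moreover have "V d > 0" using solution_V_pos[OF sol, of d] d by simp
  ultimately show False by simp
qed

end

section \<open>Passage to nonnegative representatives\<close>

text \<open>The data of the problem are classes of functions modulo null sets, and the values of the inflow outside the
  half space are arbitrary.  The following lemmas show that the problem depends only on the classes; the
  substitutions of velocities preserve null sets because they are changes of variables.\<close>

definition half_pos :: "(velocity \<Rightarrow> real) \<Rightarrow> velocity \<Rightarrow> real" where
  "half_pos f z = max 0 (indicator half_space z * f z)"

definition pos_part :: "(velocity \<Rightarrow> real) \<Rightarrow> velocity \<Rightarrow> real" where
  "pos_part f z = max 0 (f z)"

lemma half_space_borel [measurable]: "half_space \<in> sets borel"
  unfolding half_space_def by (intro borel_open) (auto intro!: open_Collect_less continuous_intros)

lemma AE_free_map: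
  assumes "AE z in lborel. Q z" and p: "p \<ge> 0"
  shows "AE z in lborel. free_dom p z \<longrightarrow> Q (free_map p z)"
proof -
  obtain N where N0: "{z \<in> space lborel. \<not> Q z} \<subseteq> N" "emeasure lborel N = 0" "N \<in> sets lborel"
    by (rule AE_E[OF assms(1)])
  then have N: "\<And>z. z \<notin> N \<Longrightarrow> Q z" and [measurable]: "N \<in> sets borel" by auto
  have "(\<integral>\<^sup>+z. (if free_dom p z then indicator N (free_map p z) else 0) \<partial>lborel)
     = (\<integral>\<^sup>+z. indicator N z * ennreal (\<bar>fst z\<bar> / sqrt ((fst z)\<^sup>2 + 2 * p)) \<partial>lborel)"
    by (rule nn_integral_free[OF _ p]) measurable
  also have "\<dots> = (\<integral>\<^sup>+(z::velocity). 0 \<partial>lborel)"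
  proof (rule nn_integral_cong_AE)
    have "AE z in lborel. z \<notin> N" using N0 by (intro AE_not_in) auto
    then show "AE z in lborel. indicator N z * ennreal (\<bar>fst z\<bar> / sqrt ((fst z)\<^sup>2 + 2 * p)) = 0"
      by eventually_elim simp
  qed
  also have "\<dots> = 0" by simp
  finally have "AE z in lborel. (if free_dom p z then indicator N (free_map p z) else 0) = (0 :: ennreal)"
    by (subst (asm) nn_integral_0_iff_AE) auto
  then show ?thesis by eventually_elim (use N in \<open>auto simp: indicator_eq_0_iff split: if_splits\<close>)
qed

lemma AE_free_map_inverse:
  assumes "AE z in lborel. Q z" and p: "p \<ge> 0"
  shows "AE z in lborel. fst z > 0 \<longrightarrow> Q (sqrt ((fst z)\<^sup>2 + 2 * p), snd (z :: velocity))"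
proof -
  obtain N where N0: "{z \<in> space lborel. \<not> Q z} \<subseteq> N" "emeasure lborel N = 0" "N \<in> sets lborel"
    by (rule AE_E[OF assms(1)])
  then have N: "\<And>z. z \<notin> N \<Longrightarrow> Q z" and Nm: "N \<in> sets (borel \<Otimes>\<^sub>M borel)" unfolding borel_prod by auto
  define g :: "velocity \<Rightarrow> ennreal" where
    "g z = indicator {0<..} (fst z) * indicator N (sqrt ((fst z)\<^sup>2 + 2 * p), snd z)" for z
  have "g \<in> borel_measurable (borel \<Otimes>\<^sub>M borel)" unfolding g_def[abs_def] using Nm by measurable
  then have gm [measurable]: "g \<in> borel_measurable borel" by (simp add: borel_prod)
  have km [measurable]: "(\<lambda>z :: velocity. \<bar>fst z\<bar> / sqrt ((fst z)\<^sup>2 + 2 * p)) \<in> borel_measurable borel"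
    unfolding borel_prod[symmetric] by measurable
  have "(\<integral>\<^sup>+z. g z * ennreal (\<bar>fst z\<bar> / sqrt ((fst z)\<^sup>2 + 2 * p)) \<partial>lborel) = (\<integral>\<^sup>+z. (if free_dom p z then g (free_map p z) else 0) \<partial>lborel)"
    by (rule nn_integral_free[OF gm p, symmetric])
  also have "\<dots> \<le> (\<integral>\<^sup>+z. indicator N z \<partial>lborel)"
  proof (intro nn_integral_mono)
    fix z :: velocity
    obtain v \<eta> where z: "z = (v, \<eta>)" by (cases z)
    show "(if free_dom p z then g (free_map p z) else 0) \<le> indicator N z"
    proof (cases "free_dom p z \<and> v > 0")
      case True
      then have "2 * p < v\<^sup>2" by (simp add: free_dom_def z)
      then have "g (free_map p z) = indicator {0<..} (sqrt (v\<^sup>2 - 2 * p)) * indicator N z"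
        using True by (simp add: g_def free_map_def z)
      then show ?thesis by (simp split: split_indicator)
    next
      case False
      then have "(if free_dom p z then g (free_map p z) else 0) = 0"
        using p by (auto simp: g_def free_map_def z sgn_if free_dom_def split: split_indicator)
      then show ?thesis by simp
    qed
  qed
  also have "\<dots> = 0" using N0 by simp
  finally have "(\<integral>\<^sup>+z. g z * ennreal (\<bar>fst z\<bar> / sqrt ((fst z)\<^sup>2 + 2 * p)) \<partial>lborel) = 0" by simp
  then have "AE z in lborel. g z * ennreal (\<bar>fst z\<bar> / sqrt ((fst z)\<^sup>2 + 2 * p)) = 0"
    by (subst (asm) nn_integral_0_iff_AE) auto
  then show ?thesis
  proof eventually_elim
    case (elim z)
    show ?case
    proof
      assume s: "fst z > 0"
      have "(fst z)\<^sup>2 + 2 * p > 0" using s p by (intro add_pos_nonneg) auto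
      then have "0 < \<bar>fst z\<bar> / sqrt ((fst z)\<^sup>2 + 2 * p)" using s by (intro divide_pos_pos) auto
      then have "ennreal (\<bar>fst z\<bar> / sqrt ((fst z)\<^sup>2 + 2 * p)) \<noteq> 0" by (simp only: ennreal_eq_0_iff not_le)
      then have "g z = 0" using elim by simp
      then show "Q (sqrt ((fst z)\<^sup>2 + 2 * p), snd z)" using N s by (auto simp: g_def split: split_indicator_asm)
    qed
  qed
qed

lemma AE_trap_map:
  assumes "AE z in lborel. Q z" and p: "0 \<le> p" "p \<le> b"
  shows "AE z in lborel. trap_dom p z \<longrightarrow> Q (trap_map b p z)"
proof -
  obtain N where N0: "{z \<in> space lborel. \<not> Q z} \<subseteq> N" "emeasure lborel N = 0" "N \<in> sets lborel"
    by (rule AE_E[OF assms(1)])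
  then have N: "\<And>z. z \<notin> N \<Longrightarrow> Q z" and Nm [measurable]: "N \<in> sets borel" by auto
  let ?k = "\<lambda>s. ennreal (s / sqrt (s\<^sup>2 - 2 * (b - p))) * indicator {sqrt (2 * (b - p))<..<sqrt (2 * b)} s"
  have Np: "AE s in lborel. (\<integral>\<^sup>+\<eta>. indicator N (s, \<eta>) \<partial>lborel) = 0"
  proof -
    have "(\<integral>\<^sup>+s. \<integral>\<^sup>+\<eta>. indicator N (s, \<eta>) \<partial>lborel \<partial>lborel) = (\<integral>\<^sup>+z. indicator N z \<partial>lborel)"
      by (rule nn_integral_lborel_pair(2)[symmetric]) measurable
    also have "\<dots> = 0" using N0 by simp
    finally show ?thesis
    proof (subst (asm) nn_integral_0_iff_AE)
      have "N \<in> sets (borel \<Otimes>\<^sub>M borel)" unfolding borel_prod by (rule Nm)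
      then show "(\<lambda>s. \<integral>\<^sup>+\<eta>. indicator N (s, \<eta>) \<partial>lborel) \<in> borel_measurable lborel"
        by (intro lborel.borel_measurable_nn_integral) measurable
    qed
  qed
  have "(\<integral>\<^sup>+z. (if trap_dom p z then indicator N (trap_map b p z) else 0) \<partial>lborel)
     = 2 * (\<integral>\<^sup>+s. (\<integral>\<^sup>+\<eta>. indicator N (s, \<eta>) \<partial>lborel) * ennreal (s / sqrt (s\<^sup>2 - 2 * (b - p))) * indicator {sqrt (2 * (b - p))<..<sqrt (2 * b)} s \<partial>lborel)"
    by (rule nn_integral_trap[OF _ p]) measurable
  also have "(\<integral>\<^sup>+s. (\<integral>\<^sup>+\<eta>. indicator N (s, \<eta>) \<partial>lborel) * ennreal (s / sqrt (s\<^sup>2 - 2 * (b - p))) * indicator {sqrt (2 * (b - p))<..<sqrt (2 * b)} s \<partial>lborel) = (\<integral>\<^sup>+(s::real). 0 \<partial>lborel)"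
    by (rule nn_integral_cong_AE, use Np in eventually_elim) simp
  finally have "(\<integral>\<^sup>+z. (if trap_dom p z then indicator N (trap_map b p z) else 0) \<partial>lborel) = 0" by simp
  then have "AE z in lborel. (if trap_dom p z then indicator N (trap_map b p z) else 0) = (0 :: ennreal)"
    by (subst (asm) nn_integral_0_iff_AE) auto
  then show ?thesis by eventually_elim (use N in \<open>auto simp: indicator_eq_0_iff split: if_splits\<close>)
qed

text \<open>Here \<open>f1\<close> is the inflow extended by zero; it is Borel, and \<open>fb\<close> is its positive part.\<close>

locale kinetic_data =
  fixes b :: real and f_b f_inf :: "velocity \<Rightarrow> real"
  assumes b: "b > 0"
    and f_b: "set_integrable lborel half_space f_b" "AE \<xi> in lborel. \<xi> \<in> half_space \<longrightarrow> f_b \<xi> \<ge> 0"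
    and f_inf: "integrable lborel f_inf" "AE \<xi> in lborel. f_inf \<xi> \<ge> 0"
begin

abbreviation "fb \<equiv> half_pos f_b"
abbreviation "fi \<equiv> pos_part f_inf"
abbreviation "f1 \<equiv> \<lambda>z. indicator half_space z * f_b z"

lemma f1_integrable: "integrable lborel f1" using f_b(1) by (simp add: set_integrable_def)
lemma fb_integrable: "integrable lborel fb"
  unfolding half_pos_def[abs_def] by (intro integrable_max f1_integrable) simp
lemma fi_integrable: "integrable lborel fi"
  unfolding pos_part_def[abs_def] by (intro integrable_max f_inf) simp
lemma fb_AE: "AE z in lborel. f1 z = fb z"
  using f_b(2) by eventually_elim (auto simp: half_pos_def split: split_indicator)
lemma fi_AE: "AE z in lborel. f_inf z = fi z"
  using f_inf(2) by eventually_elim (auto simp: pos_part_def)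

lemma section_AE: "AE s in lborel. AE \<eta> in lborel. f1 (s, \<eta>) = fb (s, \<eta>)"
proof -
  have "AE z in lborel \<Otimes>\<^sub>M lborel. f1 z = fb z" unfolding lborel_prod by (rule fb_AE)
  from lborel_pair.AE_pair[OF this] show ?thesis .
qed

lemma f1_measurable: "f1 \<in> borel_measurable borel" using f1_integrable by auto
lemma fb_measurable: "fb \<in> borel_measurable borel" using fb_integrable by auto

lemma section_measurable:
  "(\<lambda>\<eta>. f1 (s, \<eta>)) \<in> borel_measurable lborel" "(\<lambda>\<eta>. fb (s, \<eta>)) \<in> borel_measurable lborel"
proof -
  show "(\<lambda>\<eta>. f1 (s, \<eta>)) \<in> borel_measurable lborel"
    using borel_measurable_section_integral(3)[OF f1_measurable, of s] by (simp only: measurable_lborel2)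
  show "(\<lambda>\<eta>. fb (s, \<eta>)) \<in> borel_measurable lborel"
    using borel_measurable_section_integral(3)[OF fb_measurable, of s] by (simp only: measurable_lborel2)
qed

lemma rho_plus_nonneg_data: "rho_plus \<alpha> b f_b f_inf = rho_plus \<alpha> b fb fi"
proof
  fix p
  let ?k = "\<lambda>s. s / sqrt (s\<^sup>2 + 2 * (p - b))"
  define l u where "l = sqrt (2 * (b - p) * chi (b - p))" and "u = sqrt (2 * b)"
  have chi: "2 * (b - p) * chi (b - p) \<ge> 0" by (auto simp: chi_def indicator_def)
  have km: "(\<lambda>z :: velocity. \<bar>fst z\<bar> / sqrt ((fst z)\<^sup>2 + 2 * p)) \<in> borel_measurable borel"
    unfolding borel_prod[symmetric] by measurable
  have 1: "(LINT \<xi>|lborel. f_inf \<xi> * (\<bar>fst \<xi>\<bar> / sqrt ((fst \<xi>)\<^sup>2 + 2 * p))) = (LINT \<xi>|lborel. fi \<xi> * (\<bar>fst \<xi>\<bar> / sqrt ((fst \<xi>)\<^sup>2 + 2 * p)))"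
  proof (rule integral_cong_AE)
    show "(\<lambda>\<xi>. f_inf \<xi> * (\<bar>fst \<xi>\<bar> / sqrt ((fst \<xi>)\<^sup>2 + 2 * p))) \<in> borel_measurable lborel"
      "(\<lambda>\<xi>. fi \<xi> * (\<bar>fst \<xi>\<bar> / sqrt ((fst \<xi>)\<^sup>2 + 2 * p))) \<in> borel_measurable lborel"
      using borel_measurable_times[OF _ km] f_inf(1) fi_integrable by auto
    show "AE \<xi> in lborel. f_inf \<xi> * (\<bar>fst \<xi>\<bar> / sqrt ((fst \<xi>)\<^sup>2 + 2 * p)) = fi \<xi> * (\<bar>fst \<xi>\<bar> / sqrt ((fst \<xi>)\<^sup>2 + 2 * p))"
      using fi_AE by eventually_elim simp
  qed
  have l: "l \<ge> 0" unfolding l_def using chi by simp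
  have u: "u > 0" unfolding u_def using b by simp
  have I0: "s > 0" if "s \<in> einterval (min (ereal l) (ereal u)) (max (ereal l) (ereal u))" for s
    using that l u by (auto simp: einterval_def min_def max_def split: if_splits)
  have 2: "(LBINT s=l..u. (LINT \<eta>|lborel. f_b (s, \<eta>) * ?k s)) = (LBINT s=l..u. (LINT \<eta>|lborel. f1 (s, \<eta>) * ?k s))"
    by (rule interval_integral_cong) (use I0 in \<open>simp add: half_space_def\<close>)
  have m: "(\<lambda>s. LINT \<eta>|lborel. g (s, \<eta>) * ?k s) \<in> borel_measurable borel" if g: "g \<in> borel_measurable borel" for g :: "velocity \<Rightarrow> real"
  proof -
    have "(\<lambda>w :: velocity. ?k (fst w)) \<in> borel_measurable borel" unfolding borel_prod[symmetric] by measurable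
    from borel_measurable_section_integral(1)[OF borel_measurable_times[OF g this]] show ?thesis by simp
  qed
  have 3: "(LBINT s=l..u. (LINT \<eta>|lborel. f1 (s, \<eta>) * ?k s)) = (LBINT s=l..u. (LINT \<eta>|lborel. fb (s, \<eta>) * ?k s))"
  proof (rule interval_integral_cong_AE)
    show "AE s\<in>einterval (min (ereal l) (ereal u)) (max (ereal l) (ereal u)) in lborel. (LINT \<eta>|lborel. f1 (s, \<eta>) * ?k s) = (LINT \<eta>|lborel. fb (s, \<eta>) * ?k s)"
      using section_AE
    proof eventually_elim
      case (elim s)
      have "(LINT \<eta>|lborel. f1 (s, \<eta>) * ?k s) = (LINT \<eta>|lborel. fb (s, \<eta>) * ?k s)"
      proof (rule integral_cong_AE)
        show "(\<lambda>\<eta>. f1 (s, \<eta>) * ?k s) \<in> borel_measurable lborel"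
          by (rule borel_measurable_times[OF section_measurable(1) borel_measurable_const])
        show "(\<lambda>\<eta>. fb (s, \<eta>) * ?k s) \<in> borel_measurable lborel"
          by (rule borel_measurable_times[OF section_measurable(2) borel_measurable_const])
      qed (use elim in \<open>auto elim: eventually_mono\<close>)
      then show ?case by simp
    qed
  qed (intro m f1_measurable fb_measurable)+
  show "rho_plus \<alpha> b f_b f_inf p = rho_plus \<alpha> b fb fi p"
    unfolding rho_plus_def 1 l_def[symmetric] u_def[symmetric] 2 3 ..
qed

lemma V_plus_nonneg_data: "V_plus n_e \<alpha> b f_b f_inf = V_plus n_e \<alpha> b fb fi"
  by (simp add: V_plus_def[abs_def] rho_plus_nonneg_data)

lemma inflow_nonneg_data:
  assumes \<psi>: "\<psi> \<in> test_functions \<alpha>"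
  shows "(LINT \<xi>:half_space|lborel. f_b \<xi> * (fst \<xi> * \<psi> (0, \<xi>))) = (LINT \<xi>:half_space|lborel. fb \<xi> * (fst \<xi> * \<psi> (0, \<xi>)))"
  unfolding set_lebesgue_integral_def
proof (rule integral_cong_AE)
  obtain D R C where \<psi>c: "continuous_on closed_half \<psi>" by (rule test_function_props[OF \<psi>]) blast
  have "continuous_on UNIV (\<lambda>z. fst z * \<psi> (0, z))"
    by (intro continuous_intros continuous_on_compose2[OF \<psi>c]) auto
  then have m: "(\<lambda>z. fst z * \<psi> (0, z)) \<in> borel_measurable borel" by (rule borel_measurable_continuous_onI)
  have e: "indicator half_space \<xi> *\<^sub>R (f_b \<xi> * (fst \<xi> * \<psi> (0, \<xi>))) = f1 \<xi> * (fst \<xi> * \<psi> (0, \<xi>))"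
    "indicator half_space \<xi> *\<^sub>R (fb \<xi> * (fst \<xi> * \<psi> (0, \<xi>))) = fb \<xi> * (fst \<xi> * \<psi> (0, \<xi>))" for \<xi>
    by (auto simp: half_pos_def split: split_indicator)
  show "(\<lambda>\<xi>. indicator half_space \<xi> *\<^sub>R (f_b \<xi> * (fst \<xi> * \<psi> (0, \<xi>)))) \<in> borel_measurable lborel"
    "(\<lambda>\<xi>. indicator half_space \<xi> *\<^sub>R (fb \<xi> * (fst \<xi> * \<psi> (0, \<xi>)))) \<in> borel_measurable lborel"
    unfolding e using borel_measurable_times[OF f1_measurable m] borel_measurable_times[OF fb_measurable m] by auto
  show "AE \<xi> in lborel. indicator half_space \<xi> *\<^sub>R (f_b \<xi> * (fst \<xi> * \<psi> (0, \<xi>))) = indicator half_space \<xi> *\<^sub>R (fb \<xi> * (fst \<xi> * \<psi> (0, \<xi>)))"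
    unfolding e using fb_AE by eventually_elim simp
qed

lemma VP_solution_nonneg_data: "VP_solution n_e \<alpha> b f_b f_inf f \<phi> \<longleftrightarrow> VP_solution n_e \<alpha> b fb fi f \<phi>"
proof -
  have w: "VP_weak \<alpha> f_b f \<phi> \<longleftrightarrow> VP_weak \<alpha> fb f \<phi>"
    unfolding VP_weak_def by (intro ball_cong refl) (simp only: inflow_nonneg_data)
  have l: "((\<lambda>x. LINT \<xi>|lborel. \<bar>f x \<xi> - f_inf \<xi>\<bar>) \<longlongrightarrow> 0) at_top \<longleftrightarrow> ((\<lambda>x. LINT \<xi>|lborel. \<bar>f x \<xi> - fi \<xi>\<bar>) \<longlongrightarrow> 0) at_top"
    if c: "continuous_into_L1 f"
  proof (rule tendsto_cong, rule eventually_at_top_linorderI[of 0])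
    fix x :: real assume "x \<ge> 0"
    then have "integrable lborel (f x)" using c by (simp add: continuous_into_L1_def)
    then show "(LINT \<xi>|lborel. \<bar>f x \<xi> - f_inf \<xi>\<bar>) = (LINT \<xi>|lborel. \<bar>f x \<xi> - fi \<xi>\<bar>)"
      using f_inf(1) fi_integrable fi_AE by (intro integral_cong_AE) auto
  qed
  show ?thesis unfolding VP_solution_def w using l by blast
qed

lemma density_nonneg_data:
  assumes p: "0 < \<phi> x" "\<phi> x \<le> b"
  shows "AE z in lborel. density_plus \<alpha> b f_b f_inf \<phi> x z = density_plus \<alpha> b fb fi \<phi> x z"
  using AE_free_map[OF fi_AE less_imp_le[OF p(1)]] AE_trap_map[OF fb_AE less_imp_le[OF p(1)] p(2)] AE_fst_neq[of 0]
proof eventually_elim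
  case (elim z)
  obtain s \<eta> where z: "z = (s, \<eta>)" by (cases z)
  have s0: "s \<noteq> 0" using elim(3) z by simp
  have e: "s\<^sup>2 - 2 * \<phi> x + 2 * b = s\<^sup>2 + (2 * b - 2 * \<phi> x)" by simp
  have "s\<^sup>2 + (2 * b - 2 * \<phi> x) > 0" using s0 p by (intro add_pos_nonneg) auto
  then have h: "(sqrt (s\<^sup>2 + (2 * b - 2 * \<phi> x)), \<eta>) \<in> half_space" by (simp add: half_space_def)
  have fr: "f_inf (sgn s * sqrt (s\<^sup>2 - 2 * \<phi> x), \<eta>) = fi (sgn s * sqrt (s\<^sup>2 - 2 * \<phi> x), \<eta>)" if "s\<^sup>2 - 2 * \<phi> x > 0"
    using elim(1) that by (simp add: z free_dom_def free_map_def)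
  have tr: "f_b (sqrt (s\<^sup>2 + (2 * b - 2 * \<phi> x)), \<eta>) = fb (sqrt (s\<^sup>2 + (2 * b - 2 * \<phi> x)), \<eta>)" if "s\<^sup>2 < 2 * \<phi> x"
    using elim(2) that h by (simp add: z trap_dom_def trap_map_def)
  consider "s\<^sup>2 - 2 * \<phi> x > 0" "s > 0" | "s\<^sup>2 - 2 * \<phi> x > 0" "s < 0" | "s\<^sup>2 < 2 * \<phi> x" | "s\<^sup>2 = 2 * \<phi> x"
    using s0 by linarith
  then show ?case
  proof cases
    case 1 then show ?thesis using fr by (simp add: z density_plus_def chi_def)
  next
    case 2 then show ?thesis using fr by (simp add: z density_plus_def chi_def)
  next
    case 3 then show ?thesis using tr by (simp add: z density_plus_def chi_def e)
  next
    case 4 then show ?thesis by (simp add: z density_plus_def chi_def)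
  qed
qed

lemma attractive_data_nonneg_data:
  assumes \<alpha>: "0 \<le> \<alpha>" "\<alpha> < 1" and r: "r > 2" and Lr: "in_Lr_L1 r 0 (sqrt (2 * b)) f_b"
    and one: "(LINT \<xi>|lborel. f_inf \<xi>) = 1"
    and compat: "AE \<xi> in lborel. \<xi> \<in> half_space \<longrightarrow>
      f_inf \<xi> = f_b (sqrt ((fst \<xi>)\<^sup>2 + 2 * b), snd \<xi>) + \<alpha> * f_inf (- fst \<xi>, snd \<xi>)"
  shows "attractive_data \<alpha> b r fb fi"
proof
  let ?S = "sqrt (2 * b)"
  show "integrable lborel (\<lambda>s. indicator {0<..<?S} s * marg fb s powr r)"
  proof -
    have i: "integrable lborel (\<lambda>s. indicator {0<..<?S} s * (LINT \<eta>|lborel. \<bar>f_b (s, \<eta>)\<bar>) powr r)"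
      using Lr by (simp add: in_Lr_L1_def set_integrable_def zero_ereal_def)
    have ae: "AE s in lborel. indicator {0<..<?S} s * (LINT \<eta>|lborel. \<bar>f_b (s, \<eta>)\<bar>) powr r = indicator {0<..<?S} s * marg fb s powr r"
      using section_AE
    proof eventually_elim
      case (elim s)
      show ?case
      proof (cases "s \<in> {0<..<?S}")
        case True
        then have f1: "f1 (s, \<eta>) = f_b (s, \<eta>)" for \<eta> by (simp add: half_space_def)
        have "(LINT \<eta>|lborel. \<bar>f_b (s, \<eta>)\<bar>) = (LINT \<eta>|lborel. \<bar>f1 (s, \<eta>)\<bar>)" by (simp only: f1)
        also have "\<dots> = marg fb s" unfolding marg_def
        proof (rule integral_cong_AE)
          show "(\<lambda>\<eta>. \<bar>f1 (s, \<eta>)\<bar>) \<in> borel_measurable lborel"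
            by (rule borel_measurable_abs[OF section_measurable(1)])
          show "(\<lambda>\<eta>. \<bar>fb (s, \<eta>)\<bar>) \<in> borel_measurable lborel"
            by (rule borel_measurable_abs[OF section_measurable(2)])
        qed (use elim in \<open>auto elim: eventually_mono\<close>)
        finally show ?thesis by simp
      next
        case False
        then have "indicator {0<..<?S} s = (0 :: real)" by (rule indicator_simps(2))
        then show ?thesis by (simp only: mult_zero_left)
      qed
    qed
    have m: "(\<lambda>s. indicator {0<..<?S} s * marg fb s powr r) \<in> borel_measurable lborel"
      using marg_measurable[OF fb_measurable] by measurable
    show ?thesis by (rule iffD1[OF integrable_cong_AE[OF borel_measurable_integrable[OF i] m ae] i])
  qed
  show "(LINT z|lborel. fi z) = 1"
    using one fi_AE f_inf(1) fi_integrable by (subst integral_cong_AE[of _ _ f_inf]) (auto elim: eventually_mono)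
  have reflect: "AE z in lborel. f_inf (- fst z, snd z) = fi (- fst z, snd z)"
  proof -
    obtain N where N: "{z \<in> space lborel. f_inf z \<noteq> fi z} \<subseteq> N" "emeasure lborel N = 0" "N \<in> sets lborel"
      by (rule AE_E[OF fi_AE])
    have Nm: "N \<in> sets (borel \<Otimes>\<^sub>M borel)" using N(3) unfolding borel_prod by simp
    have Mm: "(\<lambda>z. indicator N (- fst z, snd z) :: ennreal) \<in> borel_measurable (borel \<Otimes>\<^sub>M borel)"
      using Nm by measurable
    have "(\<integral>\<^sup>+z. indicator N (- fst z, snd z) \<partial>lborel) = (\<integral>\<^sup>+\<eta>. \<integral>\<^sup>+s. indicator N (- s, \<eta>) \<partial>lborel \<partial>lborel)"
      using Mm unfolding borel_prod by (subst nn_integral_lborel_pair(1)) auto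
    also have "\<dots> = (\<integral>\<^sup>+\<eta>. \<integral>\<^sup>+s. indicator N (s, \<eta>) \<partial>lborel \<partial>lborel)"
    proof (rule nn_integral_cong)
      fix \<eta> :: "real^2"
      have "(\<lambda>s. indicator N (s, \<eta>) :: ennreal) \<in> borel_measurable borel" using Nm by measurable
      from nn_integral_real_affine[OF this, of "-1" 0]
      show "(\<integral>\<^sup>+s. indicator N (- s, \<eta>) \<partial>lborel) = (\<integral>\<^sup>+s. indicator N (s, \<eta>) \<partial>lborel)" by simp
    qed
    also have "\<dots> = (\<integral>\<^sup>+z. indicator N z \<partial>lborel)"
      using N(3) by (intro nn_integral_lborel_pair(1)[symmetric]) auto
    also have "\<dots> = 0" using N by simp
    finally have "AE z in lborel. indicator N (- fst z, snd z) = (0 :: ennreal)"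
      using Mm unfolding borel_prod by (subst (asm) nn_integral_0_iff_AE) auto
    then show ?thesis by eventually_elim (use N(1) in \<open>auto split: split_indicator_asm\<close>)
  qed
  have shift: "AE z in lborel. z \<in> half_space \<longrightarrow> f_b (sqrt ((fst z)\<^sup>2 + 2 * b), snd z) = fb (sqrt ((fst z)\<^sup>2 + 2 * b), snd z)"
    using AE_free_map_inverse[OF fb_AE less_imp_le[OF b]]
  proof eventually_elim
    case (elim z)
    have "0 < (fst z)\<^sup>2 + 2 * b" using b by (intro add_nonneg_pos) auto
    then have "(sqrt ((fst z)\<^sup>2 + 2 * b), snd z) \<in> half_space" by (simp add: half_space_def)
    then show ?case using elim by (simp add: half_space_def)
  qed
  show "AE z in lborel. z \<in> half_space \<longrightarrow> fi z = fb (sqrt ((fst z)\<^sup>2 + 2 * b), snd z) + \<alpha> * fi (- fst z, snd z)"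
    using compat reflect shift fi_AE by eventually_elim auto
qed (use b \<alpha> r fb_integrable fi_integrable in \<open>auto simp: half_pos_def pos_part_def\<close>)

end

section \<open>Solvability of the boundary value problem\<close>

theorem theorem2p5:
  fixes n_e :: "real \<Rightarrow> real"
    and \<alpha> \<phi>\<^sub>b r :: real
    and f_b f_inf :: "velocity \<Rightarrow> real"
  defines "V \<equiv> V_plus n_e \<alpha> \<phi>\<^sub>b f_b f_inf"
    and "B \<equiv> B_plus n_e \<alpha> \<phi>\<^sub>b f_b f_inf"
    and "ddV0 \<equiv> (deriv_within {0..\<phi>\<^sub>b} ^^ 2) (V_plus n_e \<alpha> \<phi>\<^sub>b f_b f_inf) 0"
  assumes n_e: "Ck_on 2 UNIV n_e" "n_e 0 = 1" "deriv n_e 0 = -1"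
    and \<phi>\<^sub>b: "\<phi>\<^sub>b > 0"
    and \<alpha>: "0 \<le> \<alpha>" "\<alpha> < 1"
    and r: "r > 2"
    and f_b: "set_integrable lborel half_space f_b" "in_Lr_L1 r 0 (sqrt (2 * \<phi>\<^sub>b)) f_b"
      "AE \<xi> in lborel. \<xi> \<in> half_space \<longrightarrow> f_b \<xi> \<ge> 0"
    and f_inf: "integrable lborel f_inf" "AE \<xi> in lborel. f_inf \<xi> \<ge> 0"
      "(LINT \<xi>|lborel. f_inf \<xi>) = 1"
    and compat: "AE \<xi> in lborel. \<xi> \<in> half_space \<longrightarrow>
      f_inf \<xi> = f_b (sqrt ((fst \<xi>)\<^sup>2 + 2 * \<phi>\<^sub>b), snd \<xi>) + \<alpha> * f_inf (- fst \<xi>, snd \<xi>)"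
    and V_C2: "Ck_on 2 {0..\<phi>\<^sub>b} V"
  shows
    "(ddV0 > 0 \<longrightarrow>
        B \<noteq> {} \<and>
        (ereal \<phi>\<^sub>b < Sup (ereal ` B) \<longleftrightarrow> VP_has_unique_solution n_e \<alpha> \<phi>\<^sub>b f_b f_inf) \<and>
        (ereal \<phi>\<^sub>b < Sup (ereal ` B) \<longrightarrow>
          (\<forall>f \<phi>. VP_solution n_e \<alpha> \<phi>\<^sub>b f_b f_inf f \<phi> \<longrightarrow>
            (\<forall>x\<ge>0. AE \<xi> in lborel. f x \<xi> = density_plus \<alpha> \<phi>\<^sub>b f_b f_inf \<phi> x \<xi>) \<and>
            (\<exists>c>0. \<exists>C>0. \<forall>l\<in>{0, 1, 2}. \<forall>x\<ge>0.
               \<bar>(deriv_within {0..} ^^ l) \<phi> x\<bar> \<le> C * exp (- c * x)))))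
     \<and>
     (ddV0 = 0 \<and> B \<noteq> {} \<longrightarrow>
        (ereal \<phi>\<^sub>b < Sup (ereal ` B) \<longleftrightarrow> VP_has_unique_solution n_e \<alpha> \<phi>\<^sub>b f_b f_inf) \<and>
        (ereal \<phi>\<^sub>b < Sup (ereal ` B) \<longrightarrow>
          (\<forall>f \<phi>. VP_solution n_e \<alpha> \<phi>\<^sub>b f_b f_inf f \<phi> \<longrightarrow>
            (\<forall>x\<ge>0. AE \<xi> in lborel. f x \<xi> = density_plus \<alpha> \<phi>\<^sub>b f_b f_inf \<phi> x \<xi>))))
     \<and>
     (ddV0 = 0 \<and> B = {} \<longrightarrow> \<not> (\<exists>f \<phi>. VP_solution n_e \<alpha> \<phi>\<^sub>b f_b f_inf f \<phi>))
     \<and>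
     (ddV0 < 0 \<longrightarrow> \<not> (\<exists>f \<phi>. VP_solution n_e \<alpha> \<phi>\<^sub>b f_b f_inf f \<phi>))"
proof -
  interpret K: kinetic_data \<phi>\<^sub>b f_b f_inf
    by unfold_locales (use \<phi>\<^sub>b f_b(1,3) f_inf(1,2) in auto)
  interpret A: attractive_data \<alpha> \<phi>\<^sub>b r K.fb K.fi
    by (rule K.attractive_data_nonneg_data[OF \<alpha> r f_b(2) f_inf(3) compat])
  have Veq: "V_plus n_e \<alpha> \<phi>\<^sub>b f_b f_inf = V_plus n_e \<alpha> \<phi>\<^sub>b K.fb K.fi" by (rule K.V_plus_nonneg_data)
  interpret S: sheath \<alpha> \<phi>\<^sub>b r K.fb K.fi n_e
  proof
    have "n_e differentiable_on UNIV" using n_e(1) by (simp add: numeral_2_eq_2)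
    then show "continuous_on UNIV n_e" by (rule differentiable_imp_continuous_on)
    show "n_e 0 = 1" by (rule n_e(2))
    show "Ck_on 2 {0..\<phi>\<^sub>b} (V_plus n_e \<alpha> \<phi>\<^sub>b K.fb K.fi)" using V_C2 unfolding V_def Veq .
  qed
  have Beq: "B = S.B" unfolding B_def B_plus_def Veq ..
  have dd: "ddV0 = S.curvature 0" unfolding ddV0_def Veq S.curvature_def ..
  have sol: "VP_solution n_e \<alpha> \<phi>\<^sub>b f_b f_inf f \<phi> \<longleftrightarrow> VP_solution n_e \<alpha> \<phi>\<^sub>b K.fb K.fi f \<phi>" for f \<phi>
    by (rule K.VP_solution_nonneg_data)
  have uniq: "VP_has_unique_solution n_e \<alpha> \<phi>\<^sub>b f_b f_inf \<longleftrightarrow> (\<forall>p\<in>{0<..\<phi>\<^sub>b}. S.V p > 0)"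
    unfolding VP_has_unique_solution_def sol unfolding VP_has_unique_solution_def[symmetric] by (rule S.unique_solution_iff)
  have iff: "ereal \<phi>\<^sub>b < Sup (ereal ` B) \<longleftrightarrow> VP_has_unique_solution n_e \<alpha> \<phi>\<^sub>b f_b f_inf"
    unfolding uniq Beq by (rule S.barrier_iff)
  have dens: "AE \<xi> in lborel. f x \<xi> = density_plus \<alpha> \<phi>\<^sub>b f_b f_inf \<phi> x \<xi>"
    if s: "VP_solution n_e \<alpha> \<phi>\<^sub>b f_b f_inf f \<phi>" and x: "x \<ge> 0" for f \<phi> x
  proof -
    have s': "VP_solution n_e \<alpha> \<phi>\<^sub>b K.fb K.fi f \<phi>" using s by (simp add: sol)
    interpret P: attractive_solution \<alpha> \<phi>\<^sub>b r K.fb K.fi \<phi> "deriv_within {0..} \<phi>" f by (rule S.solution_profile[OF s'])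
    show ?thesis
      using S.solution_dens[OF s' x] K.density_nonneg_data[where \<alpha> = \<alpha> and \<phi> = \<phi> and x = x, OF P.\<phi>_pos[OF x] P.\<phi>_le[OF x]]
      by eventually_elim (use A.density_plus_eq[where \<phi> = \<phi> and x = x, OF less_imp_le[OF P.\<phi>_pos[OF x]]] in simp)
  qed
  have decay: "\<exists>c>0. \<exists>C>0. \<forall>l\<in>{0, 1, 2}. \<forall>x\<ge>0. \<bar>(deriv_within {0..} ^^ l) \<phi> x\<bar> \<le> C * exp (- c * x)"
    if s: "VP_solution n_e \<alpha> \<phi>\<^sub>b f_b f_inf f \<phi>" and c: "S.curvature 0 > 0" for f \<phi>
  proof -
    have s': "VP_solution n_e \<alpha> \<phi>\<^sub>b K.fb K.fi f \<phi>" using s by (simp add: sol)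
    interpret P: positive_sheath \<alpha> \<phi>\<^sub>b r K.fb K.fi n_e
      by (rule S.positive_sheathI[OF S.solution_V_pos[OF s']])
    show ?thesis by (rule P.solution_decay[OF s' c])
  qed
  show ?thesis
    unfolding dd
    using iff dens decay S.B_nonempty S.no_solution_B_empty S.no_solution_concave
    unfolding Beq[symmetric] sol by blast
qed

end
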